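(* Let $\mathcal{B}_{opt}(R,K)$ be the ball packing of $\mathbf{S}^2\times\mathbf{R}$ described as follows. Let $\mathbf{g}_1,\mathbf{g}_2$ be the reflections of $\mathbf{S}^2\subset\mathbb{R}^3$ in the planes $y=0$ and $x=0$, let $K$ be the point with geographical coordinates $\phi=\frac{\pi}{4}$, $\theta=0$ and fibre coordinate $t=0$, let $R=\frac{\pi}{2}$, and let $\tau>0$ be determined by $$d(K,K^{\tau\mathbf{g}_1})=d(K,K^{\tau\mathbf{g}_2})=2R,\qquad d(K^{\tau\mathbf{g}_1},K^{\tau\mathbf{g}_2})=2R;$$ the packing consists of the images of the geodesic ball of centre $K$ and radius $R$ under the group (the space group $\mathbf{2q.~I.~2}$ with $q=2$) generated by $(P,t)\mapsto(\mathbf{g}_1P,t+\tau)$, $(P,t)\mapsto(\mathbf{g}_2P,t+\tau)$ and $(P,t)\mapsto(P,t+2\tau)$. Then $\mathcal{B}_{opt}(R,K)$ is the densest simply transitive ball packing belonging to the generalized Coxeter space groups and the glide reflection space groups of $\mathbf{S}^2\times\mathbf{R}$: for every generalized Coxeter space group or glide reflection space group $\Gamma$ (with any value of its parameter $q$, where present, and any lattice parameter $p>0$) and every point $K'$ with trivial stabilizer in $\Gamma$, the density $\delta(K')$ of the ball packing of $\Gamma$ with kernel point $K'$ is at most the density of $\mathcal{B}_{opt}(R,K)$.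
   Context: $\mathbf{S}^2\times\mathbf{R}$ is the Riemannian product of the unit sphere and the real line, with $ds^2=dt^2+\cos^2\theta\,d\phi^2+d\theta^2$ in geographical coordinates, where the point of $\mathbf{S}^2$ with coordinates $(\phi,\theta)$ is $(x,y,z)=(\cos\phi\cos\theta,\sin\phi\cos\theta,\sin\theta)$ and $t$ is the fibre coordinate; $d$ is the geodesic distance (length of a shortest geodesic) and $\mathrm{Vol}$ the Riemannian volume. The geodesic ball of centre $K$ and radius $\rho\in[0,\pi]$ is $\{Q: d(K,Q)\le\rho\}$. An image of a point $K$ under an isometry $\mathbf{g}$ is written $K^{\mathbf{g}}$; for $K=(P,t)$, $K^{\tau\mathbf{g}_i}=(\mathbf{g}_iP,t+\tau)$. Space groups. Let $\Gamma_0$ be a finite group of isometries of $\mathbf{S}^2$ generated by the reflections $\mathbf{g}_1,\dots,\mathbf{g}_m$ in the sides of a spherical digon or triangle, let $p>0$ and $\tau_1,\dots,\tau_m\in\{0,\frac12\}$. The space group with point group $\Gamma_0$, translation parts $(\tau_1,\dots,\tau_m)$ and lattice parameter $p$ is the group of isometries of $\mathbf{S}^2\times\mathbf{R}$ generated by $(P,t)\mapsto(\mathbf{g}_iP,t+\tau_ip)$, $i=1,\dots,m$, and $(P,t)\mapsto(P,t+p)$. The point groups considered are: (1) $m=2$, $(\mathbf{g}_1\mathbf{g}_2)^q=1$, $q\ge2$ (digon with angle $\pi/q$); (2) $m=3$, $(\mathbf{g}_1\mathbf{g}_3)^2=(\mathbf{g}_2\mathbf{g}_3)^2=(\mathbf{g}_1\mathbf{g}_2)^q=1$,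 $q\ge2$; (3) $m=3$, $(\mathbf{g}_1\mathbf{g}_2)^2=(\mathbf{g}_1\mathbf{g}_3)^3=(\mathbf{g}_2\mathbf{g}_3)^3=1$; (4) $m=3$, $(\mathbf{g}_1\mathbf{g}_2)^2=(\mathbf{g}_1\mathbf{g}_3)^3=(\mathbf{g}_2\mathbf{g}_3)^4=1$; (5) $m=3$, $(\mathbf{g}_1\mathbf{g}_2)^2=(\mathbf{g}_1\mathbf{g}_3)^3=(\mathbf{g}_2\mathbf{g}_3)^5=1$ (in each case an exponent $k$ in $(\mathbf{g}_i\mathbf{g}_j)^k=1$ means that the corresponding sides meet at angle $\pi/k$). The generalized Coxeter space groups are those with all $\tau_i=0$. The glide reflection space groups are those with at least one nonzero $\tau_i$; up to equivariance (conjugation by an isometry of $\mathbf{S}^2$ times a similarity of $\mathbf{R}$) they are the following, with $(\tau_1,\dots,\tau_m)$ given after each name. For (1): $\mathbf{2q.I.2}$: $(\frac12,\frac12)$; $\mathbf{2qe.I.3}$ ($q$ even): $(0,\frac12)$. For (2): $\mathbf{4q.I.2}$: $(0,0,\frac12)$; $\mathbf{4q.I.3}$: $(\frac12,\frac12,0)$; $\mathbf{4q.I.4}$: $(\frac12,\frac12,\frac12)$; $\mathbf{4qe.I.5}$ ($q$ even): $(0,\frac12,0)$; $\mathbf{4qe.I.6}$ ($q$ even): $(0,\frac12,\frac12)$. For (3): $\mathbf{11.I.2}$: $(\frac12,\frac12,\frac12)$. For (4): $\mathbf{12.I.2}$: $(0,\frac12,0)$; $\mathbf{12.I.3}$: $(\frac12,0,\frac12)$;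 $\mathbf{12.I.4}$: $(\frac12,\frac12,\frac12)$. For (5): $\mathbf{13.I.2}$: $(\frac12,\frac12,\frac12)$. Ball packings. For a space group $\Gamma$ the Dirichlet--Voronoi cell of $K$ is $\mathcal{D}(K)=\{X: d(K,X)\le d(K^{\mathbf{g}},X)\ \text{for all } \mathbf{g}\in\Gamma\}$. If the stabilizer of $K$ in $\Gamma$ is trivial (so $\Gamma$ acts simply transitively on the orbit $K^\Gamma$), let $\mathcal{B}_K$ be the greatest geodesic ball with centre $K$ inside $\mathcal{D}(K)$; its radius is $\rho(K)=\min_{\mathbf{g}\in\Gamma\setminus\{1\}}\frac12 d(K,K^{\mathbf{g}})$. The $\Gamma$-images of $\mathcal{B}_K$ form the (simply transitive) ball packing of $\Gamma$ with kernel point $K$, whose density is $\delta(K)=\mathrm{Vol}(\mathcal{B}_K)/\mathrm{Vol}(\mathcal{D}(K))$. For identification of the arrangement $\mathcal{B}_{opt}(R,K)$: numerically $\mathrm{Vol}(\mathcal{B}_K)\approx13.74539472$ and its density is $\approx0.80407553$. *)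

theory Defs
  imports "HOL-Analysis.Analysis" "HOL-Algebra.Bij" "HOL-Algebra.Generated_Groups"
begin

section \<open>The Riemannian product of the unit sphere and the real line\<close>

text \<open>
  The space is embedded in \<open>real^3 \<times> real\<close>.  In geographical coordinates the metric induced by the
  Euclidean one is \<open>dt\<^sup>2 + cos\<^sup>2 \<theta> d\<phi>\<^sup>2 + d\<theta>\<^sup>2\<close>, so lengths of curves and geodesics can be
  computed in the ambient Euclidean space.
\<close>

type_synonym point = "(real^3) \<times> real"

definition S2R :: "point set" where
  "S2R = sphere 0 1 \<times> UNIV"

definition geo_point :: "real \<Rightarrow> real \<Rightarrow> real \<Rightarrow> point" where
  "geo_point \<phi> \<theta> t = (vector [cos \<phi> * cos \<theta>, sin \<phi> * cos \<theta>, sin \<theta>], t)"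

definition tangent_space :: "point \<Rightarrow> point set" where
  "tangent_space X = {w. fst X \<bullet> fst w = 0}"

text \<open>
  Geodesics of an embedded submanifold with the induced metric: the acceleration is everywhere
  normal to the submanifold (the covariant acceleration vanishes).  Constant curves are included,
  so that the distance of a point from itself is 0.
\<close>

definition geodesic :: "(real \<Rightarrow> point) \<Rightarrow> bool" where
  "geodesic \<gamma> \<longleftrightarrow> \<gamma> ` {0..1} \<subseteq> S2R \<and>
     (\<exists>v a. \<forall>s\<in>{0..1}.
        (\<gamma> has_vector_derivative v s) (at s within {0..1}) \<and>
        (v has_vector_derivative a s) (at s within {0..1}) \<and>
        (\<forall>w\<in>tangent_space (\<gamma> s). a s \<bullet> w = 0))"

definition curve_length :: "(real \<Rightarrow> point) \<Rightarrow> real" where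
  "curve_length \<gamma> = integral {0..1} (\<lambda>s. norm (vector_derivative \<gamma> (at s within {0..1})))"

text \<open>The infimum below is attained for points of \<open>S2R\<close>: it is the length of a shortest geodesic.\<close>

definition geodesic_dist :: "point \<Rightarrow> point \<Rightarrow> real" where
  "geodesic_dist X Y =
     Inf {curve_length \<gamma> | \<gamma>. geodesic \<gamma> \<and> pathstart \<gamma> = X \<and> pathfinish \<gamma> = Y}"

definition geodesic_ball :: "point \<Rightarrow> real \<Rightarrow> point set" where
  "geodesic_ball K r = {Q \<in> S2R. geodesic_dist K Q \<le> r}"

text \<open>
  The volume element in the coordinates \<open>(\<phi>, \<theta>, t)\<close> is \<open>cos \<theta> d\<phi> d\<theta> dt\<close>.  The coordinate domain
  below covers everything except the fibres over the two poles, which are a null set.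
\<close>

definition riemannian_volume :: "point measure" where
  "riemannian_volume =
     distr
       (density (lborel :: (real \<times> real \<times> real) measure)
          (\<lambda>(\<phi>, \<theta>, t). ennreal (cos \<theta> * indicator {-pi<..pi} \<phi> * indicator {-pi/2<..<pi/2} \<theta>)))
       borel (\<lambda>(\<phi>, \<theta>, t). geo_point \<phi> \<theta> t)"

definition Vol :: "point set \<Rightarrow> real" where
  "Vol A = measure riemannian_volume A"

section \<open>Space groups\<close>

text \<open>
  Isometries are represented as elements of \<open>BijGroup S2R\<close>, i.e. as bijections of \<open>S2R\<close> that are
  \<open>undefined\<close> outside \<open>S2R\<close>.
\<close>

definition sphere_reflection :: "real^3 \<Rightarrow> real^3 \<Rightarrow> real^3" where
  "sphere_reflection n P = P - (2 * (n \<bullet> P)) *\<^sub>R n"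
  \<comment> \<open>the reflection in the plane through the origin with unit normal \<open>n\<close>\<close>

definition glide_reflection :: "real^3 \<Rightarrow> real \<Rightarrow> point \<Rightarrow> point" where
  "glide_reflection n s = (\<lambda>X\<in>S2R. (sphere_reflection n (fst X), snd X + s))"

definition fibre_translation :: "real \<Rightarrow> point \<Rightarrow> point" where
  "fibre_translation s = (\<lambda>X\<in>S2R. (fst X, snd X + s))"

text \<open>
  A spherical digon or triangle is given by the inward unit normals \<open>n 1, \<dots>, n m\<close> of the planes
  of its sides, i.e. it consists of the \<open>P\<close> on the sphere with \<open>n i \<bullet> P \<ge> 0\<close> for all \<open>i\<close>.  The
  interior angle of two sides is the supplement of the angle of their inward normals.
\<close>

definition interior_angle :: "real^3 \<Rightarrow> real^3 \<Rightarrow> real" where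
  "interior_angle n n' = pi - arccos (n \<bullet> n')"

definition mirror_system :: "nat \<Rightarrow> (nat \<Rightarrow> real^3) \<Rightarrow> bool" where
  "mirror_system m n \<longleftrightarrow>
     (\<forall>i\<in>{1..m}. norm (n i) = 1) \<and>
     (let meet = (\<lambda>i j (k::nat). interior_angle (n i) (n j) = pi / real k) in
        m = 2 \<and> (\<exists>q\<ge>2. meet 1 2 q) \<or>
        m = 3 \<and> (\<exists>q\<ge>2. meet 1 3 2 \<and> meet 2 3 2 \<and> meet 1 2 q) \<or>
        m = 3 \<and> meet 1 2 2 \<and> meet 1 3 3 \<and> meet 2 3 3 \<or>
        m = 3 \<and> meet 1 2 2 \<and> meet 1 3 3 \<and> meet 2 3 4 \<or>
        m = 3 \<and> meet 1 2 2 \<and> meet 1 3 3 \<and> meet 2 3 5)"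

definition space_group :: "nat \<Rightarrow> (nat \<Rightarrow> real^3) \<Rightarrow> (nat \<Rightarrow> real) \<Rightarrow> real \<Rightarrow> (point \<Rightarrow> point) set" where
  "space_group m n \<tau> p =
     generate (BijGroup S2R)
       ((\<lambda>i. glide_reflection (n i) (\<tau> i * p)) ` {1..m} \<union> {fibre_translation p})"

definition generalized_Coxeter_space_group :: "(point \<Rightarrow> point) set \<Rightarrow> bool" where
  "generalized_Coxeter_space_group \<Gamma> \<longleftrightarrow>
     (\<exists>m n p. mirror_system m n \<and> p > 0 \<and> \<Gamma> = space_group m n (\<lambda>_. 0) p)"

text \<open>
  All nonzero tuples of translation parts are admitted.  A tuple that is incompatible with the
  relations of the point group, e.g. \<open>(0, 1/2)\<close> for a digon with odd \<open>q\<close>, forces the translation by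
  \<open>p/2\<close> into the group, which is then just the generalized Coxeter space group with lattice
  parameter \<open>p/2\<close>; the compatible tuples are, up to isometries of the sphere and the numbering of
  the sides, those of the types 2q.I.2, 2qe.I.3, 4q.I.2, 4q.I.3, 4q.I.4, 4qe.I.5, 4qe.I.6, 11.I.2,
  12.I.2, 12.I.3, 12.I.4 and 13.I.2.
\<close>

definition glide_reflection_space_group :: "(point \<Rightarrow> point) set \<Rightarrow> bool" where
  "glide_reflection_space_group \<Gamma> \<longleftrightarrow>
     (\<exists>m n \<tau> p. mirror_system m n \<and> p > 0 \<and>
        (\<forall>i\<in>{1..m}. \<tau> i \<in> {0, 1/2}) \<and> (\<exists>i\<in>{1..m}. \<tau> i \<noteq> 0) \<and>
        \<Gamma> = space_group m n \<tau> p)"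

section \<open>Ball packings\<close>

definition dv_cell :: "(point \<Rightarrow> point) set \<Rightarrow> point \<Rightarrow> point set" where
  "dv_cell \<Gamma> K = {X \<in> S2R. \<forall>g\<in>\<Gamma>. geodesic_dist K X \<le> geodesic_dist (g K) X}"

definition trivial_stabilizer :: "(point \<Rightarrow> point) set \<Rightarrow> point \<Rightarrow> bool" where
  "trivial_stabilizer \<Gamma> K \<longleftrightarrow> {g \<in> \<Gamma>. g K = K} = {\<one>\<^bsub>BijGroup S2R\<^esub>}"

text \<open>The infimum is a minimum for the space groups above, because their orbits are discrete.\<close>

definition packing_radius :: "(point \<Rightarrow> point) set \<Rightarrow> point \<Rightarrow> real" where
  "packing_radius \<Gamma> K = (INF g\<in>\<Gamma> - {\<one>\<^bsub>BijGroup S2R\<^esub>}. geodesic_dist K (g K) / 2)"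

definition packing_density :: "(point \<Rightarrow> point) set \<Rightarrow> point \<Rightarrow> real" where
  "packing_density \<Gamma> K = Vol (geodesic_ball K (packing_radius \<Gamma> K)) / Vol (dv_cell \<Gamma> K)"

end

theory Submission
  imports Defs
begin

text \<open>The density of a packing with radius \<open>\<rho>\<close> is compared with the volume \<open>V\<close> of a ball of radius
\<open>pi / 2\<close> through two estimates.  On the one hand a ball of radius \<open>\<rho> \<le> pi / 2\<close> has volume at most
\<open>V * (2 / pi) * \<rho> * (1 - cos \<rho>)\<close> (\<open>Vol_geodesic_ball_le\<close>).  On the other hand, if the linear parts of
the group number at most \<open>N\<close> and the elements with a given linear part are spaced by multiples of
\<open>p\<close> along the fibre, then the images of the Dirichlet--Voronoi cell cover a slab of height \<open>p\<close>, so
the cell has volume at least \<open>4 * pi * p / N\<close> (\<open>dv_cell_volume_ge\<close>).  Together they bound the density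
by \<open>V / (sqrt 3 * pi\<^sup>2)\<close> as soon as \<open>sqrt 3 * N * \<rho> * (1 - cos \<rho>) \<le> 2 * p\<close> (\<open>packing_density_le\<close>), and
the cell of the optimal packing has volume at most \<open>sqrt 3 * pi\<^sup>2\<close> (\<open>optimal_cell_volume\<close>).

What remains is an inequality between the radius, the order of the point group and the lattice
parameter.  The kernel point may be moved into the fundamental digon or triangle; let \<open>b\<^sub>i\<close> be the
sine of the distance of its spherical part from the \<open>i\<close>-th side.  Every short element of the group
bounds \<open>\<rho>\<close> in terms of the \<open>b\<^sub>i\<close>: a reflection by \<open>sin \<rho> \<le> b\<^sub>i\<close>, a rotation \<open>g\<^sub>i g\<^sub>j\<close> by a quadratic
form in \<open>b\<^sub>i\<close> and \<open>b\<^sub>j\<close>, and a glide reflection by \<open>4 \<rho>\<^sup>2 \<le> (2 arcsin b\<^sub>i)\<^sup>2 + (p / 2)\<^sup>2\<close>.  In the other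
direction the \<open>b\<^sub>i\<close> satisfy Bessel's inequality for the Gram matrix of the normals of the sides, as
that spherical part is a unit vector.  If the group contains all the reflections, this already gives
\<open>N * (1 - cos \<rho>) \<le> 2\<close>, which with \<open>2 * \<rho> \<le> p\<close> is more than enough.  Otherwise only half of the linear
parts occur at a given height.  Then either the caps of radius \<open>\<rho>\<close> around the orbit points there cover so
little of the sphere that the translation by \<open>p\<close> suffices, or some \<open>b\<^sub>i\<close> belonging to a glide reflection is so
small that the glide reflection forces \<open>p\<close> to be large (\<open>glide_criterion\<close>).  The theorem
\<open>space_group_density_reduction\<close> carries out this reduction for all groups at once; the inequalities
are then checked for the five families of mirror systems and all tuples of translation parts.

The optimal group attains the bound.  Its orbit consists of two antipodal points at every even multiple
of \<open>\<tau>\<close> and the two antipodal points at right angles to them at every odd multiple, and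
\<open>\<tau> = sqrt 3 * pi / 2\<close> makes all neighbours have distance \<open>pi\<close>.  Over a point \<open>Q\<close> of the sphere
the cell has a fibre of length at most \<open>\<tau> + (\<beta>\<^sup>2 - \<alpha>\<^sup>2) / \<tau>\<close>, where \<open>\<alpha>\<close> and \<open>\<beta>\<close> are the angles from \<open>Q\<close>
to the nearer ends of the two axes, and only a hemisphere is covered.  Exchanging the two axes changes
the sign of \<open>\<beta>\<^sup>2 - \<alpha>\<^sup>2\<close>, so the volume of the cell is at most \<open>2 * pi * \<tau> = sqrt 3 * pi\<^sup>2\<close>.\<close>

section \<open>The geodesic distance\<close>

lemma S2R_iff: "X \<in> S2R \<longleftrightarrow> norm (fst X) = 1"
  by (auto simp: S2R_def mem_Times_iff)

definition sphere_angle :: "real^3 \<Rightarrow> real^3 \<Rightarrow> real" where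
  "sphere_angle P Q = arccos (P \<bullet> Q)"

lemma inner_unit_bounds:
  fixes P Q :: "'a::real_inner"
  assumes "norm P = 1" "norm Q = 1"
  shows "-1 \<le> P \<bullet> Q" "P \<bullet> Q \<le> 1"
  using Cauchy_Schwarz_ineq2[of P Q] assms by (auto simp: abs_le_iff)

lemma sphere_angle_bounds:
  assumes "norm P = 1" "norm Q = 1"
  shows "0 \<le> sphere_angle P Q" "sphere_angle P Q \<le> pi"
  using inner_unit_bounds[OF assms] by (auto simp: sphere_angle_def arccos_lbound arccos_ubound)

lemma cos_sphere_angle:
  assumes "norm P = 1" "norm Q = 1"
  shows "cos (sphere_angle P Q) = P \<bullet> Q"
  using inner_unit_bounds[OF assms] by (auto simp: sphere_angle_def)

lemma arccos_cos_le_abs: "arccos (cos (k::real)) \<le> \<bar>k\<bar>"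
proof (cases "\<bar>k\<bar> \<le> pi")
  case True
  have "arccos (cos k) = arccos (cos \<bar>k\<bar>)" by (simp add: abs_if)
  also have "\<dots> = \<bar>k\<bar>" using True by (intro arccos_cos) auto
  finally show ?thesis by simp
next
  case False
  have "arccos (cos k) \<le> pi" by (intro arccos_ubound) auto
  with False show ?thesis by linarith
qed

lemma has_vector_derivative_zero_const:
  fixes f :: "real \<Rightarrow> 'a::real_normed_vector"
  assumes "\<And>s. s \<in> {0..1} \<Longrightarrow> (f has_vector_derivative 0) (at s within {0..1})"
    and "s \<in> {0..1}"
  shows "f s = f 0"
proof -
  obtain c where "\<And>x. x \<in> {0..1::real} \<Longrightarrow> f x = c"
    using has_vector_derivative_zero_constant[of "{0..1::real}" f] assms(1) by blast
  then show ?thesis using assms(2) by simp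
qed

text \<open>A geodesic moves uniformly along the fibre, and its spherical part \<open>c\<close> satisfies
  \<open>c'' = - k\<^sup>2 c\<close> with constant speed \<open>k\<close>, because \<open>c''\<close> is radial and \<open>c \<bullet> c'' = - c' \<bullet> c'\<close>.
  Hence \<open>cos (k s) c - (sin (k s) / k) c'\<close> is constant, and pairing it with \<open>c\<close> at both ends gives
  \<open>c 0 \<bullet> c 1 = cos k\<close>.\<close>

lemma geodesic_length_ge:
  assumes "geodesic \<gamma>"
  shows "sqrt ((sphere_angle (fst (\<gamma> 0)) (fst (\<gamma> 1)))\<^sup>2 + (snd (\<gamma> 0) - snd (\<gamma> 1))\<^sup>2)
           \<le> curve_length \<gamma>"
proof -
  obtain v a where mem: "\<And>s. s \<in> {0..1} \<Longrightarrow> \<gamma> s \<in> S2R"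
    and dg: "\<And>s. s \<in> {0..1} \<Longrightarrow> (\<gamma> has_vector_derivative v s) (at s within {0..1})"
    and dv: "\<And>s. s \<in> {0..1} \<Longrightarrow> (v has_vector_derivative a s) (at s within {0..1})"
    and an: "\<And>s w. s \<in> {0..1} \<Longrightarrow> w \<in> tangent_space (\<gamma> s) \<Longrightarrow> a s \<bullet> w = 0"
    using assms unfolding geodesic_def image_subset_iff by metis
  define c where "c = (\<lambda>s. fst (\<gamma> s))"
  define c' where "c' = (\<lambda>s. fst (v s))"
  define c'' where "c'' = (\<lambda>s. fst (a s))"
  define h where "h = (\<lambda>s. snd (\<gamma> s))"
  define h' where "h' = (\<lambda>s. snd (v s))"
  have fst_bl: "bounded_linear (fst :: point \<Rightarrow> _)" and snd_bl: "bounded_linear (snd :: point \<Rightarrow> _)"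
    by (rule bounded_linear_fst bounded_linear_snd)+
  have dc: "(c has_vector_derivative c' s) (at s within {0..1})" if "s \<in> {0..1}" for s
    unfolding c_def c'_def using bounded_linear.has_vector_derivative[OF fst_bl dg[OF that]] .
  have dc': "(c' has_vector_derivative c'' s) (at s within {0..1})" if "s \<in> {0..1}" for s
    unfolding c'_def c''_def using bounded_linear.has_vector_derivative[OF fst_bl dv[OF that]] .
  have dh: "(h has_vector_derivative h' s) (at s within {0..1})" if "s \<in> {0..1}" for s
    unfolding h_def h'_def using bounded_linear.has_vector_derivative[OF snd_bl dg[OF that]] .
  have dh': "(h' has_vector_derivative snd (a s)) (at s within {0..1})" if "s \<in> {0..1}" for s
    unfolding h'_def using bounded_linear.has_vector_derivative[OF snd_bl dv[OF that]] .
  have snd_a: "snd (a s) = 0" if "s \<in> {0..1}" for s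
    using an[OF that, of "(0,1)"] by (auto simp: tangent_space_def inner_prod_def)
  have cc: "c s \<bullet> c s = 1" if "s \<in> {0..1}" for s
    using mem[OF that] by (simp add: c_def S2R_iff norm_eq_1)
  have c'' : "c'' s = (c'' s \<bullet> c s) *\<^sub>R c s" if s: "s \<in> {0..1}" for s
  proof -
    define w where "w = c'' s - (c'' s \<bullet> c s) *\<^sub>R c s"
    have wc: "c s \<bullet> w = 0" using cc[OF s] by (simp add: w_def inner_diff inner_commute)
    have "a s \<bullet> (w, 0) = 0" using wc by (intro an[OF s]) (simp add: tangent_space_def c_def)
    then have "c'' s \<bullet> w = 0" by (simp add: c''_def inner_prod_def)
    then have "w \<bullet> w = 0" using wc by (simp add: w_def inner_diff_left)
    then show ?thesis by (simp add: w_def)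
  qed
  have cc': "c s \<bullet> c' s = 0" if s: "s \<in> {0..1}" for s
  proof -
    have "((\<lambda>s. c s \<bullet> c s) has_vector_derivative (c s \<bullet> c' s + c' s \<bullet> c s)) (at s within {0..1})"
      by (rule bounded_bilinear.has_vector_derivative[OF bounded_bilinear_inner dc[OF s] dc[OF s]])
    moreover have "((\<lambda>s. c s \<bullet> c s) has_vector_derivative 0) (at s within {0..1})"
      by (rule has_vector_derivative_transform[OF s _ has_vector_derivative_const[of 1]])
         (use cc in auto)
    ultimately have "c s \<bullet> c' s + c' s \<bullet> c s = 0"
      using vector_derivative_unique_within_closed_interval[of 0 1 s] s by (metis cbox_interval zero_less_one)
    then show ?thesis by (simp add: inner_commute)
  qed
  have cc'': "c'' s \<bullet> c s = - (c' s \<bullet> c' s)" if s: "s \<in> {0..1}" for s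
  proof -
    have "((\<lambda>s. c s \<bullet> c' s) has_vector_derivative (c s \<bullet> c'' s + c' s \<bullet> c' s)) (at s within {0..1})"
      by (rule bounded_bilinear.has_vector_derivative[OF bounded_bilinear_inner dc[OF s] dc'[OF s]])
    moreover have "((\<lambda>s. c s \<bullet> c' s) has_vector_derivative 0) (at s within {0..1})"
      by (rule has_vector_derivative_transform[OF s _ has_vector_derivative_const[of 0]])
         (use cc' in auto)
    ultimately have "c s \<bullet> c'' s + c' s \<bullet> c' s = 0"
      using vector_derivative_unique_within_closed_interval[of 0 1 s] s by (metis cbox_interval zero_less_one)
    then show ?thesis by (simp add: inner_commute)
  qed
  define k where "k = norm (c' 0)"
  have k: "c' s \<bullet> c' s = k\<^sup>2" if s: "s \<in> {0..1}" for s
  proof -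
    have "c' s \<bullet> c' s = c' 0 \<bullet> c' 0"
    proof (rule has_vector_derivative_zero_const[OF _ s])
      fix s :: real assume s: "s \<in> {0..1}"
      have "((\<lambda>s. c' s \<bullet> c' s) has_vector_derivative (c' s \<bullet> c'' s + c'' s \<bullet> c' s)) (at s within {0..1})"
        by (rule bounded_bilinear.has_vector_derivative[OF bounded_bilinear_inner dc'[OF s] dc'[OF s]])
      moreover have "c'' s \<bullet> c' s = 0" using cc'[OF s] by (subst c''[OF s]) simp
      ultimately show "((\<lambda>s. c' s \<bullet> c' s) has_vector_derivative 0) (at s within {0..1})"
        by (simp add: inner_commute)
    qed
    then show ?thesis by (simp add: k_def power2_norm_eq_inner)
  qed
  have ode: "c'' s = - (k\<^sup>2 *\<^sub>R c s)" if s: "s \<in> {0..1}" for s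
    using c''[OF s] cc''[OF s] k[OF s] by simp
  have h': "h' s = h' 0" if s: "s \<in> {0..1}" for s
    by (rule has_vector_derivative_zero_const[OF _ s]) (use dh' snd_a in auto)
  have hlin: "h 1 - h 0 = h' 0"
  proof -
    have "h 1 - 1 *\<^sub>R h' 0 = h 0 - 0 *\<^sub>R h' 0"
    proof (rule has_vector_derivative_zero_const)
      fix s :: real assume s: "s \<in> {0..1}"
      show "((\<lambda>s. h s - s *\<^sub>R h' 0) has_vector_derivative 0) (at s within {0..1})"
        by (rule derivative_eq_intros dh[OF s] | simp)+ (use h'[OF s] in simp)
    qed auto
    then show ?thesis by simp
  qed
  have len: "curve_length \<gamma> = sqrt (k\<^sup>2 + (h' 0)\<^sup>2)"
  proof -
    have "norm (vector_derivative \<gamma> (at s within {0..1})) = sqrt (k\<^sup>2 + (h' 0)\<^sup>2)" if s: "s \<in> {0..1}" for s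
    proof -
      have "vector_derivative \<gamma> (at s within {0..1}) = v s"
        using vector_derivative_within_closed_interval[OF _ s dg[OF s]] by simp
      moreover have "norm (v s) = sqrt (c' s \<bullet> c' s + (h' s)\<^sup>2)"
        by (simp add: norm_prod_def c'_def h'_def power2_norm_eq_inner)
      ultimately show ?thesis using k[OF s] h'[OF s] by simp
    qed
    then have "curve_length \<gamma> = integral {0..1} (\<lambda>s::real. sqrt (k\<^sup>2 + (h' 0)\<^sup>2))"
      unfolding curve_length_def by (intro integral_cong) auto
    then show ?thesis by simp
  qed
  have "c 0 \<bullet> c 1 = cos k"
  proof (cases "k = 0")
    case True
    have "c' s = 0" if "s \<in> {0..1}" for s using k[OF that] True by simp
    then have "c 1 = c 0" by (intro has_vector_derivative_zero_const) (use dc in fastforce)+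
    then show ?thesis using cc[of 0] True by simp
  next
    case False
    have "cos (k * 1) *\<^sub>R c 1 - (sin (k * 1) / k) *\<^sub>R c' 1 = cos (k * 0) *\<^sub>R c 0 - (sin (k * 0) / k) *\<^sub>R c' 0"
    proof (rule has_vector_derivative_zero_const)
      fix s :: real assume s: "s \<in> {0..1}"
      have 1: "((\<lambda>s. cos (k * s)) has_vector_derivative - sin (k * s) * k) (at s within {0..1})"
        by (auto intro!: derivative_eq_intros simp flip: has_real_derivative_iff_has_vector_derivative)
      have 2: "((\<lambda>s. sin (k * s) / k) has_vector_derivative cos (k * s)) (at s within {0..1})"
        using False by (auto intro!: derivative_eq_intros simp flip: has_real_derivative_iff_has_vector_derivative)
      have 3: "((\<lambda>s. cos (k * s) *\<^sub>R c s) has_vector_derivative (cos (k * s) *\<^sub>R c' s + (- sin (k * s) * k) *\<^sub>R c s)) (at s within {0..1})"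
        by (rule bounded_bilinear.has_vector_derivative[OF bounded_bilinear_scaleR 1 dc[OF s]])
      have 4: "((\<lambda>s. (sin (k * s) / k) *\<^sub>R c' s) has_vector_derivative ((sin (k * s) / k) *\<^sub>R c'' s + cos (k * s) *\<^sub>R c' s)) (at s within {0..1})"
        by (rule bounded_bilinear.has_vector_derivative[OF bounded_bilinear_scaleR 2 dc'[OF s]])
      show "((\<lambda>s. cos (k * s) *\<^sub>R c s - (sin (k * s) / k) *\<^sub>R c' s) has_vector_derivative 0) (at s within {0..1})"
        using has_vector_derivative_diff[OF 3 4] ode[OF s] False by (simp add: power2_eq_square)
    qed auto
    then have "c 0 = cos k *\<^sub>R c 1 - (sin k / k) *\<^sub>R c' 1" by simp
    then have "c 0 \<bullet> c 1 = cos k * (c 1 \<bullet> c 1) - (sin k / k) * (c' 1 \<bullet> c 1)"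
      by (simp add: inner_diff_left)
    then show ?thesis using cc[of 1] cc'[of 1] by (simp add: inner_commute)
  qed
  then have "sphere_angle (c 0) (c 1) \<le> \<bar>k\<bar>"
    unfolding sphere_angle_def using arccos_cos_le_abs by simp
  moreover have "0 \<le> sphere_angle (c 0) (c 1)"
    using mem[of 0] mem[of 1] by (intro sphere_angle_bounds) (auto simp: c_def S2R_iff)
  ultimately have "(sphere_angle (c 0) (c 1))\<^sup>2 \<le> k\<^sup>2"
    by (metis abs_of_nonneg abs_le_square_iff)
  moreover have "(h 0 - h 1)\<^sup>2 = (h' 0)\<^sup>2" using hlin by (simp add: power2_commute)
  ultimately show ?thesis unfolding len by (simp add: c_def h_def)
qed

lemma exists_unit_orthogonal:
  fixes P :: "real^3"
  obtains w where "norm w = 1" "P \<bullet> w = 0"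
proof -
  obtain w0 :: "real^3" where w0: "w0 \<noteq> 0" "orthogonal P w0"
    using orthogonal_to_vector_exists[of P] by auto
  show ?thesis
    by (rule that[of "w0 /\<^sub>R norm w0"]) (use w0 in \<open>auto simp: orthogonal_def\<close>)
qed

lemma exists_great_circle:
  fixes P Q :: "real^3"
  assumes "norm P = 1" "norm Q = 1"
  obtains w where "norm w = 1" "P \<bullet> w = 0"
    "Q = cos (sphere_angle P Q) *\<^sub>R P + sin (sphere_angle P Q) *\<^sub>R w"
proof -
  define al where "al = sphere_angle P Q"
  have ca: "cos al = P \<bullet> Q" using cos_sphere_angle[OF assms] by (simp add: al_def)
  have PP: "P \<bullet> P = 1" "Q \<bullet> Q = 1" using assms by (simp_all add: norm_eq_1)
  define u where "u = Q - cos al *\<^sub>R P"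
  have uP: "P \<bullet> u = 0" using PP ca by (simp add: u_def inner_diff_right)
  have uu: "u \<bullet> u = (sin al)\<^sup>2"
    using PP ca by (simp add: u_def inner_diff inner_commute algebra_simps power2_eq_square)
       (use ca sin_cos_squared_add[of al] in \<open>simp add: power2_eq_square\<close>)
  show ?thesis
  proof (cases "sin al = 0")
    case True
    then have "u = 0" using uu by simp
    then have "Q = cos al *\<^sub>R P" by (simp add: u_def)
    moreover obtain w where "norm w = 1" "P \<bullet> w = 0" by (rule exists_unit_orthogonal)
    ultimately show ?thesis using that True by (simp add: al_def)
  next
    case False
    show ?thesis
    proof (rule that[of "u /\<^sub>R sin al"])
      have "norm u = \<bar>sin al\<bar>" using uu by (simp add: norm_eq_sqrt_inner)
      then show "norm (u /\<^sub>R sin al) = 1" using False by simp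
      show "P \<bullet> (u /\<^sub>R sin al) = 0" using uP by simp
      show "Q = cos (sphere_angle P Q) *\<^sub>R P + sin (sphere_angle P Q) *\<^sub>R (u /\<^sub>R sin al)"
        using False unfolding al_def[symmetric] by (simp add: u_def)
    qed
  qed
qed

text \<open>The lower bound is attained by a curve that runs uniformly along a great circle arc and along
the fibre.\<close>

theorem geodesic_dist_eq:
  assumes X: "X \<in> S2R" and Y: "Y \<in> S2R"
  shows "geodesic_dist X Y = sqrt ((sphere_angle (fst X) (fst Y))\<^sup>2 + (snd X - snd Y)\<^sup>2)"
  unfolding geodesic_dist_def
proof (rule cInf_eq_minimum)
  define P where "P = fst X"
  define Q where "Q = fst Y"
  define al where "al = sphere_angle P Q"
  have nP: "norm P = 1" "norm Q = 1" using X Y by (auto simp: P_def Q_def S2R_iff)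
  obtain w where w: "norm w = 1" "P \<bullet> w = 0" "Q = cos al *\<^sub>R P + sin al *\<^sub>R w"
    using exists_great_circle[OF nP] unfolding al_def by blast
  define d where "d = snd Y - snd X"
  define \<gamma> :: "real \<Rightarrow> point" where
    "\<gamma> = (\<lambda>s. (cos (al * s) *\<^sub>R P + sin (al * s) *\<^sub>R w, snd X + s * d))"
  define v :: "real \<Rightarrow> point" where
    "v = (\<lambda>s. ((- sin (al * s) * al) *\<^sub>R P + (cos (al * s) * al) *\<^sub>R w, d))"
  define a :: "real \<Rightarrow> point" where
    "a = (\<lambda>s. (- (al\<^sup>2 *\<^sub>R (cos (al * s) *\<^sub>R P + sin (al * s) *\<^sub>R w)), 0))"
  have PP: "P \<bullet> P = 1" "w \<bullet> w = 1" "w \<bullet> P = 0" using nP w by (simp_all add: norm_eq_1 inner_commute)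
  have dg: "(\<gamma> has_vector_derivative v s) (at s within {0..1})" for s
    unfolding \<gamma>_def v_def by (auto intro!: derivative_eq_intros)
  have dv: "(v has_vector_derivative a s) (at s within {0..1})" for s
    unfolding v_def a_def by (auto intro!: derivative_eq_intros simp: power2_eq_square algebra_simps)
  have mem: "\<gamma> s \<in> S2R" for s
    using PP w(2) unfolding \<gamma>_def S2R_iff norm_eq_1
    by (simp add: inner_add power2_eq_square[symmetric])
  have geo: "geodesic \<gamma>"
    unfolding geodesic_def
  proof (intro conjI exI ballI)
    fix s :: real and u assume "u \<in> tangent_space (\<gamma> s)"
    then show "a s \<bullet> u = 0"
      by (simp add: tangent_space_def \<gamma>_def a_def inner_prod_def inner_add_left)
  qed (use mem dg dv in auto)
  have "norm (vector_derivative \<gamma> (at s within {0..1})) = sqrt (al\<^sup>2 + d\<^sup>2)" if s: "s \<in> {0..1}" for s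
  proof -
    have "vector_derivative \<gamma> (at s within {0..1}) = v s"
      using vector_derivative_within_closed_interval[OF _ s dg] by simp
    moreover have "norm (fst (v s)) ^ 2 = al\<^sup>2"
      unfolding power2_norm_eq_inner v_def using PP w(2)
      by (simp add: inner_add power2_eq_square algebra_simps flip: distrib_left)
    ultimately show ?thesis by (simp add: norm_prod_def v_def)
  qed
  then have "curve_length \<gamma> = integral {0..1} (\<lambda>s::real. sqrt (al\<^sup>2 + d\<^sup>2))"
    unfolding curve_length_def by (intro integral_cong) auto
  then have "curve_length \<gamma> = sqrt (al\<^sup>2 + d\<^sup>2)" by simp
  moreover have "pathstart \<gamma> = X" "pathfinish \<gamma> = Y"
    using w(3) by (auto simp: pathstart_def pathfinish_def \<gamma>_def d_def P_def Q_def prod_eq_iff)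
  moreover have "d\<^sup>2 = (snd X - snd Y)\<^sup>2" by (simp add: d_def power2_commute)
  ultimately show "sqrt ((sphere_angle (fst X) (fst Y))\<^sup>2 + (snd X - snd Y)\<^sup>2)
      \<in> {curve_length \<gamma> |\<gamma>. geodesic \<gamma> \<and> pathstart \<gamma> = X \<and> pathfinish \<gamma> = Y}"
    using geo unfolding al_def P_def Q_def by (metis (mono_tags, lifting) mem_Collect_eq)
next
  fix l assume "l \<in> {curve_length \<gamma> |\<gamma>. geodesic \<gamma> \<and> pathstart \<gamma> = X \<and> pathfinish \<gamma> = Y}"
  then obtain \<gamma> where "l = curve_length \<gamma>" "geodesic \<gamma>" "\<gamma> 0 = X" "\<gamma> 1 = Y"
    by (auto simp: pathstart_def pathfinish_def)
  then show "sqrt ((sphere_angle (fst X) (fst Y))\<^sup>2 + (snd X - snd Y)\<^sup>2) \<le> l"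
    using geodesic_length_ge by blast
qed

section \<open>The area measure of the sphere\<close>

definition sph :: "real \<Rightarrow> real \<Rightarrow> real^3" where
  "sph \<phi> \<theta> = (cos \<phi> * cos \<theta>) *\<^sub>R axis 1 1 + (sin \<phi> * cos \<theta>) *\<^sub>R axis 2 1 + sin \<theta> *\<^sub>R axis 3 1"

lemma vector_3_axis: "(vector [x, y, z] :: real^3) = x *\<^sub>R axis 1 1 + y *\<^sub>R axis 2 1 + z *\<^sub>R axis 3 1"
  by (simp add: vec_eq_iff forall_3 axis_def)

lemma sph_nth [simp]: "sph \<phi> \<theta> $ 1 = cos \<phi> * cos \<theta>" "sph \<phi> \<theta> $ 2 = sin \<phi> * cos \<theta>" "sph \<phi> \<theta> $ 3 = sin \<theta>"
  by (simp_all add: sph_def axis_def)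

lemma geo_point_eq: "geo_point \<phi> \<theta> t = (sph \<phi> \<theta>, t)"
  by (simp add: geo_point_def vector_3_axis sph_def)

lemma inner_3: "(x::real^3) \<bullet> y = x $ 1 * y $ 1 + x $ 2 * y $ 2 + x $ 3 * y $ 3"
  by (simp add: inner_vec_def sum_3)

lemma norm_sph [simp]: "norm (sph \<phi> \<theta>) = 1"
proof -
  have "(cos \<phi> * cos \<theta>)\<^sup>2 + (sin \<phi> * cos \<theta>)\<^sup>2 = (cos \<theta>)\<^sup>2"
    unfolding power_mult_distrib by (simp flip: distrib_right)
  then have "(cos \<phi> * cos \<theta>)\<^sup>2 + (sin \<phi> * cos \<theta>)\<^sup>2 + (sin \<theta>)\<^sup>2 = 1" by simp
  then show ?thesis by (simp add: norm_eq_1 inner_3 power2_eq_square)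
qed

lemma sph_measurable [measurable]: "(\<lambda>(\<phi>, \<theta>). sph \<phi> \<theta>) \<in> borel_measurable borel"
  unfolding sph_def split_def by (intro borel_measurable_continuous_onI continuous_intros)

definition sphere_density :: "real \<times> real \<Rightarrow> ennreal" where
  "sphere_density = (\<lambda>(\<phi>, \<theta>). ennreal (cos \<theta> * indicator {-pi<..pi} \<phi> * indicator {-pi/2<..<pi/2} \<theta>))"

lemma sphere_density_measurable [measurable]: "sphere_density \<in> borel_measurable borel"
proof -
  have 1: "(\<lambda>x::real\<times>real. cos (snd x)) \<in> borel_measurable borel"
    by (intro borel_measurable_continuous_onI continuous_intros)
  have [measurable]: "(\<lambda>x::real\<times>real. fst x) \<in> borel_measurable borel" "(\<lambda>x::real\<times>real. snd x) \<in> borel_measurable borel"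
    by (intro borel_measurable_continuous_onI continuous_intros)+
  show ?thesis unfolding sphere_density_def split_def using 1 by measurable
qed

text \<open>A measure on the whole of the ambient space, so that spherical sets can be given by conditions on
\<open>real^3\<close> without intersecting them with the sphere.\<close>

definition sphere_area :: "(real^3) measure" where
  "sphere_area = distr (density lborel sphere_density) borel (\<lambda>(\<phi>, \<theta>). sph \<phi> \<theta>)"

lemma sets_sphere_area [simp, measurable_cong]: "sets sphere_area = sets borel"
  by (simp add: sphere_area_def)

lemma space_sphere_area [simp]: "space sphere_area = UNIV"
  by (simp add: sphere_area_def)

lemma nn_integral_sphere_area:
  assumes [measurable]: "f \<in> borel_measurable borel"
  shows "(\<integral>\<^sup>+P. f P \<partial>sphere_area) = (\<integral>\<^sup>+\<phi>. \<integral>\<^sup>+\<theta>. sphere_density (\<phi>, \<theta>) * f (sph \<phi> \<theta>) \<partial>lborel \<partial>lborel)"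
proof -
  have m: "(\<lambda>x. sphere_density x * f (sph (fst x) (snd x))) \<in> borel_measurable (borel :: (real\<times>real) measure)"
    using sph_measurable by (auto simp: split_def)
  have "(\<integral>\<^sup>+P. f P \<partial>sphere_area) = (\<integral>\<^sup>+x. sphere_density x * f (sph (fst x) (snd x)) \<partial>lborel)"
    unfolding sphere_area_def using sph_measurable
    by (subst nn_integral_distr) (auto simp: nn_integral_density split_def)
  also have "\<dots> = (\<integral>\<^sup>+x. sphere_density x * f (sph (fst x) (snd x)) \<partial>(lborel \<Otimes>\<^sub>M lborel))"
    by (simp add: lborel_prod)
  also have "\<dots> = (\<integral>\<^sup>+\<phi>. \<integral>\<^sup>+\<theta>. sphere_density (\<phi>, \<theta>) * f (sph \<phi> \<theta>) \<partial>lborel \<partial>lborel)"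
    by (subst lborel.nn_integral_fst[symmetric]) (use m in \<open>auto simp: lborel_prod\<close>)
  finally show ?thesis .
qed

lemma emeasure_polar_cap:
  assumes r: "0 \<le> r" "r \<le> pi"
  shows "emeasure sphere_area {P. cos r \<le> P $ 3} = ennreal (2 * pi * (1 - cos r))"
proof -
  have [measurable]: "{P::real^3. cos r \<le> P $ 3} \<in> sets borel"
    by (intro borel_closed closed_Collect_le continuous_intros)
  have iff: "cos r \<le> sin \<theta> \<longleftrightarrow> pi/2 - r \<le> \<theta>" if "-pi/2 < \<theta>" "\<theta> < pi/2" for \<theta>
  proof -
    have "cos r \<le> sin \<theta> \<longleftrightarrow> cos r \<le> cos (pi/2 - \<theta>)" by (simp add: cos_diff)
    also have "\<dots> \<longleftrightarrow> pi/2 - \<theta> \<le> r" by (rule cos_mono_le_eq) (use r that in auto)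
    finally show ?thesis by auto
  qed
  have inner: "(\<integral>\<^sup>+\<theta>. sphere_density (\<phi>, \<theta>) * indicator {P. cos r \<le> P $ 3} (sph \<phi> \<theta>) \<partial>lborel)
      = ennreal (1 - cos r) * indicator {-pi<..pi} \<phi>" for \<phi>
  proof -
    have "(\<integral>\<^sup>+\<theta>. sphere_density (\<phi>, \<theta>) * indicator {P. cos r \<le> P $ 3} (sph \<phi> \<theta>) \<partial>lborel)
      = (\<integral>\<^sup>+\<theta>. ennreal (cos \<theta>) * indicator {pi/2 - r .. pi/2} \<theta> * indicator {-pi<..pi} \<phi> \<partial>lborel)"
    proof (rule nn_integral_cong_AE)
      have "AE \<theta> in lborel. \<theta> \<noteq> - pi/2 \<and> \<theta> \<noteq> pi/2"
        using AE_lborel_singleton[of "-pi/2::real"] AE_lborel_singleton[of "pi/2::real"] by eventually_elim auto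
      then show "AE \<theta> in lborel. sphere_density (\<phi>, \<theta>) * indicator {P. cos r \<le> P $ 3} (sph \<phi> \<theta>)
        = ennreal (cos \<theta>) * indicator {pi/2 - r .. pi/2} \<theta> * indicator {-pi<..pi} \<phi>"
      proof eventually_elim
        case (elim \<theta>)
        show ?case using iff[of \<theta>] elim r
          by (auto simp: sphere_density_def indicator_def)
      qed
    qed
    also have "\<dots> = (\<integral>\<^sup>+\<theta>. ennreal (cos \<theta>) * indicator {pi/2 - r .. pi/2} \<theta> \<partial>lborel) * indicator {-pi<..pi} \<phi>"
      by (subst nn_integral_multc) auto
    also have "(\<integral>\<^sup>+\<theta>. ennreal (cos \<theta>) * indicator {pi/2 - r .. pi/2} \<theta> \<partial>lborel) = ennreal (sin (pi/2) - sin (pi/2 - r))"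
    proof (rule nn_integral_FTC_Icc[where F=sin and f=cos])
      show "0 \<le> cos x" if "x \<in> {pi/2 - r..pi/2}" for x
        using r that by (intro cos_ge_zero) auto
    qed (use r in \<open>auto intro!: derivative_eq_intros\<close>)
    finally show ?thesis by (simp add: sin_diff)
  qed
  have "emeasure sphere_area {P. cos r \<le> P $ 3} = (\<integral>\<^sup>+P. indicator {P. cos r \<le> P $ 3} P \<partial>sphere_area)"
    by simp
  also have "\<dots> = (\<integral>\<^sup>+\<phi>. ennreal (1 - cos r) * indicator {-pi<..pi} \<phi> \<partial>lborel)"
    by (subst nn_integral_sphere_area) (auto simp: inner)
  also have "\<dots> = ennreal (1 - cos r) * ennreal (2 * pi)"
    by (simp add: nn_integral_cmult)
  finally show ?thesis by (simp add: ennreal_mult'[symmetric] mult.commute)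
qed

lemma emeasure_sphere_area_restrict:
  assumes [measurable]: "A \<in> sets borel"
  shows "emeasure sphere_area (A \<inter> sphere 0 1) = emeasure sphere_area A"
proof -
  have [measurable]: "sphere (0::real^3) 1 \<in> sets borel" by (intro borel_closed) auto
  have "(\<integral>\<^sup>+P. indicator (A \<inter> sphere 0 1) P \<partial>sphere_area) = (\<integral>\<^sup>+P. indicator A P \<partial>sphere_area)"
    by (subst (1 2) nn_integral_sphere_area) (auto simp: indicator_def)
  then show ?thesis by simp
qed

lemma emeasure_sphere_area_UNIV: "emeasure sphere_area UNIV = ennreal (4 * pi)"
proof -
  have [measurable]: "{P::real^3. cos pi \<le> P $ 3} \<in> sets borel"
    by (intro borel_closed closed_Collect_le continuous_intros)
  have "(\<integral>\<^sup>+P. indicator {P. cos pi \<le> P $ 3} P \<partial>sphere_area) = (\<integral>\<^sup>+P. indicator UNIV P \<partial>sphere_area)"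
    by (subst (1 2) nn_integral_sphere_area) (auto simp: indicator_def)
  then show ?thesis using emeasure_polar_cap[of pi] by simp
qed

lemma finite_sphere_area: "finite_measure sphere_area"
  by (rule finite_measureI) (simp add: emeasure_sphere_area_UNIV)

text \<open>The density \<open>cos \<theta>\<close> and the map to \<open>real^3\<close> do not involve \<open>t\<close>, so integration along the fibres can be
split off.\<close>

lemma riemannian_volume_eq: "riemannian_volume = sphere_area \<Otimes>\<^sub>M lborel"
proof (rule pair_measure_eqI[symmetric])
  show "sigma_finite_measure sphere_area" "sigma_finite_measure (lborel :: real measure)"
    using finite_sphere_area by (auto intro: finite_measure.axioms lborel.sigma_finite_measure_axioms)
  show "sets (sphere_area \<Otimes>\<^sub>M lborel) = sets riemannian_volume"
    by (simp add: riemannian_volume_def borel_prod[symmetric] cong: sets_pair_measure_cong)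
  fix A :: "(real^3) set" and B :: "real set"
  assume "A \<in> sets sphere_area" "B \<in> sets lborel"
  then have [measurable]: "A \<in> sets borel" "B \<in> sets borel" by auto
  let ?d = "\<lambda>(\<phi>, \<theta>, t::real). ennreal (cos \<theta> * indicator {-pi<..pi} \<phi> * indicator {-pi/2<..<pi/2} \<theta>)"
  have d: "?d = (\<lambda>x. sphere_density (fst x, fst (snd x)))" by (auto simp: sphere_density_def)
  have pm: "(\<lambda>x::real\<times>real\<times>real. (fst x, fst (snd x))) \<in> borel_measurable borel"
    by (intro borel_measurable_continuous_onI continuous_intros)
  have dm [measurable]: "?d \<in> borel_measurable borel" unfolding d using measurable_compose[OF pm sphere_density_measurable] .
  have gm: "(\<lambda>(\<phi>, \<theta>, t). geo_point \<phi> \<theta> t) \<in> borel_measurable borel"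
    unfolding geo_point_eq sph_def split_def by (intro borel_measurable_continuous_onI continuous_intros)
  have AB: "A \<times> B \<in> sets borel" by (simp add: borel_prod[symmetric])
  have sm: "(\<lambda>x::real\<times>real. sph (fst x) (snd x)) \<in> borel_measurable borel"
    using sph_measurable by (simp add: split_def)
  have m2: "(\<lambda>x::real\<times>real. sphere_density x * indicator A (sph (fst x) (snd x))) \<in> borel_measurable borel"
    using sm by measurable
  have m3: "(\<lambda>x::real\<times>real\<times>real. sphere_density (fst x, fst (snd x)) * indicator A (sph (fst x) (fst (snd x))) * indicator B (snd (snd x))) \<in> borel_measurable borel"
  proof -
    have "(\<lambda>x::real\<times>real\<times>real. snd (snd x)) \<in> borel_measurable borel"
      by (intro borel_measurable_continuous_onI continuous_intros)
    then show ?thesis using measurable_compose[OF pm m2] by simp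
  qed
  have m4: "(\<lambda>x. indicator A (sph (fst x) (fst (snd x))) * indicator B (snd (snd x)) :: ennreal) \<in> borel_measurable borel"
    using measurable_compose[OF gm borel_measurable_indicator[OF AB, where 'b=ennreal]]
    by (simp add: split_def geo_point_eq indicator_times)
  have "emeasure riemannian_volume (A \<times> B) = (\<integral>\<^sup>+X. indicator (A \<times> B) X \<partial>riemannian_volume)"
    using AB by (simp add: riemannian_volume_def)
  also have "\<dots> = (\<integral>\<^sup>+x. sphere_density (fst x, fst (snd x)) * indicator A (sph (fst x) (fst (snd x))) * indicator B (snd (snd x)) \<partial>lborel)"
    unfolding riemannian_volume_def using gm AB dm m4 unfolding d
    by (subst nn_integral_distr) (auto simp: nn_integral_density split_def geo_point_eq indicator_times mult.assoc)
  also have "\<dots> = (\<integral>\<^sup>+x. sphere_density (fst x, fst (snd x)) * indicator A (sph (fst x) (fst (snd x))) * indicator B (snd (snd x)) \<partial>(lborel \<Otimes>\<^sub>M lborel))"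
    by (simp add: lborel_prod)
  also have "\<dots> = (\<integral>\<^sup>+\<phi>. \<integral>\<^sup>+y. sphere_density (\<phi>, fst y) * indicator A (sph \<phi> (fst y)) * indicator B (snd y) \<partial>lborel \<partial>lborel)"
    by (subst lborel.nn_integral_fst[symmetric]) (use m3 in \<open>auto simp: lborel_prod\<close>)
  also have "\<dots> = (\<integral>\<^sup>+\<phi>. (\<integral>\<^sup>+\<theta>. sphere_density (\<phi>, \<theta>) * indicator A (sph \<phi> \<theta>) \<partial>lborel) * emeasure lborel B \<partial>lborel)"
  proof (rule nn_integral_cong)
    fix \<phi> :: real
    have pm': "(\<lambda>x::real\<times>real. (\<phi>, fst x)) \<in> borel_measurable borel"
      by (intro borel_measurable_continuous_onI continuous_intros)
    have pm'': "(\<lambda>x::real. (\<phi>, x)) \<in> borel_measurable borel"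
      by (intro borel_measurable_continuous_onI continuous_intros)
    have 1: "(\<lambda>x::real\<times>real. sphere_density (\<phi>, fst x) * indicator A (sph \<phi> (fst x)) * indicator B (snd x)) \<in> borel_measurable borel"
    proof -
      have "(\<lambda>x::real\<times>real. snd x) \<in> borel_measurable borel"
        by (intro borel_measurable_continuous_onI continuous_intros)
      then show ?thesis using measurable_compose[OF pm' m2] by simp
    qed
    have 2: "(\<lambda>x::real. sphere_density (\<phi>, x) * indicator A (sph \<phi> x)) \<in> borel_measurable borel"
      using measurable_compose[OF pm'' m2] by simp
    have "(\<integral>\<^sup>+y. sphere_density (\<phi>, fst y) * indicator A (sph \<phi> (fst y)) * indicator B (snd y) \<partial>lborel)
       = (\<integral>\<^sup>+y. sphere_density (\<phi>, fst y) * indicator A (sph \<phi> (fst y)) * indicator B (snd y) \<partial>(lborel \<Otimes>\<^sub>M lborel))"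
      by (simp add: lborel_prod)
    also have "\<dots> = (\<integral>\<^sup>+\<theta>. \<integral>\<^sup>+t. sphere_density (\<phi>, \<theta>) * indicator A (sph \<phi> \<theta>) * indicator B t \<partial>lborel \<partial>lborel)"
      by (subst lborel.nn_integral_fst[symmetric]) (use 1 in \<open>auto simp: lborel_prod\<close>)
    also have "\<dots> = (\<integral>\<^sup>+\<theta>. sphere_density (\<phi>, \<theta>) * indicator A (sph \<phi> \<theta>) * emeasure lborel B \<partial>lborel)"
      by (intro nn_integral_cong) (simp add: nn_integral_cmult)
    also have "\<dots> = (\<integral>\<^sup>+\<theta>. sphere_density (\<phi>, \<theta>) * indicator A (sph \<phi> \<theta>) \<partial>lborel) * emeasure lborel B"
      using 2 by (intro nn_integral_multc) simp
    finally show "(\<integral>\<^sup>+y. sphere_density (\<phi>, fst y) * indicator A (sph \<phi> (fst y)) * indicator B (snd y) \<partial>lborel)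
      = (\<integral>\<^sup>+\<theta>. sphere_density (\<phi>, \<theta>) * indicator A (sph \<phi> \<theta>) \<partial>lborel) * emeasure lborel B" .
  qed
  also have "\<dots> = (\<integral>\<^sup>+\<phi>. (\<integral>\<^sup>+\<theta>. sphere_density (\<phi>, \<theta>) * indicator A (sph \<phi> \<theta>) \<partial>lborel) \<partial>lborel) * emeasure lborel B"
  proof (rule nn_integral_multc)
    have "(\<lambda>\<phi>. \<integral>\<^sup>+\<theta>. (\<lambda>x. sphere_density x * indicator A (sph (fst x) (snd x))) (\<phi>, \<theta>) \<partial>lborel) \<in> borel_measurable lborel"
      by (rule lborel.borel_measurable_nn_integral_fst) (use m2 in \<open>simp add: lborel_prod\<close>)
    then show "(\<lambda>\<phi>. \<integral>\<^sup>+\<theta>. sphere_density (\<phi>, \<theta>) * indicator A (sph \<phi> \<theta>) \<partial>lborel) \<in> borel_measurable lborel" by simp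
  qed
  also have "(\<integral>\<^sup>+\<phi>. (\<integral>\<^sup>+\<theta>. sphere_density (\<phi>, \<theta>) * indicator A (sph \<phi> \<theta>) \<partial>lborel) \<partial>lborel) = (\<integral>\<^sup>+P. indicator A P \<partial>sphere_area)"
    by (rule nn_integral_sphere_area[symmetric]) auto
  finally show "emeasure sphere_area A * emeasure lborel B = emeasure riemannian_volume (A \<times> B)" by simp
qed

section \<open>Rotation invariance\<close>

lemma lborel_vec3: "distr (lborel :: (real \<times> real \<times> real) measure) borel (\<lambda>(x, y, z). vector [x, y, z] :: real^3) = lborel"
proof (rule lborel_eqI[symmetric])
  fix l u :: "real^3" assume lu: "\<And>b. b \<in> Basis \<Longrightarrow> l \<bullet> b \<le> u \<bullet> b"
  have le: "l $ i \<le> u $ i" for i using lu[of "axis i 1"] by (simp add: inner_axis axis_in_Basis_iff)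
  have m: "(\<lambda>(x, y, z). vector [x, y, z] :: real^3) \<in> borel_measurable borel"
    unfolding vector_3_axis split_def by (intro borel_measurable_continuous_onI continuous_intros)
  have pre: "(\<lambda>(x, y, z). vector [x, y, z] :: real^3) -` box l u
     = box (l $ 1) (u $ 1) \<times> box (l $ 2) (u $ 2) \<times> box (l $ 3) (u $ 3)"
    by (auto simp: mem_box_cart forall_3)
  have "emeasure (distr (lborel :: (real \<times> real \<times> real) measure) borel (\<lambda>(x, y, z). vector [x, y, z] :: real^3)) (box l u)
    = emeasure (lborel \<Otimes>\<^sub>M (lborel \<Otimes>\<^sub>M lborel)) (box (l $ 1) (u $ 1) \<times> box (l $ 2) (u $ 2) \<times> box (l $ 3) (u $ 3))"
    using m by (subst emeasure_distr) (auto simp: pre lborel_prod)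
  also have "\<dots> = ennreal (u $ 1 - l $ 1) * (ennreal (u $ 2 - l $ 2) * ennreal (u $ 3 - l $ 3))"
  proof -
    have 1: "emeasure (lborel \<Otimes>\<^sub>M (lborel \<Otimes>\<^sub>M lborel)) (I \<times> J \<times> L) = emeasure lborel I * (emeasure lborel J * emeasure lborel L)"
      if "open I" "open J" "open L" for I J L :: "real set"
    proof -
      have "J \<times> L \<in> sets (lborel \<Otimes>\<^sub>M lborel)" using that by (intro pair_measureI) auto
      then have "emeasure (lborel \<Otimes>\<^sub>M (lborel \<Otimes>\<^sub>M lborel)) (I \<times> J \<times> L) = emeasure lborel I * emeasure (lborel \<Otimes>\<^sub>M lborel) (J \<times> L)"
        using that unfolding lborel_prod by (subst lborel.emeasure_pair_measure_Times[symmetric]) (auto simp: lborel_prod)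
      also have "emeasure (lborel \<Otimes>\<^sub>M lborel) (J \<times> L) = emeasure lborel J * emeasure lborel L"
        using that by (intro lborel.emeasure_pair_measure_Times) auto
      finally show ?thesis .
    qed
    show ?thesis using le by (subst 1) (auto simp: box_real)
  qed
  also have "\<dots> = ennreal (\<Prod>b\<in>Basis. (u - l) \<bullet> b)"
  proof -
    have B: "(Basis :: (real^3) set) = {axis 1 1, axis 2 1, axis 3 1}"
      by (auto simp: Basis_vec_def UNIV_3)
    have "(\<Prod>b\<in>Basis. (u - l) \<bullet> b) = (u $ 1 - l $ 1) * ((u $ 2 - l $ 2) * (u $ 3 - l $ 3))"
      unfolding B by (simp add: axis_eq_axis inner_axis)
    then show ?thesis using le by (simp add: ennreal_mult)
  qed
  finally show "emeasure (distr (lborel :: (real \<times> real \<times> real) measure) borel (\<lambda>(x, y, z). vector [x, y, z] :: real^3)) (box l u)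
    = ennreal (\<Prod>b\<in>Basis. (u - l) \<bullet> b)" .
qed simp

definition polar :: "real^3 \<Rightarrow> real^3" where
  "polar x = x $ 1 *\<^sub>R sph (x $ 2) (x $ 3)"

definition polar_deriv :: "real^3 \<Rightarrow> real^3 \<Rightarrow> real^3" where
  "polar_deriv x h =
     (h $ 1 * (cos (x $ 2) * cos (x $ 3)) + x $ 1 * (- (sin (x $ 2) * h $ 2) * cos (x $ 3) - cos (x $ 2) * (sin (x $ 3) * h $ 3))) *\<^sub>R axis 1 1 +
     (h $ 1 * (sin (x $ 2) * cos (x $ 3)) + x $ 1 * ((cos (x $ 2) * h $ 2) * cos (x $ 3) - sin (x $ 2) * (sin (x $ 3) * h $ 3))) *\<^sub>R axis 2 1 +
     (h $ 1 * sin (x $ 3) + x $ 1 * (cos (x $ 3) * h $ 3)) *\<^sub>R axis 3 1"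

lemma vec_nth_has_derivative: "((\<lambda>x::real^3. x $ i) has_derivative (\<lambda>h. h $ i)) F"
  by (rule bounded_linear_imp_has_derivative) (rule bounded_linear_vec_nth)

lemma polar_has_derivative: "(polar has_derivative polar_deriv x) (at x within S)"
proof -
  have "polar = (\<lambda>x. (x $ 1 * (cos (x $ 2) * cos (x $ 3))) *\<^sub>R axis 1 1 + (x $ 1 * (sin (x $ 2) * cos (x $ 3))) *\<^sub>R axis 2 1 + (x $ 1 * sin (x $ 3)) *\<^sub>R axis 3 1)"
    by (auto simp: polar_def sph_def scaleR_add_right fun_eq_iff)
  then have eq: "polar \<equiv> (\<lambda>x. (x $ 1 * (cos (x $ 2) * cos (x $ 3))) *\<^sub>R axis 1 1 + (x $ 1 * (sin (x $ 2) * cos (x $ 3))) *\<^sub>R axis 2 1 + (x $ 1 * sin (x $ 3)) *\<^sub>R axis 3 1)"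
    by (rule eq_reflection)
  show ?thesis
    unfolding eq
    by (rule derivative_eq_intros vec_nth_has_derivative refl)+
       (simp add: polar_deriv_def fun_eq_iff algebra_simps)
qed

lemma det_polar_deriv: "\<bar>det (matrix (polar_deriv x))\<bar> = (x $ 1)\<^sup>2 * \<bar>cos (x $ 3)\<bar>"
proof -
  let ?p = "x $ 2" and ?t = "x $ 3"
  have e: "(cos ?p)\<^sup>2 + (sin ?p)\<^sup>2 = 1" "(cos ?t)\<^sup>2 + (sin ?t)\<^sup>2 = 1" by simp_all
  let ?M = "matrix (polar_deriv x)" and ?r = "x $ 1"
  have m: "?M $ 1 $ 1 = cos ?p * cos ?t" "?M $ 1 $ 2 = - (?r * sin ?p * cos ?t)" "?M $ 1 $ 3 = - (?r * cos ?p * sin ?t)"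
    "?M $ 2 $ 1 = sin ?p * cos ?t" "?M $ 2 $ 2 = ?r * cos ?p * cos ?t" "?M $ 2 $ 3 = - (?r * sin ?p * sin ?t)"
    "?M $ 3 $ 1 = sin ?t" "?M $ 3 $ 2 = 0" "?M $ 3 $ 3 = ?r * cos ?t"
    by (simp_all add: matrix_def polar_deriv_def axis_def)
  have "det (matrix (polar_deriv x)) = (x $ 1)\<^sup>2 * cos ?t * ((cos ?p)\<^sup>2 + (sin ?p)\<^sup>2) * ((cos ?t)\<^sup>2 + (sin ?t)\<^sup>2)"
    unfolding det_3 m by algebra
  then show ?thesis unfolding e by (simp add: abs_mult)
qed

definition polar_domain :: "(real^3) set" where
  "polar_domain = {x. 0 < x $ 1 \<and> x $ 1 < 1 \<and> - pi < x $ 2 \<and> x $ 2 \<le> pi \<and> - pi/2 < x $ 3 \<and> x $ 3 < pi/2}"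

lemma inj_on_polar: "inj_on polar polar_domain"
proof (rule inj_onI)
  fix x y assume x: "x \<in> polar_domain" and y: "y \<in> polar_domain" and eq: "polar x = polar y"
  have 1: "x $ 1 = y $ 1"
    using arg_cong[OF eq, of norm] x y by (simp add: polar_def polar_domain_def)
  then have s: "sph (x $ 2) (x $ 3) = sph (y $ 2) (y $ 3)"
    using eq x by (auto simp: polar_def polar_domain_def)
  have "sin (x $ 3) = sin (y $ 3)" using arg_cong[OF s, of "\<lambda>v. v $ 3"] by simp
  then have 3: "x $ 3 = y $ 3"
    by (rule sin_inj_pi[rotated 4]) (use x y in \<open>auto simp: polar_domain_def\<close>)
  have c: "cos (y $ 3) > 0" using y by (intro cos_gt_zero_pi) (auto simp: polar_domain_def)
  have "cos (x $ 2) = cos (y $ 2)" "sin (x $ 2) = sin (y $ 2)"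
    using arg_cong[OF s, of "\<lambda>v. v $ 1"] arg_cong[OF s, of "\<lambda>v. v $ 2"] c 3 by auto
  then obtain n :: int where n: "x $ 2 = y $ 2 + 2 * pi * n"
    using sin_cos_eq_iff[of "x $ 2" "y $ 2"] by blast
  have "- (2 * pi) < x $ 2 - y $ 2" "x $ 2 - y $ 2 < 2 * pi"
    using x y unfolding polar_domain_def mem_Collect_eq by linarith+
  then have "2 * pi * (-1) < 2 * pi * n" "2 * pi * n < 2 * pi * 1" using n by linarith+
  then have "-1 < real_of_int n" "real_of_int n < 1"
    by (subst (asm) mult_less_cancel_left_pos; simp)+
  then have "n = 0" by linarith
  then show "x = y" using n 1 3 by (simp add: vec_eq_iff forall_3)
qed

lemma sph_nonzero [simp]: "sph \<phi> \<theta> \<noteq> 0"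
  by (metis norm_sph norm_zero zero_neq_one)

text \<open>Polar coordinates reach every point of the cone except those on the axis through the poles.\<close>

lemma polar_image: "polar ` {x \<in> polar_domain. sph (x $ 2) (x $ 3) \<in> A}
    = {x. 0 < norm x \<and> norm x < 1 \<and> x /\<^sub>R norm x \<in> A \<and> \<not> (x $ 1 = 0 \<and> x $ 2 = 0)}"
proof (intro equalityI subsetI)
  fix y assume "y \<in> polar ` {x \<in> polar_domain. sph (x $ 2) (x $ 3) \<in> A}"
  then obtain x where x: "x \<in> polar_domain" "sph (x $ 2) (x $ 3) \<in> A" "y = polar x" by auto
  have n: "norm y = x $ 1" using x by (simp add: polar_def polar_domain_def)
  have c: "cos (x $ 3) > 0" using x by (intro cos_gt_zero_pi) (auto simp: polar_domain_def)
  have "\<not> (y $ 1 = 0 \<and> y $ 2 = 0)"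
  proof
    assume "y $ 1 = 0 \<and> y $ 2 = 0"
    then have "cos (x $ 2) = 0 \<and> sin (x $ 2) = 0"
      using x c by (auto simp: polar_def polar_domain_def)
    then show False using sin_cos_squared_add[of "x $ 2"] by simp
  qed
  then show "y \<in> {x. 0 < norm x \<and> norm x < 1 \<and> x /\<^sub>R norm x \<in> A \<and> \<not> (x $ 1 = 0 \<and> x $ 2 = 0)}"
    using x n by (auto simp: polar_def polar_domain_def)
next
  fix y assume y: "y \<in> {x::real^3. 0 < norm x \<and> norm x < 1 \<and> x /\<^sub>R norm x \<in> A \<and> \<not> (x $ 1 = 0 \<and> x $ 2 = 0)}"
  define u where "u = y /\<^sub>R norm y"
  have u: "norm u = 1" "u \<in> A" "y = norm y *\<^sub>R u" using y by (auto simp: u_def)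
  have u12: "\<not> (u $ 1 = 0 \<and> u $ 2 = 0)" using y by (auto simp: u_def)
  have un: "(u $ 1)\<^sup>2 + (u $ 2)\<^sup>2 + (u $ 3)\<^sup>2 = 1"
    using u(1) by (simp add: norm_eq_1 inner_3 power2_eq_square)
  have pos: "(u $ 1)\<^sup>2 + (u $ 2)\<^sup>2 > 0" using u12 by (simp add: sum_power2_gt_zero_iff)
  then have "(u $ 3)\<^sup>2 < 1" using un by linarith
  then have u3: "-1 < u $ 3" "u $ 3 < 1" by (auto simp: power2_less_1_iff abs_less_iff)
  define t where "t = arcsin (u $ 3)"
  have t: "sin t = u $ 3" "-pi/2 < t" "t < pi/2"
    using u3 arcsin_lt_bounded[of "u $ 3"] by (auto simp: t_def)
  have c: "cos t > 0" using t by (intro cos_gt_zero_pi) auto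
  have c2: "(cos t)\<^sup>2 = (u $ 1)\<^sup>2 + (u $ 2)\<^sup>2" using un sin_cos_squared_add[of t] t(1) by simp
  have "(u $ 1 / cos t)\<^sup>2 + (u $ 2 / cos t)\<^sup>2 = 1"
    unfolding power_divide add_divide_distrib[symmetric] c2[symmetric] using c by simp
  then obtain p0 where "u $ 1 / cos t = cos p0" "u $ 2 / cos t = sin p0" by (rule sincos_total_2pi)
  then obtain p where p: "-pi < p" "p \<le> pi" "cos p = u $ 1 / cos t" "sin p = u $ 2 / cos t"
    using sincos_principal_value[of p0] by metis
  define x :: "real^3" where "x = vector [norm y, p, t]"
  have "sph p t = u" using p c t by (simp add: vec_eq_iff forall_3)
  then have "polar x = y" "sph (x $ 2) (x $ 3) \<in> A" "x \<in> polar_domain"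
    using u y p t by (auto simp: polar_def x_def polar_domain_def)
  then show "y \<in> polar ` {x \<in> polar_domain. sph (x $ 2) (x $ 3) \<in> A}" by blast
qed

definition solid_cone :: "(real^3) set \<Rightarrow> (real^3) set" where
  "solid_cone A = {x. 0 < norm x \<and> norm x < 1 \<and> x /\<^sub>R norm x \<in> A}"

lemma solid_cone_borel:
  assumes [measurable]: "A \<in> sets borel"
  shows "solid_cone A \<in> sets borel"
proof -
  have [measurable]: "(\<lambda>x::real^3. x /\<^sub>R norm x) \<in> borel_measurable borel" by measurable
  show ?thesis unfolding solid_cone_def by measurable
qed

text \<open>The coordinates single out the poles, so the definition of the area does not show that it is invariant
under rotations.  The invariance is inherited from Lebesgue measure: in polar coordinates the cone over
\<open>A\<close> in the unit ball has the volume element \<open>r\<^sup>2 cos \<theta> dr d\<phi> d\<theta>\<close>, and the integral of \<open>r\<^sup>2\<close> over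
\<open>{0..1}\<close> is \<open>1 / 3\<close>.\<close>

lemma emeasure_solid_cone:
  assumes A [measurable]: "A \<in> sets borel"
  shows "emeasure sphere_area A = 3 * emeasure lborel (solid_cone A)"
proof -
  define W where "W = {x \<in> polar_domain. sph (x $ 2) (x $ 3) \<in> A}"
  have nth [measurable]: "(\<lambda>x::real^3. x $ i) \<in> borel_measurable borel" for i
    by (intro borel_measurable_continuous_onI continuous_intros)
  have sm [measurable]: "(\<lambda>x::real^3. sph (x $ 2) (x $ 3)) \<in> borel_measurable borel"
    unfolding sph_def by (intro borel_measurable_continuous_onI continuous_intros)
  have Wb [measurable]: "W \<in> sets borel" unfolding W_def polar_domain_def by measurable
  let ?Z = "{x::real^3. x $ 1 = 0 \<and> x $ 2 = 0}"
  have im: "polar ` W = solid_cone A - ?Z" unfolding W_def polar_image solid_cone_def by auto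
  have Zb: "?Z \<in> sets borel" by measurable
  have imb: "polar ` W \<in> sets borel" unfolding im using solid_cone_borel[OF A] Zb by (rule sets.Diff)
  have bdd: "bounded (polar ` W)" unfolding im solid_cone_def
    by (rule bounded_subset[of "ball 0 1"]) (auto simp: dist_norm)
  have lm: "polar ` W \<in> lmeasurable"
    using imb bdd by (intro bounded_set_imp_lmeasurable) auto
  have "polar ` W \<in> lmeasurable \<and> measure lebesgue (polar ` W) = measure lebesgue (polar ` W)
     \<longleftrightarrow> ((\<lambda>x. \<bar>det (matrix (polar_deriv x))\<bar>) has_integral measure lebesgue (polar ` W)) W"
    by (rule has_measure_differentiable_image)
       (use Wb polar_has_derivative in \<open>auto intro!: inj_on_subset[OF inj_on_polar] simp: W_def\<close>)
  then have hi: "((\<lambda>x. (x $ 1)\<^sup>2 * \<bar>cos (x $ 3)\<bar>) has_integral measure lebesgue (polar ` W)) W"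
    using lm by (simp add: det_polar_deriv)
  have Zn: "emeasure lborel ?Z = 0"
  proof -
    have "negligible ?Z"
      by (rule negligible_subset[OF negligible_standard_hyperplane_cart[of 1]]) auto
    then have "?Z \<in> null_sets lebesgue" by (simp add: negligible_iff_null_sets)
    then show ?thesis using Zb by (auto simp: null_sets_def)
  qed
  have "emeasure lborel (solid_cone A) = emeasure lborel (polar ` W)"
    unfolding im using solid_cone_borel[OF A] Zb Zn
    by (subst emeasure_Diff_null_set) (auto simp: null_sets_def)
  also have "\<dots> = ennreal (measure lebesgue (polar ` W))"
    using imb emeasure_eq_measure2[OF lm] by simp
  also have "\<dots> = (\<integral>\<^sup>+x. ennreal ((x $ 1)\<^sup>2 * \<bar>cos (x $ 3)\<bar>) * indicator W x \<partial>lborel)"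
    by (rule nn_integral_has_integral_lebesgue'[symmetric, OF _ hi]) auto
  also have "\<dots> = (\<integral>\<^sup>+x. indicator {0<..<1} ((x::real^3) $ 1) * ennreal ((x $ 1)\<^sup>2) * (sphere_density (x $ 2, x $ 3) * indicator A (sph (x $ 2) (x $ 3))) \<partial>lborel)"
  proof (rule nn_integral_cong)
    fix x :: "real^3"
    have "0 \<le> cos (x $ 3)" if "- pi/2 < x $ 3" "x $ 3 < pi/2"
      using cos_gt_zero_pi[of "x $ 3"] that by auto
    then show "ennreal ((x $ 1)\<^sup>2 * \<bar>cos (x $ 3)\<bar>) * indicator W x
      = indicator {0<..<1} (x $ 1) * ennreal ((x $ 1)\<^sup>2) * (sphere_density (x $ 2, x $ 3) * indicator A (sph (x $ 2) (x $ 3)))"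
      by (auto simp: W_def polar_domain_def sphere_density_def indicator_def ennreal_mult)
  qed
  also have "\<dots> = (\<integral>\<^sup>+x. indicator {0<..<1} (fst x) * ennreal ((fst x)\<^sup>2) * (sphere_density (snd x) * indicator A (sph (fst (snd x)) (snd (snd x)))) \<partial>lborel)"
  proof -
    let ?V = "\<lambda>(x, y, z). vector [x, y, z] :: real^3"
    let ?h = "\<lambda>x::real^3. indicator {0<..<1} (x $ 1) * ennreal ((x $ 1)\<^sup>2) * (sphere_density (x $ 2, x $ 3) * indicator A (sph (x $ 2) (x $ 3)))"
    have m: "?V \<in> borel_measurable borel"
      unfolding vector_3_axis split_def by (intro borel_measurable_continuous_onI continuous_intros)
    have sdm [measurable]: "(\<lambda>x::real^3. sphere_density (x $ 2, x $ 3)) \<in> borel_measurable borel"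
    proof -
      have "(\<lambda>x::real^3. (x $ 2, x $ 3)) \<in> borel_measurable borel"
        by (intro borel_measurable_continuous_onI continuous_intros)
      from measurable_compose[OF this sphere_density_measurable] show ?thesis .
    qed
    have hm: "?h \<in> borel_measurable borel" by measurable
    have "(\<integral>\<^sup>+x. ?h x \<partial>lborel) = (\<integral>\<^sup>+x. ?h x \<partial>distr lborel borel ?V)"
      by (simp only: lborel_vec3)
    also have "\<dots> = (\<integral>\<^sup>+x. ?h (?V x) \<partial>lborel)"
      by (rule nn_integral_distr) (use m hm in simp_all)
    finally show ?thesis by (simp add: split_def)
  qed
  also have "\<dots> = (\<integral>\<^sup>+r. \<integral>\<^sup>+y. indicator {0<..<1} r * ennreal (r\<^sup>2) * (sphere_density y * indicator A (sph (fst y) (snd y))) \<partial>lborel \<partial>lborel)"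
  proof -
    have "(\<lambda>x::real\<times>real\<times>real. snd x) \<in> borel_measurable borel" "(\<lambda>x::real\<times>real\<times>real. fst x) \<in> borel_measurable borel"
      by (intro borel_measurable_continuous_onI continuous_intros)+
    note [measurable] = this
    have "(\<lambda>x::real\<times>real\<times>real. sph (fst (snd x)) (snd (snd x))) \<in> borel_measurable borel"
      unfolding sph_def by (intro borel_measurable_continuous_onI continuous_intros)
    note [measurable] = this
    have "(\<lambda>x::real\<times>real\<times>real. indicator {0<..<1} (fst x) * ennreal ((fst x)\<^sup>2) * (sphere_density (snd x) * indicator A (sph (fst (snd x)) (snd (snd x))))) \<in> borel_measurable borel"
      by measurable
    then show ?thesis
      unfolding lborel_prod[symmetric, where 'b="real\<times>real"]
      by (subst lborel.nn_integral_fst[symmetric]) (auto simp: lborel_prod)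
  qed
  also have "\<dots> = (\<integral>\<^sup>+r. indicator {0<..<1} r * ennreal (r\<^sup>2) * emeasure sphere_area A \<partial>lborel)"
  proof (rule nn_integral_cong)
    fix r :: real
    have m: "(\<lambda>y::real\<times>real. sphere_density y * indicator A (sph (fst y) (snd y))) \<in> borel_measurable borel"
      using sph_measurable by (auto simp: split_def)
    have "emeasure sphere_area A = (\<integral>\<^sup>+P. indicator A P \<partial>sphere_area)" by simp
    also have "\<dots> = (\<integral>\<^sup>+y. sphere_density y * indicator A (sph (fst y) (snd y)) \<partial>lborel)"
      unfolding sphere_area_def using sph_measurable
      by (subst nn_integral_distr) (auto simp: nn_integral_density split_def)
    finally show "(\<integral>\<^sup>+y. indicator {0<..<1} r * ennreal (r\<^sup>2) * (sphere_density y * indicator A (sph (fst y) (snd y))) \<partial>lborel)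
      = indicator {0<..<1} r * ennreal (r\<^sup>2) * emeasure sphere_area A"
      using m by (simp add: nn_integral_cmult)
  qed
  also have "\<dots> = (\<integral>\<^sup>+r. indicator {0<..<1} r * ennreal (r\<^sup>2) \<partial>lborel) * emeasure sphere_area A"
    by (rule nn_integral_multc) simp
  also have "(\<integral>\<^sup>+r. indicator {0<..<1::real} r * ennreal (r\<^sup>2) \<partial>lborel) = (\<integral>\<^sup>+r. ennreal (r\<^sup>2) * indicator {0..1} r \<partial>lborel)"
  proof (rule nn_integral_cong_AE)
    have "AE r in lborel. r \<noteq> 0 \<and> r \<noteq> (1::real)"
      using AE_lborel_singleton[of "0::real"] AE_lborel_singleton[of "1::real"] by eventually_elim auto
    then show "AE r in lborel. indicator {0<..<1} r * ennreal (r\<^sup>2) = ennreal (r\<^sup>2) * indicator {0..1} r"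
      by eventually_elim (auto simp: indicator_def)
  qed
  also have "\<dots> = ennreal (1 ^ 3 / 3 - 0 ^ 3 / 3)"
    by (rule nn_integral_FTC_Icc[where F="\<lambda>r. r ^ 3 / 3" and f="\<lambda>r. r\<^sup>2"])
       (auto intro!: derivative_eq_intros)
  finally have "3 * emeasure lborel (solid_cone A) = 3 * (ennreal (1/3) * emeasure sphere_area A)" by simp
  also have "\<dots> = emeasure sphere_area A"
  proof -
    have "3 * ennreal (1/3) = ennreal 3 * ennreal (1/3)" by simp
    also have "\<dots> = 1" by (subst ennreal_mult'[symmetric]) auto
    finally show ?thesis by (simp add: mult.assoc[symmetric])
  qed
  finally show ?thesis by simp
qed

lemma emeasure_lborel_orthogonal_vimage:
  fixes f :: "real^3 \<Rightarrow> real^3"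
  assumes f: "orthogonal_transformation f" and C: "C \<in> sets borel" "bounded C"
  shows "emeasure lborel (f -` C) = emeasure lborel C"
proof -
  have g: "orthogonal_transformation (inv_into UNIV f)" by (rule orthogonal_transformation_inv[OF f])
  have bij: "bij f" by (rule orthogonal_transformation_bij[OF f])
  have im: "f -` C = inv_into UNIV f ` C" by (rule bij_vimage_eq_inv_image[OF bij])
  have fm: "f \<in> borel_measurable borel"
    by (intro borel_measurable_continuous_onI linear_continuous_on linear_conv_bounded_linear[THEN iffD1] orthogonal_transformation_linear f)
  have vb: "f -` C \<in> sets borel" using measurable_sets[OF fm C(1)] by simp
  have C': "C \<in> lmeasurable" using C by (intro bounded_set_imp_lmeasurable) auto
  have "measure lebesgue (inv_into UNIV f ` C) = measure lebesgue C" "inv_into UNIV f ` C \<in> lmeasurable"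
    using measure_orthogonal_image[OF g C'] measurable_orthogonal_image[OF g C'] by auto
  then have "emeasure lebesgue (f -` C) = emeasure lebesgue C"
    using C' unfolding im by (simp add: emeasure_eq_measure2 fmeasurableD fmeasurableD2)
  then show ?thesis using vb C by simp
qed

theorem distr_sphere_area_orthogonal:
  assumes f: "orthogonal_transformation f"
  shows "distr sphere_area borel f = sphere_area"
proof (rule measure_eqI)
  have fm: "f \<in> borel_measurable borel"
    by (intro borel_measurable_continuous_onI linear_continuous_on linear_conv_bounded_linear[THEN iffD1] orthogonal_transformation_linear f)
  fix A assume "A \<in> sets (distr sphere_area borel f)"
  then have A: "A \<in> sets borel" by simp
  have vb: "f -` A \<in> sets borel" using measurable_sets[OF fm A] by simp
  have "f x = 0 \<longleftrightarrow> x = 0" for x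
    by (metis norm_eq_zero orthogonal_transformation_norm[OF f])
  then have "solid_cone (f -` A) = f -` solid_cone A"
    using orthogonal_transformation_norm[OF f] orthogonal_transformation_scaleR[OF f]
    by (auto simp: solid_cone_def)
  moreover have "bounded (solid_cone A)"
    by (rule bounded_subset[of "ball 0 1"]) (auto simp: dist_norm solid_cone_def)
  ultimately have "emeasure sphere_area (f -` A) = emeasure sphere_area A"
    using emeasure_lborel_orthogonal_vimage[OF f solid_cone_borel[OF A]] emeasure_solid_cone[OF A] emeasure_solid_cone[OF vb] by simp
  then show "emeasure (distr sphere_area borel f) A = emeasure sphere_area A"
    using fm A by (subst emeasure_distr) auto
qed simp

section \<open>Volume in the product\<close>

lemma sets_riemannian_volume [simp, measurable_cong]: "sets riemannian_volume = sets borel"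
  by (simp add: riemannian_volume_def)

lemma sigma_finite_sphere_area: "sigma_finite_measure sphere_area"
  using finite_sphere_area by (rule finite_measure.axioms)

lemma emeasure_riemannian_volume_Times:
  assumes "A \<in> sets borel" "B \<in> sets borel"
  shows "emeasure riemannian_volume (A \<times> B) = emeasure sphere_area A * emeasure lborel B"
  unfolding riemannian_volume_eq using assms
  by (intro lborel.emeasure_pair_measure_Times) auto

lemma emeasure_riemannian_volume_fibres:
  assumes "A \<in> sets borel"
  shows "emeasure riemannian_volume A = (\<integral>\<^sup>+P. emeasure lborel (Pair P -` A) \<partial>sphere_area)"
  using assms unfolding riemannian_volume_eq
  by (intro lborel.emeasure_pair_measure_alt) (simp add: borel_prod[symmetric] cong: sets_pair_measure_cong)

lemma emeasure_riemannian_volume_slices: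
  assumes "A \<in> sets borel"
  shows "emeasure riemannian_volume A = (\<integral>\<^sup>+t. emeasure sphere_area ((\<lambda>P. (P, t)) -` A) \<partial>lborel)"
proof -
  interpret pair_sigma_finite sphere_area "lborel :: real measure"
    by (intro pair_sigma_finite.intro sigma_finite_sphere_area lborel.sigma_finite_measure_axioms)
  show ?thesis using assms unfolding riemannian_volume_eq
    by (intro emeasure_pair_measure_alt2) (simp add: borel_prod[symmetric] cong: sets_pair_measure_cong)
qed

text \<open>The formula of \<open>isometry_of\<close> on the whole ambient space, where Borel sets and measures can be
transported without restricting to \<open>S2R\<close>.\<close>

definition product_motion :: "(real^3 \<Rightarrow> real^3) \<Rightarrow> real \<Rightarrow> point \<Rightarrow> point" where
  "product_motion A s X = (A (fst X), snd X + s)"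

lemma orthogonal_transformation_continuous:
  fixes f :: "real^3 \<Rightarrow> real^3"
  assumes "orthogonal_transformation f"
  shows "continuous_on S f"
  by (intro linear_continuous_on linear_conv_bounded_linear[THEN iffD1] orthogonal_transformation_linear assms)

lemma product_motion_measurable:
  assumes "orthogonal_transformation A"
  shows "product_motion A s \<in> borel_measurable borel"
proof -
  have "continuous_on UNIV (\<lambda>X::point. A (fst X))"
    by (rule continuous_on_compose2[OF orthogonal_transformation_continuous[OF assms, of UNIV]])
       (auto intro: continuous_intros)
  then show ?thesis unfolding product_motion_def[abs_def]
    by (intro borel_measurable_continuous_onI continuous_intros)
qed

lemma distr_riemannian_volume_motion:
  assumes A: "orthogonal_transformation A"
  shows "distr riemannian_volume borel (product_motion A s) = riemannian_volume"
proof -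
  have "A \<in> borel_measurable borel"
    by (intro borel_measurable_continuous_onI orthogonal_transformation_continuous A)
  then have Am: "A \<in> measurable sphere_area borel" by (simp add: measurable_def)
  have sm: "(\<lambda>t::real. t + s) \<in> measurable lborel borel" by simp
  have d: "distr lborel borel (\<lambda>t::real. t + s) = lborel"
  proof -
    have "(\<lambda>t::real. t + s) = (+) s" by (auto simp: add.commute)
    then show ?thesis using lborel_distr_plus[of s] by simp
  qed
  have sA: "distr sphere_area borel A = sphere_area" by (rule distr_sphere_area_orthogonal[OF A])
  have "riemannian_volume = distr sphere_area borel A \<Otimes>\<^sub>M distr lborel borel (\<lambda>t::real. t + s)"
    unfolding d sA riemannian_volume_eq ..
  also have "\<dots> = distr (sphere_area \<Otimes>\<^sub>M lborel) (borel \<Otimes>\<^sub>M borel) (\<lambda>(x, y). (A x, y + s))"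
    by (rule pair_measure_distr[OF Am sm]) (unfold d, rule lborel.sigma_finite_measure_axioms)
  also have "\<dots> = distr riemannian_volume borel (product_motion A s)"
    by (simp add: riemannian_volume_eq borel_prod product_motion_def[abs_def] split_def)
  finally show ?thesis ..
qed

lemma product_motion_vimage:
  assumes A: "orthogonal_transformation A" and B: "B \<in> sets borel"
  shows "product_motion A s -` B \<in> sets borel"
    and "emeasure riemannian_volume (product_motion A s -` B) = emeasure riemannian_volume B"
proof -
  have m: "product_motion A s \<in> measurable riemannian_volume borel"
    using product_motion_measurable[OF A] by (simp add: measurable_def riemannian_volume_def)
  show "product_motion A s -` B \<in> sets borel"
    using measurable_sets[OF product_motion_measurable[OF A] B] by simp
  have "emeasure riemannian_volume B = emeasure (distr riemannian_volume borel (product_motion A s)) B"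
    using distr_riemannian_volume_motion[OF A] by simp
  also have "\<dots> = emeasure riemannian_volume (product_motion A s -` B)"
    using m B by (subst emeasure_distr) (auto simp: riemannian_volume_def)
  finally show "emeasure riemannian_volume (product_motion A s -` B) = emeasure riemannian_volume B" ..
qed

lemma product_motion_image:
  assumes A: "orthogonal_transformation A" and B: "B \<in> sets borel"
  shows "product_motion A s ` B \<in> sets borel"
    and "emeasure riemannian_volume (product_motion A s ` B) = emeasure riemannian_volume B"
proof -
  let ?A' = "inv_into UNIV A"
  have A': "orthogonal_transformation ?A'" by (rule orthogonal_transformation_inv[OF A])
  have bij: "bij A" by (rule orthogonal_transformation_bij[OF A])
  have "product_motion A s ` B = product_motion ?A' (- s) -` B"
  proof (intro equalityI subsetI)
    fix X assume "X \<in> product_motion ?A' (- s) -` B"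
    then have "product_motion A s (product_motion ?A' (- s) X) \<in> product_motion A s ` B" by auto
    then show "X \<in> product_motion A s ` B"
      using bij by (simp add: product_motion_def bij_is_surj surj_f_inv_f)
  qed (use bij in \<open>auto simp: product_motion_def bij_is_inj inv_f_f\<close>)
  then show "product_motion A s ` B \<in> sets borel"
    "emeasure riemannian_volume (product_motion A s ` B) = emeasure riemannian_volume B"
    using product_motion_vimage[OF A' B] by auto
qed

lemma emeasure_cap:
  assumes N: "norm N = 1" and r: "0 \<le> r" "r \<le> pi"
  shows "emeasure sphere_area {P. cos r \<le> N \<bullet> P} = ennreal (2 * pi * (1 - cos r))"
proof -
  have "norm N = norm (axis 3 1 :: real^3)" using N by simp
  then obtain f where f: "orthogonal_transformation f" "f N = (axis 3 1 :: real^3)"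
    by (rule orthogonal_transformation_exists)
  have "f \<in> borel_measurable borel"
    using orthogonal_transformation_continuous[OF f(1)] by (intro borel_measurable_continuous_onI)
  then have fm: "f \<in> measurable sphere_area borel" by (simp add: measurable_def)
  have cb: "{P::real^3. cos r \<le> P $ 3} \<in> sets borel"
    by (intro borel_closed closed_Collect_le continuous_intros)
  have "f P $ 3 = N \<bullet> P" for P
  proof -
    have "f P $ 3 = f N \<bullet> f P" unfolding f(2) by (simp add: inner_axis')
    also have "\<dots> = N \<bullet> P" using f(1) by (simp add: orthogonal_transformation_def)
    finally show ?thesis .
  qed
  then have "{P. cos r \<le> N \<bullet> P} = f -` {P. cos r \<le> P $ 3}" by auto
  then have "emeasure sphere_area {P. cos r \<le> N \<bullet> P} = emeasure (distr sphere_area borel f) {P. cos r \<le> P $ 3}"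
    using fm cb by (simp add: emeasure_distr)
  then show ?thesis using distr_sphere_area_orthogonal[OF f(1)] emeasure_polar_cap[OF r] by simp
qed

section \<open>Isometries\<close>

definition isometry_of :: "(real^3 \<Rightarrow> real^3) \<Rightarrow> real \<Rightarrow> point \<Rightarrow> point" where
  "isometry_of A s = (\<lambda>X\<in>S2R. (A (fst X), snd X + s))"

lemma isometry_of_apply: "X \<in> S2R \<Longrightarrow> isometry_of A s X = (A (fst X), snd X + s)"
  by (simp add: isometry_of_def)

lemma isometry_of_eq_motion: "X \<in> S2R \<Longrightarrow> isometry_of A s X = product_motion A s X"
  by (simp add: isometry_of_def product_motion_def)

lemma isometry_of_in_S2R:
  assumes "orthogonal_transformation A" "X \<in> S2R"
  shows "isometry_of A s X \<in> S2R"
  using assms by (simp add: isometry_of_apply S2R_iff orthogonal_transformation_norm)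

lemma isometry_of_in_carrier:
  assumes A: "orthogonal_transformation A"
  shows "isometry_of A s \<in> carrier (BijGroup S2R)"
proof -
  let ?A' = "inv_into UNIV A"
  have A': "orthogonal_transformation ?A'" by (rule orthogonal_transformation_inv[OF A])
  have bij: "bij A" by (rule orthogonal_transformation_bij[OF A])
  have "bij_betw (isometry_of A s) S2R S2R"
  proof (rule bij_betwI[where g="isometry_of ?A' (- s)"])
    show "isometry_of A s \<in> S2R \<rightarrow> S2R" "isometry_of ?A' (- s) \<in> S2R \<rightarrow> S2R"
      using isometry_of_in_S2R A A' by auto
  next
    fix X assume X: "X \<in> S2R"
    show "isometry_of ?A' (- s) (isometry_of A s X) = X"
      using isometry_of_in_S2R[OF A X, of s] X bij by (simp add: isometry_of_apply bij_is_inj inv_f_f)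
    show "isometry_of A s (isometry_of ?A' (- s) X) = X"
      using isometry_of_in_S2R[OF A' X, of "- s"] X bij by (simp add: isometry_of_apply bij_is_surj surj_f_inv_f)
  qed
  then show ?thesis by (simp add: BijGroup_def Bij_def isometry_of_def)
qed

lemma isometry_of_mult:
  assumes A: "orthogonal_transformation A" and B: "orthogonal_transformation B"
  shows "isometry_of A s \<otimes>\<^bsub>BijGroup S2R\<^esub> isometry_of B t = isometry_of (A \<circ> B) (s + t)"
proof -
  have "isometry_of A s \<in> Bij S2R" "isometry_of B t \<in> Bij S2R"
    using isometry_of_in_carrier A B by (auto simp: BijGroup_def)
  then have "isometry_of A s \<otimes>\<^bsub>BijGroup S2R\<^esub> isometry_of B t = compose S2R (isometry_of A s) (isometry_of B t)"
    by (simp add: BijGroup_def)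
  also have "\<dots> = isometry_of (A \<circ> B) (s + t)"
  proof (rule ext)
    fix X show "compose S2R (isometry_of A s) (isometry_of B t) X = isometry_of (A \<circ> B) (s + t) X"
      using isometry_of_in_S2R[OF B, of X t]
      by (cases "X \<in> S2R") (auto simp: compose_def isometry_of_def)
  qed
  finally show ?thesis .
qed

lemma one_BijGroup_S2R: "\<one>\<^bsub>BijGroup S2R\<^esub> = isometry_of (\<lambda>P. P) 0"
  by (auto simp: BijGroup_def isometry_of_def)

lemma inv_isometry_of:
  assumes A: "orthogonal_transformation A"
  shows "inv\<^bsub>BijGroup S2R\<^esub> (isometry_of A s) = isometry_of (inv_into UNIV A) (- s)"
proof (rule group.inv_equality[OF group_BijGroup])
  have A': "orthogonal_transformation (inv_into UNIV A)" by (rule orthogonal_transformation_inv[OF A])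
  have "inv_into UNIV A \<circ> A = (\<lambda>P. P)"
    using orthogonal_transformation_bij[OF A] by (auto simp: bij_is_inj inv_f_f)
  then show "isometry_of (inv_into UNIV A) (- s) \<otimes>\<^bsub>BijGroup S2R\<^esub> isometry_of A s = \<one>\<^bsub>BijGroup S2R\<^esub>"
    by (simp add: isometry_of_mult[OF A' A] one_BijGroup_S2R)
qed (use isometry_of_in_carrier A orthogonal_transformation_inv[OF A] in auto)

lemma isometry_of_inject:
  assumes A: "orthogonal_transformation A" and B: "orthogonal_transformation B"
    and eq: "isometry_of A s = isometry_of B t"
  shows "A = B" "s = t"
proof -
  have e: "A P = B P \<and> s = t" if "norm P = 1" for P
    using fun_cong[OF eq, of "(P, 0)"] that by (simp add: isometry_of_def S2R_iff)
  show "s = t" using e[of "axis 1 1"] by simp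
  show "A = B"
  proof
    fix x
    show "A x = B x"
    proof (cases "x = 0")
      case True
      then show ?thesis using A B by (metis norm_eq_zero orthogonal_transformation_norm)
    next
      case False
      have "A x = norm x *\<^sub>R A (x /\<^sub>R norm x)"
        using False orthogonal_transformation_scaleR[OF A, of "norm x" "x /\<^sub>R norm x"] by simp
      moreover have "B x = norm x *\<^sub>R B (x /\<^sub>R norm x)"
        using False orthogonal_transformation_scaleR[OF B, of "norm x" "x /\<^sub>R norm x"] by simp
      moreover have "A (x /\<^sub>R norm x) = B (x /\<^sub>R norm x)"
        using e[of "x /\<^sub>R norm x"] False by simp
      ultimately show ?thesis by simp
    qed
  qed
qed

lemma geodesic_dist_isometry:
  assumes "orthogonal_transformation A" "X \<in> S2R" "Y \<in> S2R"
  shows "geodesic_dist (isometry_of A s X) (isometry_of A s Y) = geodesic_dist X Y"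
  using assms isometry_of_in_S2R[OF assms(1)]
  by (simp add: geodesic_dist_eq isometry_of_apply sphere_angle_def orthogonal_transformation_def)

section \<open>Volumes of Dirichlet--Voronoi cells\<close>

text \<open>The discreteness used below is finiteness of the set \<open>W\<close> that contains the linear parts, together with
fibre shifts in the multiples of one number \<open>u\<close>.\<close>

locale motion_group =
  fixes \<Gamma> :: "(point \<Rightarrow> point) set" and W :: "(real^3 \<Rightarrow> real^3) set" and u :: real
  assumes subgroup: "subgroup \<Gamma> (BijGroup S2R)"
    and finite_W: "finite W"
    and u_pos: "u > 0"
    and form: "\<And>g. g \<in> \<Gamma> \<Longrightarrow> \<exists>A\<in>W. \<exists>k::int. orthogonal_transformation A \<and> g = isometry_of A (k * u)"
begin

lemma form_obtain:
  assumes "g \<in> \<Gamma>"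
  obtains A k where "A \<in> W" "orthogonal_transformation A" "g = isometry_of A (of_int k * u)"
  using form[OF assms] by blast

lemma mult_closed:
  assumes "isometry_of A s \<in> \<Gamma>" "isometry_of B t \<in> \<Gamma>" "orthogonal_transformation A" "orthogonal_transformation B"
  shows "isometry_of (A \<circ> B) (s + t) \<in> \<Gamma>"
  using subgroup.m_closed[OF subgroup assms(1,2)] isometry_of_mult[OF assms(3,4)] by simp

lemma inv_closed:
  assumes "isometry_of A s \<in> \<Gamma>" "orthogonal_transformation A"
  shows "isometry_of (inv_into UNIV A) (- s) \<in> \<Gamma>"
  using subgroup.m_inv_closed[OF subgroup assms(1)] inv_isometry_of[OF assms(2)] by simp

lemma one_closed: "isometry_of (\<lambda>P. P) 0 \<in> \<Gamma>"
  using subgroup.one_closed[OF subgroup] by (simp add: one_BijGroup_S2R)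

lemma motion_in_S2R: "g \<in> \<Gamma> \<Longrightarrow> X \<in> S2R \<Longrightarrow> g X \<in> S2R"
  using form isometry_of_in_S2R by metis

lemma dist_invariant: "g \<in> \<Gamma> \<Longrightarrow> X \<in> S2R \<Longrightarrow> Y \<in> S2R \<Longrightarrow> geodesic_dist (g X) (g Y) = geodesic_dist X Y"
  using form geodesic_dist_isometry by metis

text \<open>A bound on the distance bounds the fibre shift, which leaves finitely many multiples of \<open>u\<close>.\<close>

lemma finite_near:
  assumes K: "K \<in> S2R" and X: "X \<in> S2R"
  shows "finite {g \<in> \<Gamma>. geodesic_dist (g K) X \<le> r}"
proof -
  define M where "M = \<lceil>(r + \<bar>snd K - snd X\<bar>) / u\<rceil>"
  have "{g \<in> \<Gamma>. geodesic_dist (g K) X \<le> r} \<subseteq> (\<lambda>(A, k). isometry_of A (of_int k * u)) ` (W \<times> {-M..M})"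
  proof
    fix g assume "g \<in> {g \<in> \<Gamma>. geodesic_dist (g K) X \<le> r}"
    then have g: "g \<in> \<Gamma>" and d: "geodesic_dist (g K) X \<le> r" by auto
    obtain A k where A: "A \<in> W" "orthogonal_transformation A" "g = isometry_of A (of_int k * u)"
      using g by (rule form_obtain)
    have "\<bar>snd (g K) - snd X\<bar> \<le> geodesic_dist (g K) X"
      using geodesic_dist_eq[OF motion_in_S2R[OF g K] X] by (simp add: real_le_rsqrt power2_eq_square[symmetric] real_sqrt_le_iff flip: real_sqrt_abs)
    then have "\<bar>snd K + k * u - snd X\<bar> \<le> r"
      using d A(3) K by (simp add: isometry_of_apply)
    then have "\<bar>k\<bar> * u \<le> r + \<bar>snd K - snd X\<bar>"
      using u_pos by (simp add: abs_if split: if_splits)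
    then have "\<bar>k\<bar> \<le> (r + \<bar>snd K - snd X\<bar>) / u" using u_pos by (simp add: field_simps)
    then have "\<bar>k\<bar> \<le> M" unfolding M_def by linarith
    then show "g \<in> (\<lambda>(A, k). isometry_of A (of_int k * u)) ` (W \<times> {-M..M})"
      using A by (auto simp: abs_le_iff intro!: image_eqI[where x="(A, k)"])
  qed
  then show ?thesis by (rule finite_subset) (use finite_W in auto)
qed

text \<open>By discreteness some orbit point is nearest to \<open>X\<close>; the element that moves \<open>K\<close> there moves a
point of the cell to \<open>X\<close>.\<close>

lemma dv_cell_covers:
  assumes K: "K \<in> S2R" and X: "X \<in> S2R"
  obtains g Y where "g \<in> \<Gamma>" "Y \<in> dv_cell \<Gamma> K" "g Y = X"
proof -
  let ?d = "\<lambda>g. geodesic_dist (g K) X"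
  let ?F = "{g \<in> \<Gamma>. ?d g \<le> geodesic_dist (isometry_of (\<lambda>P. P) 0 K) X}"
  have "finite ?F" "?F \<noteq> {}" using finite_near[OF K X] one_closed by auto
  then obtain g where g: "g \<in> ?F" "\<And>h. h \<in> ?F \<Longrightarrow> ?d g \<le> ?d h"
    using arg_min_if_finite[of ?F ?d] by (metis (no_types, lifting) not_le)
  have min: "?d g \<le> ?d h" if "h \<in> \<Gamma>" for h
    using g that by fastforce
  have g': "g \<in> \<Gamma>" using g by simp
  obtain A k where A: "A \<in> W" "orthogonal_transformation A" "g = isometry_of A (of_int k * u)"
    using g' by (rule form_obtain)
  have A': "orthogonal_transformation (inv_into UNIV A)" by (rule orthogonal_transformation_inv[OF A(2)])
  define Y where "Y = isometry_of (inv_into UNIV A) (- (of_int k * u)) X"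
  have Y: "Y \<in> S2R" unfolding Y_def by (rule isometry_of_in_S2R[OF A' X])
  have gY: "g Y = X"
    using Y X orthogonal_transformation_bij[OF A(2)]
    by (simp add: A(3) isometry_of_apply) (simp add: Y_def isometry_of_apply bij_is_surj surj_f_inv_f)
  have "Y \<in> dv_cell \<Gamma> K"
    unfolding dv_cell_def
  proof (intro CollectI conjI ballI Y)
    fix h assume h: "h \<in> \<Gamma>"
    have "g \<otimes>\<^bsub>BijGroup S2R\<^esub> h \<in> \<Gamma>" by (rule subgroup.m_closed[OF subgroup g' h])
    moreover have "(g \<otimes>\<^bsub>BijGroup S2R\<^esub> h) K = g (h K)"
    proof -
      have "g \<in> Bij S2R" "h \<in> Bij S2R"
        using subgroup.subset[OF subgroup] g' h by (auto simp: BijGroup_def)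
      then show ?thesis using K by (simp add: BijGroup_def compose_def)
    qed
    ultimately have "?d g \<le> geodesic_dist (g (h K)) X" using min by metis
    then have "geodesic_dist (g K) (g Y) \<le> geodesic_dist (g (h K)) (g Y)" by (simp add: gY)
    then show "geodesic_dist K Y \<le> geodesic_dist (h K) Y"
      using dist_invariant[OF g'] K Y motion_in_S2R[OF h K] by simp
  qed
  then show ?thesis using that g' gY by blast
qed

end

lemma closed_S2R: "closed S2R"
  unfolding S2R_def by (intro closed_Times) auto

lemma geodesic_dist_continuous:
  assumes "K \<in> S2R"
  shows "continuous_on S2R (geodesic_dist K)"
proof -
  have "continuous_on S2R (\<lambda>X. sqrt ((arccos (fst K \<bullet> fst X))\<^sup>2 + (snd K - snd X)\<^sup>2))"
  proof (intro continuous_intros ballI)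
    fix X assume "X \<in> S2R"
    then show "-1 \<le> fst K \<bullet> fst X \<and> fst K \<bullet> fst X \<le> 1"
      using inner_unit_bounds[of "fst K" "fst X"] assms by (auto simp: S2R_iff)
  qed
  then show ?thesis
    by (rule continuous_on_eq) (simp add: geodesic_dist_eq[OF assms] sphere_angle_def)
qed

lemma dv_cell_closed:
  assumes K: "K \<in> S2R" and "\<And>g. g \<in> \<Gamma> \<Longrightarrow> g K \<in> S2R"
  shows "closed (dv_cell \<Gamma> K)"
proof -
  have "dv_cell \<Gamma> K = S2R \<inter> (\<Inter>g\<in>\<Gamma>. {X \<in> S2R. geodesic_dist K X \<le> geodesic_dist (g K) X})"
    by (auto simp: dv_cell_def)
  moreover have "closed {X \<in> S2R. geodesic_dist K X \<le> geodesic_dist (g K) X}" if "g \<in> \<Gamma>" for g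
    by (rule continuous_on_closed_Collect_le)
       (use geodesic_dist_continuous K assms(2)[OF that] closed_S2R in auto)
  ultimately show ?thesis using closed_S2R by (simp only:) (intro closed_Int closed_INT ballI)
qed

context motion_group
begin

lemma dv_cell_borel:
  assumes "K \<in> S2R"
  shows "dv_cell \<Gamma> K \<in> sets borel"
  using dv_cell_closed[OF assms] motion_in_S2R assms by (intro borel_closed) auto

text \<open>The images of the cell under the group cover the slab of height \<open>p\<close>.  The group elements with a
given linear part differ by fibre translations through multiples of \<open>p\<close>, so together they use every point
of the cell at most once; hence the slab has at most \<open>card W\<close> times the volume of the cell.\<close>

theorem dv_cell_volume_ge:
  assumes K: "K \<in> S2R" and p: "p > 0"
    and lattice: "\<And>A s t. isometry_of A s \<in> \<Gamma> \<Longrightarrow> isometry_of A t \<in> \<Gamma> \<Longrightarrow> orthogonal_transformation A \<Longrightarrow> \<exists>k::int. t - s = k * p"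
  shows "ennreal (4 * pi * p) \<le> of_nat (card W) * emeasure riemannian_volume (dv_cell \<Gamma> K)"
proof -
  let ?D = "dv_cell \<Gamma> K" and ?V = "emeasure riemannian_volume"
  define W0 where "W0 = {A \<in> W. orthogonal_transformation A \<and> (\<exists>s. isometry_of A s \<in> \<Gamma>)}"
  define s0 where "s0 A = (SOME s. isometry_of A s \<in> \<Gamma>)" for A
  have s0: "isometry_of A (s0 A) \<in> \<Gamma>" if "A \<in> W0" for A
    using that unfolding W0_def s0_def by (auto intro: someI)
  \<comment> \<open>the fibre shifts that occur with the linear part \<open>A\<close> are among \<open>off A n\<close>, and \<open>piece A n\<close> is the part of the cell that this shift brings into the slab\<close>
  define off where "off A n = s0 A + of_int (int_decode n) * p" for A n
  define piece where "piece A n = ?D \<inter> (UNIV \<times> {- off A n..<p - off A n})" for A n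
  have Db: "?D \<in> sets borel" by (rule dv_cell_borel[OF K])
  have strip: "UNIV \<times> {a..<b} \<in> sets (borel :: point measure)" for a b :: real
    unfolding borel_prod[symmetric] by (intro pair_measureI) auto
  have pb: "piece A n \<in> sets borel" for A n
    unfolding piece_def using Db strip by blast
  have finW0: "finite W0" using finite_W by (simp add: W0_def)
  let ?S = "sphere 0 1 \<times> {0..<p} :: point set"
  have sb: "sphere (0::real^3) 1 \<in> sets borel" by (intro borel_closed) auto
  have "emeasure sphere_area (sphere 0 1) = ennreal (4 * pi)"
    using emeasure_sphere_area_restrict[of UNIV] emeasure_sphere_area_UNIV by simp
  then have VS: "?V ?S = ennreal (4 * pi * p)"
    using p sb by (subst emeasure_riemannian_volume_Times) (auto simp: ennreal_mult)
  have cover: "?S \<subseteq> (\<Union>A\<in>W0. \<Union>n. product_motion A (off A n) ` piece A n)"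
  proof
    fix X assume X: "X \<in> ?S"
    then have XS: "X \<in> S2R" and Xt: "0 \<le> snd X" "snd X < p" by (auto simp: S2R_def)
    obtain g Y where gY: "g \<in> \<Gamma>" "Y \<in> ?D" "g Y = X" by (rule dv_cell_covers[OF K XS])
    obtain A k where A: "A \<in> W" "orthogonal_transformation A" "g = isometry_of A (of_int k * u)"
      using gY(1) by (rule form_obtain)
    have AW0: "A \<in> W0" using A gY(1) by (auto simp: W0_def)
    obtain j :: int where "of_int k * u - s0 A = j * p"
      using lattice[OF s0[OF AW0], of "of_int k * u"] gY(1) A(2,3) by auto
    then have off: "of_int k * u = off A (int_encode j)" by (simp add: off_def)
    have YS: "Y \<in> S2R" using gY(2) by (simp add: dv_cell_def)
    have X': "X = product_motion A (off A (int_encode j)) Y"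
      using gY(3) YS unfolding A(3) off by (simp add: isometry_of_eq_motion)
    then have "Y \<in> piece A (int_encode j)"
      using gY(2) Xt by (simp add: piece_def product_motion_def mem_Times_iff)
    then show "X \<in> (\<Union>A\<in>W0. \<Union>n. product_motion A (off A n) ` piece A n)"
      using X' AW0 by blast
  qed
  have ib: "product_motion A (off A n) ` piece A n \<in> sets borel" if "A \<in> W0" for A n
    using that product_motion_image(1)[OF _ pb] by (simp add: W0_def)
  have each: "?V (\<Union>n. product_motion A (off A n) ` piece A n) \<le> ?V ?D" if A: "A \<in> W0" for A
  proof -
    have disj: "disjoint_family (piece A)"
      unfolding disjoint_family_on_def
    proof (intro ballI impI)
      fix m n :: nat assume "m \<noteq> n"
      then have ne: "int_decode m \<noteq> int_decode n" by (metis int_decode_inverse)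
      show "piece A m \<inter> piece A n = {}"
      proof (rule ccontr)
        assume "piece A m \<inter> piece A n \<noteq> {}"
        then obtain t where t: "- off A m \<le> t" "t < p - off A m" "- off A n \<le> t" "t < p - off A n"
          by (auto simp: piece_def)
        then have "\<bar>off A m - off A n\<bar> < p" by linarith
        then have "\<bar>of_int (int_decode m - int_decode n) * p\<bar> < 1 * p" by (simp add: off_def algebra_simps)
        then have "\<bar>real_of_int (int_decode m - int_decode n)\<bar> < 1" using p by (simp add: abs_mult)
        then show False using ne by linarith
      qed
    qed
    have "?V (\<Union>n. product_motion A (off A n) ` piece A n) \<le> (\<Sum>n. ?V (product_motion A (off A n) ` piece A n))"
      using ib[OF A] by (intro emeasure_subadditive_countably) auto
    also have "\<dots> = (\<Sum>n. ?V (piece A n))"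
      using A product_motion_image(2)[OF _ pb] by (simp add: W0_def)
    also have "\<dots> = ?V (\<Union>n. piece A n)"
      by (rule suminf_emeasure) (use pb disj in auto)
    also have "\<dots> \<le> ?V ?D" by (rule emeasure_mono) (use Db in \<open>auto simp: piece_def\<close>)
    finally show ?thesis .
  qed
  have ub: "(\<Union>n. product_motion A (off A n) ` piece A n) \<in> sets borel" if "A \<in> W0" for A
    using ib[OF that] by blast
  have "ennreal (4 * pi * p) \<le> ?V (\<Union>A\<in>W0. \<Union>n. product_motion A (off A n) ` piece A n)"
    unfolding VS[symmetric] by (rule emeasure_mono[OF cover]) (use ub finW0 in auto)
  also have "\<dots> \<le> (\<Sum>A\<in>W0. ?V (\<Union>n. product_motion A (off A n) ` piece A n))"
    by (rule emeasure_subadditive_finite) (use ub finW0 in auto)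
  also have "\<dots> \<le> (\<Sum>A\<in>W0. ?V ?D)" by (rule sum_mono) (rule each)
  also have "\<dots> = of_nat (card W0) * ?V ?D" by simp
  also have "\<dots> \<le> of_nat (card W) * ?V ?D"
    by (intro mult_right_mono of_nat_mono card_mono finite_W) (auto simp: W0_def)
  finally show ?thesis .
qed

end

section \<open>Reflections and space groups\<close>

lemma sphere_reflection_linear: "linear (sphere_reflection n)"
  unfolding sphere_reflection_def
  by (rule linearI) (simp_all add: inner_add_right algebra_simps)

lemma sphere_reflection_self: "norm n = 1 \<Longrightarrow> sphere_reflection n n = - n"
  by (simp add: sphere_reflection_def norm_eq_1 scaleR_2)

lemma sphere_reflection_minus: "sphere_reflection (- n) = sphere_reflection n"
  by (simp add: sphere_reflection_def fun_eq_iff)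

lemma sphere_reflection_twice: "norm n = 1 \<Longrightarrow> sphere_reflection n (sphere_reflection n P) = P"
  by (simp add: sphere_reflection_def norm_eq_1 inner_diff_right algebra_simps flip: scaleR_add_left)

lemma sphere_reflection_involution: "norm n = 1 \<Longrightarrow> sphere_reflection n \<circ> sphere_reflection n = (\<lambda>P. P)"
  by (simp add: fun_eq_iff sphere_reflection_twice)

lemma sphere_reflection_orthogonal:
  assumes "norm n = 1"
  shows "orthogonal_transformation (sphere_reflection n)"
  unfolding orthogonal_transformation_def
proof (intro conjI allI sphere_reflection_linear)
  fix v w show "sphere_reflection n v \<bullet> sphere_reflection n w = v \<bullet> w"
    using assms by (simp add: sphere_reflection_def norm_eq_1 inner_diff inner_commute algebra_simps)
qed

lemma sphere_reflection_conj:
  assumes "orthogonal_transformation w"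
  shows "sphere_reflection (w n) \<circ> w = w \<circ> sphere_reflection n"
proof
  fix P
  have "linear w" "w n \<bullet> w P = n \<bullet> P" using assms by (auto simp: orthogonal_transformation_def)
  then show "(sphere_reflection (w n) \<circ> w) P = (w \<circ> sphere_reflection n) P"
    by (simp add: sphere_reflection_def linear_diff linear_scale)
qed

lemma sphere_reflection_conj_sign:
  assumes "orthogonal_transformation w" "w n = n' \<or> w n = - n'"
  shows "sphere_reflection n' \<circ> w = w \<circ> sphere_reflection n"
  using sphere_reflection_conj[OF assms(1), of n] assms(2) by (auto simp: sphere_reflection_minus)

lemma sphere_reflection_inv:
  assumes "norm n = 1"
  shows "inv_into UNIV (sphere_reflection n) = sphere_reflection n"
  by (rule inv_equality) (simp_all add: sphere_reflection_twice[OF assms])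

lemma glide_reflection_eq: "glide_reflection n s = isometry_of (sphere_reflection n) s"
  by (simp add: glide_reflection_def isometry_of_def)

lemma fibre_translation_eq: "fibre_translation s = isometry_of (\<lambda>P. P) s"
  by (simp add: fibre_translation_def isometry_of_def)

lemma orthogonal_transformation_ident: "orthogonal_transformation (\<lambda>P::real^3. P)"
  by simp

lemma space_group_generators:
  "i \<in> {1..m} \<Longrightarrow> isometry_of (sphere_reflection (n i)) (\<tau> i * p) \<in> space_group m n \<tau> p"
  "isometry_of (\<lambda>P. P) p \<in> space_group m n \<tau> p"
  unfolding space_group_def glide_reflection_eq fibre_translation_eq
  by (auto intro: generate.incl)

lemma space_group_subgroup:
  assumes "\<And>i. i \<in> {1..m} \<Longrightarrow> norm (n i) = 1"
  shows "subgroup (space_group m n \<tau> p) (BijGroup S2R)"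
  unfolding space_group_def glide_reflection_eq fibre_translation_eq
  by (rule group.generate_is_subgroup[OF group_BijGroup])
     (use assms in \<open>auto intro!: isometry_of_in_carrier sphere_reflection_orthogonal\<close>)

text \<open>The property that survives multiplication is that the linear part of an element maps \<open>W\<close> to itself by
composition; applied to the identity it puts the linear part into \<open>W\<close>.\<close>

lemma space_group_motion_group:
  fixes u p :: real
  assumes n: "\<And>i. i \<in> {1..m} \<Longrightarrow> norm (n i) = 1"
    and W: "finite W" "(\<lambda>P. P) \<in> W"
    and closed: "\<And>i B. i \<in> {1..m} \<Longrightarrow> B \<in> W \<Longrightarrow> sphere_reflection (n i) \<circ> B \<in> W"
    and u: "u > 0" "\<And>i. i \<in> {1..m} \<Longrightarrow> \<exists>k::int. \<tau> i * p = k * u" "\<exists>k::int. p = k * u"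
  shows "motion_group (space_group m n \<tau> p) W u"
proof (rule motion_group.intro)
  show "subgroup (space_group m n \<tau> p) (BijGroup S2R)" by (rule space_group_subgroup) (rule n)
  fix g assume "g \<in> space_group m n \<tau> p"
  then have "\<exists>A. \<exists>k::int. orthogonal_transformation A \<and> (\<forall>B\<in>W. A \<circ> B \<in> W) \<and> g = isometry_of A (k * u)"
    unfolding space_group_def
  proof (induction rule: generate.induct)
    case one
    show ?case
      by (rule exI[of _ "\<lambda>P. P"], rule exI[of _ 0]) (auto simp: one_BijGroup_S2R comp_def)
  next
    case (incl h)
    then consider i where "i \<in> {1..m}" "h = glide_reflection (n i) (\<tau> i * p)" | "h = fibre_translation p" by auto
    then show ?case
    proof cases
      case 1
      obtain k :: int where "\<tau> i * p = k * u" using u(2)[OF 1(1)] by blast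
      then have "h = isometry_of (sphere_reflection (n i)) (k * u)" by (simp only: 1(2) glide_reflection_eq)
      then show ?thesis using sphere_reflection_orthogonal[OF n[OF 1(1)]] closed[OF 1(1)] by blast
    next
      case 2
      obtain k :: int where "p = k * u" using u(3) by blast
      then show ?thesis using 2
        by (intro exI[of _ "\<lambda>P. P"] exI[of _ k]) (simp add: fibre_translation_eq comp_def)
    qed
  next
    case (inv h)
    then consider i where "i \<in> {1..m}" "h = glide_reflection (n i) (\<tau> i * p)" | "h = fibre_translation p" by auto
    then show ?case
    proof cases
      case 1
      obtain k :: int where "\<tau> i * p = k * u" using u(2)[OF 1(1)] by blast
      then have "inv\<^bsub>BijGroup S2R\<^esub> h = isometry_of (sphere_reflection (n i)) (real_of_int (- k) * u)"
        by (simp add: 1(2) glide_reflection_eq inv_isometry_of sphere_reflection_inv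
            sphere_reflection_orthogonal n[OF 1(1)])
      then show ?thesis using sphere_reflection_orthogonal[OF n[OF 1(1)]] closed[OF 1(1)] by blast
    next
      case 2
      obtain k :: int where "p = k * u" using u(3) by blast
      moreover have "inv_into UNIV (\<lambda>P::real^3. P) = (\<lambda>P. P)" by (rule inv_equality) auto
      ultimately show ?thesis using 2
        by (intro exI[of _ "\<lambda>P. P"] exI[of _ "- k"]) (simp add: fibre_translation_eq comp_def inv_isometry_of)
    qed
  next
    case (eng h1 h2)
    obtain A and k :: int where A: "orthogonal_transformation A" "\<forall>B\<in>W. A \<circ> B \<in> W" "h1 = isometry_of A (k * u)"
      using eng.IH(1) by blast
    obtain A' and k' :: int where A': "orthogonal_transformation A'" "\<forall>B\<in>W. A' \<circ> B \<in> W" "h2 = isometry_of A' (k' * u)"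
      using eng.IH(2) by blast
    show ?case
    proof (intro exI[of _ "A \<circ> A'"] exI[of _ "k + k'"] conjI)
      show "orthogonal_transformation (A \<circ> A')"
        using A(1) A'(1) by (rule orthogonal_transformation_compose)
      show "\<forall>B\<in>W. A \<circ> A' \<circ> B \<in> W" using A(2) A'(2) by (simp add: comp_assoc)
      show "h1 \<otimes>\<^bsub>BijGroup S2R\<^esub> h2 = isometry_of (A \<circ> A') (real_of_int (k + k') * u)"
        using A(1,3) A'(1,3) by (simp add: isometry_of_mult algebra_simps)
    qed
  qed
  then show "\<exists>A\<in>W. \<exists>k::int. orthogonal_transformation A \<and> g = isometry_of A (k * u)"
    using W(2) by (metis comp_id eq_id_iff)
qed (rule W(1), rule u(1))

context motion_group
begin

lemma translation_quotient:
  assumes "isometry_of A s \<in> \<Gamma>" "isometry_of A t \<in> \<Gamma>" "orthogonal_transformation A"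
  shows "isometry_of (\<lambda>P. P) (t - s) \<in> \<Gamma>"
proof -
  have "isometry_of (inv_into UNIV A \<circ> A) (- s + t) \<in> \<Gamma>"
    using inv_closed[OF assms(1,3)] assms(2,3) by (intro mult_closed orthogonal_transformation_inv)
  moreover have "inv_into UNIV A \<circ> A = (\<lambda>P. P)"
    using orthogonal_transformation_bij[OF assms(3)] by (auto simp: bij_is_inj inv_f_f)
  ultimately show ?thesis by simp
qed

lemma translation_minus:
  assumes "isometry_of (\<lambda>P. P) s \<in> \<Gamma>"
  shows "isometry_of (\<lambda>P. P) (- s) \<in> \<Gamma>"
  using translation_quotient[OF assms one_closed] by simp

lemma translation_multiple:
  assumes "isometry_of (\<lambda>P. P) s \<in> \<Gamma>"
  shows "isometry_of (\<lambda>P. P) (of_int k * s) \<in> \<Gamma>"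
proof -
  have nat: "isometry_of (\<lambda>P. P) (of_nat j * s) \<in> \<Gamma>" for j :: nat
  proof (induction j)
    case (Suc j)
    from mult_closed[OF assms this] show ?case by (simp add: comp_def algebra_simps)
  qed (simp add: one_closed)
  show ?thesis
    using nat translation_minus[OF nat] by (cases k rule: int_cases2) auto
qed

lemma translate_closed:
  assumes "isometry_of A s \<in> \<Gamma>" "orthogonal_transformation A" "isometry_of (\<lambda>P. P) t \<in> \<Gamma>"
  shows "isometry_of A (s + t) \<in> \<Gamma>"
  using mult_closed[OF assms(1,3,2)] by (simp add: comp_def)

end

section \<open>Orders of reflection groups\<close>

text \<open>The products of coset representatives \<open>w\<close> and elements of \<open>D\<close> form a set closed under the generators
\<open>r i\<close>: a generator either takes \<open>w\<close> to another representative, or it turns into a generator from \<open>J\<close> when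
moved past \<open>w\<close> and is absorbed by \<open>D\<close>.\<close>

lemma coset_enumeration:
  fixes D ws :: "('a \<Rightarrow> 'a) set" and r :: "nat \<Rightarrow> 'a \<Rightarrow> 'a"
  assumes D: "finite D" "(\<lambda>P. P) \<in> D" "\<And>j d. j \<in> J \<Longrightarrow> d \<in> D \<Longrightarrow> r j \<circ> d \<in> D"
    and ws: "finite ws" "(\<lambda>P. P) \<in> ws"
    and step: "\<And>i w. i \<in> I \<Longrightarrow> w \<in> ws \<Longrightarrow> r i \<circ> w \<in> ws \<or> (\<exists>j\<in>J. r i \<circ> w = w \<circ> r j)"
  obtains W where "finite W" "card W \<le> card ws * card D" "(\<lambda>P. P) \<in> W"
    "\<And>i B. i \<in> I \<Longrightarrow> B \<in> W \<Longrightarrow> r i \<circ> B \<in> W"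
proof -
  define W where "W = (\<lambda>(w, d). w \<circ> d) ` (ws \<times> D)"
  show ?thesis
  proof (rule that[of W])
    show "finite W" unfolding W_def using D ws by simp
    show "card W \<le> card ws * card D"
      unfolding W_def card_cartesian_product[symmetric] using D ws by (intro card_image_le) simp
    show "(\<lambda>P. P) \<in> W" unfolding W_def using D ws by (auto simp: comp_def intro!: image_eqI[where x="(\<lambda>P. P, \<lambda>P. P)"])
    fix i B assume i: "i \<in> I" and "B \<in> W"
    then obtain w d where wd: "w \<in> ws" "d \<in> D" "B = w \<circ> d" unfolding W_def by auto
    from step[OF i wd(1)] show "r i \<circ> B \<in> W"
    proof
      assume "r i \<circ> w \<in> ws"
      then show ?thesis using wd unfolding W_def
        by (auto simp: comp_assoc intro!: image_eqI[where x="(r i \<circ> w, d)"])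
    next
      assume "\<exists>j\<in>J. r i \<circ> w = w \<circ> r j"
      then obtain j where j: "j \<in> J" "r i \<circ> w = w \<circ> r j" by blast
      then have "r i \<circ> B = w \<circ> (r j \<circ> d)" using wd(3) by (metis comp_assoc)
      then show ?thesis using wd D(3)[OF j(1) wd(2)] unfolding W_def
        by (auto intro!: image_eqI[where x="(w, r j \<circ> d)"])
    qed
  qed
qed

text \<open>The mirrors of the dihedral group have normals \<open>u j\<close> at angle \<open>j * pi / k\<close> from \<open>n\<close>.  The reflections \<open>s j\<close>
in them satisfy \<open>s (j + 1) \<circ> s j = s 1 \<circ> s 0\<close>, so \<open>s 1\<close> shifts the index of \<open>s 0 \<circ> s j\<close> and there are only
\<open>k\<close> reflections and \<open>k\<close> rotations.\<close>

lemma dihedral_closure: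
  fixes n n' :: "real^3" and k :: nat
  assumes n: "norm n = 1" "norm n' = 1" and k: "k \<ge> 2" and ang: "n \<bullet> n' = - cos (pi / k)"
  obtains D where "finite D" "card D \<le> 2 * k" "(\<lambda>P. P) \<in> D"
    "\<And>d. d \<in> D \<Longrightarrow> sphere_reflection n \<circ> d \<in> D" "\<And>d. d \<in> D \<Longrightarrow> sphere_reflection n' \<circ> d \<in> D"
proof -
  define a where "a = pi / k"
  have a: "0 < a" "a < pi" using k by (auto simp: a_def divide_less_eq)
  then have sa: "sin a > 0" by (rule sin_gt_zero)
  define e where "e = (- n' - cos a *\<^sub>R n) /\<^sub>R sin a"
  have nn: "n \<bullet> n = 1" "n' \<bullet> n' = 1" "n' \<bullet> n = - cos a" "n \<bullet> n' = - cos a"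
    using n ang by (auto simp: norm_eq_1 a_def inner_commute)
  have ne: "n \<bullet> e = 0" using nn by (simp add: e_def inner_diff_right)
  have ee: "e \<bullet> e = 1"
  proof -
    have "(- n' - cos a *\<^sub>R n) \<bullet> (- n' - cos a *\<^sub>R n) = 1 - (cos a)\<^sup>2"
      using nn by (simp add: inner_diff inner_add algebra_simps power2_eq_square)
    also have "\<dots> = (sin a)\<^sup>2" by (simp add: sin_squared_eq)
    finally show ?thesis using sa by (simp add: e_def power2_eq_square) (simp add: field_simps)
  qed
  define u where "u j = cos (of_int j * a) *\<^sub>R n + sin (of_int j * a) *\<^sub>R e" for j :: int
  have u0: "u 0 = n" and u1: "u 1 = - n'"
    using sa by (simp_all add: u_def e_def algebra_simps)
  have inner_u: "u i \<bullet> u j = cos (of_int i * a - of_int j * a)" for i j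
    using nn ne ee by (simp add: u_def inner_add inner_commute[of e n] cos_diff)
  have norm_u: "norm (u j) = 1" for j by (simp add: norm_eq_1 inner_u)
  define s where "s j = sphere_reflection (u j)" for j
  have ss: "s j \<circ> s j = (\<lambda>P. P)" for j unfolding s_def by (rule sphere_reflection_involution[OF norm_u])
  have ss': "s j (s j P) = P" for j P unfolding s_def by (rule sphere_reflection_twice[OF norm_u])
  have s0: "s 0 = sphere_reflection n" and s1: "s 1 = sphere_reflection n'"
    by (simp_all add: s_def u0 u1 sphere_reflection_minus)
  have refl_u: "s j (u (j - 1)) = - u (j + 1)" for j
  proof -
    have c: "cos (of_int (j - 1) * a) + cos (of_int (j + 1) * a) = 2 * cos a * cos (of_int j * a)"
      by (simp add: left_diff_distrib distrib_right cos_add cos_diff)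
    have s: "sin (of_int (j - 1) * a) + sin (of_int (j + 1) * a) = 2 * cos a * sin (of_int j * a)"
      by (simp add: left_diff_distrib distrib_right sin_add sin_diff)
    have "u (j - 1) + u (j + 1) = (cos (of_int (j - 1) * a) + cos (of_int (j + 1) * a)) *\<^sub>R n
        + (sin (of_int (j - 1) * a) + sin (of_int (j + 1) * a)) *\<^sub>R e"
      unfolding u_def scaleR_add_left by (simp only: add_ac)
    then have "u (j - 1) + u (j + 1) = (2 * cos a) *\<^sub>R u j"
      unfolding c s by (simp add: u_def scaleR_right_distrib)
    moreover have "u j \<bullet> u (j - 1) = cos a" by (simp add: inner_u algebra_simps)
    ultimately have "s j (u (j - 1)) = u (j - 1) - (u (j - 1) + u (j + 1))"
      by (simp add: s_def sphere_reflection_def)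
    then show ?thesis by simp
  qed
  have shift: "s (j + 1) \<circ> s j = s j \<circ> s (j - 1)" for j
  proof -
    have "sphere_reflection (u (j + 1)) \<circ> s j = s j \<circ> sphere_reflection (u (j - 1))"
      by (rule sphere_reflection_conj_sign)
         (use refl_u[of j] norm_u in \<open>auto simp: s_def intro: sphere_reflection_orthogonal\<close>)
    then show ?thesis by (simp add: s_def)
  qed
  have const: "s (j + 1) \<circ> s j = s 1 \<circ> s 0" for j
  proof (induction j rule: int_induct[where k=0])
    case (step1 i) then show ?case using shift[of "i + 1"] by simp
  next
    case (step2 i) then show ?case using shift[of i] by simp
  qed simp
  have step1: "s 1 \<circ> (s 0 \<circ> s j) = s (j + 1)" for j
  proof -
    have "s 1 \<circ> (s 0 \<circ> s j) = s (j + 1) \<circ> (s j \<circ> s j)" using const[of j] by (metis comp_assoc)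
    then show ?thesis by (simp add: fun_eq_iff ss')
  qed
  have step2: "s 1 \<circ> s j = s 0 \<circ> s (j - 1)" for j
  proof -
    have "s 1 \<circ> (s 0 \<circ> s (j - 1)) = s j" using step1[of "j - 1"] by simp
    then have "s 1 \<circ> s j = (s 1 \<circ> s 1) \<circ> (s 0 \<circ> s (j - 1))" by (simp add: comp_assoc)
    then show ?thesis by (simp add: fun_eq_iff ss')
  qed
  have ka: "of_nat k * a = pi" using k by (simp add: a_def)
  have per: "s (j + int k) = s j" for j
  proof -
    have "of_int (j + int k) * a = of_int j * a + pi" using ka by (simp add: algebra_simps)
    then have "u (j + int k) = - u j" by (simp add: u_def)
    then show ?thesis by (simp add: s_def sphere_reflection_minus)
  qed
  have per': "s (j + i * int k) = s j" for i j
  proof (induction i rule: int_induct[where k=0])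
    case (step1 i) then show ?case using per[of "j + i * int k"] by (simp add: algebra_simps)
  next
    case (step2 i) then show ?case using per[of "j + (i - 1) * int k"] by (simp add: algebra_simps)
  qed simp
  have range_s: "range s = s ` {0..<int k}"
  proof (intro equalityI subsetI)
    fix x assume "x \<in> range s"
    then obtain j where "x = s j" by auto
    also have "s j = s (j mod int k)" using per'[of "j mod int k" "j div int k"] by (simp add: algebra_simps)
    finally show "x \<in> s ` {0..<int k}" using k by auto
  qed auto
  have fin: "finite (range s)" unfolding range_s by simp
  have card: "card (range s) \<le> k" unfolding range_s using card_image_le[of "{0..<int k}" s] by simp
  define D where "D = range s \<union> (\<lambda>g. s 0 \<circ> g) ` range s"
  show ?thesis
  proof (rule that[of D])
    show "finite D" unfolding D_def using fin by simp
    have "card D \<le> card (range s) + card ((\<lambda>g. s 0 \<circ> g) ` range s)" unfolding D_def by (rule card_Un_le)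
    also have "\<dots> \<le> card (range s) + card (range s)" by (intro add_left_mono card_image_le fin)
    finally show "card D \<le> 2 * k" using card by simp
    have "s 0 \<circ> s 0 \<in> D" unfolding D_def by blast
    then show "(\<lambda>P. P) \<in> D" by (simp add: ss)
    fix d assume d: "d \<in> D"
    then consider j where "d = s j" | j where "d = s 0 \<circ> s j" unfolding D_def by blast
    then show "sphere_reflection n \<circ> d \<in> D"
    proof cases
      case (2 j)
      have "s 0 \<circ> (s 0 \<circ> s j) = s j" by (simp add: fun_eq_iff ss')
      then show ?thesis using 2 unfolding s0[symmetric] D_def by simp
    qed (auto simp: s0[symmetric] D_def)
    from d consider j where "d = s j" | j where "d = s 0 \<circ> s j" unfolding D_def by blast
    then show "sphere_reflection n' \<circ> d \<in> D"
      by cases (auto simp: s1[symmetric] D_def step1 step2)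
  qed
qed

text \<open>Coordinates with respect to the normals with coefficients in the ring generated by \<open>\<mu>\<close>, which is
\<open>1\<close>, \<open>sqrt 2\<close> or the golden ratio.  The two components of a coefficient are kept apart, so that the
reflections act by integer arithmetic.\<close>

definition triangle_coords :: "real^3 \<Rightarrow> real^3 \<Rightarrow> real^3 \<Rightarrow> real \<Rightarrow> real \<Rightarrow> real \<Rightarrow> real \<Rightarrow> real \<Rightarrow> real \<Rightarrow> real \<Rightarrow> real^3" where
  "triangle_coords n1 n2 n3 \<mu> a a' b b' c c' =
     (a + a' * \<mu>) *\<^sub>R n1 + (b + b' * \<mu>) *\<^sub>R n2 + (c + c' * \<mu>) *\<^sub>R n3"

lemma triangle_coords_reflect:
  fixes n1 n2 n3 :: "real^3"
  assumes norm: "norm n1 = 1" "norm n2 = 1" "norm n3 = 1"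
    and ang: "n1 \<bullet> n2 = 0" "n1 \<bullet> n3 = - (1 / 2)" "n2 \<bullet> n3 = - (\<mu> / 2)"
    and \<mu>: "\<mu>\<^sup>2 = \<alpha> + \<beta> * \<mu>"
  shows "sphere_reflection n1 (triangle_coords n1 n2 n3 \<mu> a a' b b' c c') = triangle_coords n1 n2 n3 \<mu> (c - a) (c' - a') b b' c c'"
    and "sphere_reflection n2 (triangle_coords n1 n2 n3 \<mu> a a' b b' c c') = triangle_coords n1 n2 n3 \<mu> a a' (\<alpha> * c' - b) (c + \<beta> * c' - b') c c'"
    and "sphere_reflection n3 (triangle_coords n1 n2 n3 \<mu> a a' b b' c c') = triangle_coords n1 n2 n3 \<mu> a a' b b' (a + \<alpha> * b' - c) (a' + b + \<beta> * b' - c')"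
proof -
  let ?v = "triangle_coords n1 n2 n3 \<mu> a a' b b' c c'"
  have ip: "n1 \<bullet> n1 = 1" "n2 \<bullet> n2 = 1" "n3 \<bullet> n3 = 1" "n2 \<bullet> n1 = 0" "n3 \<bullet> n1 = - (1 / 2)" "n3 \<bullet> n2 = - (\<mu> / 2)"
    using norm ang by (simp_all add: norm_eq_1 inner_commute)
  have i1: "2 * (n1 \<bullet> ?v) = 2 * (a + a' * \<mu>) - (c + c' * \<mu>)"
    by (simp add: triangle_coords_def inner_add_right ip ang field_simps)
  have i2: "2 * (n2 \<bullet> ?v) = 2 * (b + b' * \<mu>) - \<mu> * (c + c' * \<mu>)"
    by (simp add: triangle_coords_def inner_add_right ip ang field_simps)
  have i3: "2 * (n3 \<bullet> ?v) = 2 * (c + c' * \<mu>) - (a + a' * \<mu>) - \<mu> * (b + b' * \<mu>)"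
    by (simp add: triangle_coords_def inner_add_right ip ang field_simps)
  have m: "\<mu> * (x * \<mu>) = x * \<alpha> + x * \<beta> * \<mu>" for x
    using arg_cong[OF \<mu>, of "\<lambda>t. x * t"] by (simp add: power2_eq_square algebra_simps)
  have "sphere_reflection n1 ?v = (a + a' * \<mu> - (2 * (a + a' * \<mu>) - (c + c' * \<mu>))) *\<^sub>R n1 + (b + b' * \<mu>) *\<^sub>R n2 + (c + c' * \<mu>) *\<^sub>R n3"
    unfolding sphere_reflection_def i1 scaleR_left_diff_distrib by (simp add: triangle_coords_def)
  also have "a + a' * \<mu> - (2 * (a + a' * \<mu>) - (c + c' * \<mu>)) = (c - a) + (c' - a') * \<mu>"
    by (simp add: algebra_simps)
  finally show "sphere_reflection n1 ?v = triangle_coords n1 n2 n3 \<mu> (c - a) (c' - a') b b' c c'"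
    by (simp add: triangle_coords_def)
  have "sphere_reflection n2 ?v = (a + a' * \<mu>) *\<^sub>R n1 + (b + b' * \<mu> - (2 * (b + b' * \<mu>) - \<mu> * (c + c' * \<mu>))) *\<^sub>R n2 + (c + c' * \<mu>) *\<^sub>R n3"
    unfolding sphere_reflection_def i2 scaleR_left_diff_distrib by (simp add: triangle_coords_def)
  also have "b + b' * \<mu> - (2 * (b + b' * \<mu>) - \<mu> * (c + c' * \<mu>)) = (\<alpha> * c' - b) + (c + \<beta> * c' - b') * \<mu>"
    using m[of c'] by (simp add: algebra_simps)
  finally show "sphere_reflection n2 ?v = triangle_coords n1 n2 n3 \<mu> a a' (\<alpha> * c' - b) (c + \<beta> * c' - b') c c'"
    by (simp add: triangle_coords_def)
  have "sphere_reflection n3 ?v = (a + a' * \<mu>) *\<^sub>R n1 + (b + b' * \<mu>) *\<^sub>R n2 + (c + c' * \<mu> - (2 * (c + c' * \<mu>) - (a + a' * \<mu>) - \<mu> * (b + b' * \<mu>))) *\<^sub>R n3"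
    unfolding sphere_reflection_def i3 scaleR_left_diff_distrib by (simp add: triangle_coords_def)
  also have "c + c' * \<mu> - (2 * (c + c' * \<mu>) - (a + a' * \<mu>) - \<mu> * (b + b' * \<mu>)) = (a + \<alpha> * b' - c) + (a' + b + \<beta> * b' - c') * \<mu>"
    using m[of b'] by (simp add: algebra_simps)
  finally show "sphere_reflection n3 ?v = triangle_coords n1 n2 n3 \<mu> a a' b b' (a + \<alpha> * b' - c) (a' + b + \<beta> * b' - c')"
    by (simp add: triangle_coords_def)
qed

text \<open>The subgroup generated by the last two reflections has 4, 6 and 12 cosets in the three polyhedral
groups.  The representatives \<open>w0\<close>, \<open>w1\<close>, ... are found by multiplying with generators as long as new
cosets appear.  The other products are recognised from the images of \<open>n2\<close> and \<open>n3\<close>: if \<open>w\<close> takes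
\<open>n\<^sub>j\<close> to \<open>n\<^sub>i\<close> or \<open>- n\<^sub>i\<close>, then \<open>r i \<circ> w = w \<circ> r j\<close>.\<close>

lemma tetrahedral_order:
  fixes n1 n2 n3 :: "real^3"
  assumes norm: "norm n1 = 1" "norm n2 = 1" "norm n3 = 1"
    and ang: "n1 \<bullet> n2 = 0" "n1 \<bullet> n3 = - (1 / 2)" "n2 \<bullet> n3 = - (\<mu> / 2)"
    and \<mu>: "\<mu> = 1"
    and D: "finite D" "card D \<le> 6" "(\<lambda>P. P) \<in> D"
      "\<And>d. d \<in> D \<Longrightarrow> sphere_reflection n2 \<circ> d \<in> D" "\<And>d. d \<in> D \<Longrightarrow> sphere_reflection n3 \<circ> d \<in> D"
  obtains W where "finite W" "card W \<le> 24" "(\<lambda>P. P) \<in> W"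
    "\<And>B. B \<in> W \<Longrightarrow> sphere_reflection n1 \<circ> B \<in> W"
    "\<And>B. B \<in> W \<Longrightarrow> sphere_reflection n2 \<circ> B \<in> W"
    "\<And>B. B \<in> W \<Longrightarrow> sphere_reflection n3 \<circ> B \<in> W"
proof -
  have \<mu>': "\<mu>\<^sup>2 = 1 + 0 * \<mu>" using \<mu> by simp
  define r where "r i = sphere_reflection (if i = 1 then n1 else if i = 2 then n2 else n3)" for i :: nat
  have r: "r 1 = sphere_reflection n1" "r 2 = sphere_reflection n2" "r 3 = sphere_reflection n3"
    by (simp_all add: r_def)
  note zr = triangle_coords_reflect[OF norm ang \<mu>', folded r]
  have rr: "r i \<circ> r i = (\<lambda>P. P)" "r i (r i P) = P" for i P
    using norm by (simp_all add: r_def sphere_reflection_involution sphere_reflection_twice)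
  have ro: "orthogonal_transformation (r i)" for i
    using norm by (simp add: r_def sphere_reflection_orthogonal)
  let ?z = "triangle_coords n1 n2 n3 \<mu>"
  have nz: "n1 = ?z 1 0 0 0 0 0" "n2 = ?z 0 0 1 0 0 0" "n3 = ?z 0 0 0 0 1 0"
    "- n1 = ?z (-1) 0 0 0 0 0" "- n2 = ?z 0 0 (-1) 0 0 0" "- n3 = ?z 0 0 0 0 (-1) 0"
    by (simp_all add: triangle_coords_def)
  have nzs: "n1 = ?z 0 1 0 0 0 0" "n2 = ?z 0 0 0 1 0 0" "n3 = ?z 0 0 0 0 0 1"
    "- n1 = ?z 0 (-1) 0 0 0 0" "- n2 = ?z 0 0 0 (-1) 0 0" "- n3 = ?z 0 0 0 0 0 (-1)"
    using \<mu> by (simp_all add: triangle_coords_def)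
  define w0 :: "real^3 \<Rightarrow> real^3" where "w0 = (\<lambda>P. P)"
  define w1 where "w1 = r 1 \<circ> w0"
  define w2 where "w2 = r 3 \<circ> w1"
  define w3 where "w3 = r 2 \<circ> w2"
  note ws_defs = w0_def w1_def w2_def w3_def
  have wo: "orthogonal_transformation w0" "orthogonal_transformation w1" "orthogonal_transformation w2" "orthogonal_transformation w3"
    unfolding ws_defs by (intro orthogonal_transformation_compose ro orthogonal_transformation_ident)+
  have im0: "w0 n2 = ?z 0 0 1 0 0 0" "w0 n3 = ?z 0 0 0 0 1 0"
    by (simp_all add: w0_def triangle_coords_def)
  have im1: "w1 n2 = ?z 0 0 1 0 0 0" "w1 n3 = ?z 1 0 0 0 1 0"
    by (simp_all add: w1_def im0 zr del: One_nat_def)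
  have im2: "w2 n2 = ?z 0 0 1 0 0 1" "w2 n3 = ?z 1 0 0 0 0 0"
    by (simp_all add: w2_def im1 zr del: One_nat_def)
  have im3: "w3 n2 = ?z 0 0 0 0 0 1" "w3 n3 = ?z 1 0 0 0 0 0"
    by (simp_all add: w3_def im2 zr del: One_nat_def)
  have s0_1: "r 1 \<circ> w0 = w1"
    by (simp add: w1_def)
  have s0_2: "r 2 \<circ> w0 = w0 \<circ> r 2"
    unfolding r by (rule sphere_reflection_conj_sign[OF wo(1)]) (rule disjI1, rule trans[OF im0(1) nz(2)[symmetric]])
  have s0_3: "r 3 \<circ> w0 = w0 \<circ> r 3"
    unfolding r by (rule sphere_reflection_conj_sign[OF wo(1)]) (rule disjI1, rule trans[OF im0(2) nz(3)[symmetric]])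
  have s1_1: "r 1 \<circ> w1 = w0"
    by (simp add: w1_def comp_assoc[symmetric] rr) (simp add: comp_def)
  have s1_2: "r 2 \<circ> w1 = w1 \<circ> r 2"
    unfolding r by (rule sphere_reflection_conj_sign[OF wo(2)]) (rule disjI1, rule trans[OF im1(1) nz(2)[symmetric]])
  have s1_3: "r 3 \<circ> w1 = w2"
    by (simp add: w2_def)
  have s2_1: "r 1 \<circ> w2 = w2 \<circ> r 3"
    unfolding r by (rule sphere_reflection_conj_sign[OF wo(3)]) (rule disjI1, rule trans[OF im2(2) nz(1)[symmetric]])
  have s2_2: "r 2 \<circ> w2 = w3"
    by (simp add: w3_def)
  have s2_3: "r 3 \<circ> w2 = w1"
    by (simp add: w2_def comp_assoc[symmetric] rr) (simp add: comp_def)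
  have s3_1: "r 1 \<circ> w3 = w3 \<circ> r 3"
    unfolding r by (rule sphere_reflection_conj_sign[OF wo(4)]) (rule disjI1, rule trans[OF im3(2) nz(1)[symmetric]])
  have s3_2: "r 2 \<circ> w3 = w2"
    by (simp add: w3_def comp_assoc[symmetric] rr) (simp add: comp_def)
  have s3_3: "r 3 \<circ> w3 = w3 \<circ> r 2"
    unfolding r by (rule sphere_reflection_conj_sign[OF wo(4)]) (rule disjI1, rule trans[OF im3(1) nzs(3)[symmetric]])
  let ?ws = "{w0, w1, w2, w3}"
  have cw: "card ?ws \<le> 4" using card_length[of "[w0, w1, w2, w3]"] by simp
  obtain W where W: "finite W" "card W \<le> card ?ws * card D" "(\<lambda>P. P) \<in> W"
    "\<And>i B. i \<in> {1, 2, 3} \<Longrightarrow> B \<in> W \<Longrightarrow> r i \<circ> B \<in> W"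
  proof (rule coset_enumeration[of D "{2, 3}" r ?ws "{1, 2, 3}"])
    show "r j \<circ> d \<in> D" if "j \<in> {2, 3}" "d \<in> D" for j d
      using that D(4,5) r by auto
    show "(\<lambda>P. P) \<in> ?ws" by (simp add: w0_def)
    show "r i \<circ> w \<in> ?ws \<or> (\<exists>j\<in>{2, 3}. r i \<circ> w = w \<circ> r j)" if "i \<in> {1, 2, 3}" "w \<in> ?ws" for i w
      using that by (elim insertE emptyE) (simp_all only: bex_simps s0_1 s0_2 s0_3 s1_1 s1_2 s1_3 s2_1 s2_2 s2_3 s3_1 s3_2 s3_3 insert_iff simp_thms)
  qed (use D in auto)
  have "card W \<le> 4 * 6"
    using W(2) mult_le_mono[OF cw D(2)] by linarith
  then have "card W \<le> 24" by simp
  moreover have "sphere_reflection n1 \<circ> B \<in> W" "sphere_reflection n2 \<circ> B \<in> W" "sphere_reflection n3 \<circ> B \<in> W" if "B \<in> W" for B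
    unfolding r[symmetric] using that by (intro W(4); simp)+
  ultimately show ?thesis using that[OF W(1) _ W(3)] by blast
qed

lemma octahedral_order:
  fixes n1 n2 n3 :: "real^3"
  assumes norm: "norm n1 = 1" "norm n2 = 1" "norm n3 = 1"
    and ang: "n1 \<bullet> n2 = 0" "n1 \<bullet> n3 = - (1 / 2)" "n2 \<bullet> n3 = - (\<mu> / 2)"
    and \<mu>: "\<mu>\<^sup>2 = 2"
    and D: "finite D" "card D \<le> 8" "(\<lambda>P. P) \<in> D"
      "\<And>d. d \<in> D \<Longrightarrow> sphere_reflection n2 \<circ> d \<in> D" "\<And>d. d \<in> D \<Longrightarrow> sphere_reflection n3 \<circ> d \<in> D"
  obtains W where "finite W" "card W \<le> 48" "(\<lambda>P. P) \<in> W"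
    "\<And>B. B \<in> W \<Longrightarrow> sphere_reflection n1 \<circ> B \<in> W"
    "\<And>B. B \<in> W \<Longrightarrow> sphere_reflection n2 \<circ> B \<in> W"
    "\<And>B. B \<in> W \<Longrightarrow> sphere_reflection n3 \<circ> B \<in> W"
proof -
  have \<mu>': "\<mu>\<^sup>2 = 2 + 0 * \<mu>" using \<mu> by simp
  define r where "r i = sphere_reflection (if i = 1 then n1 else if i = 2 then n2 else n3)" for i :: nat
  have r: "r 1 = sphere_reflection n1" "r 2 = sphere_reflection n2" "r 3 = sphere_reflection n3"
    by (simp_all add: r_def)
  note zr = triangle_coords_reflect[OF norm ang \<mu>', folded r]
  have rr: "r i \<circ> r i = (\<lambda>P. P)" "r i (r i P) = P" for i P
    using norm by (simp_all add: r_def sphere_reflection_involution sphere_reflection_twice)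
  have ro: "orthogonal_transformation (r i)" for i
    using norm by (simp add: r_def sphere_reflection_orthogonal)
  let ?z = "triangle_coords n1 n2 n3 \<mu>"
  have nz: "n1 = ?z 1 0 0 0 0 0" "n2 = ?z 0 0 1 0 0 0" "n3 = ?z 0 0 0 0 1 0"
    "- n1 = ?z (-1) 0 0 0 0 0" "- n2 = ?z 0 0 (-1) 0 0 0" "- n3 = ?z 0 0 0 0 (-1) 0"
    by (simp_all add: triangle_coords_def)
  define w0 :: "real^3 \<Rightarrow> real^3" where "w0 = (\<lambda>P. P)"
  define w1 where "w1 = r 1 \<circ> w0"
  define w2 where "w2 = r 3 \<circ> w1"
  define w3 where "w3 = r 2 \<circ> w2"
  define w4 where "w4 = r 3 \<circ> w3"
  define w5 where "w5 = r 1 \<circ> w4"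
  note ws_defs = w0_def w1_def w2_def w3_def w4_def w5_def
  have wo: "orthogonal_transformation w0" "orthogonal_transformation w1" "orthogonal_transformation w2" "orthogonal_transformation w3" "orthogonal_transformation w4" "orthogonal_transformation w5"
    unfolding ws_defs by (intro orthogonal_transformation_compose ro orthogonal_transformation_ident)+
  have im0: "w0 n2 = ?z 0 0 1 0 0 0" "w0 n3 = ?z 0 0 0 0 1 0"
    by (simp_all add: w0_def triangle_coords_def)
  have im1: "w1 n2 = ?z 0 0 1 0 0 0" "w1 n3 = ?z 1 0 0 0 1 0"
    by (simp_all add: w1_def im0 zr del: One_nat_def)
  have im2: "w2 n2 = ?z 0 0 1 0 0 1" "w2 n3 = ?z 1 0 0 0 0 0"
    by (simp_all add: w2_def im1 zr del: One_nat_def)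
  have im3: "w3 n2 = ?z 0 0 1 0 0 1" "w3 n3 = ?z 1 0 0 0 0 0"
    by (simp_all add: w3_def im2 zr del: One_nat_def)
  have im4: "w4 n2 = ?z 0 0 1 0 0 0" "w4 n3 = ?z 1 0 0 0 1 0"
    by (simp_all add: w4_def im3 zr del: One_nat_def)
  have im5: "w5 n2 = ?z 0 0 1 0 0 0" "w5 n3 = ?z 0 0 0 0 1 0"
    by (simp_all add: w5_def im4 zr del: One_nat_def)
  have s0_1: "r 1 \<circ> w0 = w1"
    by (simp add: w1_def)
  have s0_2: "r 2 \<circ> w0 = w0 \<circ> r 2"
    unfolding r by (rule sphere_reflection_conj_sign[OF wo(1)]) (rule disjI1, rule trans[OF im0(1) nz(2)[symmetric]])
  have s0_3: "r 3 \<circ> w0 = w0 \<circ> r 3"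
    unfolding r by (rule sphere_reflection_conj_sign[OF wo(1)]) (rule disjI1, rule trans[OF im0(2) nz(3)[symmetric]])
  have s1_1: "r 1 \<circ> w1 = w0"
    by (simp add: w1_def comp_assoc[symmetric] rr) (simp add: comp_def)
  have s1_2: "r 2 \<circ> w1 = w1 \<circ> r 2"
    unfolding r by (rule sphere_reflection_conj_sign[OF wo(2)]) (rule disjI1, rule trans[OF im1(1) nz(2)[symmetric]])
  have s1_3: "r 3 \<circ> w1 = w2"
    by (simp add: w2_def)
  have s2_1: "r 1 \<circ> w2 = w2 \<circ> r 3"
    unfolding r by (rule sphere_reflection_conj_sign[OF wo(3)]) (rule disjI1, rule trans[OF im2(2) nz(1)[symmetric]])
  have s2_2: "r 2 \<circ> w2 = w3"
    by (simp add: w3_def)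
  have s2_3: "r 3 \<circ> w2 = w1"
    by (simp add: w2_def comp_assoc[symmetric] rr) (simp add: comp_def)
  have s3_1: "r 1 \<circ> w3 = w3 \<circ> r 3"
    unfolding r by (rule sphere_reflection_conj_sign[OF wo(4)]) (rule disjI1, rule trans[OF im3(2) nz(1)[symmetric]])
  have s3_2: "r 2 \<circ> w3 = w2"
    by (simp add: w3_def comp_assoc[symmetric] rr) (simp add: comp_def)
  have s3_3: "r 3 \<circ> w3 = w4"
    by (simp add: w4_def)
  have s4_1: "r 1 \<circ> w4 = w5"
    by (simp add: w5_def)
  have s4_2: "r 2 \<circ> w4 = w4 \<circ> r 2"
    unfolding r by (rule sphere_reflection_conj_sign[OF wo(5)]) (rule disjI1, rule trans[OF im4(1) nz(2)[symmetric]])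
  have s4_3: "r 3 \<circ> w4 = w3"
    by (simp add: w4_def comp_assoc[symmetric] rr) (simp add: comp_def)
  have s5_1: "r 1 \<circ> w5 = w4"
    by (simp add: w5_def comp_assoc[symmetric] rr) (simp add: comp_def)
  have s5_2: "r 2 \<circ> w5 = w5 \<circ> r 2"
    unfolding r by (rule sphere_reflection_conj_sign[OF wo(6)]) (rule disjI1, rule trans[OF im5(1) nz(2)[symmetric]])
  have s5_3: "r 3 \<circ> w5 = w5 \<circ> r 3"
    unfolding r by (rule sphere_reflection_conj_sign[OF wo(6)]) (rule disjI1, rule trans[OF im5(2) nz(3)[symmetric]])
  let ?ws = "{w0, w1, w2, w3, w4, w5}"
  have cw: "card ?ws \<le> 6" using card_length[of "[w0, w1, w2, w3, w4, w5]"] by simp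
  obtain W where W: "finite W" "card W \<le> card ?ws * card D" "(\<lambda>P. P) \<in> W"
    "\<And>i B. i \<in> {1, 2, 3} \<Longrightarrow> B \<in> W \<Longrightarrow> r i \<circ> B \<in> W"
  proof (rule coset_enumeration[of D "{2, 3}" r ?ws "{1, 2, 3}"])
    show "r j \<circ> d \<in> D" if "j \<in> {2, 3}" "d \<in> D" for j d
      using that D(4,5) r by auto
    show "(\<lambda>P. P) \<in> ?ws" by (simp add: w0_def)
    show "r i \<circ> w \<in> ?ws \<or> (\<exists>j\<in>{2, 3}. r i \<circ> w = w \<circ> r j)" if "i \<in> {1, 2, 3}" "w \<in> ?ws" for i w
      using that by (elim insertE emptyE) (simp_all only: bex_simps s0_1 s0_2 s0_3 s1_1 s1_2 s1_3 s2_1 s2_2 s2_3 s3_1 s3_2 s3_3 s4_1 s4_2 s4_3 s5_1 s5_2 s5_3 insert_iff simp_thms)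
  qed (use D in auto)
  have "card W \<le> 6 * 8"
    using W(2) mult_le_mono[OF cw D(2)] by linarith
  then have "card W \<le> 48" by simp
  moreover have "sphere_reflection n1 \<circ> B \<in> W" "sphere_reflection n2 \<circ> B \<in> W" "sphere_reflection n3 \<circ> B \<in> W" if "B \<in> W" for B
    unfolding r[symmetric] using that by (intro W(4); simp)+
  ultimately show ?thesis using that[OF W(1) _ W(3)] by blast
qed

lemma icosahedral_order:
  fixes n1 n2 n3 :: "real^3"
  assumes norm: "norm n1 = 1" "norm n2 = 1" "norm n3 = 1"
    and ang: "n1 \<bullet> n2 = 0" "n1 \<bullet> n3 = - (1 / 2)" "n2 \<bullet> n3 = - (\<mu> / 2)"
    and \<mu>: "\<mu>\<^sup>2 = \<mu> + 1"
    and D: "finite D" "card D \<le> 10" "(\<lambda>P. P) \<in> D"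
      "\<And>d. d \<in> D \<Longrightarrow> sphere_reflection n2 \<circ> d \<in> D" "\<And>d. d \<in> D \<Longrightarrow> sphere_reflection n3 \<circ> d \<in> D"
  obtains W where "finite W" "card W \<le> 120" "(\<lambda>P. P) \<in> W"
    "\<And>B. B \<in> W \<Longrightarrow> sphere_reflection n1 \<circ> B \<in> W"
    "\<And>B. B \<in> W \<Longrightarrow> sphere_reflection n2 \<circ> B \<in> W"
    "\<And>B. B \<in> W \<Longrightarrow> sphere_reflection n3 \<circ> B \<in> W"
proof -
  have \<mu>': "\<mu>\<^sup>2 = 1 + 1 * \<mu>" using \<mu> by simp
  define r where "r i = sphere_reflection (if i = 1 then n1 else if i = 2 then n2 else n3)" for i :: nat
  have r: "r 1 = sphere_reflection n1" "r 2 = sphere_reflection n2" "r 3 = sphere_reflection n3"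
    by (simp_all add: r_def)
  note zr = triangle_coords_reflect[OF norm ang \<mu>', folded r]
  have rr: "r i \<circ> r i = (\<lambda>P. P)" "r i (r i P) = P" for i P
    using norm by (simp_all add: r_def sphere_reflection_involution sphere_reflection_twice)
  have ro: "orthogonal_transformation (r i)" for i
    using norm by (simp add: r_def sphere_reflection_orthogonal)
  have r12: "r 2 \<circ> r 1 = r 1 \<circ> r 2"
    unfolding r using norm ang
    by (intro sphere_reflection_conj_sign sphere_reflection_orthogonal)
       (simp_all add: sphere_reflection_def inner_commute)
  let ?z = "triangle_coords n1 n2 n3 \<mu>"
  have nz: "n1 = ?z 1 0 0 0 0 0" "n2 = ?z 0 0 1 0 0 0" "n3 = ?z 0 0 0 0 1 0"
    "- n1 = ?z (-1) 0 0 0 0 0" "- n2 = ?z 0 0 (-1) 0 0 0" "- n3 = ?z 0 0 0 0 (-1) 0"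
    by (simp_all add: triangle_coords_def)
  define w0 :: "real^3 \<Rightarrow> real^3" where "w0 = (\<lambda>P. P)"
  define w1 where "w1 = r 1 \<circ> w0"
  define w2 where "w2 = r 3 \<circ> w1"
  define w3 where "w3 = r 2 \<circ> w2"
  define w4 where "w4 = r 3 \<circ> w3"
  define w5 where "w5 = r 2 \<circ> w4"
  define w6 where "w6 = r 1 \<circ> w4"
  define w7 where "w7 = r 1 \<circ> w5"
  define w8 where "w8 = r 3 \<circ> w7"
  define w9 where "w9 = r 2 \<circ> w8"
  define w10 where "w10 = r 3 \<circ> w9"
  define w11 where "w11 = r 1 \<circ> w10"
  note ws_defs = w0_def w1_def w2_def w3_def w4_def w5_def w6_def w7_def w8_def w9_def w10_def w11_def
  have wo: "orthogonal_transformation w0" "orthogonal_transformation w1" "orthogonal_transformation w2" "orthogonal_transformation w3" "orthogonal_transformation w4" "orthogonal_transformation w5" "orthogonal_transformation w6" "orthogonal_transformation w7" "orthogonal_transformation w8" "orthogonal_transformation w9" "orthogonal_transformation w10" "orthogonal_transformation w11"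
    unfolding ws_defs by (intro orthogonal_transformation_compose ro orthogonal_transformation_ident)+
  have im0: "w0 n2 = ?z 0 0 1 0 0 0" "w0 n3 = ?z 0 0 0 0 1 0"
    by (simp_all add: w0_def triangle_coords_def)
  have im1: "w1 n2 = ?z 0 0 1 0 0 0" "w1 n3 = ?z 1 0 0 0 1 0"
    by (simp_all add: w1_def im0 zr del: One_nat_def)
  have im2: "w2 n2 = ?z 0 0 1 0 0 1" "w2 n3 = ?z 1 0 0 0 0 0"
    by (simp_all add: w2_def im1 zr del: One_nat_def)
  have im3: "w3 n2 = ?z 0 0 0 1 0 1" "w3 n3 = ?z 1 0 0 0 0 0"
    by (simp_all add: w3_def im2 zr del: One_nat_def)
  have im4: "w4 n2 = ?z 0 0 0 1 1 0" "w4 n3 = ?z 1 0 0 0 1 0"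
    by (simp_all add: w4_def im3 zr del: One_nat_def)
  have im5: "w5 n2 = ?z 0 0 0 0 1 0" "w5 n3 = ?z 1 0 0 1 1 0"
    by (simp_all add: w5_def im4 zr del: One_nat_def)
  have im6: "w6 n2 = ?z 1 0 0 1 1 0" "w6 n3 = ?z 0 0 0 0 1 0"
    by (simp_all add: w6_def im4 zr del: One_nat_def)
  have im7: "w7 n2 = ?z 1 0 0 0 1 0" "w7 n3 = ?z 0 0 0 1 1 0"
    by (simp_all add: w7_def im5 zr del: One_nat_def)
  have im8: "w8 n2 = ?z 1 0 0 0 0 0" "w8 n3 = ?z 0 0 0 1 0 1"
    by (simp_all add: w8_def im7 zr del: One_nat_def)
  have im9: "w9 n2 = ?z 1 0 0 0 0 0" "w9 n3 = ?z 0 0 1 0 0 1"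
    by (simp_all add: w9_def im8 zr del: One_nat_def)
  have im10: "w10 n2 = ?z 1 0 0 0 1 0" "w10 n3 = ?z 0 0 1 0 0 0"
    by (simp_all add: w10_def im9 zr del: One_nat_def)
  have im11: "w11 n2 = ?z 0 0 0 0 1 0" "w11 n3 = ?z 0 0 1 0 0 0"
    by (simp_all add: w11_def im10 zr del: One_nat_def)
  have s0_1: "r 1 \<circ> w0 = w1"
    by (simp add: w1_def)
  have s0_2: "r 2 \<circ> w0 = w0 \<circ> r 2"
    unfolding r by (rule sphere_reflection_conj_sign[OF wo(1)]) (rule disjI1, rule trans[OF im0(1) nz(2)[symmetric]])
  have s0_3: "r 3 \<circ> w0 = w0 \<circ> r 3"
    unfolding r by (rule sphere_reflection_conj_sign[OF wo(1)]) (rule disjI1, rule trans[OF im0(2) nz(3)[symmetric]])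
  have s1_1: "r 1 \<circ> w1 = w0"
    by (simp add: w1_def comp_assoc[symmetric] rr) (simp add: comp_def)
  have s1_2: "r 2 \<circ> w1 = w1 \<circ> r 2"
    unfolding r by (rule sphere_reflection_conj_sign[OF wo(2)]) (rule disjI1, rule trans[OF im1(1) nz(2)[symmetric]])
  have s1_3: "r 3 \<circ> w1 = w2"
    by (simp add: w2_def)
  have s2_1: "r 1 \<circ> w2 = w2 \<circ> r 3"
    unfolding r by (rule sphere_reflection_conj_sign[OF wo(3)]) (rule disjI1, rule trans[OF im2(2) nz(1)[symmetric]])
  have s2_2: "r 2 \<circ> w2 = w3"
    by (simp add: w3_def)
  have s2_3: "r 3 \<circ> w2 = w1"
    by (simp add: w2_def comp_assoc[symmetric] rr) (simp add: comp_def)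
  have s3_1: "r 1 \<circ> w3 = w3 \<circ> r 3"
    unfolding r by (rule sphere_reflection_conj_sign[OF wo(4)]) (rule disjI1, rule trans[OF im3(2) nz(1)[symmetric]])
  have s3_2: "r 2 \<circ> w3 = w2"
    by (simp add: w3_def comp_assoc[symmetric] rr) (simp add: comp_def)
  have s3_3: "r 3 \<circ> w3 = w4"
    by (simp add: w4_def)
  have s4_1: "r 1 \<circ> w4 = w6"
    by (simp add: w6_def)
  have s4_2: "r 2 \<circ> w4 = w5"
    by (simp add: w5_def)
  have s4_3: "r 3 \<circ> w4 = w3"
    by (simp add: w4_def comp_assoc[symmetric] rr) (simp add: comp_def)
  have s5_1: "r 1 \<circ> w5 = w7"
    by (simp add: w7_def)
  have s5_2: "r 2 \<circ> w5 = w4"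
    by (simp add: w5_def comp_assoc[symmetric] rr) (simp add: comp_def)
  have s5_3: "r 3 \<circ> w5 = w5 \<circ> r 2"
    unfolding r by (rule sphere_reflection_conj_sign[OF wo(6)]) (rule disjI1, rule trans[OF im5(1) nz(3)[symmetric]])
  have s6_1: "r 1 \<circ> w6 = w4"
    by (simp add: w6_def comp_assoc[symmetric] rr) (simp add: comp_def)
  have s6_2: "r 2 \<circ> w6 = w7"
    unfolding ws_defs using fun_cong[OF r12] by (simp add: fun_eq_iff rr)
  have s6_3: "r 3 \<circ> w6 = w6 \<circ> r 3"
    unfolding r by (rule sphere_reflection_conj_sign[OF wo(7)]) (rule disjI1, rule trans[OF im6(2) nz(3)[symmetric]])
  have s7_1: "r 1 \<circ> w7 = w5"
    by (simp add: w7_def comp_assoc[symmetric] rr) (simp add: comp_def)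
  have s7_2: "r 2 \<circ> w7 = w6"
    unfolding ws_defs using fun_cong[OF r12] by (simp add: fun_eq_iff rr)
  have s7_3: "r 3 \<circ> w7 = w8"
    by (simp add: w8_def)
  have s8_1: "r 1 \<circ> w8 = w8 \<circ> r 2"
    unfolding r by (rule sphere_reflection_conj_sign[OF wo(9)]) (rule disjI1, rule trans[OF im8(1) nz(1)[symmetric]])
  have s8_2: "r 2 \<circ> w8 = w9"
    by (simp add: w9_def)
  have s8_3: "r 3 \<circ> w8 = w7"
    by (simp add: w8_def comp_assoc[symmetric] rr) (simp add: comp_def)
  have s9_1: "r 1 \<circ> w9 = w9 \<circ> r 2"
    unfolding r by (rule sphere_reflection_conj_sign[OF wo(10)]) (rule disjI1, rule trans[OF im9(1) nz(1)[symmetric]])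
  have s9_2: "r 2 \<circ> w9 = w8"
    by (simp add: w9_def comp_assoc[symmetric] rr) (simp add: comp_def)
  have s9_3: "r 3 \<circ> w9 = w10"
    by (simp add: w10_def)
  have s10_1: "r 1 \<circ> w10 = w11"
    by (simp add: w11_def)
  have s10_2: "r 2 \<circ> w10 = w10 \<circ> r 3"
    unfolding r by (rule sphere_reflection_conj_sign[OF wo(11)]) (rule disjI1, rule trans[OF im10(2) nz(2)[symmetric]])
  have s10_3: "r 3 \<circ> w10 = w9"
    by (simp add: w10_def comp_assoc[symmetric] rr) (simp add: comp_def)
  have s11_1: "r 1 \<circ> w11 = w10"
    by (simp add: w11_def comp_assoc[symmetric] rr) (simp add: comp_def)
  have s11_2: "r 2 \<circ> w11 = w11 \<circ> r 3"
    unfolding r by (rule sphere_reflection_conj_sign[OF wo(12)]) (rule disjI1, rule trans[OF im11(2) nz(2)[symmetric]])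
  have s11_3: "r 3 \<circ> w11 = w11 \<circ> r 2"
    unfolding r by (rule sphere_reflection_conj_sign[OF wo(12)]) (rule disjI1, rule trans[OF im11(1) nz(3)[symmetric]])
  let ?ws = "{w0, w1, w2, w3, w4, w5, w6, w7, w8, w9, w10, w11}"
  have cw: "card ?ws \<le> 12" using card_length[of "[w0, w1, w2, w3, w4, w5, w6, w7, w8, w9, w10, w11]"] by simp
  obtain W where W: "finite W" "card W \<le> card ?ws * card D" "(\<lambda>P. P) \<in> W"
    "\<And>i B. i \<in> {1, 2, 3} \<Longrightarrow> B \<in> W \<Longrightarrow> r i \<circ> B \<in> W"
  proof (rule coset_enumeration[of D "{2, 3}" r ?ws "{1, 2, 3}"])
    show "r j \<circ> d \<in> D" if "j \<in> {2, 3}" "d \<in> D" for j d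
      using that D(4,5) r by auto
    show "(\<lambda>P. P) \<in> ?ws" by (simp add: w0_def)
    show "r i \<circ> w \<in> ?ws \<or> (\<exists>j\<in>{2, 3}. r i \<circ> w = w \<circ> r j)" if "i \<in> {1, 2, 3}" "w \<in> ?ws" for i w
      using that by (elim insertE emptyE) (simp_all only: bex_simps s0_1 s0_2 s0_3 s1_1 s1_2 s1_3 s2_1 s2_2 s2_3 s3_1 s3_2 s3_3 s4_1 s4_2 s4_3 s5_1 s5_2 s5_3 s6_1 s6_2 s6_3 s7_1 s7_2 s7_3 s8_1 s8_2 s8_3 s9_1 s9_2 s9_3 s10_1 s10_2 s10_3 s11_1 s11_2 s11_3 insert_iff simp_thms)
  qed (use D in auto)
  have "card W \<le> 12 * 10"
    using W(2) mult_le_mono[OF cw D(2)] by linarith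
  then have "card W \<le> 120" by simp
  moreover have "sphere_reflection n1 \<circ> B \<in> W" "sphere_reflection n2 \<circ> B \<in> W" "sphere_reflection n3 \<circ> B \<in> W" if "B \<in> W" for B
    unfolding r[symmetric] using that by (intro W(4); simp)+
  ultimately show ?thesis using that[OF W(1) _ W(3)] by blast
qed

section \<open>Volumes of geodesic balls\<close>

text \<open>The quotient \<open>sin (c * z) / sin z\<close> increases: the numerator \<open>N\<close> of its derivative vanishes at 0 and
increases.\<close>

lemma sin_scale_le:
  assumes x: "0 \<le> x" "x \<le> y" "y \<le> pi / 2" and c: "0 \<le> c" "c \<le> (1::real)"
  shows "sin (c * x) * sin y \<le> sin x * sin (c * y)"
proof -
  define N where "N z = c * cos (c * z) * sin z - sin (c * z) * cos z" for z
  have sn: "0 \<le> sin (c * z)" "0 \<le> sin z" if "0 \<le> z" "z \<le> pi / 2" for z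
  proof -
    have "c * z \<le> 1 * z" using c that by (intro mult_right_mono) auto
    then show "0 \<le> sin (c * z)" "0 \<le> sin z" using that c by (auto intro!: sin_ge_zero)
  qed
  have Npos: "0 \<le> N z" if z: "0 \<le> z" "z \<le> pi / 2" for z
  proof -
    have "N 0 \<le> N z"
    proof (rule DERIV_nonneg_imp_nondecreasing[OF z(1)])
      fix t assume t: "0 \<le> t" "t \<le> z"
      have "(N has_real_derivative (1 - c\<^sup>2) * (sin (c * t) * sin t)) (at t)"
        unfolding N_def by (auto intro!: derivative_eq_intros simp: power2_eq_square algebra_simps)
      moreover have "0 \<le> (1 - c\<^sup>2) * (sin (c * t) * sin t)"
        using sn[of t] t z c by (intro mult_nonneg_nonneg) (auto simp: power_le_one)
      ultimately show "\<exists>d. (N has_real_derivative d) (at t) \<and> 0 \<le> d" by blast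
    qed
    then show ?thesis by (simp add: N_def)
  qed
  show ?thesis
  proof (cases "x = 0")
    case False
    then have x0: "0 < x" using x by simp
    have "sin (c * x) / sin x \<le> sin (c * y) / sin y"
    proof (rule DERIV_nonneg_imp_nondecreasing[OF x(2)])
      fix t assume t: "x \<le> t" "t \<le> y"
      have st: "sin t > 0" using t x x0 by (intro sin_gt_zero) auto
      have "((\<lambda>t. sin (c * t) / sin t) has_real_derivative N t / (sin t)\<^sup>2) (at t)"
        unfolding N_def using st by (auto intro!: derivative_eq_intros simp: power2_eq_square algebra_simps)
      moreover have "0 \<le> N t / (sin t)\<^sup>2" using Npos[of t] t x x0 by simp
      ultimately show "\<exists>d. ((\<lambda>t. sin (c * t) / sin t) has_real_derivative d) (at t) \<and> 0 \<le> d" by blast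
    qed
    moreover have "sin x > 0" "sin y > 0" using x x0 by (auto intro!: sin_gt_zero)
    ultimately show ?thesis by (simp add: field_simps)
  qed simp
qed

lemma one_minus_cos: "1 - cos (2 * x) = 2 * (sin (x::real))\<^sup>2"
  by (simp add: cos_double_sin)

lemma one_minus_cos_scale_le:
  assumes r: "0 \<le> r" "r \<le> pi / 2" and c: "0 \<le> c" "c \<le> (1::real)"
  shows "1 - cos (r * c) \<le> (1 - cos r) * (1 - cos (pi / 2 * c))"
proof -
  \<comment> \<open>with \<open>1 - cos (2 * x) = 2 * (sin x)\<^sup>2\<close> and \<open>2 * (sin (pi / 4))\<^sup>2 = 1\<close> the claim is the square of this inequality\<close>
  have "sin (c * (r / 2)) * sin (pi / 4) \<le> sin (r / 2) * sin (c * (pi / 4))"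
    by (rule sin_scale_le) (use r c in auto)
  moreover have "0 \<le> sin (c * (r / 2))"
  proof (rule sin_ge_zero)
    show "0 \<le> c * (r / 2)" using r c by simp
    have "c * (r / 2) \<le> 1 * (r / 2)" using r c by (intro mult_right_mono) auto
    then show "c * (r / 2) \<le> pi" using r by simp
  qed
  ultimately have "(sin (c * (r / 2)) * sin (pi / 4))\<^sup>2 \<le> (sin (r / 2) * sin (c * (pi / 4)))\<^sup>2"
    by (intro power_mono) (auto simp: sin_45)
  then have "(sin (c * (r / 2)))\<^sup>2 \<le> 2 * ((sin (r / 2))\<^sup>2 * (sin (c * (pi / 4)))\<^sup>2)"
    by (simp add: power_mult_distrib sin_45 power_divide)
  moreover have "1 - cos (r * c) = 2 * (sin (c * (r / 2)))\<^sup>2"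
    using one_minus_cos[of "c * (r / 2)"] by (simp add: mult.commute)
  moreover have "1 - cos r = 2 * (sin (r / 2))\<^sup>2"
    using one_minus_cos[of "r / 2"] by simp
  moreover have "1 - cos (pi / 2 * c) = 2 * (sin (c * (pi / 4)))\<^sup>2"
    using one_minus_cos[of "c * (pi / 4)"] by (simp add: mult.commute)
  ultimately show ?thesis by simp
qed

text \<open>The slices of a ball of radius \<open>r\<close> are caps of radius \<open>sqrt (r\<^sup>2 - t\<^sup>2)\<close>.  Their heights are scaled to
\<open>{-1..1}\<close>, which makes balls of different radii comparable pointwise.\<close>

definition scaled_ball_integral :: "real \<Rightarrow> ennreal" where
  "scaled_ball_integral r = (\<integral>\<^sup>+w. ennreal (1 - cos (r * sqrt (1 - w\<^sup>2))) * indicator {-1..1} w \<partial>lborel)"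

lemma scaled_ball_integral_le:
  assumes r: "0 \<le> r" "r \<le> pi / 2"
  shows "scaled_ball_integral r \<le> ennreal (1 - cos r) * scaled_ball_integral (pi / 2)"
proof -
  have "scaled_ball_integral r
     \<le> (\<integral>\<^sup>+w. ennreal (1 - cos r) * (ennreal (1 - cos (pi / 2 * sqrt (1 - w\<^sup>2))) * indicator {-1..1} w) \<partial>lborel)"
    unfolding scaled_ball_integral_def
  proof (rule nn_integral_mono)
    fix w :: real
    show "ennreal (1 - cos (r * sqrt (1 - w\<^sup>2))) * indicator {-1..1} w
      \<le> ennreal (1 - cos r) * (ennreal (1 - cos (pi / 2 * sqrt (1 - w\<^sup>2))) * indicator {-1..1} w)"
    proof (cases "w \<in> {-1..1}")
      case True
      then have "w\<^sup>2 \<le> 1" by (simp add: abs_le_iff abs_square_le_1)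
      then have "1 - cos (r * sqrt (1 - w\<^sup>2)) \<le> (1 - cos r) * (1 - cos (pi / 2 * sqrt (1 - w\<^sup>2)))"
        by (intro one_minus_cos_scale_le r) auto
      then show ?thesis using True by (simp add: ennreal_mult'[symmetric])
    qed simp
  qed
  also have "\<dots> = ennreal (1 - cos r) * scaled_ball_integral (pi / 2)"
    unfolding scaled_ball_integral_def by (rule nn_integral_cmult) measurable
  finally show ?thesis .
qed

lemma scaled_ball_integral_finite: "scaled_ball_integral r < \<infinity>"
proof -
  have "scaled_ball_integral r \<le> (\<integral>\<^sup>+w. ennreal 2 * indicator {-1..1::real} w \<partial>lborel)"
    unfolding scaled_ball_integral_def
  proof (intro nn_integral_mono mult_right_mono ennreal_leI)
    fix w :: real show "1 - cos (r * sqrt (1 - w\<^sup>2)) \<le> 2" using cos_ge_minus_one[of "r * sqrt (1 - w\<^sup>2)"] by linarith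
  qed auto
  also have "\<dots> = ennreal 2 * ennreal 2" by (subst nn_integral_cmult_indicator) auto
  also have "\<dots> < \<infinity>" by (simp add: ennreal_mult[symmetric])
  finally show ?thesis .
qed

lemma geodesic_ball_slice:
  assumes K: "K \<in> S2R" and r: "0 \<le> r" "r \<le> pi"
  shows "emeasure sphere_area ((\<lambda>P. (P, t)) -` geodesic_ball K r)
     = ennreal (2 * pi) * (ennreal (1 - cos (sqrt (r\<^sup>2 - (t - snd K)\<^sup>2))) * indicator {snd K - r..snd K + r} t)"
proof (cases "\<bar>t - snd K\<bar> \<le> r")
  case True
  define h where "h = sqrt (r\<^sup>2 - (t - snd K)\<^sup>2)"
  have "(t - snd K)\<^sup>2 \<le> r\<^sup>2" using True r by (simp add: abs_le_square_iff[symmetric])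
  then have h: "0 \<le> h" "h\<^sup>2 = r\<^sup>2 - (t - snd K)\<^sup>2" by (auto simp: h_def)
  have "h\<^sup>2 \<le> r\<^sup>2" using h by simp
  then have hr: "h \<le> r" using r(1) by (rule power2_le_imp_le)
  have nK: "norm (fst K) = 1" using K by (simp add: S2R_iff)
  have "(\<lambda>P. (P, t)) -` geodesic_ball K r = {P. cos h \<le> fst K \<bullet> P} \<inter> sphere 0 1"
  proof (rule Set.set_eqI)
    fix P :: "real^3"
    show "P \<in> (\<lambda>P. (P, t)) -` geodesic_ball K r \<longleftrightarrow> P \<in> {P. cos h \<le> fst K \<bullet> P} \<inter> sphere 0 1"
    proof (cases "norm P = 1")
      case P: True
      let ?a = "sphere_angle (fst K) P"
      have a: "0 \<le> ?a" "?a \<le> pi" "cos ?a = fst K \<bullet> P"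
        using sphere_angle_bounds[OF nK P] cos_sphere_angle[OF nK P] by auto
      have "P \<in> (\<lambda>P. (P, t)) -` geodesic_ball K r \<longleftrightarrow> sqrt (?a\<^sup>2 + (snd K - t)\<^sup>2) \<le> r"
        using P K by (simp add: geodesic_ball_def geodesic_dist_eq S2R_iff)
      also have "\<dots> \<longleftrightarrow> ?a\<^sup>2 + (snd K - t)\<^sup>2 \<le> r\<^sup>2" using r by (auto simp: sqrt_le_D real_le_lsqrt)
      also have "\<dots> \<longleftrightarrow> ?a\<^sup>2 \<le> h\<^sup>2" unfolding h(2) by (simp add: power2_commute[of t]) linarith
      also have "\<dots> \<longleftrightarrow> ?a \<le> h" using a(1) h(1) by (metis abs_le_square_iff abs_of_nonneg)
      also have "\<dots> \<longleftrightarrow> cos h \<le> cos ?a" by (rule cos_mono_le_eq[symmetric]) (use a h hr r in auto)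
      finally show ?thesis using P a(3) by simp
    qed (auto simp: geodesic_ball_def S2R_iff)
  qed
  moreover have "{P. cos h \<le> fst K \<bullet> P} \<in> sets borel"
    by (intro borel_closed closed_Collect_le continuous_intros)
  ultimately have "emeasure sphere_area ((\<lambda>P. (P, t)) -` geodesic_ball K r) = ennreal (2 * pi * (1 - cos h))"
    using emeasure_cap[OF nK, of h] h hr r by (simp add: emeasure_sphere_area_restrict)
  moreover have "t \<in> {snd K - r..snd K + r}" using True by (auto simp: abs_le_iff)
  ultimately show ?thesis by (simp add: h_def ennreal_mult)
next
  case False
  have "(\<lambda>P. (P, t)) -` geodesic_ball K r = {}"
  proof -
    have "\<bar>t - snd K\<bar> \<le> geodesic_dist K (P, t)" if "(P, t) \<in> S2R" for P
      using geodesic_dist_eq[OF K that] real_sqrt_ge_abs2[of "snd K - t" "sphere_angle (fst K) P"]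
      by (simp add: abs_minus_commute)
    then show ?thesis using False by (fastforce simp: geodesic_ball_def)
  qed
  moreover have "t \<notin> {snd K - r..snd K + r}" using False by (auto simp: abs_le_iff)
  ultimately show ?thesis by simp
qed

lemma geodesic_ball_borel:
  assumes K: "K \<in> S2R"
  shows "geodesic_ball K r \<in> sets borel"
proof -
  have "closed {Q \<in> S2R. geodesic_dist K Q \<le> r}"
    by (rule continuous_on_closed_Collect_le) (use geodesic_dist_continuous[OF K] closed_S2R in auto)
  then show ?thesis by (simp add: geodesic_ball_def borel_closed)
qed

lemma emeasure_geodesic_ball:
  assumes K: "K \<in> S2R" and r: "0 \<le> r" "r \<le> pi"
  shows "emeasure riemannian_volume (geodesic_ball K r) = ennreal (2 * pi * r) * scaled_ball_integral r"
proof -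
  let ?f = "\<lambda>t. ennreal (1 - cos (sqrt (r\<^sup>2 - (t - snd K)\<^sup>2))) * indicator {snd K - r..snd K + r} t"
  have "emeasure riemannian_volume (geodesic_ball K r) = (\<integral>\<^sup>+t. ennreal (2 * pi) * ?f t \<partial>lborel)"
    unfolding emeasure_riemannian_volume_slices[OF geodesic_ball_borel[OF K]]
    by (simp only: geodesic_ball_slice[OF K r])
  also have "\<dots> = ennreal (2 * pi) * (\<integral>\<^sup>+t. ?f t \<partial>lborel)"
    by (rule nn_integral_cmult) measurable
  also have "(\<integral>\<^sup>+t. ?f t \<partial>lborel) = ennreal r * scaled_ball_integral r"
  proof (cases "r = 0")
    case True
    have "(\<integral>\<^sup>+t. ?f t \<partial>lborel) = (\<integral>\<^sup>+t. 0 \<partial>(lborel :: real measure))"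
    proof (rule nn_integral_cong_AE)
      show "AE t in lborel. ?f t = 0"
        using AE_lborel_singleton[of "snd K"] by eventually_elim (use True in \<open>auto simp: indicator_def\<close>)
    qed
    then show ?thesis using True by simp
  next
    case False
    then have r0: "r > 0" using r by simp
    have "(\<integral>\<^sup>+t. ?f t \<partial>lborel) = ennreal \<bar>r\<bar> * (\<integral>\<^sup>+w. ?f (snd K + r * w) \<partial>lborel)"
      by (rule nn_integral_real_affine) (use r0 in auto)
    also have "(\<integral>\<^sup>+w. ?f (snd K + r * w) \<partial>lborel) = scaled_ball_integral r"
      unfolding scaled_ball_integral_def
    proof (rule nn_integral_cong)
      fix w :: real
      have "sqrt (r\<^sup>2 - (r * w)\<^sup>2) = sqrt (r\<^sup>2 * (1 - w\<^sup>2))" by (simp add: power_mult_distrib algebra_simps)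
      also have "\<dots> = r * sqrt (1 - w\<^sup>2)" using r by (simp add: real_sqrt_mult)
      finally have s: "sqrt (r\<^sup>2 - (r * w)\<^sup>2) = r * sqrt (1 - w\<^sup>2)" .
      have "snd K + r * w \<in> {snd K - r..snd K + r} \<longleftrightarrow> w \<in> {-1..1}"
      proof -
        have "- r \<le> r * w \<longleftrightarrow> r * (- 1) \<le> r * w" by simp
        also have "\<dots> \<longleftrightarrow> - 1 \<le> w" using r0 by (rule mult_le_cancel_left_pos)
        finally show ?thesis using r0 by auto
      qed
      then show "?f (snd K + r * w) = ennreal (1 - cos (r * sqrt (1 - w\<^sup>2))) * indicator {-1..1} w"
        by (simp add: s indicator_def)
    qed
    finally show ?thesis using r by simp
  qed
  finally show ?thesis using r by (simp add: ennreal_mult mult.assoc)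
qed

text \<open>A ball of radius \<open>r\<close> fills a smaller part of the cylinder over its equatorial cap than the ball of radius
\<open>pi / 2\<close> does, because this holds slice by slice.\<close>

theorem Vol_geodesic_ball_le:
  assumes K: "K \<in> S2R" "K' \<in> S2R" and r: "0 \<le> r" "r \<le> pi / 2"
  shows "Vol (geodesic_ball K r) \<le> Vol (geodesic_ball K' (pi / 2)) * (2 / pi * (r * (1 - cos r)))"
proof -
  define I where "I = enn2real (scaled_ball_integral (pi / 2))"
  have I: "scaled_ball_integral (pi / 2) = ennreal I" "0 \<le> I"
    using scaled_ball_integral_finite[of "pi / 2"] by (auto simp: I_def)
  have c: "0 \<le> 1 - cos r" by simp
  have "emeasure riemannian_volume (geodesic_ball K r) \<le> ennreal (2 * pi * r) * (ennreal (1 - cos r) * ennreal I)"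
    using r scaled_ball_integral_le[OF r] by (subst emeasure_geodesic_ball[OF K(1)]) (auto simp: I mult_left_mono)
  also have "\<dots> = ennreal (2 * pi * r * ((1 - cos r) * I))"
    using r c I(2) by (simp add: ennreal_mult)
  finally have L: "Vol (geodesic_ball K r) \<le> 2 * pi * r * ((1 - cos r) * I)"
    unfolding Vol_def measure_def using r c I(2) by (intro enn2real_leI) auto
  have V: "Vol (geodesic_ball K' (pi / 2)) = 2 * pi * (pi / 2) * I"
    unfolding Vol_def measure_def emeasure_geodesic_ball[OF K(2), of "pi / 2", simplified] I(1)
    using I(2) by (simp add: ennreal_mult[symmetric])
  have E: "2 * pi * (pi / 2) * I * (2 / pi * (r * (1 - cos r))) = 2 * pi * r * ((1 - cos r) * I)"
    by (simp add: field_simps)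
  show ?thesis unfolding V E by (rule L)
qed

section \<open>From packing densities to inequalities between mirror distances\<close>

lemma sphere_angle_half:
  assumes "norm P = 1" "norm Q = 1"
  shows "sin (sphere_angle P Q / 2) = norm (P - Q) / 2" "sphere_angle P Q / 2 = arcsin (norm (P - Q) / 2)"
proof -
  let ?a = "sphere_angle P Q"
  have a: "0 \<le> ?a" "?a \<le> pi" "cos ?a = P \<bullet> Q"
    using sphere_angle_bounds[OF assms] cos_sphere_angle[OF assms] by auto
  have "(norm (P - Q))\<^sup>2 = 2 - 2 * (P \<bullet> Q)"
    using assms by (simp add: power2_norm_eq_inner inner_diff inner_commute norm_eq_1)
  also have "\<dots> = (2 * sin (?a / 2))\<^sup>2"
    using one_minus_cos[of "?a / 2"] a(3) by (simp add: power_mult_distrib)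
  finally have "norm (P - Q) = 2 * sin (?a / 2)"
    by (rule power2_eq_imp_eq) (use a in \<open>auto intro!: sin_ge_zero\<close>)
  then show s: "sin (?a / 2) = norm (P - Q) / 2" by simp
  show "?a / 2 = arcsin (norm (P - Q) / 2)"
    unfolding s[symmetric] by (rule arcsin_sin[symmetric]) (use a in auto)
qed

lemma norm_reflection_diff:
  assumes "norm n = 1"
  shows "norm (P - sphere_reflection n P) = 2 * \<bar>n \<bullet> P\<bar>"
  using assms by (simp add: sphere_reflection_def abs_mult)

text \<open>The chord that a rotation moves \<open>P\<close> by, in terms of the distances of \<open>P\<close> from the two mirrors.\<close>

lemma norm_rotation_diff:
  assumes n: "norm n = 1" "norm n' = 1"
  shows "(norm (P - sphere_reflection n (sphere_reflection n' P)))\<^sup>2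
     = 4 * ((n \<bullet> P)\<^sup>2 + (n' \<bullet> P)\<^sup>2 - 2 * (n \<bullet> P) * (n' \<bullet> P) * (n \<bullet> n'))"
proof -
  define x where "x = n \<bullet> P"
  define y where "y = n' \<bullet> P"
  define g where "g = n \<bullet> n'"
  have nn: "n \<bullet> n = 1" "n' \<bullet> n' = 1" "n \<bullet> n' = g" "n' \<bullet> n = g"
    using n by (auto simp: norm_eq_1 g_def inner_commute)
  have "n \<bullet> sphere_reflection n' P = x - 2 * y * g"
    by (simp add: sphere_reflection_def inner_diff_right nn x_def y_def)
  then have d: "P - sphere_reflection n (sphere_reflection n' P) = (2 * y) *\<^sub>R n' + (2 * (x - 2 * y * g)) *\<^sub>R n"
    by (simp add: sphere_reflection_def[of n "sphere_reflection n' P"])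
       (simp add: sphere_reflection_def y_def)
  have sq: "(norm (s *\<^sub>R n' + t *\<^sub>R n))\<^sup>2 = s\<^sup>2 + 2 * s * t * g + t\<^sup>2" for s t
    by (simp add: power2_norm_eq_inner inner_add nn) (simp add: power2_eq_square algebra_simps)
  have "(norm (P - sphere_reflection n (sphere_reflection n' P)))\<^sup>2
    = (2 * y)\<^sup>2 + 2 * (2 * y) * (2 * (x - 2 * y * g)) * g + (2 * (x - 2 * y * g))\<^sup>2"
    unfolding d by (rule sq)
  also have "\<dots> = 4 * (x\<^sup>2 + y\<^sup>2 - 2 * x * y * g)" by algebra
  finally show ?thesis by (simp add: x_def y_def g_def)
qed

context motion_group
begin

text \<open>The elements \<open>h\<close> and \<open>inverse w \<circ> h \<circ> w\<close> move the points \<open>w K\<close> and \<open>K\<close> by the same distance, so the radius can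
be estimated at any point of the orbit.\<close>

lemma packing_radius_le:
  assumes K: "K \<in> S2R" and w: "w \<in> \<Gamma>" and h: "h \<in> \<Gamma>" "h \<noteq> \<one>\<^bsub>BijGroup S2R\<^esub>"
  shows "packing_radius \<Gamma> K \<le> geodesic_dist (w K) (h (w K)) / 2"
proof -
  interpret G: group "BijGroup S2R" by (rule group_BijGroup)
  let ?G = "BijGroup S2R"
  define g where "g = inv\<^bsub>?G\<^esub> w \<otimes>\<^bsub>?G\<^esub> (h \<otimes>\<^bsub>?G\<^esub> w)"
  have c: "w \<in> carrier ?G" "h \<in> carrier ?G" using subgroup.subset[OF subgroup] w h by auto
  have g: "g \<in> \<Gamma>"
    unfolding g_def using subgroup w h by (intro subgroup.m_closed subgroup.m_inv_closed)
  have wg: "w \<otimes>\<^bsub>?G\<^esub> g = h \<otimes>\<^bsub>?G\<^esub> w"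
    unfolding g_def using c by (simp add: G.m_assoc[symmetric])
  have "g \<noteq> \<one>\<^bsub>?G\<^esub>"
  proof
    assume "g = \<one>\<^bsub>?G\<^esub>"
    then have "h \<otimes>\<^bsub>?G\<^esub> w = \<one>\<^bsub>?G\<^esub> \<otimes>\<^bsub>?G\<^esub> w" using wg c by simp
    then show False using h(2) c G.right_cancel[of w h "\<one>\<^bsub>?G\<^esub>"] by simp
  qed
  have ap: "(a \<otimes>\<^bsub>?G\<^esub> b) K = a (b K)" if "a \<in> \<Gamma>" "b \<in> \<Gamma>" for a b
  proof -
    have "a \<in> Bij S2R" "b \<in> Bij S2R" using subgroup.subset[OF subgroup] that by (auto simp: BijGroup_def)
    then show ?thesis using K by (simp add: BijGroup_def compose_def)
  qed
  have "bdd_below ((\<lambda>g. geodesic_dist K (g K) / 2) ` (\<Gamma> - {\<one>\<^bsub>?G\<^esub>}))"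
  proof (rule bdd_belowI[of _ 0])
    fix x assume "x \<in> (\<lambda>g. geodesic_dist K (g K) / 2) ` (\<Gamma> - {\<one>\<^bsub>?G\<^esub>})"
    then show "0 \<le> x" using K motion_in_S2R by (auto simp: geodesic_dist_eq)
  qed
  then have "packing_radius \<Gamma> K \<le> geodesic_dist K (g K) / 2"
    unfolding packing_radius_def using g \<open>g \<noteq> \<one>\<^bsub>?G\<^esub>\<close> by (intro cINF_lower) auto
  also have "geodesic_dist K (g K) = geodesic_dist (w K) (w (g K))"
    using dist_invariant[OF w K motion_in_S2R[OF g K]] by simp
  also have "w (g K) = h (w K)" using wg ap[OF w g] ap[OF h(1) w] by metis
  finally show ?thesis .
qed

lemma packing_radius_nonneg:
  assumes K: "K \<in> S2R" and t: "isometry_of (\<lambda>P. P) t \<in> \<Gamma>" "t \<noteq> 0"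
  shows "0 \<le> packing_radius \<Gamma> K"
  unfolding packing_radius_def
proof (rule cINF_greatest)
  have "isometry_of (\<lambda>P. P) t \<noteq> \<one>\<^bsub>BijGroup S2R\<^esub>"
    using isometry_of_inject(2)[of "\<lambda>P. P" "\<lambda>P. P" t 0] t(2) by (auto simp: one_BijGroup_S2R)
  then show "\<Gamma> - {\<one>\<^bsub>BijGroup S2R\<^esub>} \<noteq> {}" using t by auto
qed (use K motion_in_S2R in \<open>auto simp: geodesic_dist_eq\<close>)

text \<open>The volume estimates for the ball and for the cell combined.  A cell of infinite volume would have \<open>Vol\<close>
equal to 0 and hence density 0.\<close>

theorem packing_density_le:
  assumes K: "K \<in> S2R" "K0 \<in> S2R" and N: "card W \<le> N" and p: "p > 0"
    and lattice: "\<And>A s t. isometry_of A s \<in> \<Gamma> \<Longrightarrow> isometry_of A t \<in> \<Gamma> \<Longrightarrow> orthogonal_transformation A \<Longrightarrow> \<exists>k::int. t - s = k * p"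
    and rho: "\<rho> = packing_radius \<Gamma> K" "0 \<le> \<rho>" "\<rho> \<le> pi / 2"
    and main: "sqrt 3 * N * \<rho> * (1 - cos \<rho>) \<le> 2 * p"
  shows "packing_density \<Gamma> K \<le> Vol (geodesic_ball K0 (pi / 2)) / (sqrt 3 * pi\<^sup>2)"
proof -
  define V0 where "V0 = Vol (geodesic_ball K0 (pi / 2))"
  have V0: "0 \<le> V0" by (simp add: V0_def Vol_def)
  define d where "d = Vol (dv_cell \<Gamma> K)"
  have ball: "Vol (geodesic_ball K \<rho>) \<le> V0 * (2 / pi * (\<rho> * (1 - cos \<rho>)))"
    unfolding V0_def by (rule Vol_geodesic_ball_le[OF K rho(2,3)])
  have dens: "packing_density \<Gamma> K = Vol (geodesic_ball K \<rho>) / d"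
    by (simp add: packing_density_def rho(1) d_def)
  show ?thesis
  proof (cases "emeasure riemannian_volume (dv_cell \<Gamma> K) = \<infinity>")
    case True
    then have "d = 0" by (simp add: d_def Vol_def measure_def)
    then show ?thesis using V0 by (simp add: dens V0_def)
  next
    case False
    then have e: "emeasure riemannian_volume (dv_cell \<Gamma> K) = ennreal d" "0 \<le> d"
      by (auto simp: d_def Vol_def emeasure_eq_ennreal_measure)
    have "ennreal (4 * pi * p) \<le> of_nat (card W) * ennreal d"
      using dv_cell_volume_ge[OF K(1) p lattice] e(1) by simp
    also have "\<dots> = ennreal (card W * d)"
      using e(2) by (simp add: ennreal_mult ennreal_of_nat_eq_real_of_nat)
    finally have "4 * pi * p \<le> card W * d" using e(2) by (simp add: ennreal_le_iff)
    also have "\<dots> \<le> N * d" using N e(2) by (intro mult_right_mono) auto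
    finally have vol: "4 * pi * p \<le> N * d" .
    then have "0 < N * d" using p by (smt (verit) mult_pos_pos pi_gt_zero)
    then have d: "0 < d" using e(2) by (cases "d = 0") auto
    have "sqrt 3 * pi\<^sup>2 * Vol (geodesic_ball K \<rho>) \<le> sqrt 3 * pi\<^sup>2 * (V0 * (2 / pi * (\<rho> * (1 - cos \<rho>))))"
      by (intro mult_left_mono ball) auto
    also have "\<dots> = V0 * (2 * pi * (sqrt 3 * \<rho> * (1 - cos \<rho>)))"
      by (simp add: power2_eq_square field_simps)
    also have "\<dots> \<le> V0 * d"
    proof (rule mult_left_mono[OF _ V0])
      have N0: "0 < real N" using \<open>0 < N * d\<close> d by (simp add: zero_less_mult_iff)
      have "N * (2 * pi * (sqrt 3 * \<rho> * (1 - cos \<rho>))) = 2 * pi * (sqrt 3 * N * \<rho> * (1 - cos \<rho>))" by simp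
      also have "\<dots> \<le> 2 * pi * (2 * p)" by (intro mult_left_mono main) auto
      also have "\<dots> \<le> N * d" using vol by simp
      finally show "2 * pi * (sqrt 3 * \<rho> * (1 - cos \<rho>)) \<le> d" using N0 by simp
    qed
    finally show ?thesis unfolding dens V0_def[symmetric] using d by (simp add: field_simps)
  qed
qed

text \<open>The vector \<open>c\<close> points into the chamber.  Among the finitely many spherical parts of the orbit take one
with maximal inner product with \<open>c\<close>; a reflection in a side that separated it from \<open>c\<close> would increase this
product.\<close>

lemma move_to_chamber:
  assumes K: "K \<in> S2R"
    and refl: "\<And>i. i \<in> I \<Longrightarrow> norm (n i) = 1" "\<And>i. i \<in> I \<Longrightarrow> \<exists>s. isometry_of (sphere_reflection (n i)) s \<in> \<Gamma>"
    and c: "\<And>i. i \<in> I \<Longrightarrow> 0 < c \<bullet> n i"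
  obtains w where "w \<in> \<Gamma>" "\<And>i. i \<in> I \<Longrightarrow> 0 \<le> n i \<bullet> fst (w K)"
proof -
  let ?v = "\<lambda>w. c \<bullet> fst (w K)"
  have sub: "?v ` \<Gamma> \<subseteq> (\<lambda>A. c \<bullet> A (fst K)) ` W"
  proof
    fix x assume "x \<in> ?v ` \<Gamma>"
    then obtain w where w: "w \<in> \<Gamma>" "x = ?v w" by auto
    obtain A k where "A \<in> W" "orthogonal_transformation A" "w = isometry_of A (of_int k * u)"
      using w(1) by (rule form_obtain)
    then show "x \<in> (\<lambda>A. c \<bullet> A (fst K)) ` W" using w K by (auto simp: isometry_of_apply)
  qed
  have fin: "finite (?v ` \<Gamma>)" by (rule finite_subset[OF sub]) (use finite_W in auto)
  have ne: "?v ` \<Gamma> \<noteq> {}" using one_closed by auto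
  obtain w where w: "w \<in> \<Gamma>" "?v w = Max (?v ` \<Gamma>)" using Max_in[OF fin ne] by auto
  have max: "?v h \<le> ?v w" if "h \<in> \<Gamma>" for h using w(2) that fin by simp
  obtain A k where A: "A \<in> W" "orthogonal_transformation A" "w = isometry_of A (of_int k * u)"
    using w(1) by (rule form_obtain)
  show ?thesis
  proof (rule that[OF w(1)])
    fix i assume i: "i \<in> I"
    obtain s where s: "isometry_of (sphere_reflection (n i)) s \<in> \<Gamma>" using refl(2)[OF i] by blast
    have ro: "orthogonal_transformation (sphere_reflection (n i))" by (rule sphere_reflection_orthogonal[OF refl(1)[OF i]])
    have h: "isometry_of (sphere_reflection (n i) \<circ> A) (s + of_int k * u) \<in> \<Gamma>"
      using s w(1) A ro by (intro mult_closed) auto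
    have "?v (isometry_of (sphere_reflection (n i) \<circ> A) (s + of_int k * u)) = c \<bullet> sphere_reflection (n i) (fst (w K))"
      using K A by (simp add: isometry_of_apply)
    then have "c \<bullet> sphere_reflection (n i) (fst (w K)) \<le> c \<bullet> fst (w K)" using max[OF h] by simp
    then have "0 \<le> (n i \<bullet> fst (w K)) * (c \<bullet> n i)"
      by (simp add: sphere_reflection_def inner_diff_right mult.commute)
    then show "0 \<le> n i \<bullet> fst (w K)" using c[OF i] by (simp add: zero_le_mult_iff)
  qed
qed

end

text \<open>When two mirrors meet at an angle \<open>pi / k\<close> with \<open>k\<close> odd, the reflections satisfy a braid relation of odd
length.  Its two sides contain each of the reflections a different number of times, so in a space group
unequal translation parts would produce a translation by \<open>p / 2\<close>.\<close>

lemma braid_3: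
  assumes n: "norm n = 1" "norm n' = 1" and g: "n \<bullet> n' = - (1 / 2)"
  shows "sphere_reflection n \<circ> (sphere_reflection n' \<circ> sphere_reflection n)
     = sphere_reflection n' \<circ> (sphere_reflection n \<circ> sphere_reflection n')"
proof -
  let ?r = "sphere_reflection n" and ?s = "sphere_reflection n'"
  have o: "orthogonal_transformation (?r \<circ> ?s)"
    using n by (intro orthogonal_transformation_compose sphere_reflection_orthogonal)
  have "?s n = n + n'" using g by (simp add: sphere_reflection_def inner_commute)
  then have "(?r \<circ> ?s) n = n'"
    using n(1) g sphere_reflection_linear[of n] by (simp add: linear_add sphere_reflection_self) (simp add: sphere_reflection_def)
  then have "?s \<circ> (?r \<circ> ?s) = (?r \<circ> ?s) \<circ> ?r"
    by (intro sphere_reflection_conj_sign[OF o]) simp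
  then show ?thesis by (simp add: comp_assoc)
qed

lemma braid_5:
  assumes n: "norm n = 1" "norm n' = 1" and g: "n \<bullet> n' = - (\<mu> / 2)" and \<mu>: "\<mu>\<^sup>2 = \<mu> + 1"
  shows "sphere_reflection n \<circ> (sphere_reflection n' \<circ> (sphere_reflection n \<circ> (sphere_reflection n' \<circ> sphere_reflection n)))
     = sphere_reflection n' \<circ> (sphere_reflection n \<circ> (sphere_reflection n' \<circ> (sphere_reflection n \<circ> sphere_reflection n')))"
proof -
  let ?r = "sphere_reflection n" and ?s = "sphere_reflection n'"
  have o: "orthogonal_transformation (?r \<circ> (?s \<circ> (?r \<circ> ?s)))"
    using n by (intro orthogonal_transformation_compose sphere_reflection_orthogonal)
  have nn: "n \<bullet> n = 1" "n' \<bullet> n' = 1" "n' \<bullet> n = - (\<mu> / 2)" using n g by (auto simp: norm_eq_1 inner_commute)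
  have lr: "?r (a *\<^sub>R n + b *\<^sub>R n') = (\<mu> * b - a) *\<^sub>R n + b *\<^sub>R n'" for a b
  proof -
    have "2 * (n \<bullet> (a *\<^sub>R n + b *\<^sub>R n')) = a - (\<mu> * b - a)" by (simp add: inner_add_right nn g)
    then show ?thesis unfolding sphere_reflection_def by (simp only: scaleR_diff_left) simp
  qed
  have ls: "?s (a *\<^sub>R n + b *\<^sub>R n') = a *\<^sub>R n + (\<mu> * a - b) *\<^sub>R n'" for a b
  proof -
    have "2 * (n' \<bullet> (a *\<^sub>R n + b *\<^sub>R n')) = b - (\<mu> * a - b)" by (simp add: inner_add_right nn)
    then show ?thesis unfolding sphere_reflection_def by (simp only: scaleR_diff_left) simp
  qed
  have m: "\<mu> * \<mu> = \<mu> + 1" using \<mu> by (simp add: power2_eq_square)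
  have m': "\<mu> * \<mu> - 1 = \<mu>" "\<mu> * \<mu> - \<mu> = 1" using m by simp_all
  have "(?r \<circ> (?s \<circ> (?r \<circ> ?s))) (1 *\<^sub>R n + 0 *\<^sub>R n') = 0 *\<^sub>R n + 1 *\<^sub>R n'"
    unfolding comp_def ls lr by (simp add: m')
  then have "(?r \<circ> (?s \<circ> (?r \<circ> ?s))) n = n'" by simp
  then have "?s \<circ> (?r \<circ> (?s \<circ> (?r \<circ> ?s))) = (?r \<circ> (?s \<circ> (?r \<circ> ?s))) \<circ> ?r"
    by (intro sphere_reflection_conj_sign[OF o]) simp
  then show ?thesis by (simp add: comp_assoc)
qed

text \<open>If the translation by \<open>p / 2\<close> belongs to the group, or if all translation parts vanish, then the group
contains all the reflections, and \<open>reflections\<close> is applied with lattice parameter \<open>p / 2\<close> or \<open>p\<close>.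
Otherwise the lattice parameter is \<open>p\<close>, and \<open>glides\<close> may use what the short elements of the group
imply: the translation by \<open>p\<close>, the reflections, the glide reflections, the rotations of height 0, and the
equality of translation parts forced by odd braid relations.\<close>

theorem space_group_density_reduction:
  fixes n :: "nat \<Rightarrow> real^3" and \<tau> :: "nat \<Rightarrow> real" and p :: real and N m :: nat
  defines "I \<equiv> {1..m}"
  assumes m: "m \<ge> 2"
    and norm: "\<And>i. i \<in> I \<Longrightarrow> norm (n i) = 1"
    and indep: "\<And>i j. i \<in> I \<Longrightarrow> j \<in> I \<Longrightarrow> i \<noteq> j \<Longrightarrow> \<bar>n i \<bullet> n j\<bar> < 1"
    and W: "finite W" "card W \<le> N" "(\<lambda>P. P) \<in> W" "\<And>i B. i \<in> I \<Longrightarrow> B \<in> W \<Longrightarrow> sphere_reflection (n i) \<circ> B \<in> W"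
    and c: "\<And>i. i \<in> I \<Longrightarrow> 0 < c \<bullet> n i"
    and p: "p > 0" and \<tau>: "\<And>i. i \<in> I \<Longrightarrow> \<tau> i \<in> {0, 1/2}"
    and K: "K \<in> S2R" "K0 \<in> S2R"
    and reflections: "\<And>\<rho> P. norm P = 1 \<Longrightarrow> 0 \<le> \<rho> \<Longrightarrow> \<rho> \<le> pi / 2 \<Longrightarrow> (\<And>i. i \<in> I \<Longrightarrow> sin \<rho> \<le> n i \<bullet> P) \<Longrightarrow>
        N * (1 - cos \<rho>) \<le> 2"
    and glides: "\<And>\<rho> P. norm P = 1 \<Longrightarrow> 0 \<le> \<rho> \<Longrightarrow> \<rho> \<le> pi / 2 \<Longrightarrow> 2 * \<rho> \<le> p \<Longrightarrow> (\<And>i. i \<in> I \<Longrightarrow> 0 \<le> n i \<bullet> P) \<Longrightarrow>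
        (\<exists>i\<in>I. \<tau> i = 1/2) \<Longrightarrow>
        (\<And>i. i \<in> I \<Longrightarrow> \<tau> i = 0 \<Longrightarrow> sin \<rho> \<le> n i \<bullet> P) \<Longrightarrow>
        (\<And>i. i \<in> I \<Longrightarrow> \<tau> i = 1/2 \<Longrightarrow> 16 * \<rho>\<^sup>2 \<le> 16 * (arcsin (n i \<bullet> P))\<^sup>2 + p\<^sup>2) \<Longrightarrow>
        (\<And>i j. i \<in> I \<Longrightarrow> j \<in> I \<Longrightarrow> i \<noteq> j \<Longrightarrow> \<tau> i = \<tau> j \<Longrightarrow>
           (sin \<rho>)\<^sup>2 \<le> (n i \<bullet> P)\<^sup>2 + (n j \<bullet> P)\<^sup>2 - 2 * (n i \<bullet> P) * (n j \<bullet> P) * (n i \<bullet> n j)) \<Longrightarrow>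
        (\<And>i j. i \<in> I \<Longrightarrow> j \<in> I \<Longrightarrow> n i \<bullet> n j = - (1 / 2) \<Longrightarrow> \<tau> i = \<tau> j) \<Longrightarrow>
        (\<And>i j \<mu>. i \<in> I \<Longrightarrow> j \<in> I \<Longrightarrow> n i \<bullet> n j = - (\<mu> / 2) \<Longrightarrow> \<mu>\<^sup>2 = \<mu> + 1 \<Longrightarrow> \<tau> i = \<tau> j) \<Longrightarrow>
        sqrt 3 * N * \<rho> * (1 - cos \<rho>) \<le> 2 * p"
  shows "packing_density (space_group m n \<tau> p) K \<le> Vol (geodesic_ball K0 (pi / 2)) / (sqrt 3 * pi\<^sup>2)"
proof -
  let ?\<Gamma> = "space_group m n \<tau> p"
  interpret motion_group ?\<Gamma> W "p / 2"
  proof (rule space_group_motion_group)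
    fix i assume i: "i \<in> {1..m}"
    show "norm (n i) = 1" using norm i by (simp add: I_def)
    show "\<exists>k::int. \<tau> i * p = k * (p / 2)"
    proof (cases "\<tau> i = 0")
      case True then show ?thesis by (intro exI[of _ 0]) simp
    next
      case False then show ?thesis using \<tau>[unfolded I_def, OF i] by (intro exI[of _ 1]) simp
    qed
  next
    show "\<exists>k::int. p = k * (p / 2)" by (intro exI[of _ 2]) simp
  qed (use W p in \<open>auto simp: I_def\<close>)
  let ?r = "\<lambda>i. sphere_reflection (n i)"
  have ro: "orthogonal_transformation (?r i)" if "i \<in> I" for i
    by (rule sphere_reflection_orthogonal[OF norm[OF that]])
  have gen: "isometry_of (?r i) (\<tau> i * p) \<in> ?\<Gamma>" if "i \<in> I" for i
    using that by (auto simp: I_def intro: space_group_generators)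
  have genp: "isometry_of (\<lambda>P. P) p \<in> ?\<Gamma>" by (rule space_group_generators)
  define \<rho> where "\<rho> = packing_radius ?\<Gamma> K"
  have rho0: "0 \<le> \<rho>" unfolding \<rho>_def using packing_radius_nonneg[OF K(1) genp] p by simp
  obtain w where w: "w \<in> ?\<Gamma>" "\<And>i. i \<in> I \<Longrightarrow> 0 \<le> n i \<bullet> fst (w K)"
    using move_to_chamber[OF K(1), of I n c] norm gen c by blast
  define P where "P = fst (w K)"
  have wK: "w K \<in> S2R" by (rule motion_in_S2R[OF w(1) K(1)])
  have P: "norm P = 1" using wK by (simp add: P_def S2R_iff)
  have b0: "0 \<le> n i \<bullet> P" if "i \<in> I" for i using w(2)[OF that] by (simp add: P_def)
  have dist: "2 * \<rho> \<le> sqrt ((sphere_angle P (A P))\<^sup>2 + t\<^sup>2)"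
    if A: "orthogonal_transformation A" "isometry_of A t \<in> ?\<Gamma>" "A \<noteq> (\<lambda>P. P) \<or> t \<noteq> 0" for A t
  proof -
    have "isometry_of A t \<noteq> \<one>\<^bsub>BijGroup S2R\<^esub>"
      using isometry_of_inject[OF A(1), of "\<lambda>P. P" t 0] A(3) by (auto simp: one_BijGroup_S2R)
    then have "\<rho> \<le> geodesic_dist (w K) (isometry_of A t (w K)) / 2"
      unfolding \<rho>_def by (intro packing_radius_le K w A)
    then show ?thesis
      using geodesic_dist_eq[OF wK isometry_of_in_S2R[OF A(1) wK, of t]] wK
      by (simp add: isometry_of_apply P_def)
  qed
  have translation: "2 * \<rho> \<le> \<bar>t\<bar>" if "isometry_of (\<lambda>P. P) t \<in> ?\<Gamma>" "t \<noteq> 0" for t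
    using dist[of "\<lambda>P. P" t] that P by (simp add: sphere_angle_def norm_eq_1)
  have r_ne: "?r i \<noteq> (\<lambda>P. P)" if "i \<in> I" for i
  proof
    assume "?r i = (\<lambda>P. P)"
    then have "- n i = n i" using sphere_reflection_self[OF norm[OF that]] by metis
    then have "n i + n i = 0" using add.right_inverse[of "n i"] by simp
    then have "2 *\<^sub>R n i = 0" by (simp add: scaleR_2)
    then show False using norm[OF that] by simp
  qed
  have half: "sphere_angle P (?r i P) / 2 = arcsin (n i \<bullet> P)" "sin (sphere_angle P (?r i P) / 2) = n i \<bullet> P"
    if i: "i \<in> I" for i
  proof -
    have r: "norm (?r i P) = 1" using P ro[OF i] by (simp add: orthogonal_transformation_norm)
    have d: "norm (P - ?r i P) / 2 = n i \<bullet> P" using norm_reflection_diff[OF norm[OF i]] b0[OF i] by simp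
    show "sphere_angle P (?r i P) / 2 = arcsin (n i \<bullet> P)" "sin (sphere_angle P (?r i P) / 2) = n i \<bullet> P"
      using sphere_angle_half[OF P r] unfolding d by blast+
  qed
  have angle: "\<rho> \<le> pi / 2 \<and> sin \<rho> \<le> sin (sphere_angle P (A P) / 2)"
    if A: "orthogonal_transformation A" "isometry_of A 0 \<in> ?\<Gamma>" "A \<noteq> (\<lambda>P. P)" for A
  proof -
    have AP: "norm (A P) = 1" using P A(1) by (simp add: orthogonal_transformation_norm)
    have "2 * \<rho> \<le> sphere_angle P (A P)" using dist[OF A(1,2)] A(3) sphere_angle_bounds[OF P AP] by simp
    then show ?thesis using rho0 sphere_angle_bounds[OF P AP]
      by (intro conjI sin_monotone_2pi_le) auto
  qed
  have mirror: "\<rho> \<le> pi / 2 \<and> sin \<rho> \<le> n i \<bullet> P" if i: "i \<in> I" "isometry_of (?r i) 0 \<in> ?\<Gamma>" for i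
    using angle[OF ro[OF i(1)] i(2) r_ne[OF i(1)]] half(2)[OF i(1)] by simp
  have glide: "16 * \<rho>\<^sup>2 \<le> 16 * (arcsin (n i \<bullet> P))\<^sup>2 + p\<^sup>2" if i: "i \<in> I" "\<tau> i = 1/2" for i
  proof -
    have "2 * \<rho> \<le> sqrt ((sphere_angle P (?r i P))\<^sup>2 + (p / 2)\<^sup>2)"
      by (rule dist[OF ro[OF i(1)] _ disjI1[OF r_ne[OF i(1)]]]) (use gen[OF i(1)] i(2) in simp)
    then have "(2 * \<rho>)\<^sup>2 \<le> (sqrt ((sphere_angle P (?r i P))\<^sup>2 + (p / 2)\<^sup>2))\<^sup>2"
      using rho0 by (intro power_mono) auto
    then have "(2 * \<rho>)\<^sup>2 \<le> (sphere_angle P (?r i P))\<^sup>2 + (p / 2)\<^sup>2" by simp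
    moreover have "sphere_angle P (?r i P) = 2 * arcsin (n i \<bullet> P)" using half(1)[OF i(1)] by simp
    ultimately show ?thesis by (simp add: power_mult_distrib power_divide)
  qed
  have rotation: "\<rho> \<le> pi / 2 \<and> (sin \<rho>)\<^sup>2 \<le> (n i \<bullet> P)\<^sup>2 + (n j \<bullet> P)\<^sup>2 - 2 * (n i \<bullet> P) * (n j \<bullet> P) * (n i \<bullet> n j)"
    if ij: "i \<in> I" "j \<in> I" "i \<noteq> j" "\<tau> i = \<tau> j" for i j
  proof -
    let ?A = "?r i \<circ> ?r j"
    have oA: "orthogonal_transformation ?A" using ro ij by (intro orthogonal_transformation_compose) auto
    have A1: "isometry_of ?A (\<tau> i * p + \<tau> j * p) \<in> ?\<Gamma>" by (intro mult_closed gen ro ij)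
    have A0: "isometry_of ?A 0 \<in> ?\<Gamma>"
    proof (cases "\<tau> i = 0")
      case True then show ?thesis using A1 ij by simp
    next
      case False
      then have h: "\<tau> i = 1/2" "\<tau> j = 1/2" using \<tau>[OF ij(1)] ij(4) by auto
      have z: "\<tau> i * p + \<tau> j * p + - p = 0" unfolding h by simp
      show ?thesis using translate_closed[OF A1 oA translation_minus[OF genp]] unfolding z .
    qed
    have "?A \<noteq> (\<lambda>P. P)"
    proof
      assume "?A = (\<lambda>P. P)"
      then have "?r i (?r j (n j)) = n j" by (metis comp_apply)
      then have "?r i (n j) = - n j"
        using sphere_reflection_self[OF norm[OF ij(2)]] linear_neg[OF sphere_reflection_linear[of "n i"]]
        by (metis minus_minus)
      then have "?r i (n j) \<bullet> n j = - 1" using norm[OF ij(2)] by (simp add: norm_eq_1)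
      moreover have "?r i (n j) \<bullet> n j = 1 - 2 * (n i \<bullet> n j)\<^sup>2"
        using norm[OF ij(2)] by (simp add: sphere_reflection_def inner_diff_left norm_eq_1 power2_eq_square)
      ultimately have "(n i \<bullet> n j)\<^sup>2 = 1" by simp
      then show False using indep[OF ij(1-3)] abs_square_less_1[of "n i \<bullet> n j"] by simp
    qed
    from angle[OF oA A0 this] have a: "\<rho> \<le> pi / 2" "sin \<rho> \<le> sin (sphere_angle P (?A P) / 2)" by auto
    have "norm (?A P) = 1" using orthogonal_transformation_norm[OF oA, of P] P by simp
    then have "sin \<rho> \<le> norm (P - ?A P) / 2" using a(2) sphere_angle_half(1)[OF P] by simp
    moreover have "0 \<le> sin \<rho>" using rho0 a(1) by (intro sin_ge_zero) auto
    ultimately have "(sin \<rho>)\<^sup>2 \<le> (norm (P - ?A P) / 2)\<^sup>2" by (intro power_mono) auto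
    then show ?thesis
      using a(1) norm_rotation_diff[OF norm[OF ij(1)] norm[OF ij(2)], of P] by (simp add: power_divide)
  qed
  have half_translation: "isometry_of (\<lambda>P. P) (p / 2) \<in> ?\<Gamma>"
    if h: "isometry_of A s \<in> ?\<Gamma>" "isometry_of A t \<in> ?\<Gamma>" "orthogonal_transformation A" "t - s = of_int k * (p / 2)" "odd k" for A s t and k :: int
  proof -
    have 1: "isometry_of (\<lambda>P. P) (of_int k * (p / 2)) \<in> ?\<Gamma>" using translation_quotient[OF h(1-3)] h(4) by simp
    obtain l where l: "k = 2 * l + 1" using h(5) by (rule oddE)
    have "isometry_of (\<lambda>P. P) (of_int (- l) * p) \<in> ?\<Gamma>" by (rule translation_multiple[OF genp])
    from translate_closed[OF 1 _ this] show ?thesis by (simp add: l algebra_simps)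
  qed
  have diff_int: "\<exists>k::int. t - s = k * (p / 2)" if h: "isometry_of A s \<in> ?\<Gamma>" "isometry_of A t \<in> ?\<Gamma>" for A s t
  proof -
    obtain A1 k1 where 1: "isometry_of A s = isometry_of A1 (of_int k1 * (p / 2))"
      using form_obtain[OF h(1)] by metis
    obtain A2 k2 where 2: "isometry_of A t = isometry_of A2 (of_int k2 * (p / 2))"
      using form_obtain[OF h(2)] by metis
    have "s = of_int k1 * (p / 2)" "t = of_int k2 * (p / 2)"
      using fun_cong[OF 1, of K] fun_cong[OF 2, of K] K(1) by (auto simp: isometry_of_apply)
    then have "t - s = real_of_int (k2 - k1) * (p / 2)" by (simp add: algebra_simps)
    then show ?thesis by blast
  qed
  have all_reflections: "packing_density ?\<Gamma> K \<le> Vol (geodesic_ball K0 (pi / 2)) / (sqrt 3 * pi\<^sup>2)"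
    if p': "p' > 0" "isometry_of (\<lambda>P. P) p' \<in> ?\<Gamma>"
      and lat: "\<And>A s t. isometry_of A s \<in> ?\<Gamma> \<Longrightarrow> isometry_of A t \<in> ?\<Gamma> \<Longrightarrow> orthogonal_transformation A \<Longrightarrow> \<exists>k::int. t - s = k * p'"
      and r0: "\<And>i. i \<in> I \<Longrightarrow> isometry_of (?r i) 0 \<in> ?\<Gamma>" for p'
  proof (rule packing_density_le[OF K W(2) p'(1) lat \<rho>_def rho0])
    show r: "\<rho> \<le> pi / 2" using mirror[OF _ r0, of 1] m by (simp add: I_def)
    have N: "N * (1 - cos \<rho>) \<le> 2" using mirror r0 by (intro reflections[OF P rho0 r]) auto
    have "sqrt 3 * N * \<rho> * (1 - cos \<rho>) = (sqrt 3 * \<rho>) * (N * (1 - cos \<rho>))" by simp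
    also have "\<dots> \<le> (sqrt 3 * \<rho>) * 2" using N rho0 by (intro mult_left_mono) auto
    also have "\<dots> \<le> (2 * \<rho>) * 2"
      using rho0 real_sqrt_le_iff[of 3 4] by (intro mult_right_mono) auto
    also have "\<dots> \<le> p' * 2" using translation[OF p'(2)] p'(1) by (intro mult_right_mono) auto
    finally show "sqrt 3 * N * \<rho> * (1 - cos \<rho>) \<le> 2 * p'" by simp
  qed
  show ?thesis
  proof (cases "isometry_of (\<lambda>P. P) (p / 2) \<in> ?\<Gamma>")
    case True
    show ?thesis
    proof (rule all_reflections[OF _ True diff_int])
      fix i assume i: "i \<in> I"
      show "isometry_of (?r i) 0 \<in> ?\<Gamma>"
      proof (cases "\<tau> i = 0")
        case True then show ?thesis using gen[OF i] by simp
      next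
        case False
        then have "\<tau> i = 1/2" using \<tau>[OF i] by simp
        then have z: "\<tau> i * p + - (p / 2) = 0" by (simp only:)
        show ?thesis using translate_closed[OF gen[OF i] ro[OF i] translation_minus[OF True]] unfolding z .
      qed
    qed (use p in auto)
  next
    case False
    have lat: "\<exists>k::int. t - s = k * p"
      if st: "isometry_of A s \<in> ?\<Gamma>" "isometry_of A t \<in> ?\<Gamma>" "orthogonal_transformation A" for A s t
    proof -
      obtain k :: int where k: "t - s = k * (p / 2)" using diff_int[OF st(1,2)] by blast
      then have "even k" using half_translation[OF st k] False by blast
      then obtain l where "k = 2 * l" by (rule evenE)
      then show ?thesis using k by (intro exI[of _ l]) simp
    qed
    show ?thesis
    proof (cases "\<exists>i\<in>I. \<tau> i = 1/2")
      case no: False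
      have "\<tau> i = 0" if "i \<in> I" for i using no that \<tau>[OF that] by auto
      then show ?thesis using gen by (intro all_reflections[OF p genp lat]) force+
    next
      case ex: True
      \<comment> \<open>two elements with the same linear part whose fibre shifts count \<open>\<tau> i\<close> and \<open>\<tau> j\<close> with \<open>a\<close> and \<open>b\<close> exchanged\<close>
      have compat: "\<tau> i = \<tau> j"
        if ij: "i \<in> I" "j \<in> I" and A: "isometry_of A (a * (\<tau> i * p) + b * (\<tau> j * p)) \<in> ?\<Gamma>" "isometry_of A (b * (\<tau> i * p) + a * (\<tau> j * p)) \<in> ?\<Gamma>"
          "orthogonal_transformation A" and ab: "a = b + 1" for i j A a b
      proof (rule ccontr)
        assume ne: "\<tau> i \<noteq> \<tau> j"
        have d: "b * (\<tau> i * p) + a * (\<tau> j * p) - (a * (\<tau> i * p) + b * (\<tau> j * p)) = (\<tau> j - \<tau> i) * p"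
          by (simp add: ab algebra_simps)
        consider "\<tau> i = 0" "\<tau> j = 1/2" | "\<tau> i = 1/2" "\<tau> j = 0" using ne \<tau>[OF ij(1)] \<tau>[OF ij(2)] by auto
        then have "isometry_of (\<lambda>P. P) (p / 2) \<in> ?\<Gamma>"
        proof cases
          case 1
          have "b * (\<tau> i * p) + a * (\<tau> j * p) - (a * (\<tau> i * p) + b * (\<tau> j * p)) = of_int 1 * (p / 2)"
            unfolding d unfolding 1 by simp
          then show ?thesis by (rule half_translation[OF A]) simp
        next
          case 2
          have "b * (\<tau> i * p) + a * (\<tau> j * p) - (a * (\<tau> i * p) + b * (\<tau> j * p)) = of_int (- 1) * (p / 2)"
            unfolding d unfolding 2 by simp
          then show ?thesis by (rule half_translation[OF A]) simp
        qed
        then show False using False by simp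
      qed
      show ?thesis
      proof (rule packing_density_le[OF K W(2) p lat \<rho>_def rho0])
        have 12: "1 \<in> I" "2 \<in> I" using m by (auto simp: I_def)
        show r: "\<rho> \<le> pi / 2"
        proof (cases "\<tau> 1 = \<tau> 2")
          case True then show ?thesis using rotation[of 1 2] 12 by simp
        next
          case False
          then have "\<tau> 1 = 0 \<or> \<tau> 2 = 0" using \<tau>[OF 12(1)] \<tau>[OF 12(2)] by auto
          then show ?thesis using mirror[OF 12(1)] mirror[OF 12(2)] gen[OF 12(1)] gen[OF 12(2)] by auto
        qed
        show "sqrt 3 * N * \<rho> * (1 - cos \<rho>) \<le> 2 * p"
        proof (rule glides[OF P rho0 r _ b0 ex])
          show "2 * \<rho> \<le> p" using translation[OF genp] p by simp
        next
          fix i assume "i \<in> I" "\<tau> i = 0"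
          then show "sin \<rho> \<le> n i \<bullet> P" using mirror gen by force
        next
          fix i j assume ij: "i \<in> I" "j \<in> I" "n i \<bullet> n j = - (1 / 2)"
          have g1: "isometry_of (?r i \<circ> (?r j \<circ> ?r i)) (\<tau> i * p + (\<tau> j * p + \<tau> i * p)) \<in> ?\<Gamma>"
            by (intro mult_closed gen ro ij orthogonal_transformation_compose)
          have g2: "isometry_of (?r j \<circ> (?r i \<circ> ?r j)) (\<tau> j * p + (\<tau> i * p + \<tau> j * p)) \<in> ?\<Gamma>"
            by (intro mult_closed gen ro ij orthogonal_transformation_compose)
          have e1: "\<tau> i * p + (\<tau> j * p + \<tau> i * p) = 2 * (\<tau> i * p) + 1 * (\<tau> j * p)"
            and e2: "\<tau> j * p + (\<tau> i * p + \<tau> j * p) = 1 * (\<tau> i * p) + 2 * (\<tau> j * p)" by simp_all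
          show "\<tau> i = \<tau> j"
          proof (rule compat[OF ij(1,2)])
            show "isometry_of (?r i \<circ> (?r j \<circ> ?r i)) (2 * (\<tau> i * p) + 1 * (\<tau> j * p)) \<in> ?\<Gamma>" using g1 unfolding e1 .
            show "isometry_of (?r i \<circ> (?r j \<circ> ?r i)) (1 * (\<tau> i * p) + 2 * (\<tau> j * p)) \<in> ?\<Gamma>"
              using g2 unfolding e2 braid_3[OF norm[OF ij(1)] norm[OF ij(2)] ij(3)] .
          qed (use ro ij in \<open>auto intro: orthogonal_transformation_compose\<close>)
        next
          fix i j \<mu> assume ij: "i \<in> I" "j \<in> I" "n i \<bullet> n j = - (\<mu> / 2)" "\<mu>\<^sup>2 = \<mu> + (1::real)"
          let ?A = "?r i \<circ> (?r j \<circ> (?r i \<circ> (?r j \<circ> ?r i)))"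
          have g1: "isometry_of ?A (\<tau> i * p + (\<tau> j * p + (\<tau> i * p + (\<tau> j * p + \<tau> i * p)))) \<in> ?\<Gamma>"
            by (intro mult_closed gen ro ij orthogonal_transformation_compose)
          have g2: "isometry_of (?r j \<circ> (?r i \<circ> (?r j \<circ> (?r i \<circ> ?r j)))) (\<tau> j * p + (\<tau> i * p + (\<tau> j * p + (\<tau> i * p + \<tau> j * p)))) \<in> ?\<Gamma>"
            by (intro mult_closed gen ro ij orthogonal_transformation_compose)
          have e1: "\<tau> i * p + (\<tau> j * p + (\<tau> i * p + (\<tau> j * p + \<tau> i * p))) = 3 * (\<tau> i * p) + 2 * (\<tau> j * p)"
            and e2: "\<tau> j * p + (\<tau> i * p + (\<tau> j * p + (\<tau> i * p + \<tau> j * p))) = 2 * (\<tau> i * p) + 3 * (\<tau> j * p)" by simp_all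
          show "\<tau> i = \<tau> j"
          proof (rule compat[OF ij(1,2)])
            show "isometry_of ?A (3 * (\<tau> i * p) + 2 * (\<tau> j * p)) \<in> ?\<Gamma>" using g1 unfolding e1 .
            show "isometry_of ?A (2 * (\<tau> i * p) + 3 * (\<tau> j * p)) \<in> ?\<Gamma>"
              using g2 unfolding e2 braid_5[OF norm[OF ij(1)] norm[OF ij(2)] ij(3,4)] .
          qed (use ro ij in \<open>auto intro!: orthogonal_transformation_compose\<close>)
        qed (use glide rotation in auto)
      qed
    qed
  qed
qed

section \<open>The inequalities for glide reflection groups\<close>

lemma sin_ge_chord:
  assumes "0 \<le> x" "x \<le> pi" "0 \<le> c" "c \<le> (1::real)"
  shows "c * sin x \<le> sin (c * x)"
proof -
  have "sin (c * 0) - c * sin 0 \<le> sin (c * x) - c * sin x"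
  proof (rule DERIV_nonneg_imp_nondecreasing[OF assms(1), where f="\<lambda>t. sin (c * t) - c * sin t"])
    fix t assume t: "0 \<le> t" "t \<le> x"
    have "((\<lambda>t. sin (c * t) - c * sin t) has_real_derivative c * (cos (c * t) - cos t)) (at t)"
      by (auto intro!: derivative_eq_intros simp: algebra_simps)
    moreover have "c * t \<le> 1 * t" using assms t by (intro mult_right_mono) auto
    then have "cos t \<le> cos (c * t)" using assms t by (intro cos_monotone_0_pi_le) auto
    then have "0 \<le> c * (cos (c * t) - cos t)" using assms by simp
    ultimately show "\<exists>y. ((\<lambda>t. sin (c * t) - c * sin t) has_real_derivative y) (at t) \<and> 0 \<le> y" by blast
  qed
  then show ?thesis by simp
qed

text \<open>The quotient \<open>arcsin b / b\<close> increases with \<open>b\<close>, by the concavity of the sine.\<close>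

lemma arcsin_ratio:
  assumes r: "0 \<le> r" "r \<le> pi / 2" and b: "0 \<le> b" "b \<le> sin r"
  shows "sin r * arcsin b \<le> b * r"
proof (cases "sin r = 0")
  case False
  then have s: "0 < sin r" using b by simp
  let ?c = "b / sin r"
  have c: "0 \<le> ?c" "?c \<le> 1" using b s by auto
  have "?c * r \<le> 1 * r" using c r by (intro mult_right_mono) auto
  then have cr: "?c * r \<le> r" by simp
  have "?c * sin r \<le> sin (?c * r)" by (rule sin_ge_chord) (use r c in auto)
  then have "b \<le> sin (?c * r)" using s by simp
  then have "arcsin b \<le> arcsin (sin (?c * r))" using b by (intro arcsin_le_arcsin) auto
  also have "\<dots> = ?c * r"
  proof (rule arcsin_sin)
    show "- (pi / 2) \<le> ?c * r" using mult_nonneg_nonneg[OF c(1) r(1)] pi_ge_zero by linarith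
    show "?c * r \<le> pi / 2" using cr r(2) by (rule order_trans)
  qed
  finally show ?thesis using s by (simp add: field_simps)
qed (use b in auto)

text \<open>At one height there are at most \<open>N / 2\<close> orbit points, and \<open>D\<close> bounds the part of the sphere covered by
the caps of radius \<open>\<rho>\<close> around them.  The claim is \<open>2 * sqrt 3 * D * \<rho> \<le> p\<close>.  It follows from \<open>2 * \<rho> \<le> p\<close> if
\<open>D \<le> 1 / sqrt 3\<close>, and from the glide reflection if the distance \<open>\<beta>\<close> to its mirror is small.\<close>

lemma glide_criterion_angle:
  fixes \<rho> \<beta> p N D :: real
  assumes "0 \<le> \<rho>" "2 * \<rho> \<le> p" "0 \<le> D" and D: "D = N * (1 - cos \<rho>) / 4"
    and glide: "16 * \<rho>\<^sup>2 \<le> 16 * \<beta>\<^sup>2 + p\<^sup>2"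
    and crit: "3 * D\<^sup>2 \<le> 1 \<or> 4 * \<beta>\<^sup>2 \<le> \<rho>\<^sup>2 * (4 - 3 * D\<^sup>2)"
  shows "sqrt 3 * N * \<rho> * (1 - cos \<rho>) \<le> 2 * p"
proof -
  have "(2 * sqrt 3 * D * \<rho>)\<^sup>2 \<le> p\<^sup>2"
    using crit
  proof
    assume "3 * D\<^sup>2 \<le> 1"
    then have "4 * (3 * D\<^sup>2) * \<rho>\<^sup>2 \<le> 4 * 1 * \<rho>\<^sup>2" by (intro mult_right_mono mult_left_mono) auto
    also have "\<dots> = (2 * \<rho>)\<^sup>2" by (simp add: power_mult_distrib)
    also have "\<dots> \<le> p\<^sup>2" using assms by (intro power_mono) auto
    finally show ?thesis by (simp add: power_mult_distrib)
  next
    assume "4 * \<beta>\<^sup>2 \<le> \<rho>\<^sup>2 * (4 - 3 * D\<^sup>2)"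
    then have "12 * (D\<^sup>2 * \<rho>\<^sup>2) \<le> 16 * \<rho>\<^sup>2 - 16 * \<beta>\<^sup>2" by (simp add: algebra_simps)
    then show ?thesis using glide by (simp add: power_mult_distrib)
  qed
  then have "2 * sqrt 3 * D * \<rho> \<le> p"
    by (rule power2_le_imp_le) (use assms in linarith)
  then show ?thesis unfolding D by (simp add: field_simps)
qed

text \<open>The sines of the distances are the quantities that Bessel's inequality controls.\<close>

lemma glide_criterion:
  fixes \<rho> b p N D :: real
  assumes r: "0 \<le> \<rho>" "\<rho> \<le> pi / 2" "2 * \<rho> \<le> p" "0 \<le> D" and D: "D = N * (1 - cos \<rho>) / 4"
    and b: "0 \<le> b" and glide: "16 * \<rho>\<^sup>2 \<le> 16 * (arcsin b)\<^sup>2 + p\<^sup>2"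
    and crit: "3 * D\<^sup>2 \<le> 1 \<or> 4 * b\<^sup>2 \<le> (sin \<rho>)\<^sup>2 * (4 - 3 * D\<^sup>2)"
  shows "sqrt 3 * N * \<rho> * (1 - cos \<rho>) \<le> 2 * p"
proof (cases "3 * D\<^sup>2 \<le> 1 \<or> \<rho> = 0")
  case True
  then show ?thesis using glide_criterion_angle[OF r(1,3,4) D glide] r(3) by auto
next
  case False
  then have c: "4 * b\<^sup>2 \<le> (sin \<rho>)\<^sup>2 * (4 - 3 * D\<^sup>2)" using crit by simp
  have s: "0 < sin \<rho>" using False r by (intro sin_gt_zero) auto
  have "(sin \<rho>)\<^sup>2 * (4 - 3 * D\<^sup>2) \<le> (sin \<rho>)\<^sup>2 * 4" by (intro mult_left_mono) auto
  then have "b\<^sup>2 \<le> (sin \<rho>)\<^sup>2" using c by simp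
  then have bs: "b \<le> sin \<rho>" by (rule power2_le_imp_le) (use s in simp)
  have a0: "0 \<le> arcsin b" using b bs arcsin_le_arcsin[of 0 b] sin_le_one[of \<rho>] by simp
  have "(sin \<rho> * arcsin b)\<^sup>2 \<le> (b * \<rho>)\<^sup>2"
    using arcsin_ratio[OF r(1,2) b bs] a0 s by (intro power_mono) auto
  then have "4 * ((sin \<rho>)\<^sup>2 * (arcsin b)\<^sup>2) \<le> (4 * b\<^sup>2) * \<rho>\<^sup>2" by (simp add: power_mult_distrib)
  also have "\<dots> \<le> (sin \<rho>)\<^sup>2 * (4 - 3 * D\<^sup>2) * \<rho>\<^sup>2" using c by (intro mult_right_mono) auto
  finally have "(sin \<rho>)\<^sup>2 * (4 * (arcsin b)\<^sup>2) \<le> (sin \<rho>)\<^sup>2 * (\<rho>\<^sup>2 * (4 - 3 * D\<^sup>2))" by (simp add: algebra_simps)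
  then have "4 * (arcsin b)\<^sup>2 \<le> \<rho>\<^sup>2 * (4 - 3 * D\<^sup>2)" using s by simp
  then show ?thesis using glide_criterion_angle[OF r(1,3,4) D glide] by blast
qed

lemma sqrt_third_less:
  assumes "\<not> 3 * D\<^sup>2 \<le> 1" "0 \<le> (D::real)"
  shows "5773 / 10000 < D"
proof (rule ccontr)
  assume "\<not> ?thesis"
  then have "D\<^sup>2 \<le> (5773 / 10000)\<^sup>2" using assms(2) by (intro power_mono) auto
  then show False using assms(1) by (simp add: power_divide)
qed

lemma cubic_ge:
  assumes "5773 / 10000 \<le> D" "D \<le> h" "79 / 100 \<le> (h::real)"
  shows "h * (4 - 3 * h\<^sup>2) \<le> D * (4 - 3 * D\<^sup>2)"
proof -
  have "(79/100)\<^sup>2 \<le> h\<^sup>2" "(5773/10000)\<^sup>2 \<le> D\<^sup>2" using assms by (intro power_mono; simp)+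
  moreover have "(79/100) * (5773/10000) \<le> h * D" using assms by (intro mult_mono) auto
  ultimately have "0 \<le> 3 * (h\<^sup>2 + h * D + D\<^sup>2) - 4" by (simp add: power_divide)
  then have "0 \<le> (h - D) * (3 * (h\<^sup>2 + h * D + D\<^sup>2) - 4)" using assms by simp
  also have "\<dots> = D * (4 - 3 * D\<^sup>2) - h * (4 - 3 * h\<^sup>2)" by algebra
  finally show ?thesis by simp
qed

text \<open>Since \<open>s\<^sup>2 = 4 * D * (1 + C) / N\<close>, the criterion asks for a lower bound of \<open>D * (4 - 3 * D\<^sup>2)\<close>.  For
\<open>D\<close> between \<open>1 / sqrt 3\<close> and \<open>h \<ge> 79 / 100\<close> this cubic is at least its value at \<open>h\<close>.\<close>

lemma criterion_cubic:
  fixes C s b D N h :: real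
  assumes C: "0 \<le> C" "s\<^sup>2 = 1 - C\<^sup>2" and N: "N > 0" and D: "D = N * (1 - C) / 4" "0 \<le> D" "D \<le> h" "79 / 100 \<le> h"
    and b: "\<not> 3 * D\<^sup>2 \<le> 1 \<Longrightarrow> N * b\<^sup>2 \<le> h * (4 - 3 * h\<^sup>2) * (1 + C)"
  shows "3 * D\<^sup>2 \<le> 1 \<or> 4 * b\<^sup>2 \<le> s\<^sup>2 * (4 - 3 * D\<^sup>2)"
proof (rule disjCI)
  assume n: "\<not> 4 * b\<^sup>2 \<le> s\<^sup>2 * (4 - 3 * D\<^sup>2)"
  show "3 * D\<^sup>2 \<le> 1"
  proof (rule ccontr)
    assume nD: "\<not> 3 * D\<^sup>2 \<le> 1"
    have "N * b\<^sup>2 \<le> h * (4 - 3 * h\<^sup>2) * (1 + C)" by (rule b[OF nD])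
    also have "\<dots> \<le> D * (4 - 3 * D\<^sup>2) * (1 + C)"
      using sqrt_third_less[OF nD D(2)] D C by (intro mult_right_mono cubic_ge) auto
    also have "\<dots> = N / 4 * (s\<^sup>2 * (4 - 3 * D\<^sup>2))" unfolding C(2) D(1) by algebra
    finally have "N * (4 * b\<^sup>2) \<le> N * (s\<^sup>2 * (4 - 3 * D\<^sup>2))" by simp
    then show False using n N by simp
  qed
qed

text \<open>Convexity of \<open>1 - cos\<close> on \<open>{0..pi / 2}\<close>.\<close>

lemma one_minus_cos_le_chord:
  assumes "0 \<le> r" "r \<le> a" "a \<le> pi / 2" "0 < (a::real)"
  shows "a * (1 - cos r) \<le> r * (1 - cos a)"
proof -
  define c where "c = r / a"
  have a: "a \<noteq> 0" using assms(4) by simp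
  have c: "0 \<le> c" "c \<le> 1" "c * a = r" using assms a by (simp_all add: c_def divide_le_eq)
  have "(1 - cos (c * 0)) - c * (1 - cos 0) \<ge> (1 - cos (c * a)) - c * (1 - cos a)"
  proof (rule DERIV_nonpos_imp_nonincreasing[where f="\<lambda>t. (1 - cos (c * t)) - c * (1 - cos t)"])
    fix t assume t: "0 \<le> t" "t \<le> a"
    have "((\<lambda>t. (1 - cos (c * t)) - c * (1 - cos t)) has_real_derivative c * (sin (c * t) - sin t)) (at t)"
      by (auto intro!: derivative_eq_intros simp: algebra_simps)
    moreover have "c * t \<le> 1 * t" using c t by (intro mult_right_mono) auto
    moreover have "0 \<le> c * t" using c t by simp
    ultimately have "((\<lambda>t. (1 - cos (c * t)) - c * (1 - cos t)) has_real_derivative c * (sin (c * t) - sin t)) (at t)"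
      and "sin (c * t) \<le> sin t"
      using t assms pi_gt_zero by (auto intro!: sin_monotone_2pi_le)
    then show "\<exists>y. ((\<lambda>t. (1 - cos (c * t)) - c * (1 - cos t)) has_real_derivative y) (at t) \<and> y \<le> 0"
      using c(1) by (intro exI conjI) (assumption, simp add: mult_nonneg_nonpos)
  qed (use assms in auto)
  then have "1 - cos r \<le> c * (1 - cos a)" using c(3) by simp
  then have "a * (1 - cos r) \<le> a * (c * (1 - cos a))" using assms(4) by (intro mult_left_mono) auto
  then show ?thesis using c(3) by (simp add: mult.assoc[symmetric] mult.commute[of a c])
qed

text \<open>Here \<open>x\<close> and \<open>y\<close> are \<open>\<rho>\<close> and \<open>p\<close> in units of the angle of the digon.  The two alternatives are those of the
distance from the glide mirror in \<open>digon_glide\<close>.\<close>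

lemma digon_scaled:
  fixes x y :: real
  assumes x: "0 \<le> x" "x \<le> 1" and y: "2 * x \<le> y"
    and "16 * x\<^sup>2 \<le> 4 + y\<^sup>2 \<or> 16 * x\<^sup>2 \<le> 16 * (1 - x)\<^sup>2 + y\<^sup>2"
  shows "2 * sqrt 3 * x\<^sup>2 \<le> y"
proof -
  define u where "u = x\<^sup>2"
  have x4: "x ^ 4 = u * u" unfolding u_def by (simp flip: power_add)
  have "12 * x ^ 4 \<le> y\<^sup>2"
  proof (cases "3 * u \<le> 1")
    case True
    then have "(3 * u) * (4 * u) \<le> 1 * (4 * u)" by (intro mult_right_mono) (auto simp: u_def)
    then have "12 * x ^ 4 \<le> 4 * x\<^sup>2" by (simp add: x4 u_def[symmetric])
    also have "\<dots> = (2 * x)\<^sup>2" by (simp add: power_mult_distrib)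
    also have "\<dots> \<le> y\<^sup>2" using x y by (intro power_mono) auto
    finally show ?thesis .
  next
    case False
    have xx: "x\<^sup>2 \<le> 1" using x by (simp add: power_le_one)
    from assms(4) show ?thesis
    proof
      assume "16 * x\<^sup>2 \<le> 4 + y\<^sup>2"
      moreover have "0 \<le> 4 * ((3 * x\<^sup>2 - 1) * (1 - x\<^sup>2))" using False xx by (simp add: u_def)
      moreover have "4 * ((3 * x\<^sup>2 - 1) * (1 - x\<^sup>2)) = 16 * x\<^sup>2 - 4 - 12 * x ^ 4" unfolding x4 u_def by algebra
      ultimately show ?thesis by linarith
    next
      assume a: "16 * x\<^sup>2 \<le> 16 * (1 - x)\<^sup>2 + y\<^sup>2"
      have l: "5773 / 10000 < x" using False x by (intro sqrt_third_less) (auto simp: u_def)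
      have "3 * x ^ 4 \<le> 8 * x - 4"
      proof (cases "x \<le> 2 / 3")
        case True
        then have "x ^ 4 \<le> (2/3) ^ 4" using x by (intro power_mono) auto
        then have "3 * x ^ 4 \<le> 3 * (16 / 81)" by (simp add: power_divide)
        then show ?thesis using l by linarith
      next
        case 2: False
        have "x ^ 4 \<le> x\<^sup>2" using x by (intro power_decreasing) auto
        moreover have "(3 * x - 2) * (2 - x) \<ge> 0" using 2 x by simp
        then have "3 * x\<^sup>2 \<le> 8 * x - 4" by (simp add: power2_eq_square algebra_simps)
        ultimately show ?thesis by linarith
      qed
      moreover have e: "16 * x\<^sup>2 - 16 * (1 - x)\<^sup>2 = 4 * (8 * x - 4)" by algebra
      have "16 * x\<^sup>2 - 16 * (1 - x)\<^sup>2 \<le> y\<^sup>2" using a by simp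
      then have "4 * (8 * x - 4) \<le> y\<^sup>2" unfolding e .
      moreover have "12 * x ^ 4 = 4 * (3 * x ^ 4)" by simp
      ultimately show ?thesis by (smt (verit) mult_left_mono)
    qed
  qed
  moreover have "(2 * sqrt 3 * x\<^sup>2)\<^sup>2 = 12 * x ^ 4" by (simp add: power_mult_distrib flip: power_mult)
  ultimately have "(2 * sqrt 3 * x\<^sup>2)\<^sup>2 \<le> y\<^sup>2" by simp
  then show ?thesis by (rule power2_le_imp_le) (use x y in linarith)
qed

text \<open>If both sides of the digon are glide mirrors, one of them is within \<open>a / 2\<close>; if one of them is a mirror,
it keeps the point at distance \<open>\<rho>\<close>, so the other one is within \<open>a - \<rho>\<close>.\<close>

lemma digon_glide:
  fixes \<rho> a \<beta> p q :: real
  assumes a: "0 < a" "a \<le> pi / 2" and q: "0 < q" "q * (1 - cos a) \<le> 2"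
    and r: "0 \<le> \<rho>" "\<rho> \<le> a" "2 * \<rho> \<le> p" and beta: "0 \<le> \<beta>" "\<beta> \<le> a / 2 \<or> \<beta> \<le> a - \<rho>"
    and glide: "16 * \<rho>\<^sup>2 \<le> 16 * \<beta>\<^sup>2 + p\<^sup>2"
  shows "sqrt 3 * (2 * q) * \<rho> * (1 - cos \<rho>) \<le> 2 * p"
proof -
  let ?x = "\<rho> / a" and ?y = "p / a"
  have x: "0 \<le> ?x" "?x \<le> 1" "2 * ?x \<le> ?y" using a r by (auto simp: field_simps)
  have sc: "16 * (z / a)\<^sup>2 \<le> 16 * (w / a)\<^sup>2 + ?y\<^sup>2" if "16 * z\<^sup>2 \<le> 16 * w\<^sup>2 + p\<^sup>2" for z w
  proof -
    have "16 * z\<^sup>2 / a\<^sup>2 \<le> (16 * w\<^sup>2 + p\<^sup>2) / a\<^sup>2" using that a by (intro divide_right_mono) auto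
    then show ?thesis by (simp add: power_divide add_divide_distrib)
  qed
  have "16 * ?x\<^sup>2 \<le> 4 + ?y\<^sup>2 \<or> 16 * ?x\<^sup>2 \<le> 16 * (1 - ?x)\<^sup>2 + ?y\<^sup>2"
    using beta(2)
  proof
    assume "\<beta> \<le> a / 2"
    then have "\<beta>\<^sup>2 \<le> (a / 2)\<^sup>2" using beta by (intro power_mono) auto
    then have "16 * ?x\<^sup>2 \<le> 16 * (a / 2 / a)\<^sup>2 + ?y\<^sup>2" using glide by (intro sc) auto
    then show ?thesis using a by (simp add: power_divide)
  next
    assume "\<beta> \<le> a - \<rho>"
    then have "\<beta>\<^sup>2 \<le> (a - \<rho>)\<^sup>2" using beta by (intro power_mono) auto
    then have "16 * ?x\<^sup>2 \<le> 16 * ((a - \<rho>) / a)\<^sup>2 + ?y\<^sup>2" using glide by (intro sc) auto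
    then show ?thesis using a by (simp add: diff_divide_distrib)
  qed
  then have main: "2 * sqrt 3 * ?x\<^sup>2 \<le> ?y" by (rule digon_scaled[OF x])
  have "a * (q * (1 - cos \<rho>)) = q * (a * (1 - cos \<rho>))" by simp
  also have "\<dots> \<le> q * (\<rho> * (1 - cos a))" using one_minus_cos_le_chord[OF r(1,2) a(2,1)] q by (intro mult_left_mono) auto
  also have "\<dots> = \<rho> * (q * (1 - cos a))" by simp
  also have "\<dots> \<le> \<rho> * 2" using q r by (intro mult_left_mono) auto
  finally have "q * (1 - cos \<rho>) \<le> 2 * ?x" using a by (simp add: field_simps)
  then have "(2 * sqrt 3 * \<rho>) * (q * (1 - cos \<rho>)) \<le> (2 * sqrt 3 * \<rho>) * (2 * ?x)" using r by (intro mult_left_mono) auto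
  also have "\<dots> = 2 * a * (2 * sqrt 3 * ?x\<^sup>2)" using a by (simp add: power2_eq_square field_simps)
  also have "\<dots> \<le> 2 * a * ?y" using main a by (intro mult_left_mono) auto
  also have "\<dots> = 2 * p" using a by simp
  finally show ?thesis by (simp add: algebra_simps)
qed

lemma pi_squared_le_10: "pi\<^sup>2 \<le> 10"
proof -
  have "cos (158/100 :: real) \<le> 0"
  proof -
    obtain t where "cos (158/100 :: real) = (\<Sum>m<8. cos_coeff m * (158/100) ^ m) + (cos (t + 1/2 * real 8 * pi) / fact 8) * (158/100) ^ 8"
      using Maclaurin_cos_expansion[of "158/100" 8] by auto
    moreover have "cos (t + 1/2 * real 8 * pi) \<le> 1" by simp
    then have "(cos (t + 1/2 * real 8 * pi) / fact 8) * (158/100) ^ 8 \<le> (1 / fact 8) * (158/100) ^ 8"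
      by (intro mult_right_mono divide_right_mono) auto
    moreover have "(\<Sum>m<8. cos_coeff m * (158/100::real) ^ m)
      = 1 - (158/100)^2 / 2 + (158/100)^4 / 24 - (158/100)^6 / 720"
      by (simp add: lessThan_nat_numeral cos_coeff_def fact_numeral)
    moreover have "1 - (158/100)^2 / 2 + (158/100)^4 / 24 - (158/100)^6 / 720 + (1 / fact 8) * (158/100::real) ^ 8 \<le> 0"
      by (simp add: fact_numeral power_divide)
    ultimately show ?thesis by linarith
  qed
  then have "\<not> 158/100 < pi / 2" using cos_gt_zero[of "158/100"] by force
  then have "pi \<le> 316/100" by simp
  then have "pi\<^sup>2 \<le> (316/100)\<^sup>2" by (intro power_mono) auto
  then show ?thesis by (simp add: power_divide)
qed

text \<open>What is used about \<open>t = cos (pi / q)\<close>: its value for \<open>q \<le> 4\<close>, and for larger \<open>q\<close> the estimates of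
\<open>(sin (pi / q))\<^sup>2\<close> and \<open>1 - cos (pi / q)\<close> by \<open>pi\<^sup>2 \<le> 10\<close>.\<close>

definition digon_data :: "real \<Rightarrow> real \<Rightarrow> bool" where
  "digon_data q t \<longleftrightarrow> q = 2 \<and> t = 0 \<or> q = 3 \<and> t = 1 / 2 \<or> q = 4 \<and> 0 \<le> t \<and> 2 * t\<^sup>2 = 1 \<or>
     5 \<le> q \<and> 4 / 5 \<le> t \<and> t \<le> 1 \<and> q\<^sup>2 * (1 - t\<^sup>2) \<le> 10 \<and> q\<^sup>2 * (1 - t) \<le> 5"

lemma digon_data_cases:
  assumes "digon_data q t"
  obtains (two) "q = 2" "t = 0" | (three) "q = 3" "t = 1 / 2"
    | (four) "q = 4" "t\<^sup>2 = 1 / 2" "707 / 1000 \<le> t" "t \<le> 1"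
    | (many) "5 \<le> q" "4 / 5 \<le> t" "t \<le> 1" "q\<^sup>2 * (1 - t\<^sup>2) \<le> 10" "q\<^sup>2 * (1 - t) \<le> 5"
proof -
  have "707 / 1000 \<le> t \<and> t \<le> 1" if "0 \<le> t" "2 * t\<^sup>2 = 1"
  proof
    show "707 / 1000 \<le> t" by (rule power2_le_imp_le) (use that in \<open>auto simp: power_divide\<close>)
    show "t \<le> 1" by (rule power2_le_imp_le) (use that in auto)
  qed
  then show ?thesis using assms that unfolding digon_data_def by (elim disjE conjE) auto
qed

lemma digon_data_range:
  assumes "digon_data q t"
  shows "0 < q" "0 \<le> t" "t \<le> 1" "q * (1 - t) \<le> 2"
proof -
  show "0 < q" "0 \<le> t" "t \<le> 1" using assms by (cases rule: digon_data_cases; simp)+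
  show "q * (1 - t) \<le> 2" using assms
  proof (cases rule: digon_data_cases)
    case many
    have "5 * (q * (1 - t)) \<le> q * (q * (1 - t))" using many by (intro mult_right_mono) auto
    moreover have "q * (q * (1 - t)) \<le> 5" using many(5) by (simp add: power2_eq_square mult.assoc)
    ultimately show ?thesis by linarith
  qed auto
qed

lemma digon_data_cos:
  fixes q :: nat
  assumes "q \<ge> 2"
  shows "digon_data q (cos (pi / q))"
proof -
  consider "q = 2" | "q = 3" | "q = 4" | "q \<ge> 5" using assms by linarith
  then show ?thesis
  proof cases
    case 3 then show ?thesis by (simp add: digon_data_def cos_45 power_divide)
  next
    case 4
    let ?a = "pi / q"
    have q: "real q \<ge> 5" using 4 by simp
    have a: "0 < ?a" using 4 by simp
    have qa: "(real q * ?a)\<^sup>2 \<le> 10" using 4 pi_squared_le_10 by simp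
    have "(real q)\<^sup>2 * (1 - (cos ?a)\<^sup>2) = (q * sin ?a)\<^sup>2" by (simp add: power_mult_distrib sin_squared_eq)
    also have "\<dots> \<le> (q * ?a)\<^sup>2"
      using sin_x_le_x[of ?a] sin_ge_zero[of ?a] a 4 by (intro power_mono mult_left_mono) (auto simp: divide_le_eq)
    finally have 1: "(real q)\<^sup>2 * (1 - (cos ?a)\<^sup>2) \<le> 10" using qa by linarith
    have "1 - cos ?a = 2 * (sin (?a / 2))\<^sup>2" using cos_double_sin[of "?a / 2"] by simp
    moreover have "(sin (?a / 2))\<^sup>2 \<le> (?a / 2)\<^sup>2"
      using sin_x_le_x[of "?a / 2"] sin_ge_zero[of "?a / 2"] a 4 by (intro power_mono) (auto simp: divide_le_eq)
    ultimately have "1 - cos ?a \<le> ?a\<^sup>2 / 2" by (simp add: power_divide)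
    then have "(real q)\<^sup>2 * (1 - cos ?a) \<le> (real q)\<^sup>2 * (?a\<^sup>2 / 2)" by (intro mult_left_mono) auto
    also have "\<dots> = (q * ?a)\<^sup>2 / 2" by (simp only: power_mult_distrib)
    finally have 2: "(real q)\<^sup>2 * (1 - cos ?a) \<le> 5" using qa by linarith
    have "5\<^sup>2 * (1 - cos ?a) \<le> (real q)\<^sup>2 * (1 - cos ?a)" using q by (intro mult_right_mono power_mono) auto
    then have "4 / 5 \<le> cos ?a" using 2 by simp
    then show ?thesis unfolding digon_data_def using q 1 2 by simp
  qed (auto simp: digon_data_def cos_60)
qed

text \<open>The largest cap inside a digon touches both sides at its middle, so its radius is half the angle.\<close>

lemma digon_mirrors_bound:
  assumes d: "digon_data q t" and C: "0 \<le> C" "C \<le> 1" "s\<^sup>2 = 1 - C\<^sup>2" and s: "2 * s\<^sup>2 \<le> 1 - t"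
  shows "q * (1 - C) \<le> 6 / 10" "q \<noteq> 2 \<Longrightarrow> q * (1 - C) \<le> 1 / 2"
proof -
  have "q * (1 - C) \<le> 6 / 10 \<and> (q \<noteq> 2 \<longrightarrow> q * (1 - C) \<le> 1 / 2)" using d
  proof (cases rule: digon_data_cases)
    case two
    have "7 / 10 \<le> C" by (rule power2_le_imp_le) (use s C in \<open>auto simp: two power_divide\<close>)
    then show ?thesis using two by simp
  next
    case three
    have "86 / 100 \<le> C" by (rule power2_le_imp_le) (use s C in \<open>auto simp: three power_divide\<close>)
    then show ?thesis using three by simp
  next
    case four
    have "9 / 10 \<le> C" by (rule power2_le_imp_le) (use s C four(3,4) in \<open>auto simp: four(1,2) power_divide\<close>)
    then show ?thesis using four by simp
  next
    case many
    have "C\<^sup>2 \<le> C" using C by (simp add: power2_eq_square mult_left_le)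
    then have "2 * (1 - C) \<le> 1 - t" using s C by simp
    then have "q\<^sup>2 * (2 * (1 - C)) \<le> q\<^sup>2 * (1 - t)" by (intro mult_left_mono) auto
    then have "q * (q * (2 * (1 - C))) \<le> 5" using many(5) by (simp only: power2_eq_square mult.assoc)
    moreover have "5 * (q * (2 * (1 - C))) \<le> q * (q * (2 * (1 - C)))" using many C by (intro mult_right_mono) auto
    ultimately have "q * (1 - C) \<le> 1 / 2" by linarith
    then show ?thesis by simp
  qed
  then show "q * (1 - C) \<le> 6 / 10" "q \<noteq> 2 \<Longrightarrow> q * (1 - C) \<le> 1 / 2" by auto
qed

text \<open>For \<open>q = 2\<close> the half angle bound is too weak by itself, and the reflection in the equator is needed.\<close>

lemma digon_equator_mirrors_bound:
  assumes d: "digon_data q t" and C: "0 \<le> C" "C \<le> 1" "s\<^sup>2 = 1 - C\<^sup>2" and s: "2 * s\<^sup>2 \<le> (1 - t) * (1 - s\<^sup>2)"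
  shows "4 * q * (1 - C) \<le> 2"
proof (cases "q = 2")
  case True
  then have t: "t = 0" using d by (auto simp: digon_data_def)
  have "81 / 100 \<le> C" by (rule power2_le_imp_le) (use s C in \<open>auto simp: t power_divide\<close>)
  then show ?thesis using True by simp
next
  case False
  have "(1 - t) * (1 - s\<^sup>2) \<le> (1 - t) * 1" using digon_data_range[OF d] by (intro mult_left_mono) auto
  then have "2 * s\<^sup>2 \<le> 1 - t" using s by simp
  then show ?thesis using digon_mirrors_bound(2)[OF d C] False by simp
qed

text \<open>The hypothesis holds if the rotation about the vertices of the digon moves a point by at least \<open>2 * \<rho>\<close>
whose distance from the equator is at least \<open>\<rho>\<close>.\<close>

lemma digon_rotation_bound:
  assumes d: "digon_data q t" and C: "0 \<le> C" "C \<le> 1" "s\<^sup>2 = 1 - C\<^sup>2" and s: "s\<^sup>2 \<le> C\<^sup>2 * (1 - t\<^sup>2)"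
  shows "q = 2 \<Longrightarrow> 7 / 10 \<le> C" "q = 3 \<Longrightarrow> 3 / 4 \<le> C" "q = 4 \<Longrightarrow> 4 / 5 \<le> C"
    "5 \<le> q \<Longrightarrow> q * (1 - C) \<le> 1" "5 \<le> q \<Longrightarrow> 4 / 5 \<le> C"
proof -
  have "(q = 2 \<longrightarrow> 7 / 10 \<le> C) \<and> (q = 3 \<longrightarrow> 3 / 4 \<le> C) \<and> (q = 4 \<longrightarrow> 4 / 5 \<le> C) \<and> (5 \<le> q \<longrightarrow> q * (1 - C) \<le> 1 \<and> 4 / 5 \<le> C)"
    using d
  proof (cases rule: digon_data_cases)
    case two
    have "7 / 10 \<le> C" by (rule power2_le_imp_le) (use s C in \<open>auto simp: two power_divide\<close>)
    then show ?thesis using two by simp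
  next
    case three
    have "3 / 4 \<le> C" by (rule power2_le_imp_le) (use s C in \<open>auto simp: three power_divide\<close>)
    then show ?thesis using three by simp
  next
    case four
    have "4 / 5 \<le> C" by (rule power2_le_imp_le) (use s C four(3,4) in \<open>auto simp: four(1,2) power_divide\<close>)
    then show ?thesis using four by simp
  next
    case many
    have "q\<^sup>2 * (1 - C\<^sup>2) \<le> C\<^sup>2 * (q\<^sup>2 * (1 - t\<^sup>2))"
      using mult_left_mono[OF s, of "q\<^sup>2"] C by (simp add: algebra_simps)
    also have "\<dots> \<le> C\<^sup>2 * 10" using many by (intro mult_left_mono) auto
    also have "\<dots> \<le> 5 * (1 + C)"
    proof -
      have "C\<^sup>2 \<le> C" using C by (simp add: power2_eq_square mult_left_le)
      then show ?thesis using C by simp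
    qed
    finally have "(q\<^sup>2 * (1 - C)) * (1 + C) \<le> 5 * (1 + C)" by (simp add: power2_eq_square algebra_simps)
    then have "q\<^sup>2 * (1 - C) \<le> 5" by (rule mult_right_le_imp_le) (use C in simp)
    then have "q * (q * (1 - C)) \<le> 5" by (simp add: power2_eq_square mult.assoc)
    moreover have qq: "5 * (q * (1 - C)) \<le> q * (q * (1 - C))" "5 * (1 - C) \<le> q * (1 - C)" using many C by (intro mult_right_mono; simp)+
    ultimately have "q * (1 - C) \<le> 1" by linarith
    then show ?thesis using many qq by simp
  qed
  then show "q = 2 \<Longrightarrow> 7 / 10 \<le> C" "q = 3 \<Longrightarrow> 3 / 4 \<le> C" "q = 4 \<Longrightarrow> 4 / 5 \<le> C"
    "5 \<le> q \<Longrightarrow> q * (1 - C) \<le> 1" "5 \<le> q \<Longrightarrow> 4 / 5 \<le> C" by auto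
qed

text \<open>The tuples of translation parts of a triangle with two right angles, named in the lemmas.  The first two
sides are those of the digon with angle \<open>pi / q\<close> and the third one is the equator; \<open>s\<close> and \<open>C\<close> are
\<open>sin \<rho>\<close> and \<open>cos \<rho>\<close>, and \<open>b\<close> is the sine of the distance from the nearest glide mirror.  If the
first alternative fails, then \<open>D\<close> lies between \<open>1 / sqrt 3\<close> and the bound that the constraints on \<open>s\<close> impose,
and on this range the criterion leaves room for rational estimates.\<close>

lemma glide_0_0_half:
  assumes d: "digon_data q t" and C: "0 \<le> C" "C \<le> 1" "s\<^sup>2 = 1 - C\<^sup>2"
    and D: "D = q * (1 - C)" and h: "2 * s\<^sup>2 \<le> (1 - t) * (1 - b\<^sup>2)" and b: "0 \<le> b"
  shows "3 * D\<^sup>2 \<le> 1 \<or> 4 * b\<^sup>2 \<le> s\<^sup>2 * (4 - 3 * D\<^sup>2)"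
proof -
  have q: "0 < q" "t \<le> 1" using digon_data_range[OF d] by auto
  have D0: "0 \<le> D" using D q C by simp
  have "(1 - t) * (1 - b\<^sup>2) \<le> (1 - t) * 1" using q by (intro mult_left_mono) auto
  then have s: "2 * s\<^sup>2 \<le> 1 - t" using h by simp
  show ?thesis
  proof (cases "q = 2")
    case False
    then have "D \<le> 1 / 2" using digon_mirrors_bound(2)[OF d C s] D by simp
    then have "D\<^sup>2 \<le> (1 / 2)\<^sup>2" using D0 by (intro power_mono) auto
    then show ?thesis by (simp add: power_divide)
  next
    case True
    then have t: "t = 0" using d by (auto simp: digon_data_def)
    have D6: "D \<le> 6 / 10" using digon_mirrors_bound(1)[OF d C s] D by simp
    then have D2: "D\<^sup>2 \<le> (6 / 10)\<^sup>2" using D0 by (intro power_mono) auto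
    show ?thesis
    proof (cases "3 * D\<^sup>2 \<le> 1")
      case False
      then have "5773 / 10000 < D" using D0 by (rule sqrt_third_less)
      then have "C \<le> 712 / 1000" using D True by simp
      then have "C\<^sup>2 \<le> (712 / 1000)\<^sup>2" using C by (intro power_mono) auto
      then have s2: "49 / 100 \<le> s\<^sup>2" using C by (simp add: power_divide)
      then have "4 * b\<^sup>2 \<le> 49 / 100 * (4 - 3 * (6 / 10)\<^sup>2)" using h t by (simp add: power_divide)
      also have "\<dots> \<le> s\<^sup>2 * (4 - 3 * D\<^sup>2)" using s2 D2 by (intro mult_mono) (auto simp: power_divide)
      finally show ?thesis by simp
    qed simp
  qed
qed

lemma glide_half_half_0:
  assumes d: "digon_data q t" and C: "0 \<le> C" "C \<le> 1" "s\<^sup>2 = 1 - C\<^sup>2"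
    and D: "D = q * (1 - C)" and s: "s\<^sup>2 \<le> C\<^sup>2 * (1 - t\<^sup>2)" and b: "2 * b\<^sup>2 \<le> C\<^sup>2 * (1 - t)"
  shows "3 * D\<^sup>2 \<le> 1 \<or> 4 * b\<^sup>2 \<le> s\<^sup>2 * (4 - 3 * D\<^sup>2)"
proof -
  have q: "0 < q" "t \<le> 1" using digon_data_range[OF d] by auto
  have D0: "0 \<le> D" using D q C by simp
  have D': "D = (4 * q) * (1 - C) / 4" using D by simp
  have CC: "C\<^sup>2 \<le> C" using C by (simp add: power2_eq_square mult_left_le)
  note rb = digon_rotation_bound[OF d C s]
  show ?thesis using d
  proof (cases rule: digon_data_cases)
    case two
    have b1: "8 * b\<^sup>2 \<le> 4 * C\<^sup>2" using b two by simp
    show ?thesis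
    proof (rule criterion_cubic[OF C(1,3) _ D' D0, of "8 / 10"])
      assume "\<not> 3 * D\<^sup>2 \<le> 1"
      then have "5773 / 10000 < D" using D0 by (rule sqrt_third_less)
      then have "C \<le> 72 / 100" using D two by simp
      then have "C * C \<le> 72 / 100 * C" using C by (intro mult_right_mono) auto
      then have "8 * b\<^sup>2 \<le> 288 / 100 * C" using b1 by (simp add: power2_eq_square)
      then show "4 * q * b\<^sup>2 \<le> 8 / 10 * (4 - 3 * (8 / 10)\<^sup>2) * (1 + C)" using two C by (simp add: power_divide)
    qed (use rb two D in auto)
  next
    case three
    have b1: "12 * b\<^sup>2 \<le> 3 * C\<^sup>2" using b by (simp add: three)
    show ?thesis
    proof (rule criterion_cubic[OF C(1,3) _ D' D0, of "8 / 10"])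
      assume "\<not> 3 * D\<^sup>2 \<le> 1"
      then have "5773 / 10000 < D" using D0 by (rule sqrt_third_less)
      then have "C \<le> 81 / 100" using D three by simp
      then have "C * C \<le> 81 / 100 * C" using C by (intro mult_right_mono) auto
      then have "12 * b\<^sup>2 \<le> 243 / 100 * C" using b1 by (simp add: power2_eq_square)
      then show "4 * q * b\<^sup>2 \<le> 8 / 10 * (4 - 3 * (8 / 10)\<^sup>2) * (1 + C)" using three C by (simp add: power_divide)
    qed (use rb three D in auto)
  next
    case four
    have "C\<^sup>2 * (1 - t) \<le> C\<^sup>2 * (3 / 10)" using four by (intro mult_left_mono) auto
    then have b1: "16 * b\<^sup>2 \<le> 24 / 10 * C" using b CC by simp
    show ?thesis
      by (rule criterion_cubic[OF C(1,3) _ D' D0, of "8 / 10"])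
         (use rb four D b1 C in \<open>auto simp: power_divide\<close>)
  next
    case many
    have "5 * (q * (1 - t)) \<le> q * (q * (1 - t))" using many by (intro mult_right_mono) auto
    moreover have "q * (q * (1 - t)) \<le> 5" using many(5) by (simp add: power2_eq_square mult.assoc)
    ultimately have "q * (1 - t) \<le> 1" by linarith
    then have "C\<^sup>2 * (q * (1 - t)) \<le> C\<^sup>2 * 1" by (intro mult_left_mono) auto
    moreover have "q * (2 * b\<^sup>2) \<le> q * (C\<^sup>2 * (1 - t))" using b q by (intro mult_left_mono) auto
    ultimately have b1: "4 * q * b\<^sup>2 \<le> 2 * C" using CC by (simp add: algebra_simps)
    show ?thesis
      by (rule criterion_cubic[OF C(1,3) _ D' D0, of 1])
         (use rb many D b1 C in auto)
  qed
qed

lemma glide_0_half_0: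
  assumes d: "digon_data q t" and C: "0 \<le> C" "C \<le> 1" "s\<^sup>2 = 1 - C\<^sup>2"
    and D: "D = q * (1 - C)" and s: "s\<^sup>2 + b\<^sup>2 \<le> C\<^sup>2 * (1 - t\<^sup>2)"
  shows "3 * D\<^sup>2 \<le> 1 \<or> 4 * b\<^sup>2 \<le> s\<^sup>2 * (4 - 3 * D\<^sup>2)"
proof (cases "3 * D\<^sup>2 \<le> 1")
  case False
  have q: "0 < q" "t \<le> 1" using digon_data_range[OF d] by auto
  have D0: "0 \<le> D" using D q C by simp
  have l: "5773 / 10000 < D" using False D0 by (rule sqrt_third_less)
  have CC: "C\<^sup>2 \<le> C" using C by (simp add: power2_eq_square mult_left_le)
  have s': "s\<^sup>2 \<le> C\<^sup>2 * (1 - t\<^sup>2)" using s by (smt (verit) zero_le_power2)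
  note rb = digon_rotation_bound[OF d C s']
  have D1: "D \<le> 1" using d by (cases rule: digon_data_cases) (use rb D in auto)
  \<comment> \<open>as \<open>b\<^sup>2 \<le> C\<^sup>2 * (1 - t\<^sup>2) - s\<^sup>2\<close>, it suffices to bound \<open>4 * C\<^sup>2 * (1 - t\<^sup>2)\<close> by \<open>s\<^sup>2 * (8 - 3 * D\<^sup>2)\<close>; the cubic increases with \<open>D\<close>\<close>
  have cubic: "404 / 100 \<le> D * (8 - 3 * D\<^sup>2)"
  proof -
    let ?l = "5773 / 10000 :: real"
    have "D\<^sup>2 \<le> 1" using D0 D1 by (simp add: power_le_one)
    then have "0 \<le> 8 - 3 * (D\<^sup>2 + D * ?l + ?l\<^sup>2)" using D1 by (simp add: power_divide)
    then have "0 \<le> (D - ?l) * (8 - 3 * (D\<^sup>2 + D * ?l + ?l\<^sup>2))" using l by simp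
    also have "\<dots> = D * (8 - 3 * D\<^sup>2) - ?l * (8 - 3 * ?l\<^sup>2)" by algebra
    finally show ?thesis by (simp add: power_divide)
  qed
  have key: "q * (4 * (C\<^sup>2 * (1 - t\<^sup>2))) \<le> 404 / 100 * (1 + C)" using d
  proof (cases rule: digon_data_cases)
    case two
    have "C \<le> 72 / 100" using l D two by simp
    then have "C * C \<le> 72 / 100 * C" using C by (intro mult_right_mono) auto
    then show ?thesis using C by (simp add: two power2_eq_square)
  next
    case three
    have "C \<le> 81 / 100" using l D three by simp
    then have "C * C \<le> 81 / 100 * C" using C by (intro mult_right_mono) auto
    then show ?thesis using C by (simp add: three power2_eq_square)
  next
    case four then show ?thesis using CC C by (simp add: four(1,2))
  next
    case many
    have "5 * (q * (1 - t\<^sup>2)) \<le> q * (q * (1 - t\<^sup>2))"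
      using many by (intro mult_right_mono) (auto simp: power_le_one)
    moreover have "q * (q * (1 - t\<^sup>2)) \<le> 10"
      using many(4) unfolding power2_eq_square[of q] by (simp only: mult.assoc)
    ultimately have "q * (1 - t\<^sup>2) \<le> 2" by linarith
    then have "C\<^sup>2 * (q * (1 - t\<^sup>2)) \<le> C\<^sup>2 * 2" by (intro mult_left_mono) auto
    then have "q * (4 * (C\<^sup>2 * (1 - t\<^sup>2))) \<le> 8 * C" using CC by (simp add: algebra_simps)
    then show ?thesis using C by simp
  qed
  also have "\<dots> \<le> D * (8 - 3 * D\<^sup>2) * (1 + C)" using cubic C by (intro mult_right_mono) auto
  also have "\<dots> = q * (s\<^sup>2 * (8 - 3 * D\<^sup>2))" unfolding C(3) D by algebra
  finally have "4 * (C\<^sup>2 * (1 - t\<^sup>2)) \<le> s\<^sup>2 * (8 - 3 * D\<^sup>2)" using q by simp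
  then have "4 * b\<^sup>2 \<le> s\<^sup>2 * (4 - 3 * D\<^sup>2)" using s by (simp add: algebra_simps)
  then show ?thesis by simp
qed simp

lemma glide_0_half_half:
  assumes d: "digon_data q t" and C: "0 \<le> C" "C \<le> 1" "s\<^sup>2 = 1 - C\<^sup>2" and s0: "0 \<le> s" and b: "0 \<le> b"
    and D: "D = q * (1 - C)" and s: "s\<^sup>2 \<le> C\<^sup>2 * (1 - t\<^sup>2)"
    and h: "s\<^sup>2 + b\<^sup>2 + 2 * s * b * t + b\<^sup>2 * (1 - t\<^sup>2) \<le> 1 - t\<^sup>2"
  shows "3 * D\<^sup>2 \<le> 1 \<or> 4 * b\<^sup>2 \<le> s\<^sup>2 * (4 - 3 * D\<^sup>2)"
proof (rule ccontr)
  assume n: "\<not> ?thesis"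
  have q: "0 < q" "0 \<le> t" "t \<le> 1" using digon_data_range[OF d] by auto
  have D0: "0 \<le> D" using D q C by simp
  have l: "5773 / 10000 < D" using n D0 by (intro sqrt_third_less) auto
  note rb = digon_rotation_bound[OF d C s]
  have bs: "s\<^sup>2 * (4 - 3 * e\<^sup>2) \<le> 4 * b\<^sup>2" if "D \<le> e" for e
  proof -
    have "s\<^sup>2 * (4 - 3 * e\<^sup>2) \<le> s\<^sup>2 * (4 - 3 * D\<^sup>2)" using that D0 by (intro mult_left_mono) (auto intro: power_mono)
    then show ?thesis using n by simp
  qed
  have D1: "D \<le> 1" using d by (cases rule: digon_data_cases) (use rb D in auto)
  have "s\<^sup>2 \<le> (2 * b)\<^sup>2" using bs[OF D1] by (simp add: power_mult_distrib)
  then have "s \<le> 2 * b" by (rule power2_le_imp_le) (use b in simp)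
  then have sb: "s * s \<le> s * (2 * b)" using s0 by (intro mult_left_mono) auto
  \<comment> \<open>if the criterion fails, then \<open>s \<le> 2 * b\<close>, and the mixed term of \<open>h\<close> is bounded below by \<open>s\<^sup>2\<close>\<close>
  then have cross: "s\<^sup>2 * t \<le> 2 * s * b * t" using mult_right_mono[OF sb q(2)] by (simp add: power2_eq_square algebra_simps)
  have qs: "q * s\<^sup>2 = D * (1 + C)" unfolding C(3) D by algebra
  have qs': "5773 / 10000 * (1 + c) \<le> q * s\<^sup>2" if "c \<le> C" "0 \<le> c" for c
    unfolding qs using l that by (intro mult_mono) auto
  show False using d
  proof (cases rule: digon_data_cases)
    case two
    have "D \<le> 6 / 10" using rb two D by simp
    then show False using bs[of "6 / 10"] qs'[of "7 / 10"] rb two(1) h by (simp add: two power_divide)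
  next
    case three
    have "D \<le> 75 / 100" using rb three D by simp
    then show False using bs[of "75 / 100"] qs'[of "3 / 4"] rb three(1) h cross by (simp add: three power_divide)
  next
    case four
    have "D \<le> 8 / 10" using rb four D by simp
    moreover have "s\<^sup>2 * (7 / 10) \<le> s\<^sup>2 * t" using four by (intro mult_left_mono) auto
    ultimately show False using bs[of "8 / 10"] qs'[of "4 / 5"] rb four(1) h cross by (simp add: four(1,2) power_divide)
  next
    case many
    have "s\<^sup>2 * (8 / 10) \<le> s\<^sup>2 * t" using many by (intro mult_left_mono) auto
    moreover have "0 \<le> b\<^sup>2 * (1 - t\<^sup>2)" using q by (simp add: power_le_one)
    ultimately have "205 / 100 * s\<^sup>2 \<le> 1 - t\<^sup>2" using bs[OF D1] h cross by simp
    then have "q\<^sup>2 * (205 / 100 * s\<^sup>2) \<le> q\<^sup>2 * (1 - t\<^sup>2)" by (intro mult_left_mono) auto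
    then have "q\<^sup>2 * (205 / 100 * s\<^sup>2) \<le> 10" using many(4) by linarith
    moreover have "5 * (q * s\<^sup>2) \<le> q * (q * s\<^sup>2)" using many by (intro mult_right_mono) auto
    ultimately have "q * s\<^sup>2 \<le> 10 / (5 * (205 / 100))" by (simp add: power2_eq_square)
    then show False using qs'[of "4 / 5"] rb many by simp
  qed
qed

lemma glide_half_half_half:
  assumes d: "digon_data q t" "q \<noteq> 2" and C: "0 \<le> C" "C \<le> 1" "s\<^sup>2 = 1 - C\<^sup>2"
    and D: "D = q * (1 - C)" and s: "s\<^sup>2 \<le> 2 * C\<^sup>2 * (1 - t)" and b: "2 * b\<^sup>2 \<le> (1 - t) * (1 - b\<^sup>2)"
  shows "3 * D\<^sup>2 \<le> 1 \<or> 4 * b\<^sup>2 \<le> s\<^sup>2 * (4 - 3 * D\<^sup>2)"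
proof -
  have q: "0 < q" "t \<le> 1" using digon_data_range[OF d(1)] by auto
  have D0: "0 \<le> D" using D q C by simp
  have D': "D = (4 * q) * (1 - C) / 4" using D by simp
  have b1: "b\<^sup>2 \<le> 1" using b q by (smt (verit) mult_nonneg_nonpos zero_le_power2)
  show ?thesis using d(1)
  proof (cases rule: digon_data_cases)
    case two then show ?thesis using d(2) by simp
  next
    case three
    have "7067 / 10000 \<le> C" by (rule power2_le_imp_le) (use s C in \<open>auto simp: three power_divide\<close>)
    moreover have "5 * b\<^sup>2 \<le> 1" using b by (simp add: three)
    ultimately show ?thesis
      by (intro criterion_cubic[OF C(1,3) _ D' D0, of "88 / 100"]) (use three D in \<open>auto simp: power_divide\<close>)
  next
    case four
    have Ct: "C\<^sup>2 * (1 - t) \<le> C\<^sup>2 * (293 / 1000)" using four by (intro mult_left_mono) auto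
    have "794 / 1000 \<le> C" by (rule power2_le_imp_le) (use s C Ct in \<open>auto simp: power_divide\<close>)
    moreover have "(1 - t) * (1 - b\<^sup>2) \<le> 293 / 1000 * (1 - b\<^sup>2)" using four b1 by (intro mult_right_mono) auto
    then have "b\<^sup>2 \<le> 128 / 1000" using b by simp
    ultimately show ?thesis
      by (intro criterion_cubic[OF C(1,3) _ D' D0, of "83 / 100"]) (use four D in \<open>auto simp: power_divide\<close>)
  next
    case many
    have "q\<^sup>2 * (1 - C\<^sup>2) \<le> 2 * C\<^sup>2 * (q\<^sup>2 * (1 - t))"
      using mult_left_mono[OF s, of "q\<^sup>2"] C by (simp add: algebra_simps)
    also have "\<dots> \<le> 2 * C\<^sup>2 * 5" using many by (intro mult_left_mono) auto
    finally have c1: "q\<^sup>2 * (1 - C\<^sup>2) \<le> 10 * C\<^sup>2" by simp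
    have q25: "25 * (1 - C\<^sup>2) \<le> q\<^sup>2 * (1 - C\<^sup>2)"
      using many C power_mono[of 5 q 2] by (intro mult_right_mono) (auto simp: power_le_one)
    have "25 * (1 - C\<^sup>2) \<le> 10 * C\<^sup>2" using q25 c1 by (rule order_trans)
    then have "(845 / 1000)\<^sup>2 \<le> C\<^sup>2" by (simp add: power_divide)
    then have C8: "845 / 1000 \<le> C" using C(1) by (rule power2_le_imp_le)
    have "C\<^sup>2 \<le> C" using C by (simp add: power2_eq_square mult_left_le)
    then have "(q\<^sup>2 * (1 - C)) * (1 + C) \<le> 5 * (1 + C)" using c1 C by (simp add: power2_eq_square algebra_simps)
    then have "q\<^sup>2 * (1 - C) \<le> 5" by (rule mult_right_le_imp_le) (use C in simp)
    then have "q * (q * (1 - C)) \<le> 5" by (simp add: power2_eq_square mult.assoc)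
    moreover have "5 * (q * (1 - C)) \<le> q * (q * (1 - C))" using many C by (intro mult_right_mono) auto
    ultimately have D1: "D \<le> 1" using D by simp
    have "q\<^sup>2 * (2 * b\<^sup>2) \<le> (q\<^sup>2 * (1 - t)) * (1 - b\<^sup>2)" using mult_left_mono[OF b, of "q\<^sup>2"] by (simp add: mult.assoc)
    also have "\<dots> \<le> 5 * (1 - b\<^sup>2)" using many b1 by (intro mult_right_mono) auto
    finally have bq: "b\<^sup>2 * (q\<^sup>2 + 5 / 2) \<le> 5 / 2" by (simp add: algebra_simps)
    have pos: "0 < q\<^sup>2 + 5 / 2" by (simp add: add_nonneg_pos)
    have "0 \<le> (q - 5) * (1845 / 1000 * q - 775 / 1000)" using many by (intro mult_nonneg_nonneg) auto
    also have "(q - 5) * (1845 / 1000 * q - 775 / 1000) = 1845 / 1000 * (q\<^sup>2 + 5 / 2) - 10 * q - 7375 / 10000"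
      by algebra
    finally have quad: "10 * q \<le> 1845 / 1000 * (q\<^sup>2 + 5 / 2)" by linarith
    have "(4 * q * b\<^sup>2) * (q\<^sup>2 + 5 / 2) = 4 * q * (b\<^sup>2 * (q\<^sup>2 + 5 / 2))" by simp
    also have "\<dots> \<le> 4 * q * (5 / 2)" using q by (intro mult_left_mono bq) auto
    also have "\<dots> \<le> 1845 / 1000 * (q\<^sup>2 + 5 / 2)" using quad by simp
    finally have "4 * q * b\<^sup>2 \<le> 1845 / 1000" using pos by (rule mult_right_le_imp_le)
    then show ?thesis
      by (intro criterion_cubic[OF C(1,3) _ D' D0, of 1]) (use many D1 C8 in auto)
  qed
qed

section \<open>The polyhedral inequalities\<close>

text \<open>The rotations about the three vertices of the triangle bound \<open>S = (sin \<rho>)\<^sup>2\<close> by the squares of the \<open>b\<^sub>i\<close> and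
their products.  Here it is bounded by the products alone: where the products are small against the
squares, two of the \<open>b\<^sub>i\<close> are small and one of the rotations moves the point very little.\<close>

lemma rotation_products_ge:
  fixes b1 b2 b3 S w \<mu> :: real
  assumes b: "0 \<le> b1" "0 \<le> b2" "0 \<le> b3" and w: "1 \<le> w" and \<mu>: "1 \<le> \<mu>" "\<mu> \<le> 2" "2 * \<mu> \<le> 2 + w"
    and S: "S \<le> b1\<^sup>2 + b2\<^sup>2" "S \<le> b1\<^sup>2 + b3\<^sup>2 + b1 * b3" "S \<le> b2\<^sup>2 + b3\<^sup>2 + \<mu> * b2 * b3"
  shows "S \<le> w * b1 * b2 + b1 * b3 + b2 * b3"
proof (rule ccontr)
  let ?E = "w * b1 * b2 + b1 * b3 + b2 * b3"
  assume "\<not> S \<le> ?E"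
  then have 12: "?E < b1\<^sup>2 + b2\<^sup>2" and 13: "?E < b1\<^sup>2 + b3\<^sup>2 + b1 * b3" and 23: "?E < b2\<^sup>2 + b3\<^sup>2 + \<mu> * b2 * b3"
    using S by linarith+
  have wb: "b1 * b2 \<le> w * b1 * b2" using mult_right_mono[OF w, of "b1 * b2"] b by simp
  show False
  proof (cases "b1 \<le> b2")
    case True
    have "b1 * b1 \<le> b1 * b2" using True b by (intro mult_left_mono) auto
    then have "b2 * b3 < b3 * b3" using 13 wb by (simp add: power2_eq_square)
    then have b23: "b2 < b3" using b by (simp add: mult_less_cancel_right)
    have "b2 * b2 \<le> b2 * b3" using b23 b by (intro mult_left_mono) auto
    moreover have "0 \<le> b1 * b3" using b by simp
    ultimately show False using 12 wb \<open>b1 * b1 \<le> b1 * b2\<close> by (simp add: power2_eq_square)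
  next
    case False
    then have b21: "b2 < b1" by simp
    have 1: "b2 * b2 \<le> b1 * b2" using b21 b by (intro mult_right_mono) auto
    have "(b1 - (\<mu> - 1) * b2) * b3 < b3 * b3"
      using 23 1 wb by (simp add: power2_eq_square algebra_simps)
    then have b3: "b1 - (\<mu> - 1) * b2 < b3" using b by (simp add: mult_less_cancel_right)
    have "(b1 + b2) * (b1 - (\<mu> - 1) * b2) \<le> (b1 + b2) * b3" using b3 b by (intro mult_left_mono) auto
    then have "w * b1 * b2 + (b1 + b2) * (b1 - (\<mu> - 1) * b2) < b1\<^sup>2 + b2\<^sup>2"
      using 12 by (simp add: algebra_simps)
    then have "(w + 2 - \<mu>) * (b1 * b2) < \<mu> * (b2 * b2)" by (simp add: power2_eq_square algebra_simps)
    moreover have "\<mu> * (b2 * b2) \<le> \<mu> * (b1 * b2)" using 1 \<mu> by (intro mult_left_mono) auto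
    moreover have "\<mu> * (b1 * b2) \<le> (w + 2 - \<mu>) * (b1 * b2)" using \<mu> b by (intro mult_right_mono) auto
    ultimately show False by linarith
  qed
qed

text \<open>Twice the quadratic forms of the inverse Gram matrices of the normals of the three triangles, where
\<open>\<mu> = 2 * cos (pi / k)\<close> for the angle \<open>pi / k\<close> between the second and the third side.\<close>

definition tetrahedral_form :: "real \<Rightarrow> real \<Rightarrow> real \<Rightarrow> real" where
  "tetrahedral_form b1 b2 b3 = 3 * b1\<^sup>2 + 3 * b2\<^sup>2 + 4 * b3\<^sup>2 + 2 * b1 * b2 + 4 * b1 * b3 + 4 * b2 * b3"

definition octahedral_form :: "real \<Rightarrow> real \<Rightarrow> real \<Rightarrow> real \<Rightarrow> real" where
  "octahedral_form \<mu> b1 b2 b3 = 4 * b1\<^sup>2 + 6 * b2\<^sup>2 + 8 * b3\<^sup>2 + 4 * \<mu> * b1 * b2 + 8 * b1 * b3 + 8 * \<mu> * b2 * b3"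

definition icosahedral_form :: "real \<Rightarrow> real \<Rightarrow> real \<Rightarrow> real \<Rightarrow> real" where
  "icosahedral_form \<mu> b1 b2 b3 = (2 * \<mu> + 4) * b1\<^sup>2 + (6 * \<mu> + 6) * b2\<^sup>2 + (8 * \<mu> + 8) * b3\<^sup>2
     + (8 * \<mu> + 4) * b1 * b2 + (8 * \<mu> + 8) * b1 * b3 + (16 * \<mu> + 8) * b2 * b3"

lemma nonneg_square_products:
  assumes "c \<le> b1" "c \<le> b2" "c \<le> b3" "0 \<le> (c::real)"
  shows "c\<^sup>2 \<le> b1\<^sup>2" "c\<^sup>2 \<le> b2\<^sup>2" "c\<^sup>2 \<le> b3\<^sup>2" "c\<^sup>2 \<le> b1 * b2" "c\<^sup>2 \<le> b1 * b3" "c\<^sup>2 \<le> b2 * b3"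
  using assms by (auto simp: power2_eq_square intro!: mult_mono)

lemma tetrahedral_form_ge:
  assumes "c \<le> b1" "c \<le> b2" "c \<le> b3" "0 \<le> c"
  shows "20 * c\<^sup>2 \<le> tetrahedral_form b1 b2 b3"
  using nonneg_square_products[OF assms] unfolding tetrahedral_form_def mult.assoc by linarith

lemma octahedral_form_ge:
  assumes "c \<le> b1" "c \<le> b2" "c \<le> b3" "0 \<le> c" and \<mu>: "141 / 100 \<le> \<mu>"
  shows "428 / 10 * c\<^sup>2 \<le> octahedral_form \<mu> b1 b2 b3"
proof -
  note np = nonneg_square_products[OF assms(1-4)]
  have m: "(141 / 100) * c\<^sup>2 \<le> \<mu> * x" if "c\<^sup>2 \<le> x" for x using that \<mu> by (intro mult_mono) auto
  have "141 / 100 * c\<^sup>2 \<le> \<mu> * (b1 * b2)" "141 / 100 * c\<^sup>2 \<le> \<mu> * (b2 * b3)" using np[THEN m] by auto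
  then show ?thesis using np zero_le_power2[of c] unfolding octahedral_form_def mult.assoc by linarith
qed

lemma icosahedral_form_ge:
  assumes "c \<le> b1" "c \<le> b2" "c \<le> b3" "0 \<le> c" and \<mu>: "16 / 10 \<le> \<mu>"
  shows "1148 / 10 * c\<^sup>2 \<le> icosahedral_form \<mu> b1 b2 b3"
proof -
  note np = nonneg_square_products[OF assms(1-4)]
  have m: "(16 / 10) * c\<^sup>2 \<le> \<mu> * x" if "c\<^sup>2 \<le> x" for x using that \<mu> by (intro mult_mono) auto
  show ?thesis using np np[THEN m] zero_le_power2[of c] unfolding icosahedral_form_def mult.assoc distrib_right by linarith
qed

lemma tetrahedral_mirrors:
  fixes C s :: real
  assumes C: "0 \<le> C" "s\<^sup>2 = 1 - C\<^sup>2" and s: "10 * s\<^sup>2 \<le> 1"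
  shows "24 * (1 - C) \<le> 2"
proof -
  have "11 / 12 \<le> C" by (rule power2_le_imp_le) (use C s in \<open>auto simp: power_divide\<close>)
  then show ?thesis by simp
qed

lemma octahedral_mirrors:
  fixes C s :: real
  assumes C: "0 \<le> C" "s\<^sup>2 = 1 - C\<^sup>2" and s: "214 / 10 * s\<^sup>2 \<le> 1"
  shows "48 * (1 - C) \<le> 2"
proof -
  have "23 / 24 \<le> C" by (rule power2_le_imp_le) (use C s in \<open>auto simp: power_divide\<close>)
  then show ?thesis by simp
qed

lemma icosahedral_mirrors:
  fixes C s :: real
  assumes C: "0 \<le> C" "s\<^sup>2 = 1 - C\<^sup>2" and s: "574 / 10 * s\<^sup>2 \<le> 1"
  shows "120 * (1 - C) \<le> 2"
proof -
  have "59 / 60 \<le> C" by (rule power2_le_imp_le) (use C s in \<open>auto simp: power_divide\<close>)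
  then show ?thesis by simp
qed

lemma tetrahedral_rotations:
  assumes C: "0 \<le> C" "C \<le> 1" "s\<^sup>2 = 1 - C\<^sup>2" and D: "D = 24 * (1 - C) / 4"
    and c: "c \<le> b1" "c \<le> b2" "c \<le> b3" "0 \<le> c" and Q: "tetrahedral_form b1 b2 b3 \<le> 2"
    and s: "s\<^sup>2 \<le> b1\<^sup>2 + b2\<^sup>2" "s\<^sup>2 \<le> b1\<^sup>2 + b3\<^sup>2 + b1 * b3" "s\<^sup>2 \<le> b2\<^sup>2 + b3\<^sup>2 + b2 * b3"
  shows "3 * D\<^sup>2 \<le> 1 \<or> 4 * c\<^sup>2 \<le> s\<^sup>2 * (4 - 3 * D\<^sup>2)"
proof -
  have "s\<^sup>2 \<le> 1 * b1 * b2 + b1 * b3 + b2 * b3"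
    by (rule rotation_products_ge[where \<mu>=1]) (use c s in auto)
  then have "7 * s\<^sup>2 \<le> tetrahedral_form b1 b2 b3" using s unfolding tetrahedral_form_def mult.assoc by linarith
  then have "(8451 / 10000)\<^sup>2 \<le> C\<^sup>2" using Q C by (simp add: power_divide)
  then have C8: "8451 / 10000 \<le> C" using C(1) by (rule power2_le_imp_le)
  have c2: "20 * c\<^sup>2 \<le> 2" using tetrahedral_form_ge[OF c] Q by linarith
  show ?thesis
    by (rule criterion_cubic[OF C(1,3) _ D, of "9294 / 10000"]) (use D C C8 c2 in \<open>auto simp: power_divide\<close>)
qed

lemma octahedral_rotations:
  assumes C: "0 \<le> C" "C \<le> 1" "s\<^sup>2 = 1 - C\<^sup>2" and D: "D = 48 * (1 - C) / 4" and \<mu>: "141 / 100 \<le> \<mu>" "\<mu> \<le> 142 / 100"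
    and c: "c \<le> b1" "c \<le> b2" "c \<le> b3" "0 \<le> c" and Q: "octahedral_form \<mu> b1 b2 b3 \<le> 2"
    and s: "s\<^sup>2 \<le> b1\<^sup>2 + b2\<^sup>2" "s\<^sup>2 \<le> b1\<^sup>2 + b3\<^sup>2 + b1 * b3" "s\<^sup>2 \<le> b2\<^sup>2 + b3\<^sup>2 + \<mu> * b2 * b3"
  shows "3 * D\<^sup>2 \<le> 1 \<or> 4 * c\<^sup>2 \<le> s\<^sup>2 * (4 - 3 * D\<^sup>2)"
proof -
  have b: "0 \<le> b1" "0 \<le> b2" "0 \<le> b3" using c by auto
  have e: "s\<^sup>2 \<le> 1 * b1 * b2 + b1 * b3 + b2 * b3"
    by (rule rotation_products_ge[where \<mu>=\<mu>]) (use b s \<mu> in auto)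
  have pr: "0 \<le> b1 * b2" "0 \<le> b1 * b3" "0 \<le> b2 * b3" using b by auto
  have "141 / 100 * (b1 * b2) \<le> \<mu> * (b1 * b2)" "141 / 100 * (b2 * b3) \<le> \<mu> * (b2 * b3)"
    using mult_right_mono[OF \<mu>(1) pr(1)] mult_right_mono[OF \<mu>(1) pr(3)] by (simp_all only:)
  then have "132 / 10 * s\<^sup>2 \<le> octahedral_form \<mu> b1 b2 b3" using s e pr unfolding octahedral_form_def mult.assoc by linarith
  then have "(9211 / 10000)\<^sup>2 \<le> C\<^sup>2" using Q C by (simp add: power_divide)
  then have C9: "9211 / 10000 \<le> C" using C(1) by (rule power2_le_imp_le)
  have c2: "428 / 10 * c\<^sup>2 \<le> 2" using octahedral_form_ge[OF c \<mu>(1)] Q by linarith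
  show ?thesis
    by (rule criterion_cubic[OF C(1,3) _ D, of "95 / 100"]) (use D C C9 c2 in \<open>auto simp: power_divide\<close>)
qed

lemma icosahedral_rotations:
  assumes C: "0 \<le> C" "C \<le> 1" "s\<^sup>2 = 1 - C\<^sup>2" and D: "D = 120 * (1 - C) / 4" and \<mu>: "16 / 10 \<le> \<mu>" "\<mu> \<le> 165 / 100"
    and c: "c \<le> b1" "c \<le> b2" "c \<le> b3" "0 \<le> c" and Q: "icosahedral_form \<mu> b1 b2 b3 \<le> 2" and \<mu>2: "\<mu>\<^sup>2 = \<mu> + 1"
    and s: "s\<^sup>2 \<le> b1\<^sup>2 + b2\<^sup>2" "s\<^sup>2 \<le> b1\<^sup>2 + b3\<^sup>2 + b1 * b3" "s\<^sup>2 \<le> b2\<^sup>2 + b3\<^sup>2 + \<mu> * b2 * b3"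
  shows "3 * D\<^sup>2 \<le> 1 \<or> 4 * c\<^sup>2 \<le> s\<^sup>2 * (4 - 3 * D\<^sup>2)"
proof -
  have b: "0 \<le> b1" "0 \<le> b2" "0 \<le> b3" using c by auto
  let ?E = "13 / 10 * b1 * b2 + b1 * b3 + b2 * b3"
  have e: "s\<^sup>2 \<le> ?E"
    by (rule rotation_products_ge[where \<mu>=\<mu>]) (use b s \<mu> in auto)
  have pr: "0 \<le> b1 * b2" "0 \<le> b1 * b3" "0 \<le> b2 * b3" using b by auto
  \<comment> \<open>the weights of the four bounds for \<open>s\<^sup>2\<close> leave products with nonnegative coefficients\<close>
  have "icosahedral_form \<mu> b1 b2 b3 = 1 * (b1\<^sup>2 + b2\<^sup>2) + (2 * \<mu> + 3) * (b1\<^sup>2 + b3\<^sup>2 + b1 * b3)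
      + (6 * \<mu> + 5) * (b2\<^sup>2 + b3\<^sup>2 + \<mu> * b2 * b3) + (5 * \<mu> + 2) * ?E
      + ((15 / 10 * \<mu> + 14 / 10) * (b1 * b2) + (\<mu> + 3) * (b1 * b3))"
    unfolding icosahedral_form_def using \<mu>2 by algebra
  moreover have "1 * s\<^sup>2 \<le> 1 * (b1\<^sup>2 + b2\<^sup>2)" "(2 * \<mu> + 3) * s\<^sup>2 \<le> (2 * \<mu> + 3) * (b1\<^sup>2 + b3\<^sup>2 + b1 * b3)"
    "(6 * \<mu> + 5) * s\<^sup>2 \<le> (6 * \<mu> + 5) * (b2\<^sup>2 + b3\<^sup>2 + \<mu> * b2 * b3)" "(5 * \<mu> + 2) * s\<^sup>2 \<le> (5 * \<mu> + 2) * ?E"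
    using s e \<mu> by (auto intro!: mult_left_mono)
  moreover have "0 \<le> (15 / 10 * \<mu> + 14 / 10) * (b1 * b2) + (\<mu> + 3) * (b1 * b3)" using pr \<mu> by simp
  ultimately have "(1 + (2 * \<mu> + 3) + (6 * \<mu> + 5) + (5 * \<mu> + 2)) * s\<^sup>2 \<le> icosahedral_form \<mu> b1 b2 b3"
    unfolding distrib_right by linarith
  moreover have "318 / 10 * s\<^sup>2 \<le> (1 + (2 * \<mu> + 3) + (6 * \<mu> + 5) + (5 * \<mu> + 2)) * s\<^sup>2" using \<mu> by (intro mult_right_mono) auto
  ultimately have "318 / 10 * s\<^sup>2 \<le> 2" using Q by linarith
  then have "(9674 / 10000)\<^sup>2 \<le> C\<^sup>2" using C by (simp add: power_divide)
  then have C9: "9674 / 10000 \<le> C" using C(1) by (rule power2_le_imp_le)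
  have c2: "1148 / 10 * c\<^sup>2 \<le> 2" using icosahedral_form_ge[OF c \<mu>(1)] Q by linarith
  show ?thesis
    by (rule criterion_cubic[OF C(1,3) _ D, of "98 / 100"]) (use D C C9 c2 in \<open>auto simp: power_divide\<close>)
qed

lemma octahedral_0_half_0:
  assumes C: "0 \<le> C" "C \<le> 1" "s\<^sup>2 = 1 - C\<^sup>2" and s0: "0 \<le> s" and D: "D = 48 * (1 - C) / 4" and \<mu>: "141 / 100 \<le> \<mu>"
    and b: "s \<le> b1" "0 \<le> b2" "s \<le> b3" and Q: "octahedral_form \<mu> b1 b2 b3 \<le> 2"
  shows "3 * D\<^sup>2 \<le> 1 \<or> 4 * b2\<^sup>2 \<le> s\<^sup>2 * (4 - 3 * D\<^sup>2)"
proof (rule ccontr)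
  assume n: "\<not> ?thesis"
  have D0: "0 \<le> D" using D C by simp
  have l: "5773 / 10000 < D" using n D0 by (intro sqrt_third_less) auto
  have np: "s\<^sup>2 \<le> b1\<^sup>2" "s\<^sup>2 \<le> b3\<^sup>2" "s\<^sup>2 \<le> b1 * b3" "s * b2 \<le> b1 * b2" "b2 * s \<le> b2 * b3" "0 \<le> s * b2"
    using b s0 by (auto simp: power2_eq_square intro!: mult_mono)
  have "0 \<le> b1 * b2" "0 \<le> b2 * b3" using b s0 by auto
  then have "141 / 100 * (b1 * b2) \<le> \<mu> * (b1 * b2)" "141 / 100 * (b2 * b3) \<le> \<mu> * (b2 * b3)"
    using mult_right_mono[OF \<mu>, of "b1 * b2"] mult_right_mono[OF \<mu>, of "b2 * b3"] by (simp_all only:)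
  then have Q': "20 * s\<^sup>2 + 16 * (s * b2) + 6 * b2\<^sup>2 \<le> 2"
    using Q np unfolding octahedral_form_def mult.assoc by (simp add: mult.commute[of b2 s])
  have "0 \<le> b2\<^sup>2" by simp
  then have "s\<^sup>2 \<le> 1 / 10" using Q' np(6) by linarith
  then have "(94 / 100)\<^sup>2 \<le> C\<^sup>2" using C by (simp add: power_divide)
  then have C9: "94 / 100 \<le> C" using C(1) by (rule power2_le_imp_le)
  have "s\<^sup>2 = D / 12 * (1 + C)" unfolding C(3) D by algebra
  moreover have "5773 / 10000 / 12 * (1 + 94 / 100) \<le> D / 12 * (1 + C)" using l C9 by (intro mult_mono) auto
  ultimately have s2: "9 / 100 \<le> s\<^sup>2" by simp
  have "D \<le> 72 / 100" using D C9 by simp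
  then have "D\<^sup>2 \<le> (72 / 100)\<^sup>2" using D0 by (intro power_mono) auto
  then have "s\<^sup>2 * 1 \<le> s\<^sup>2 * (4 - 3 * D\<^sup>2)" by (intro mult_left_mono) (auto simp: power_divide)
  then have "s\<^sup>2 \<le> (2 * b2)\<^sup>2" using n by (simp add: power_mult_distrib)
  then have "s \<le> 2 * b2" by (rule power2_le_imp_le) (use b in simp)
  then have "s * s \<le> s * (2 * b2)" using s0 by (intro mult_left_mono) auto
  then have "28 * s\<^sup>2 \<le> 2" using Q' \<open>0 \<le> b2\<^sup>2\<close> unfolding power2_eq_square by linarith
  then show False using s2 by simp
qed

lemma octahedral_half_0_half:
  assumes C: "0 \<le> C" "C \<le> 1" "s\<^sup>2 = 1 - C\<^sup>2" and s0: "0 \<le> s" and D: "D = 48 * (1 - C) / 4" and \<mu>: "141 / 100 \<le> \<mu>"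
    and b: "c \<le> b1" "s \<le> b2" "c \<le> b3" "0 \<le> c" and Q: "octahedral_form \<mu> b1 b2 b3 \<le> 2"
    and s: "s\<^sup>2 \<le> b1\<^sup>2 + b3\<^sup>2 + b1 * b3"
  shows "3 * D\<^sup>2 \<le> 1 \<or> 4 * c\<^sup>2 \<le> s\<^sup>2 * (4 - 3 * D\<^sup>2)"
proof (rule ccontr)
  assume n: "\<not> ?thesis"
  have b0: "0 \<le> b1" "0 \<le> b3" "0 \<le> b2" using b s0 by auto
  have D0: "0 \<le> D" using D C by simp
  have l: "5773 / 10000 < D" using n D0 by (intro sqrt_third_less) auto
  have "0 \<le> b1 * b2" "0 \<le> b2 * b3" using b0 by auto
  then have mm: "141 / 100 * (b1 * b2) \<le> \<mu> * (b1 * b2)" "141 / 100 * (b2 * b3) \<le> \<mu> * (b2 * b3)"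
    using mult_right_mono[OF \<mu>, of "b1 * b2"] mult_right_mono[OF \<mu>, of "b2 * b3"] by (simp_all only:)
  have "s\<^sup>2 \<le> (b1 + b3)\<^sup>2"
  proof -
    have "(b1 + b3)\<^sup>2 = b1\<^sup>2 + b3\<^sup>2 + b1 * b3 + b1 * b3" by algebra
    then show ?thesis using s mult_nonneg_nonneg[OF b0(1,2)] by linarith
  qed
  then have "s \<le> b1 + b3" by (rule power2_le_imp_le) (use b0 in simp)
  then have "s * s \<le> b2 * (b1 + b3)" using b b0 s0 by (intro mult_mono) auto
  then have sb: "s\<^sup>2 \<le> b1 * b2 + b2 * b3" by (simp add: power2_eq_square algebra_simps)
  have b22: "s\<^sup>2 \<le> b2\<^sup>2" using b s0 by (intro power_mono) auto
  have "156 / 10 * s\<^sup>2 \<le> 2"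
    using Q mm sb b22 s mult_nonneg_nonneg[OF b0(1,2)] zero_le_power2[of b1] zero_le_power2[of b3] mult_nonneg_nonneg[OF b0(3,2)]
    unfolding octahedral_form_def mult.assoc by linarith
  then have "(9336 / 10000)\<^sup>2 \<le> C\<^sup>2" using C by (simp add: power_divide)
  then have C9: "9336 / 10000 \<le> C" using C(1) by (rule power2_le_imp_le)
  have "s\<^sup>2 = D / 12 * (1 + C)" unfolding C(3) D by algebra
  moreover have "5773 / 10000 / 12 * (1 + 93 / 100) \<le> D / 12 * (1 + C)" using l C9 by (intro mult_mono) auto
  ultimately have s2: "9 / 100 \<le> s\<^sup>2" by simp
  have "D \<le> 8 / 10" using D C9 by simp
  then have "D\<^sup>2 \<le> (8 / 10)\<^sup>2" using D0 by (intro power_mono) auto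
  then have "s\<^sup>2 * 2 \<le> s\<^sup>2 * (4 - 3 * D\<^sup>2)" by (intro mult_left_mono) (auto simp: power_divide)
  then have c2: "s\<^sup>2 \<le> 2 * c\<^sup>2" using n by simp
  then have "s\<^sup>2 \<le> 100 / 49 * c\<^sup>2" using zero_le_power2[of c] by linarith
  also have "\<dots> = (10 / 7 * c)\<^sup>2" by (simp add: power_mult_distrib power_divide)
  finally have "s \<le> 10 / 7 * c" by (intro power2_le_imp_le[of s]) (use b in auto)
  then have "s * s \<le> s * (10 / 7 * c)" using s0 by (intro mult_left_mono) auto
  then have sc: "7 / 10 * s\<^sup>2 \<le> s * c" by (simp add: power2_eq_square)
  have "s * c \<le> b2 * b1" "s * c \<le> b2 * b3" using b b0 s0 by (auto intro!: mult_mono)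
  moreover have "c\<^sup>2 \<le> b1\<^sup>2" "c\<^sup>2 \<le> b3\<^sup>2" "c\<^sup>2 \<le> b1 * b3" using b b0 by (auto simp: power2_eq_square intro!: mult_mono)
  ultimately have "20 * c\<^sup>2 + 169 / 10 * (s * c) + 6 * s\<^sup>2 \<le> 2"
    using Q mm b22 mult_nonneg_nonneg[OF s0 b(4)]
    unfolding octahedral_form_def mult.assoc mult.commute[of b2 b1] by linarith
  then have "27 * s\<^sup>2 \<le> 2" using c2 sc by linarith
  then show False using s2 by simp
qed

text \<open>A triangle with three right angles in which all sides are glide mirrors is the case for
which the criterion with sines is not precise enough: at the extreme value \<open>cos \<rho> = 1 / sqrt 3\<close> the
orbit at one height is a regular tetrahedron.  Near this position the distances are compared themselves,
with the triple angle formula for \<open>\<rho> / 3\<close>.\<close>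

lemma arcsin_le_two_thirds:
  assumes r: "0 \<le> \<rho>" "\<rho> \<le> pi / 2" and C: "cos \<rho> \<le> 601 / 1000" and b: "0 \<le> b" "3 * b\<^sup>2 \<le> 1"
  shows "arcsin b \<le> 2 / 3 * \<rho>"
proof -
  define y where "y = \<rho> / 3"
  define z where "z = cos y"
  have y: "0 \<le> y" "y \<le> pi / 6" "\<rho> = 3 * y" using r by (auto simp: y_def)
  have z0: "0 \<le> z" unfolding z_def using y by (intro cos_ge_zero) auto
  have "cos (3 * y) = 4 * z ^ 3 - 3 * z"
  proof -
    have "cos (3 * y) = cos (2 * y + y)" by simp
    also have "\<dots> = (2 * z\<^sup>2 - 1) * z - 2 * (sin y)\<^sup>2 * z"
      unfolding cos_add sin_double cos_double_cos z_def by (simp add: power2_eq_square)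
    also have "\<dots> = 4 * z ^ 3 - 3 * z" unfolding sin_squared_eq z_def[symmetric] by algebra
    finally show ?thesis .
  qed
  then have cub: "4 * z ^ 3 - 3 * z \<le> 601 / 1000" using C y by simp
  have zu: "z < 953 / 1000"
  proof (rule ccontr)
    assume "\<not> ?thesis"
    then have z9: "953 / 1000 \<le> z" by simp
    then have "(953 / 1000)\<^sup>2 \<le> z\<^sup>2" by (intro power_mono) auto
    then have "953 / 1000 * (4 * (953 / 1000)\<^sup>2 - 3) \<le> z * (4 * z\<^sup>2 - 3)" using z9 by (intro mult_mono) (auto simp: power_divide)
    also have "\<dots> = 4 * z ^ 3 - 3 * z" by algebra
    finally show False using cub by (simp add: power_divide)
  qed
  have zl: "sqrt 3 / 2 \<le> z"
  proof -
    have "cos (pi / 6) \<le> cos y" using y by (intro cos_monotone_0_pi_le) auto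
    then show ?thesis by (simp add: z_def cos_30)
  qed
  then have "(sqrt 3 / 2)\<^sup>2 \<le> z\<^sup>2" by (intro power_mono) auto
  then have z34: "3 / 4 \<le> z\<^sup>2" by (simp add: power_divide)
  have "z\<^sup>2 \<le> (953 / 1000)\<^sup>2" using zu z0 by (intro power_mono) auto
  then have zz: "0 \<le> ((953 / 1000)\<^sup>2 - z\<^sup>2) * (z\<^sup>2 + (953 / 1000)\<^sup>2 - 1)" using z34 by (intro mult_nonneg_nonneg) (auto simp: power_divide)
  have "1 / 3 \<le> 4 * ((953 / 1000)\<^sup>2 * (1 - (953 / 1000)\<^sup>2) :: real)" by (simp add: power_divide)
  also have "\<dots> \<le> 4 * (z\<^sup>2 * (1 - z\<^sup>2))"
  proof -
    have "((953 / 1000)\<^sup>2 - z\<^sup>2) * (z\<^sup>2 + (953 / 1000)\<^sup>2 - 1) = z\<^sup>2 * (1 - z\<^sup>2) - (953 / 1000)\<^sup>2 * (1 - (953 / 1000)\<^sup>2)" by algebra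
    then show ?thesis using zz by simp
  qed
  also have "\<dots> = (sin (2 * y))\<^sup>2" unfolding sin_double z_def by (simp add: power_mult_distrib sin_squared_eq)
  finally have "b\<^sup>2 \<le> (sin (2 * y))\<^sup>2" using b by simp
  then have bs: "b \<le> sin (2 * y)" by (rule power2_le_imp_le) (use y in \<open>auto intro!: sin_ge_zero\<close>)
  have "arcsin b \<le> arcsin (sin (2 * y))" using bs b by (intro arcsin_le_arcsin) auto
  also have "\<dots> = 2 * y" using y by (intro arcsin_sin) auto
  finally show ?thesis by (simp add: y_def)
qed

lemma glide_half_half_half_right:
  assumes r: "0 \<le> \<rho>" "\<rho> \<le> pi / 2" "2 * \<rho> \<le> p" and s: "(sin \<rho>)\<^sup>2 \<le> 2 * (cos \<rho>)\<^sup>2" and b: "0 \<le> b" "3 * b\<^sup>2 \<le> 1"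
    and glide: "16 * \<rho>\<^sup>2 \<le> 16 * (arcsin b)\<^sup>2 + p\<^sup>2"
  shows "sqrt 3 * 8 * \<rho> * (1 - cos \<rho>) \<le> 2 * p"
proof -
  define C where "C = cos \<rho>"
  define D where "D = 8 * (1 - C) / 4"
  have C0: "0 \<le> C" "C \<le> 1" unfolding C_def using r by (auto intro: cos_ge_zero)
  have ss: "(sin \<rho>)\<^sup>2 = 1 - C\<^sup>2" by (simp add: C_def sin_squared_eq)
  have D0: "0 \<le> D" using C0 by (simp add: D_def)
  have C5: "577 / 1000 \<le> C" by (rule power2_le_imp_le) (use s ss C0 in \<open>auto simp: C_def[symmetric] power_divide\<close>)
  show ?thesis
  proof (cases "601 / 1000 \<le> C")
    case True
    have "3 * D\<^sup>2 \<le> 1 \<or> 4 * b\<^sup>2 \<le> (sin \<rho>)\<^sup>2 * (4 - 3 * D\<^sup>2)"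
      by (rule criterion_cubic[OF C0(1) ss _ D_def D0, of "798 / 1000"]) (use True b in \<open>auto simp: D_def power_divide\<close>)
    then show ?thesis by (rule glide_criterion[OF r D0 D_def[unfolded C_def] b(1) glide])
  next
    case False
    have "arcsin b \<le> 2 / 3 * \<rho>" by (rule arcsin_le_two_thirds[OF r(1,2) _ b]) (use False in \<open>simp add: C_def\<close>)
    moreover have "b \<le> 1" by (rule power2_le_imp_le) (use b in auto)
    then have "0 \<le> arcsin b" using b arcsin_le_arcsin[of 0 b] by simp
    ultimately have "(arcsin b)\<^sup>2 \<le> (2 / 3 * \<rho>)\<^sup>2" by (intro power_mono) auto
    then have g: "16 * \<rho>\<^sup>2 \<le> 16 * (2 / 3 * \<rho>)\<^sup>2 + p\<^sup>2" using glide by linarith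
    have "D \<le> 846 / 1000" using C5 by (simp add: D_def)
    then have "D\<^sup>2 \<le> (846 / 1000)\<^sup>2" using D0 by (intro power_mono) auto
    then have "\<rho>\<^sup>2 * (16 / 9) \<le> \<rho>\<^sup>2 * (4 - 3 * D\<^sup>2)" by (intro mult_left_mono) (auto simp: power_divide)
    then have "4 * (2 / 3 * \<rho>)\<^sup>2 \<le> \<rho>\<^sup>2 * (4 - 3 * D\<^sup>2)" by (simp add: power_mult_distrib power_divide)
    then show ?thesis by (intro glide_criterion_angle[OF r(1,3) D0 D_def[unfolded C_def] g]) simp
  qed
qed

section \<open>The five families of mirror systems\<close>

text \<open>The expansion of \<open>0 \<le> norm (P - x1 n1 - x2 n2 - x3 n3)\<^sup>2\<close>.  Taking for the coefficients \<open>x\<close> the inverse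
Gram matrix applied to the inner products with \<open>P\<close> gives Bessel's inequality for an oblique system.\<close>

lemma bessel_combination:
  fixes n1 n2 n3 P :: "real^3"
  assumes "norm n1 = 1" "norm n2 = 1" "norm n3 = 1" "norm P = 1"
  shows "2 * (x1 * (n1 \<bullet> P) + x2 * (n2 \<bullet> P) + x3 * (n3 \<bullet> P))
    - (x1\<^sup>2 + x2\<^sup>2 + x3\<^sup>2 + 2 * x1 * x2 * (n1 \<bullet> n2) + 2 * x1 * x3 * (n1 \<bullet> n3) + 2 * x2 * x3 * (n2 \<bullet> n3)) \<le> 1"
proof -
  let ?v = "x1 *\<^sub>R n1 + x2 *\<^sub>R n2 + x3 *\<^sub>R n3"
  have nn: "n1 \<bullet> n1 = 1" "n2 \<bullet> n2 = 1" "n3 \<bullet> n3 = 1" "P \<bullet> P = 1" using assms by (auto simp: norm_eq_1)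
  have "0 \<le> (P - ?v) \<bullet> (P - ?v)" by simp
  also have "(P - ?v) \<bullet> (P - ?v) = P \<bullet> P - 2 * (?v \<bullet> P) + ?v \<bullet> ?v"
    by (simp add: inner_diff inner_commute)
  also have "?v \<bullet> P = x1 * (n1 \<bullet> P) + x2 * (n2 \<bullet> P) + x3 * (n3 \<bullet> P)" by (simp add: inner_add_left)
  also have "?v \<bullet> ?v = x1\<^sup>2 + x2\<^sup>2 + x3\<^sup>2 + 2 * x1 * x2 * (n1 \<bullet> n2) + 2 * x1 * x3 * (n1 \<bullet> n3) + 2 * x2 * x3 * (n2 \<bullet> n3)"
    by (simp add: inner_add nn inner_commute[of n2 n1] inner_commute[of n3 n1] inner_commute[of n3 n2])
       (simp add: power2_eq_square algebra_simps)
  finally show ?thesis using nn by simp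
qed

lemma bessel_digon:
  fixes n1 n2 n3 P :: "real^3"
  assumes norm: "norm n1 = 1" "norm n2 = 1" "norm n3 = 1" "norm P = 1"
    and ang: "n1 \<bullet> n2 = - t" "n1 \<bullet> n3 = 0" "n2 \<bullet> n3 = 0" and t: "t\<^sup>2 < 1"
  shows "(n1 \<bullet> P)\<^sup>2 + (n2 \<bullet> P)\<^sup>2 + 2 * (n1 \<bullet> P) * (n2 \<bullet> P) * t \<le> (1 - (n3 \<bullet> P)\<^sup>2) * (1 - t\<^sup>2)"
proof -
  define b1 where "b1 = n1 \<bullet> P"
  define b2 where "b2 = n2 \<bullet> P"
  define b3 where "b3 = n3 \<bullet> P"
  define e where "e = 1 - t\<^sup>2"
  have e: "0 < e" using t by (simp add: e_def)
  define Z where "Z = b1\<^sup>2 + b2\<^sup>2 + 2 * b1 * b2 * t"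
  define x1 where "x1 = (b1 + t * b2) / e"
  define x2 where "x2 = (b2 + t * b1) / e"
  have ex: "e * x1 = b1 + t * b2" "e * x2 = b2 + t * b1" using e by (simp_all add: x1_def x2_def)
  have "e * (x1 * b1 + x2 * b2) = Z" unfolding Z_def using ex by algebra
  then have l: "x1 * b1 + x2 * b2 = Z / e" using e by (simp add: field_simps)
  have "e * (e * (x1\<^sup>2 + x2\<^sup>2 - 2 * x1 * x2 * t)) = e * Z"
    unfolding Z_def using ex e_def by algebra
  then have "e * (x1\<^sup>2 + x2\<^sup>2 - 2 * x1 * x2 * t) = Z" using e by simp
  then have q: "x1\<^sup>2 + x2\<^sup>2 - 2 * x1 * x2 * t = Z / e" using e by (simp add: field_simps)
  have "2 * (x1 * b1 + x2 * b2 + b3 * b3) - (x1\<^sup>2 + x2\<^sup>2 + b3\<^sup>2 + 2 * x1 * x2 * (- t) + 2 * x1 * b3 * 0 + 2 * x2 * b3 * 0) \<le> 1"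
    using bessel_combination[OF norm, of x1 x2 b3] unfolding ang b1_def[symmetric] b2_def[symmetric] b3_def[symmetric] .
  then have "2 * (x1 * b1 + x2 * b2) - (x1\<^sup>2 + x2\<^sup>2 - 2 * x1 * x2 * t) + b3\<^sup>2 \<le> 1" by (simp add: power2_eq_square)
  then have "Z / e \<le> 1 - b3\<^sup>2" unfolding l q by simp
  then have "Z \<le> (1 - b3\<^sup>2) * e" using e by (simp add: divide_le_eq)
  then show ?thesis by (simp add: Z_def e_def b1_def b2_def b3_def)
qed

lemma bessel_tetrahedral:
  fixes n1 n2 n3 P :: "real^3"
  assumes norm: "norm n1 = 1" "norm n2 = 1" "norm n3 = 1" "norm P = 1"
    and ang: "n1 \<bullet> n2 = 0" "n1 \<bullet> n3 = - (1 / 2)" "n2 \<bullet> n3 = - (1 / 2)"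
  shows "tetrahedral_form (n1 \<bullet> P) (n2 \<bullet> P) (n3 \<bullet> P) \<le> 2"
proof -
  define b1 where "b1 = n1 \<bullet> P"
  define b2 where "b2 = n2 \<bullet> P"
  define b3 where "b3 = n3 \<bullet> P"
  define x1 where "x1 = 3 / 2 * b1 + 1 / 2 * b2 + b3"
  define x2 where "x2 = 1 / 2 * b1 + 3 / 2 * b2 + b3"
  define x3 where "x3 = b1 + b2 + 2 * b3"
  define E where "E = 2 * (x1 * b1 + x2 * b2 + x3 * b3) - (x1\<^sup>2 + x2\<^sup>2 + x3\<^sup>2 + 2 * x1 * x2 * 0 + 2 * x1 * x3 * - (1 / 2) + 2 * x2 * x3 * - (1 / 2))"
  have "E \<le> 1"
    using bessel_combination[OF norm, of x1 x2 x3]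
    unfolding ang b1_def[symmetric] b2_def[symmetric] b3_def[symmetric] E_def .
  moreover have "2 * E = tetrahedral_form b1 b2 b3"
    unfolding tetrahedral_form_def x1_def x2_def x3_def E_def by algebra
  ultimately show ?thesis unfolding b1_def b2_def b3_def by linarith
qed

lemma bessel_octahedral:
  fixes n1 n2 n3 P :: "real^3"
  assumes norm: "norm n1 = 1" "norm n2 = 1" "norm n3 = 1" "norm P = 1"
    and ang: "n1 \<bullet> n2 = 0" "n1 \<bullet> n3 = - (1 / 2)" "n2 \<bullet> n3 = - (\<mu> / 2)" and \<mu>: "\<mu>\<^sup>2 = 2"
  shows "octahedral_form \<mu> (n1 \<bullet> P) (n2 \<bullet> P) (n3 \<bullet> P) \<le> 2"
proof -
  define b1 where "b1 = n1 \<bullet> P"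
  define b2 where "b2 = n2 \<bullet> P"
  define b3 where "b3 = n3 \<bullet> P"
  define x1 where "x1 = 2 * b1 + \<mu> * b2 + 2 * b3"
  define x2 where "x2 = \<mu> * b1 + 3 * b2 + 2 * \<mu> * b3"
  define x3 where "x3 = 2 * b1 + 2 * \<mu> * b2 + 4 * b3"
  define E where "E = 2 * (x1 * b1 + x2 * b2 + x3 * b3) - (x1\<^sup>2 + x2\<^sup>2 + x3\<^sup>2 + 2 * x1 * x2 * 0 + 2 * x1 * x3 * - (1 / 2) + 2 * x2 * x3 * - (\<mu> / 2))"
  have "E \<le> 1"
    using bessel_combination[OF norm, of x1 x2 x3]
    unfolding ang b1_def[symmetric] b2_def[symmetric] b3_def[symmetric] E_def .
  moreover have "2 * E = octahedral_form \<mu> b1 b2 b3 + 2 * (\<mu>\<^sup>2 - 2) * (x3 * b1 / 2 + x2 * b2 + x3 * b3)"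
    unfolding octahedral_form_def x1_def x2_def x3_def E_def by algebra
  then have "2 * E = octahedral_form \<mu> b1 b2 b3" using \<mu> by simp
  ultimately show ?thesis unfolding b1_def b2_def b3_def by linarith
qed

lemma bessel_icosahedral:
  fixes n1 n2 n3 P :: "real^3"
  assumes norm: "norm n1 = 1" "norm n2 = 1" "norm n3 = 1" "norm P = 1"
    and ang: "n1 \<bullet> n2 = 0" "n1 \<bullet> n3 = - (1 / 2)" "n2 \<bullet> n3 = - (\<mu> / 2)" and \<mu>: "\<mu>\<^sup>2 = \<mu> + 1"
  shows "icosahedral_form \<mu> (n1 \<bullet> P) (n2 \<bullet> P) (n3 \<bullet> P) \<le> 2"
proof -
  define b1 where "b1 = n1 \<bullet> P"
  define b2 where "b2 = n2 \<bullet> P"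
  define b3 where "b3 = n3 \<bullet> P"
  define x1 where "x1 = (\<mu> + 2) * b1 + (2 * \<mu> + 1) * b2 + (2 * \<mu> + 2) * b3"
  define x2 where "x2 = (2 * \<mu> + 1) * b1 + (3 * \<mu> + 3) * b2 + (4 * \<mu> + 2) * b3"
  define x3 where "x3 = (2 * \<mu> + 2) * b1 + (4 * \<mu> + 2) * b2 + (4 * \<mu> + 4) * b3"
  define E where "E = 2 * (x1 * b1 + x2 * b2 + x3 * b3) - (x1\<^sup>2 + x2\<^sup>2 + x3\<^sup>2 + 2 * x1 * x2 * 0 + 2 * x1 * x3 * - (1 / 2) + 2 * x2 * x3 * - (\<mu> / 2))"
  have "E \<le> 1"
    using bessel_combination[OF norm, of x1 x2 x3]
    unfolding ang b1_def[symmetric] b2_def[symmetric] b3_def[symmetric] E_def .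
  moreover have "2 * E = icosahedral_form \<mu> b1 b2 b3"
    unfolding icosahedral_form_def x1_def x2_def x3_def E_def using \<mu> by algebra
  ultimately show ?thesis unfolding b1_def b2_def b3_def by linarith
qed

text \<open>The denominator is the upper bound for the volume of the cell of the optimal packing from
\<open>optimal_cell_volume\<close>.\<close>

definition optimal_density :: real where
  "optimal_density = Vol (geodesic_ball (geo_point (pi / 4) 0 0) (pi / 2)) / (sqrt 3 * pi\<^sup>2)"

lemma geo_point_S2R: "geo_point \<phi> \<theta> t \<in> S2R"
  by (simp add: geo_point_eq S2R_iff)

lemma digon_cos:
  fixes q :: nat
  assumes "q \<ge> 2"
  shows "0 < pi / q" "pi / q \<le> pi / 2" "0 \<le> cos (pi / q)" "cos (pi / q) < 1" "(cos (pi / q))\<^sup>2 < 1"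
proof -
  show a: "0 < pi / q" using assms by simp
  show b: "pi / q \<le> pi / 2" using assms by (intro divide_left_mono) auto
  show c: "0 \<le> cos (pi / q)" using a b by (intro cos_ge_zero) linarith+
  have "cos (pi / q) < cos 0" using a b pi_gt_zero by (intro cos_monotone_0_pi) linarith+
  then show d: "cos (pi / q) < 1" by simp
  show "(cos (pi / q))\<^sup>2 < 1" using c d by (simp add: abs_square_less_1)
qed

lemma digon_square_le:
  assumes "c \<le> b1" "c \<le> b2" "0 \<le> c" "0 \<le> (t::real)" "b1\<^sup>2 + b2\<^sup>2 + 2 * b1 * b2 * t \<le> r * (1 - t\<^sup>2)"
  shows "2 * c\<^sup>2 \<le> r * (1 - t)"
proof -
  have p: "c\<^sup>2 \<le> b1\<^sup>2" "c\<^sup>2 \<le> b2\<^sup>2" "c\<^sup>2 \<le> b1 * b2"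
    using assms by (auto simp: power2_eq_square intro!: mult_mono)
  have "c\<^sup>2 * t \<le> b1 * b2 * t" using p(3) assms(4) by (rule mult_right_mono)
  then have "(2 * c\<^sup>2) * (1 + t) \<le> r * (1 - t\<^sup>2)" using p assms(5) by (simp add: algebra_simps)
  also have "\<dots> = (r * (1 - t)) * (1 + t)" by algebra
  finally show ?thesis by (rule mult_right_le_imp_le) (use assms in simp)
qed

lemma digon_arcsin_half:
  assumes a: "0 \<le> a" "a \<le> pi / 2" and c: "0 \<le> c" "2 * c\<^sup>2 \<le> 1 - cos a"
  shows "0 \<le> arcsin c" "arcsin c \<le> a / 2"
proof -
  have "c\<^sup>2 \<le> (sin (a / 2))\<^sup>2" using c cos_double_sin[of "a / 2"] by simp
  then have cs: "c \<le> sin (a / 2)" by (rule power2_le_imp_le) (use a in \<open>auto intro!: sin_ge_zero\<close>)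
  have "arcsin c \<le> arcsin (sin (a / 2))" using cs c by (intro arcsin_le_arcsin) auto
  also have "\<dots> = a / 2" using a by (intro arcsin_sin) auto
  finally show "arcsin c \<le> a / 2" .
  have "c \<le> 1" using cs sin_le_one[of "a / 2"] by linarith
  then show "0 \<le> arcsin c" using c arcsin_le_arcsin[of 0 c] by simp
qed

text \<open>The distances of a point of the digon from its two sides add up to at most its angle; this is
\<open>cos a \<le> cos (\<rho> + arcsin b2)\<close> with the addition theorem.\<close>

lemma digon_arcsin_sum:
  assumes r: "0 \<le> \<rho>" "\<rho> \<le> pi / 2" and a: "0 \<le> a" "a \<le> pi / 2" and b: "sin \<rho> \<le> b1" "0 \<le> b2"
    and Z: "b1\<^sup>2 + b2\<^sup>2 + 2 * b1 * b2 * cos a \<le> 1 - (cos a)\<^sup>2"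
  shows "0 \<le> arcsin b2" "\<rho> + arcsin b2 \<le> a"
proof -
  have t: "0 \<le> cos a" using a by (intro cos_ge_zero) auto
  have s: "0 \<le> sin \<rho>" using r by (intro sin_ge_zero) auto
  have sq: "(sin \<rho>)\<^sup>2 \<le> b1\<^sup>2" using b s by (intro power_mono) auto
  have "sin \<rho> * b2 * cos a \<le> b1 * b2 * cos a" using b t by (intro mult_right_mono) auto
  then have Z': "(sin \<rho>)\<^sup>2 + b2\<^sup>2 + 2 * (sin \<rho> * b2 * cos a) \<le> 1 - (cos a)\<^sup>2" using Z sq by simp
  have "0 \<le> sin \<rho> * b2 * cos a" using s b t by simp
  then have "b2\<^sup>2 \<le> 1" using Z' zero_le_power2[of "sin \<rho>"] zero_le_power2[of "cos a"] by linarith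
  then have b1: "b2 \<le> 1" by (intro power2_le_imp_le[of b2 1]) auto
  define be where "be = arcsin b2"
  have sb: "sin be = b2" unfolding be_def using b b1 by (intro sin_arcsin) auto
  show b0: "0 \<le> arcsin b2" using b b1 arcsin_le_arcsin[of 0 b2] by simp
  have bu: "be \<le> pi / 2" unfolding be_def using b b1 by (intro arcsin_ubound) auto
  have cr: "0 \<le> cos \<rho>" using r by (intro cos_ge_zero) auto
  have cb: "0 \<le> cos be" using b0 bu by (intro cos_ge_zero) (auto simp: be_def)
  have "(cos a + sin \<rho> * b2)\<^sup>2 \<le> (1 - (sin \<rho>)\<^sup>2) * (1 - b2\<^sup>2)"
  proof -
    have "(1 - (sin \<rho>)\<^sup>2) * (1 - b2\<^sup>2) - (cos a + sin \<rho> * b2)\<^sup>2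
      = 1 - (cos a)\<^sup>2 - ((sin \<rho>)\<^sup>2 + b2\<^sup>2 + 2 * (sin \<rho> * b2 * cos a))" by algebra
    then show ?thesis using Z' by simp
  qed
  also have "\<dots> = (cos \<rho> * cos be)\<^sup>2" unfolding sb[symmetric] by (simp add: power_mult_distrib cos_squared_eq)
  finally have "cos a + sin \<rho> * b2 \<le> cos \<rho> * cos be" by (rule power2_le_imp_le) (use cr cb in simp)
  then have "cos a \<le> cos (\<rho> + be)" by (simp add: cos_add sb)
  then have "\<rho> + be \<le> a" using cos_mono_le_eq[of a "\<rho> + be"] a r b0 bu by (simp add: be_def)
  then show "\<rho> + arcsin b2 \<le> a" by (simp add: be_def)
qed

theorem density_digon:
  fixes n :: "nat \<Rightarrow> real^3" and q :: nat
  assumes norm: "norm (n 1) = 1" "norm (n 2) = 1" and q: "q \<ge> 2" and ang: "n 1 \<bullet> n 2 = - cos (pi / q)"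
    and p: "p > 0" and \<tau>: "\<And>i. i \<in> {1..2} \<Longrightarrow> \<tau> i \<in> {0, 1/2}" and K: "K \<in> S2R"
  shows "packing_density (space_group 2 n \<tau> p) K \<le> optimal_density"
proof -
  define t where "t = cos (pi / q)"
  have a: "0 < pi / q" "pi / q \<le> pi / 2" "0 \<le> t" "t < 1" "t\<^sup>2 < 1" using digon_cos[OF q] by (auto simp: t_def)
  have dd: "digon_data q t" unfolding t_def by (rule digon_data_cos[OF q])
  have g: "n 1 \<bullet> n 2 = - t" "n 2 \<bullet> n 1 = - t" using ang by (auto simp: t_def inner_commute)
  have nn: "n 1 \<bullet> n 1 = 1" "n 2 \<bullet> n 2 = 1" using norm by (auto simp: norm_eq_1)
  have I: "{1..2} = {1, 2::nat}" by auto
  obtain D where D: "finite D" "card D \<le> 2 * q" "(\<lambda>P. P) \<in> D"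
    "\<And>d. d \<in> D \<Longrightarrow> sphere_reflection (n 1) \<circ> d \<in> D" "\<And>d. d \<in> D \<Longrightarrow> sphere_reflection (n 2) \<circ> d \<in> D"
    using dihedral_closure[OF norm q ang] by metis
  have bessel: "(n 1 \<bullet> P)\<^sup>2 + (n 2 \<bullet> P)\<^sup>2 + 2 * (n 1 \<bullet> P) * (n 2 \<bullet> P) * t \<le> 1 * (1 - t\<^sup>2)" if "norm P = 1" for P
  proof -
    \<comment> \<open>the two normals are completed to three by a unit vector orthogonal to both of them\<close>
    have d: "dim {n 1, n 2} \<le> 2" using dim_le_card'[of "{n 1, n 2}"] by (simp add: card_insert_if split: if_splits)
    obtain x :: "real^3" where x: "x \<noteq> 0" "\<And>y. y \<in> span {n 1, n 2} \<Longrightarrow> orthogonal x y"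
      by (rule orthogonal_to_subspace_exists[of "{n 1, n 2}"]) (use d in auto)
    have xo: "n 1 \<bullet> x = 0" "n 2 \<bullet> x = 0"
      using x(2)[OF span_base[of "n 1"]] x(2)[OF span_base[of "n 2"]] by (auto simp: orthogonal_def inner_commute)
    have "norm (x /\<^sub>R norm x) = 1" using x by simp
    from bessel_digon[OF norm this that g(1) _ _ a(5)]
    have "(n 1 \<bullet> P)\<^sup>2 + (n 2 \<bullet> P)\<^sup>2 + 2 * (n 1 \<bullet> P) * (n 2 \<bullet> P) * t \<le> (1 - ((x /\<^sub>R norm x) \<bullet> P)\<^sup>2) * (1 - t\<^sup>2)"
      using xo by simp
    also have "\<dots> \<le> 1 * (1 - t\<^sup>2)" using a by (intro mult_right_mono) auto
    finally show ?thesis .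
  qed
  have "packing_density (space_group 2 n \<tau> p) K \<le> Vol (geodesic_ball (geo_point (pi / 4) 0 0) (pi / 2)) / (sqrt 3 * pi\<^sup>2)"
  proof (rule space_group_density_reduction[where m=2 and n=n and \<tau>=\<tau> and p=p and W=D and N="2 * q" and c="n 1 + n 2", unfolded I])
    show "\<tau> i \<in> {0, 1/2}" if "i \<in> {1, 2}" for i using \<tau>[of i] that by force
    show "real (2 * q) * (1 - cos \<rho>) \<le> 2"
      if P: "norm P = 1" and r: "0 \<le> \<rho>" "\<rho> \<le> pi / 2" and b: "\<And>i. i \<in> {1, 2} \<Longrightarrow> sin \<rho> \<le> n i \<bullet> P" for \<rho> P
    proof -
      have s: "0 \<le> sin \<rho>" using r by (intro sin_ge_zero) auto
      have "2 * (sin \<rho>)\<^sup>2 \<le> 1 * (1 - t)"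
        by (rule digon_square_le[OF _ _ s a(3) bessel[OF P]]) (use b in auto)
      then have "q * (1 - cos \<rho>) \<le> 6 / 10"
        by (intro digon_mirrors_bound(1)[OF dd, where s="sin \<rho>"]) (use r in \<open>auto intro: cos_ge_zero simp: sin_squared_eq\<close>)
      then show ?thesis by simp
    qed
    show "sqrt 3 * real (2 * q) * \<rho> * (1 - cos \<rho>) \<le> 2 * p"
      if P: "norm P = 1" and r: "0 \<le> \<rho>" "\<rho> \<le> pi / 2" "2 * \<rho> \<le> p" and b: "\<And>i. i \<in> {1, 2} \<Longrightarrow> 0 \<le> n i \<bullet> P"
        and ex: "\<exists>i\<in>{1, 2}. \<tau> i = 1/2"
        and mir: "\<And>i. i \<in> {1, 2} \<Longrightarrow> \<tau> i = 0 \<Longrightarrow> sin \<rho> \<le> n i \<bullet> P"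
        and gl: "\<And>i. i \<in> {1, 2} \<Longrightarrow> \<tau> i = 1/2 \<Longrightarrow> 16 * \<rho>\<^sup>2 \<le> 16 * (arcsin (n i \<bullet> P))\<^sup>2 + p\<^sup>2"
        and rot: "\<And>i j. i \<in> {1, 2} \<Longrightarrow> j \<in> {1, 2} \<Longrightarrow> i \<noteq> j \<Longrightarrow> \<tau> i = \<tau> j \<Longrightarrow>
           (sin \<rho>)\<^sup>2 \<le> (n i \<bullet> P)\<^sup>2 + (n j \<bullet> P)\<^sup>2 - 2 * (n i \<bullet> P) * (n j \<bullet> P) * (n i \<bullet> n j)" for \<rho> P
    proof -
      define b1 where "b1 = n 1 \<bullet> P"
      define b2 where "b2 = n 2 \<bullet> P"
      have b0: "0 \<le> b1" "0 \<le> b2" using b by (auto simp: b1_def b2_def)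
      have Z: "b1\<^sup>2 + b2\<^sup>2 + 2 * b1 * b2 * t \<le> 1 * (1 - t\<^sup>2)" using bessel[OF P] by (simp add: b1_def b2_def)
      have qq: "0 < real q" "q * (1 - cos (pi / q)) \<le> 2" using digon_data_range[OF dd] by (auto simp: t_def)
      have one: ?thesis if "\<beta> = arcsin c" "0 \<le> \<beta>" "\<rho> \<le> pi / q" "\<beta> \<le> pi / q / 2 \<or> \<beta> \<le> pi / q - \<rho>"
        "16 * \<rho>\<^sup>2 \<le> 16 * \<beta>\<^sup>2 + p\<^sup>2" for \<beta> c
        using digon_glide[OF a(1,2) qq r(1) that(3) r(3) that(2,4,5)] by simp
      consider "\<tau> 1 = 1/2" "\<tau> 2 = 1/2" | "\<tau> 1 = 0" "\<tau> 2 = 1/2" | "\<tau> 1 = 1/2" "\<tau> 2 = 0"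
        using ex \<tau>[of 1] \<tau>[of 2] by auto
      then show ?thesis
      proof cases
        case 1
        have "(sin \<rho>)\<^sup>2 \<le> 1 - t\<^sup>2" using rot[of 1 2] 1 Z g by (simp add: b1_def b2_def)
        also have "\<dots> = (sin (pi / q))\<^sup>2" by (simp add: t_def sin_squared_eq)
        finally have "sin \<rho> \<le> sin (pi / q)" by (rule power2_le_imp_le) (use a pi_gt_zero in \<open>intro sin_ge_zero; linarith\<close>)
        then have ra: "\<rho> \<le> pi / q" using sin_mono_le_eq[of \<rho> "pi / q"] r a by simp
        define c where "c = min b1 b2"
        have c: "c \<le> b1" "c \<le> b2" "0 \<le> c" using b0 by (auto simp: c_def)
        have "2 * c\<^sup>2 \<le> 1 * (1 - t)" by (rule digon_square_le[OF c a(3) Z])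
        then have h: "0 \<le> arcsin c" "arcsin c \<le> pi / q / 2"
          using digon_arcsin_half[of "pi / q" c] a c by (auto simp: t_def)
        have "16 * \<rho>\<^sup>2 \<le> 16 * (arcsin c)\<^sup>2 + p\<^sup>2" using gl[of 1] gl[of 2] 1 by (auto simp: c_def min_def b1_def b2_def)
        then show ?thesis using one[OF refl] h ra by blast
      next
        case 2
        have s1: "sin \<rho> \<le> b1" using mir[of 1] 2 by (simp add: b1_def)
        have h: "0 \<le> arcsin b2" "\<rho> + arcsin b2 \<le> pi / q"
          using digon_arcsin_sum[OF r(1,2) _ a(2) s1 b0(2)] Z a(1) by (auto simp: t_def)
        have "16 * \<rho>\<^sup>2 \<le> 16 * (arcsin b2)\<^sup>2 + p\<^sup>2" using gl[of 2] 2 by (simp add: b2_def)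
        then show ?thesis using one[of _ b2, OF refl] h by simp
      next
        case 3
        have s1: "sin \<rho> \<le> b2" using mir[of 2] 3 by (simp add: b2_def)
        have h: "0 \<le> arcsin b1" "\<rho> + arcsin b1 \<le> pi / q"
          using digon_arcsin_sum[OF r(1,2) _ a(2) s1 b0(1)] Z a(1) by (auto simp: t_def algebra_simps)
        have "16 * \<rho>\<^sup>2 \<le> 16 * (arcsin b1)\<^sup>2 + p\<^sup>2" using gl[of 1] 3 by (simp add: b1_def)
        then show ?thesis using one[of _ b1, OF refl] h by simp
      qed
    qed
  qed (use norm nn D p K a geo_point_S2R in \<open>auto simp: inner_add_left g simp del: One_nat_def\<close>)
  then show ?thesis by (simp add: optimal_density_def)
qed


text \<open>Two right angles: the mirror group of the digon is doubled by the reflection in the equator, which commutes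
with it.\<close>

theorem density_digon_equator:
  fixes n :: "nat \<Rightarrow> real^3" and q :: nat
  assumes norm: "norm (n 1) = 1" "norm (n 2) = 1" "norm (n 3) = 1" and q: "q \<ge> 2"
    and ang: "n 1 \<bullet> n 2 = - cos (pi / q)" "n 1 \<bullet> n 3 = 0" "n 2 \<bullet> n 3 = 0"
    and p: "p > 0" and \<tau>: "\<And>i. i \<in> {1..3} \<Longrightarrow> \<tau> i \<in> {0, 1/2}" and K: "K \<in> S2R"
  shows "packing_density (space_group 3 n \<tau> p) K \<le> optimal_density"
proof -
  define t where "t = cos (pi / q)"
  have a: "0 \<le> t" "t < 1" "t\<^sup>2 < 1" using digon_cos[OF q] by (auto simp: t_def)
  have dd: "digon_data q t" unfolding t_def by (rule digon_data_cos[OF q])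
  have g: "n 1 \<bullet> n 2 = - t" "n 2 \<bullet> n 1 = - t" "n 3 \<bullet> n 1 = 0" "n 3 \<bullet> n 2 = 0"
    using ang by (auto simp: t_def inner_commute)
  have nn: "n 1 \<bullet> n 1 = 1" "n 2 \<bullet> n 2 = 1" "n 3 \<bullet> n 3 = 1" using norm by (auto simp: norm_eq_1)
  have I: "{1..3} = {1, 2, 3::nat}" by auto
  obtain D where D: "finite D" "card D \<le> 2 * q" "(\<lambda>P. P) \<in> D"
    "\<And>d. d \<in> D \<Longrightarrow> sphere_reflection (n 1) \<circ> d \<in> D" "\<And>d. d \<in> D \<Longrightarrow> sphere_reflection (n 2) \<circ> d \<in> D"
    using dihedral_closure[OF norm(1,2) q ang(1)] by metis
  define r where "r i = sphere_reflection (n i)" for i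
  have com: "r 1 \<circ> r 3 = r 3 \<circ> r 1" "r 2 \<circ> r 3 = r 3 \<circ> r 2" "r 3 \<circ> r 3 = (\<lambda>P. P)"
    by (auto simp: r_def fun_eq_iff sphere_reflection_def inner_diff_right g ang nn algebra_simps simp del: One_nat_def)
  obtain W where W: "finite W" "card W \<le> card {(\<lambda>P. P), r 3} * card D" "(\<lambda>P. P) \<in> W"
    "\<And>i B. i \<in> {1, 2, 3} \<Longrightarrow> B \<in> W \<Longrightarrow> r i \<circ> B \<in> W"
  proof (rule coset_enumeration[of D "{1, 2}" r "{(\<lambda>P. P), r 3}" "{1, 2, 3}"])
    show "r j \<circ> d \<in> D" if "j \<in> {1, 2}" "d \<in> D" for j d using that D(4,5) by (auto simp: r_def)
    show "r i \<circ> w \<in> {(\<lambda>P. P), r 3} \<or> (\<exists>j\<in>{1, 2}. r i \<circ> w = w \<circ> r j)"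
      if "i \<in> {1, 2, 3}" "w \<in> {(\<lambda>P. P), r 3}" for i w
      using that com by (auto simp: comp_def)
  qed (use D in auto)
  have "card {(\<lambda>P. P), r 3} \<le> 2" by (simp add: card_insert_if)
  then have cW: "card W \<le> 4 * q" using W(2) mult_le_mono[OF _ D(2), of "card {(\<lambda>P. P), r 3}" 2] by linarith
  have "packing_density (space_group 3 n \<tau> p) K \<le> Vol (geodesic_ball (geo_point (pi / 4) 0 0) (pi / 2)) / (sqrt 3 * pi\<^sup>2)"
  proof (rule space_group_density_reduction[where m=3 and n=n and \<tau>=\<tau> and p=p and W=W and N="4 * q" and c="n 1 + n 2 + n 3", unfolded I])
    show "sphere_reflection (n i) \<circ> B \<in> W" if "i \<in> {1, 2, 3}" "B \<in> W" for i B
      using W(4)[OF that] by (simp add: r_def)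
    show "\<tau> i \<in> {0, 1/2}" if "i \<in> {1, 2, 3}" for i using \<tau>[of i] that by force
    show "real (4 * q) * (1 - cos \<rho>) \<le> 2"
      if P: "norm P = 1" and r: "0 \<le> \<rho>" "\<rho> \<le> pi / 2" and b: "\<And>i. i \<in> {1, 2, 3} \<Longrightarrow> sin \<rho> \<le> n i \<bullet> P" for \<rho> P
    proof -
      have s: "0 \<le> sin \<rho>" using r by (intro sin_ge_zero) auto
      have "2 * (sin \<rho>)\<^sup>2 \<le> (1 - (n 3 \<bullet> P)\<^sup>2) * (1 - t)"
        by (rule digon_square_le[OF _ _ s a(1) bessel_digon[OF norm P g(1) ang(2,3) a(3)]]) (use b in auto)
      also have "\<dots> \<le> (1 - (sin \<rho>)\<^sup>2) * (1 - t)"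
        by (intro mult_right_mono diff_left_mono power_mono) (use b s a in auto)
      finally have "4 * real q * (1 - cos \<rho>) \<le> 2"
        by (intro digon_equator_mirrors_bound[OF dd, where s="sin \<rho>"])
           (use r in \<open>auto intro: cos_ge_zero simp: sin_squared_eq mult.commute\<close>)
      then show ?thesis by simp
    qed
    show "sqrt 3 * real (4 * q) * \<rho> * (1 - cos \<rho>) \<le> 2 * p"
      if P: "norm P = 1" and r: "0 \<le> \<rho>" "\<rho> \<le> pi / 2" "2 * \<rho> \<le> p" and b: "\<And>i. i \<in> {1, 2, 3} \<Longrightarrow> 0 \<le> n i \<bullet> P"
        and ex: "\<exists>i\<in>{1, 2, 3}. \<tau> i = 1/2"
        and mir: "\<And>i. i \<in> {1, 2, 3} \<Longrightarrow> \<tau> i = 0 \<Longrightarrow> sin \<rho> \<le> n i \<bullet> P"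
        and gl: "\<And>i. i \<in> {1, 2, 3} \<Longrightarrow> \<tau> i = 1/2 \<Longrightarrow> 16 * \<rho>\<^sup>2 \<le> 16 * (arcsin (n i \<bullet> P))\<^sup>2 + p\<^sup>2"
        and rot: "\<And>i j. i \<in> {1, 2, 3} \<Longrightarrow> j \<in> {1, 2, 3} \<Longrightarrow> i \<noteq> j \<Longrightarrow> \<tau> i = \<tau> j \<Longrightarrow>
           (sin \<rho>)\<^sup>2 \<le> (n i \<bullet> P)\<^sup>2 + (n j \<bullet> P)\<^sup>2 - 2 * (n i \<bullet> P) * (n j \<bullet> P) * (n i \<bullet> n j)" for \<rho> P
    proof -
      define s where "s = sin \<rho>"
      define C where "C = cos \<rho>"
      define b1 where "b1 = n 1 \<bullet> P"
      define b2 where "b2 = n 2 \<bullet> P"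
      define b3 where "b3 = n 3 \<bullet> P"
      define D where "D = q * (1 - C)"
      have b0: "0 \<le> b1" "0 \<le> b2" "0 \<le> b3" using b by (auto simp: b1_def b2_def b3_def)
      have Z: "b1\<^sup>2 + b2\<^sup>2 + 2 * b1 * b2 * t \<le> (1 - b3\<^sup>2) * (1 - t\<^sup>2)"
        using bessel_digon[OF norm P g(1) ang(2,3) a(3)] by (simp add: b1_def b2_def b3_def)
      then have Z': "b2\<^sup>2 + b1\<^sup>2 + 2 * b2 * b1 * t \<le> (1 - b3\<^sup>2) * (1 - t\<^sup>2)" by (simp add: algebra_simps)
      have s0: "0 \<le> s" unfolding s_def using r by (intro sin_ge_zero) auto
      have C: "0 \<le> C" "C \<le> 1" "s\<^sup>2 = 1 - C\<^sup>2"
        unfolding s_def C_def using r by (auto intro: cos_ge_zero simp: sin_squared_eq)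
      have q0: "0 < real q" using q by simp
      have t2: "0 \<le> 1 - t\<^sup>2" using a by simp
      have D0: "0 \<le> D" unfolding D_def using q0 C by (intro mult_nonneg_nonneg) auto
      have fin: ?thesis if "0 \<le> c" "16 * \<rho>\<^sup>2 \<le> 16 * (arcsin c)\<^sup>2 + p\<^sup>2"
        "3 * D\<^sup>2 \<le> 1 \<or> 4 * c\<^sup>2 \<le> s\<^sup>2 * (4 - 3 * D\<^sup>2)" for c
        by (rule glide_criterion[OF r D0 _ that(1,2) that(3)[unfolded s_def]]) (simp add: D_def C_def)
      have mirror: "s \<le> b1" if "\<tau> 1 = 0" using mir[of 1] that by (simp add: s_def b1_def)
      have mirror2: "s \<le> b2" if "\<tau> 2 = 0" using mir[of 2] that by (simp add: s_def b2_def)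
      have mirror3: "s \<le> b3" if "\<tau> 3 = 0" using mir[of 3] that by (simp add: s_def b3_def)
      have glide: "16 * \<rho>\<^sup>2 \<le> 16 * (arcsin b1)\<^sup>2 + p\<^sup>2" if "\<tau> 1 = 1/2" using gl[of 1] that by (simp add: b1_def)
      have glide2: "16 * \<rho>\<^sup>2 \<le> 16 * (arcsin b2)\<^sup>2 + p\<^sup>2" if "\<tau> 2 = 1/2" using gl[of 2] that by (simp add: b2_def)
      have glide3: "16 * \<rho>\<^sup>2 \<le> 16 * (arcsin b3)\<^sup>2 + p\<^sup>2" if "\<tau> 3 = 1/2" using gl[of 3] that by (simp add: b3_def)
      have rot12: "s\<^sup>2 \<le> b1\<^sup>2 + b2\<^sup>2 + 2 * b1 * b2 * t" if "\<tau> 1 = \<tau> 2"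
        using rot[of 1 2] that g by (simp add: s_def b1_def b2_def)
      have rot13: "s\<^sup>2 \<le> b1\<^sup>2 + b3\<^sup>2" if "\<tau> 1 = \<tau> 3"
        using rot[of 1 3] that ang by (simp add: s_def b1_def b3_def)
      have rot23: "s\<^sup>2 \<le> b2\<^sup>2 + b3\<^sup>2" if "\<tau> 2 = \<tau> 3"
        using rot[of 2 3] that ang by (simp add: s_def b2_def b3_def)
      have far: "(1 - b3\<^sup>2) * e \<le> C\<^sup>2 * e" if "s \<le> b3" "0 \<le> e" for e
        using power_mono[OF that(1) s0, of 2] C(3) that(2) by (intro mult_right_mono) auto
      have g3: "3 * D\<^sup>2 \<le> 1 \<or> 4 * y\<^sup>2 \<le> s\<^sup>2 * (4 - 3 * D\<^sup>2)"
        if "s \<le> x" "0 \<le> y" "s \<le> b3" "x\<^sup>2 + y\<^sup>2 + 2 * x * y * t \<le> (1 - b3\<^sup>2) * (1 - t\<^sup>2)" for x y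
      proof (rule glide_0_half_0[OF dd C D_def])
        have "s\<^sup>2 \<le> x\<^sup>2" using that s0 by (intro power_mono) auto
        moreover have "0 \<le> x * y * t" using that s0 a by simp
        ultimately show "s\<^sup>2 + y\<^sup>2 \<le> C\<^sup>2 * (1 - t\<^sup>2)" using that(4) far[OF that(3) t2] by simp
      qed
      have g4: "3 * D\<^sup>2 \<le> 1 \<or> 4 * (min y b3)\<^sup>2 \<le> s\<^sup>2 * (4 - 3 * D\<^sup>2)"
        if x: "s \<le> x" "0 \<le> y" and sy: "s\<^sup>2 \<le> y\<^sup>2 + b3\<^sup>2" and
          xy: "x\<^sup>2 + y\<^sup>2 + 2 * x * y * t \<le> (1 - b3\<^sup>2) * (1 - t\<^sup>2)" for x y
      proof -
        define c where "c = min y b3"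
        have c: "c \<le> y" "c \<le> b3" "0 \<le> c" using x b0 by (auto simp: c_def)
        have sx: "s\<^sup>2 \<le> x\<^sup>2" using x s0 by (intro power_mono) auto
        have "0 \<le> x * y * t" using x s0 a by simp
        then have e: "s\<^sup>2 + y\<^sup>2 \<le> (1 - b3\<^sup>2) * (1 - t\<^sup>2)" using sx xy by simp
        have "0 \<le> t\<^sup>2 * y\<^sup>2" by simp
        moreover have "s\<^sup>2 * (1 - t\<^sup>2) \<le> (y\<^sup>2 + b3\<^sup>2) * (1 - t\<^sup>2)" using sy t2 by (rule mult_right_mono)
        ultimately have s1: "s\<^sup>2 \<le> (1 - s\<^sup>2) * (1 - t\<^sup>2)" using e by (simp only: ring_distribs mult_1_left mult_1_right mult.commute[of "t\<^sup>2"])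
        have "s * c * t \<le> x * y * t" using x c s0 a by (intro mult_right_mono mult_mono) auto
        moreover have "c\<^sup>2 \<le> y\<^sup>2" using c by (intro power_mono) auto
        moreover have "c\<^sup>2 * (1 - t\<^sup>2) \<le> b3\<^sup>2 * (1 - t\<^sup>2)" using c t2 by (intro mult_right_mono power_mono) auto
        ultimately have "s\<^sup>2 + c\<^sup>2 + 2 * s * c * t + c\<^sup>2 * (1 - t\<^sup>2) \<le> 1 - t\<^sup>2"
          using xy sx by (simp add: algebra_simps)
        from glide_0_half_half[OF dd C s0 c(3) D_def _ this] s1 C(3) show ?thesis by (simp add: c_def)
      qed
      consider "\<tau> 1 = 0" "\<tau> 2 = 0" "\<tau> 3 = 1/2" | "\<tau> 1 = 1/2" "\<tau> 2 = 1/2" "\<tau> 3 = 0" | "\<tau> 1 = 0" "\<tau> 2 = 1/2" "\<tau> 3 = 0"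
        | "\<tau> 1 = 1/2" "\<tau> 2 = 0" "\<tau> 3 = 0" | "\<tau> 1 = 0" "\<tau> 2 = 1/2" "\<tau> 3 = 1/2" | "\<tau> 1 = 1/2" "\<tau> 2 = 0" "\<tau> 3 = 1/2"
        | "\<tau> 1 = 1/2" "\<tau> 2 = 1/2" "\<tau> 3 = 1/2"
        using ex \<tau>[of 1] \<tau>[of 2] \<tau>[of 3] by auto
      then show ?thesis
      proof cases
        case 1
        have "2 * s\<^sup>2 \<le> (1 - t) * (1 - b3\<^sup>2)"
          using digon_square_le[OF mirror[OF 1(1)] mirror2[OF 1(2)] s0 a(1) Z] by (simp add: mult.commute)
        from glide_0_0_half[OF dd C D_def this b0(3)] show ?thesis
          by (rule fin[OF b0(3) glide3[OF 1(3)]])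
      next
        case 2
        define c where "c = min b1 b2"
        have c: "c \<le> b1" "c \<le> b2" "0 \<le> c" using b0 by (auto simp: c_def)
        have "s\<^sup>2 \<le> C\<^sup>2 * (1 - t\<^sup>2)" using rot12 2 Z far[OF mirror3[OF 2(3)] t2] by simp
        moreover have "2 * c\<^sup>2 \<le> C\<^sup>2 * (1 - t)"
          by (rule order_trans[OF digon_square_le[OF c a(1) Z] far[OF mirror3[OF 2(3)]]]) (use a in simp)
        ultimately have "3 * D\<^sup>2 \<le> 1 \<or> 4 * c\<^sup>2 \<le> s\<^sup>2 * (4 - 3 * D\<^sup>2)"
          by (rule glide_half_half_0[OF dd C D_def])
        moreover have "16 * \<rho>\<^sup>2 \<le> 16 * (arcsin c)\<^sup>2 + p\<^sup>2" using glide glide2 2 by (auto simp: c_def min_def)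
        ultimately show ?thesis using fin[OF c(3)] by blast
      next
        case 3
        from g3[OF mirror[OF 3(1)] b0(2) mirror3[OF 3(3)] Z] show ?thesis by (rule fin[OF b0(2) glide2[OF 3(2)]])
      next
        case 4
        from g3[OF mirror2[OF 4(2)] b0(1) mirror3[OF 4(3)] Z'] show ?thesis by (rule fin[OF b0(1) glide[OF 4(1)]])
      next
        case 5
        have "16 * \<rho>\<^sup>2 \<le> 16 * (arcsin (min b2 b3))\<^sup>2 + p\<^sup>2" using glide2 glide3 5 by (auto simp: min_def)
        moreover have "3 * D\<^sup>2 \<le> 1 \<or> 4 * (min b2 b3)\<^sup>2 \<le> s\<^sup>2 * (4 - 3 * D\<^sup>2)"
          by (rule g4[OF mirror[OF 5(1)] b0(2) _ Z]) (use rot23 5 in simp)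
        ultimately show ?thesis by (intro fin[of "min b2 b3"]) (use b0 in auto)
      next
        case 6
        have "16 * \<rho>\<^sup>2 \<le> 16 * (arcsin (min b1 b3))\<^sup>2 + p\<^sup>2" using glide glide3 6 by (auto simp: min_def)
        moreover have "3 * D\<^sup>2 \<le> 1 \<or> 4 * (min b1 b3)\<^sup>2 \<le> s\<^sup>2 * (4 - 3 * D\<^sup>2)"
          by (rule g4[OF mirror2[OF 6(2)] b0(1) _ Z']) (use rot13 6 in simp)
        ultimately show ?thesis by (intro fin[of "min b1 b3"]) (use b0 in auto)
      next
        case 7
        define m where "m = min b1 b2"
        define c where "c = min m b3"
        have m: "m \<le> b1" "m \<le> b2" "0 \<le> m" "s\<^sup>2 \<le> m\<^sup>2 + b3\<^sup>2"
          using b0 rot13 rot23 7 by (auto simp: m_def min_def)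
        have c: "c \<le> b1" "c \<le> b2" "c \<le> b3" "0 \<le> c" using b0 by (auto simp: c_def m_def)
        have m2: "2 * m\<^sup>2 \<le> (1 - b3\<^sup>2) * (1 - t)" by (rule digon_square_le[OF m(1-3) a(1) Z])
        have "(1 - b3\<^sup>2) * (1 + t) \<le> 2 * C\<^sup>2" using m(4) m2 C(3) by (simp add: algebra_simps)
        then have "(1 - b3\<^sup>2) * (1 + t) * (1 - t) \<le> 2 * C\<^sup>2 * (1 - t)" using a by (intro mult_right_mono) auto
        moreover have "(1 - b3\<^sup>2) * (1 + t) * (1 - t) = (1 - b3\<^sup>2) * (1 - t\<^sup>2)" by algebra
        ultimately have s1: "s\<^sup>2 \<le> 2 * C\<^sup>2 * (1 - t)" using rot12 7 Z by simp
        have "2 * c\<^sup>2 \<le> (1 - b3\<^sup>2) * (1 - t)" by (rule digon_square_le[OF c(1,2,4) a(1) Z])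
        also have "\<dots> \<le> (1 - c\<^sup>2) * (1 - t)" using c a by (intro mult_right_mono diff_left_mono power_mono) auto
        finally have c2: "2 * c\<^sup>2 \<le> (1 - t) * (1 - c\<^sup>2)" by (simp add: mult.commute)
        have gc: "16 * \<rho>\<^sup>2 \<le> 16 * (arcsin c)\<^sup>2 + p\<^sup>2" using glide glide2 glide3 7 by (auto simp: c_def m_def min_def)
        show ?thesis
        proof (cases "q = 2")
          case True
          then have t0: "t = 0" by (simp add: t_def)
          have "3 * c\<^sup>2 \<le> 1" using c2 t0 by simp
          moreover have "(sin \<rho>)\<^sup>2 \<le> 2 * (cos \<rho>)\<^sup>2" using s1 t0 by (simp add: s_def C_def)
          ultimately show ?thesis using glide_half_half_half_right[OF r _ c(4) _ gc] True by simp
        next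
          case False
          then have "real q \<noteq> 2" by simp
          from glide_half_half_half[OF dd this C D_def s1 c2] show ?thesis by (rule fin[OF c(4) gc])
        qed
      qed
    qed
  qed (use norm nn W cW p K a geo_point_S2R in \<open>auto simp: inner_add_left g ang simp del: One_nat_def\<close>)
  then show ?thesis by (simp add: optimal_density_def)
qed

text \<open>The common part of the three polyhedral families.  An angle \<open>pi / 3\<close> between the first and the third
side forces \<open>\<tau> 1 = \<tau> 3\<close>.  The predicate \<open>G\<close> stands for the glide condition on the sine of a distance to a
glide mirror, and \<open>b\<close> is one of these sines, usually the smallest one.\<close>

lemma density_triangle_right_angle:
  fixes n :: "nat \<Rightarrow> real^3" and N :: nat and \<mu> :: real
  assumes norm: "norm (n 1) = 1" "norm (n 2) = 1" "norm (n 3) = 1"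
    and ang: "n 1 \<bullet> n 2 = 0" "n 1 \<bullet> n 3 = - (1 / 2)" "n 2 \<bullet> n 3 = - (\<mu> / 2)" and \<mu>: "0 \<le> \<mu>" "\<mu> < 2"
    and W: "finite W" "card W \<le> N" "(\<lambda>P. P) \<in> W"
      "\<And>B. B \<in> W \<Longrightarrow> sphere_reflection (n 1) \<circ> B \<in> W"
      "\<And>B. B \<in> W \<Longrightarrow> sphere_reflection (n 2) \<circ> B \<in> W"
      "\<And>B. B \<in> W \<Longrightarrow> sphere_reflection (n 3) \<circ> B \<in> W"
    and inner_point: "0 < c \<bullet> n 1" "0 < c \<bullet> n 2" "0 < c \<bullet> n 3"
    and p: "p > 0" and \<tau>: "\<And>i. i \<in> {1..3} \<Longrightarrow> \<tau> i \<in> {0, 1/2}" and K: "K \<in> S2R"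
    and mirrors: "\<And>P s (C::real). norm P = 1 \<Longrightarrow> 0 \<le> s \<Longrightarrow> 0 \<le> C \<Longrightarrow> s\<^sup>2 = 1 - C\<^sup>2 \<Longrightarrow>
        s \<le> n 1 \<bullet> P \<Longrightarrow> s \<le> n 2 \<bullet> P \<Longrightarrow> s \<le> n 3 \<bullet> P \<Longrightarrow> N * (1 - C) \<le> 2"
    and glides: "\<And>P s (C::real) (D::real) G. norm P = 1 \<Longrightarrow> 0 \<le> s \<Longrightarrow> 0 \<le> C \<Longrightarrow> C \<le> 1 \<Longrightarrow> s\<^sup>2 = 1 - C\<^sup>2 \<Longrightarrow>
        D = N * (1 - C) / 4 \<Longrightarrow> 0 \<le> n 1 \<bullet> P \<Longrightarrow> 0 \<le> n 2 \<bullet> P \<Longrightarrow> 0 \<le> n 3 \<bullet> P \<Longrightarrow>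
        \<tau> 1 = 1/2 \<or> \<tau> 2 = 1/2 \<Longrightarrow> \<tau> 1 = \<tau> 3 \<Longrightarrow> (\<mu> = 1 \<or> \<mu>\<^sup>2 = \<mu> + 1 \<Longrightarrow> \<tau> 2 = \<tau> 3) \<Longrightarrow>
        (\<tau> 1 = 0 \<Longrightarrow> s \<le> n 1 \<bullet> P) \<Longrightarrow> (\<tau> 2 = 0 \<Longrightarrow> s \<le> n 2 \<bullet> P) \<Longrightarrow> (\<tau> 3 = 0 \<Longrightarrow> s \<le> n 3 \<bullet> P) \<Longrightarrow>
        (\<tau> 1 = 1/2 \<Longrightarrow> G (n 1 \<bullet> P)) \<Longrightarrow> (\<tau> 2 = 1/2 \<Longrightarrow> G (n 2 \<bullet> P)) \<Longrightarrow> (\<tau> 3 = 1/2 \<Longrightarrow> G (n 3 \<bullet> P)) \<Longrightarrow>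
        (\<tau> 1 = \<tau> 2 \<Longrightarrow> s\<^sup>2 \<le> (n 1 \<bullet> P)\<^sup>2 + (n 2 \<bullet> P)\<^sup>2) \<Longrightarrow>
        s\<^sup>2 \<le> (n 1 \<bullet> P)\<^sup>2 + (n 3 \<bullet> P)\<^sup>2 + (n 1 \<bullet> P) * (n 3 \<bullet> P) \<Longrightarrow>
        (\<tau> 2 = \<tau> 3 \<Longrightarrow> s\<^sup>2 \<le> (n 2 \<bullet> P)\<^sup>2 + (n 3 \<bullet> P)\<^sup>2 + \<mu> * (n 2 \<bullet> P) * (n 3 \<bullet> P)) \<Longrightarrow>
        \<exists>b\<ge>0. G b \<and> (3 * D\<^sup>2 \<le> 1 \<or> 4 * b\<^sup>2 \<le> s\<^sup>2 * (4 - 3 * D\<^sup>2))"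
  shows "packing_density (space_group 3 n \<tau> p) K \<le> optimal_density"
proof -
  have g: "n 2 \<bullet> n 1 = 0" "n 3 \<bullet> n 1 = - (1 / 2)" "n 3 \<bullet> n 2 = - (\<mu> / 2)"
    using ang by (simp_all add: inner_commute del: One_nat_def)
  have I: "{1..3} = {1, 2, 3::nat}" by auto
  have "packing_density (space_group 3 n \<tau> p) K \<le> Vol (geodesic_ball (geo_point (pi / 4) 0 0) (pi / 2)) / (sqrt 3 * pi\<^sup>2)"
  proof (rule space_group_density_reduction[where m=3 and n=n and \<tau>=\<tau> and p=p and W=W and N=N and c=c, unfolded I])
    show "sphere_reflection (n i) \<circ> B \<in> W" if "i \<in> {1, 2, 3}" "B \<in> W" for i B
      using W(4-6) that by auto
    show "\<tau> i \<in> {0, 1/2}" if "i \<in> {1, 2, 3}" for i using \<tau>[of i] that by force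
    show "real N * (1 - cos \<rho>) \<le> 2"
      if P: "norm P = 1" and r: "0 \<le> \<rho>" "\<rho> \<le> pi / 2" and b: "\<And>i. i \<in> {1, 2, 3} \<Longrightarrow> sin \<rho> \<le> n i \<bullet> P" for \<rho> P
      by (rule mirrors[where P=P and s="sin \<rho>" and C="cos \<rho>"]) (use P r b in \<open>auto intro: sin_ge_zero cos_ge_zero simp: sin_squared_eq\<close>)
    show "sqrt 3 * real N * \<rho> * (1 - cos \<rho>) \<le> 2 * p"
      if P: "norm P = 1" and r: "0 \<le> \<rho>" "\<rho> \<le> pi / 2" "2 * \<rho> \<le> p" and b: "\<And>i. i \<in> {1, 2, 3} \<Longrightarrow> 0 \<le> n i \<bullet> P"
        and ex: "\<exists>i\<in>{1, 2, 3}. \<tau> i = 1/2"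
        and mir: "\<And>i. i \<in> {1, 2, 3} \<Longrightarrow> \<tau> i = 0 \<Longrightarrow> sin \<rho> \<le> n i \<bullet> P"
        and gl: "\<And>i. i \<in> {1, 2, 3} \<Longrightarrow> \<tau> i = 1/2 \<Longrightarrow> 16 * \<rho>\<^sup>2 \<le> 16 * (arcsin (n i \<bullet> P))\<^sup>2 + p\<^sup>2"
        and rot: "\<And>i j. i \<in> {1, 2, 3} \<Longrightarrow> j \<in> {1, 2, 3} \<Longrightarrow> i \<noteq> j \<Longrightarrow> \<tau> i = \<tau> j \<Longrightarrow>
           (sin \<rho>)\<^sup>2 \<le> (n i \<bullet> P)\<^sup>2 + (n j \<bullet> P)\<^sup>2 - 2 * (n i \<bullet> P) * (n j \<bullet> P) * (n i \<bullet> n j)"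
        and three: "\<And>i j. i \<in> {1, 2, 3} \<Longrightarrow> j \<in> {1, 2, 3} \<Longrightarrow> n i \<bullet> n j = - (1 / 2) \<Longrightarrow> \<tau> i = \<tau> j"
        and five: "\<And>i j \<mu>. i \<in> {1, 2, 3} \<Longrightarrow> j \<in> {1, 2, 3} \<Longrightarrow> n i \<bullet> n j = - (\<mu> / 2) \<Longrightarrow> \<mu>\<^sup>2 = \<mu> + 1 \<Longrightarrow> \<tau> i = \<tau> j"
      for \<rho> P
    proof -
      define D where "D = N * (1 - cos \<rho>) / 4"
      have D0: "0 \<le> D" by (simp add: D_def)
      have s0: "0 \<le> sin \<rho>" using r by (intro sin_ge_zero) auto
      have C: "0 \<le> cos \<rho>" "cos \<rho> \<le> 1" "(sin \<rho>)\<^sup>2 = 1 - (cos \<rho>)\<^sup>2"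
        using r by (auto intro: cos_ge_zero simp: sin_squared_eq)
      have t13: "\<tau> 1 = \<tau> 3" using three[of 1 3] ang by simp
      have t23: "\<tau> 2 = \<tau> 3" if "\<mu> = 1 \<or> \<mu>\<^sup>2 = \<mu> + 1"
        using that three[of 2 3] five[of 2 3 \<mu>] ang by auto
      have half: "\<tau> 1 = 1/2 \<or> \<tau> 2 = 1/2" using ex t13 by auto
      have "\<exists>b\<ge>0. 16 * \<rho>\<^sup>2 \<le> 16 * (arcsin b)\<^sup>2 + p\<^sup>2 \<and> (3 * D\<^sup>2 \<le> 1 \<or> 4 * b\<^sup>2 \<le> (sin \<rho>)\<^sup>2 * (4 - 3 * D\<^sup>2))"
      proof (rule glides[OF P s0 C D_def _ _ _ half t13 t23])
        show "(sin \<rho>)\<^sup>2 \<le> (n 1 \<bullet> P)\<^sup>2 + (n 2 \<bullet> P)\<^sup>2" if "\<tau> 1 = \<tau> 2" using rot[of 1 2] that ang by simp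
        show "(sin \<rho>)\<^sup>2 \<le> (n 1 \<bullet> P)\<^sup>2 + (n 3 \<bullet> P)\<^sup>2 + (n 1 \<bullet> P) * (n 3 \<bullet> P)" using rot[of 1 3] t13 ang by simp
        show "(sin \<rho>)\<^sup>2 \<le> (n 2 \<bullet> P)\<^sup>2 + (n 3 \<bullet> P)\<^sup>2 + \<mu> * (n 2 \<bullet> P) * (n 3 \<bullet> P)" if "\<tau> 2 = \<tau> 3"
          using rot[of 2 3] that ang by (simp add: algebra_simps)
        show "sin \<rho> \<le> n 1 \<bullet> P" if "\<tau> 1 = 0" using mir[of 1] that by simp
        show "sin \<rho> \<le> n 2 \<bullet> P" if "\<tau> 2 = 0" using mir[of 2] that by simp
        show "sin \<rho> \<le> n 3 \<bullet> P" if "\<tau> 3 = 0" using mir[of 3] that by simp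
        show "16 * \<rho>\<^sup>2 \<le> 16 * (arcsin (n 1 \<bullet> P))\<^sup>2 + p\<^sup>2" if "\<tau> 1 = 1/2" using gl[of 1] that by simp
        show "16 * \<rho>\<^sup>2 \<le> 16 * (arcsin (n 2 \<bullet> P))\<^sup>2 + p\<^sup>2" if "\<tau> 2 = 1/2" using gl[of 2] that by simp
        show "16 * \<rho>\<^sup>2 \<le> 16 * (arcsin (n 3 \<bullet> P))\<^sup>2 + p\<^sup>2" if "\<tau> 3 = 1/2" using gl[of 3] that by simp
      qed (use b in auto)
      then obtain b where "0 \<le> b" "16 * \<rho>\<^sup>2 \<le> 16 * (arcsin b)\<^sup>2 + p\<^sup>2"
        "3 * D\<^sup>2 \<le> 1 \<or> 4 * b\<^sup>2 \<le> (sin \<rho>)\<^sup>2 * (4 - 3 * D\<^sup>2)" by blast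
      then show ?thesis by (rule glide_criterion[OF r D0 D_def])
    qed
  qed (use norm W(1-3) inner_point p K \<mu> geo_point_S2R in \<open>auto simp: g ang simp del: One_nat_def\<close>)
  then show ?thesis by (simp add: optimal_density_def)
qed

text \<open>The coefficients of \<open>c\<close> are the row sums of the inverse Gram matrix up to a positive factor, so \<open>c\<close> has
the same inner product with the three normals; likewise for the other two groups.\<close>

theorem density_tetrahedral:
  fixes n :: "nat \<Rightarrow> real^3"
  assumes norm: "norm (n 1) = 1" "norm (n 2) = 1" "norm (n 3) = 1"
    and ang: "n 1 \<bullet> n 2 = - cos (pi / 2)" "n 1 \<bullet> n 3 = - cos (pi / 3)" "n 2 \<bullet> n 3 = - cos (pi / 3)"
    and p: "p > 0" and \<tau>: "\<And>i. i \<in> {1..3} \<Longrightarrow> \<tau> i \<in> {0, 1/2}" and K: "K \<in> S2R"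
  shows "packing_density (space_group 3 n \<tau> p) K \<le> optimal_density"
proof -
  have an: "n 1 \<bullet> n 2 = 0" "n 1 \<bullet> n 3 = - (1 / 2)" "n 2 \<bullet> n 3 = - (1 / 2)"
    using ang by (simp_all add: cos_60)
  have g: "n 2 \<bullet> n 1 = 0" "n 3 \<bullet> n 1 = - (1 / 2)" "n 3 \<bullet> n 2 = - (1 / 2)"
    using an by (simp_all add: inner_commute del: One_nat_def)
  have nn: "n 1 \<bullet> n 1 = 1" "n 2 \<bullet> n 2 = 1" "n 3 \<bullet> n 3 = 1" using norm by (auto simp: norm_eq_1)
  have k: "2 \<le> (3::nat)" "n 2 \<bullet> n 3 = - cos (pi / real 3)" using ang(3) by simp_all
  obtain D where D: "finite D" "card D \<le> 2 * 3" "(\<lambda>P. P) \<in> D"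
    "\<And>d. d \<in> D \<Longrightarrow> sphere_reflection (n 2) \<circ> d \<in> D" "\<And>d. d \<in> D \<Longrightarrow> sphere_reflection (n 3) \<circ> d \<in> D"
    using dihedral_closure[OF norm(2,3) k] by metis
  have c: "card D \<le> 6" using D(2) by simp
  obtain W where W: "finite W" "card W \<le> 24" "(\<lambda>P. P) \<in> W"
    "\<And>B. B \<in> W \<Longrightarrow> sphere_reflection (n 1) \<circ> B \<in> W"
    "\<And>B. B \<in> W \<Longrightarrow> sphere_reflection (n 2) \<circ> B \<in> W"
    "\<And>B. B \<in> W \<Longrightarrow> sphere_reflection (n 3) \<circ> B \<in> W"
    using tetrahedral_order[OF norm an refl D(1) c D(3-5)] by metis
  show ?thesis
  proof (rule density_triangle_right_angle[OF norm an _ _ W _ _ _ p \<tau> K, where c="3 *\<^sub>R n 1 + 3 *\<^sub>R n 2 + 4 *\<^sub>R n 3"])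
    show "real 24 * (1 - C) \<le> 2"
      if "norm P = 1" "0 \<le> s" "0 \<le> C" "s\<^sup>2 = 1 - C\<^sup>2" "s \<le> n 1 \<bullet> P" "s \<le> n 2 \<bullet> P" "s \<le> n 3 \<bullet> P" for P s C
      using tetrahedral_mirrors[OF that(3,4)] tetrahedral_form_ge[OF that(5-7,2)] bessel_tetrahedral[OF norm that(1) an] by simp
    show "\<exists>b\<ge>0. G b \<and> (3 * D\<^sup>2 \<le> 1 \<or> 4 * b\<^sup>2 \<le> s\<^sup>2 * (4 - 3 * D\<^sup>2))"
      if P: "norm P = 1" and C: "0 \<le> C" "C \<le> 1" "s\<^sup>2 = 1 - C\<^sup>2" and D: "D = real 24 * (1 - C) / 4"
        and b: "0 \<le> n 1 \<bullet> P" "0 \<le> n 2 \<bullet> P" "0 \<le> n 3 \<bullet> P"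
        and t: "\<tau> 1 = 1/2 \<or> \<tau> 2 = 1/2" "\<tau> 1 = \<tau> 3" "1 = (1::real) \<or> 1\<^sup>2 = 1 + (1::real) \<Longrightarrow> \<tau> 2 = \<tau> 3"
        and G: "\<tau> 1 = 1/2 \<Longrightarrow> G (n 1 \<bullet> P)" "\<tau> 2 = 1/2 \<Longrightarrow> G (n 2 \<bullet> P)" "\<tau> 3 = 1/2 \<Longrightarrow> G (n 3 \<bullet> P)"
        and s: "\<tau> 1 = \<tau> 2 \<Longrightarrow> s\<^sup>2 \<le> (n 1 \<bullet> P)\<^sup>2 + (n 2 \<bullet> P)\<^sup>2"
          "s\<^sup>2 \<le> (n 1 \<bullet> P)\<^sup>2 + (n 3 \<bullet> P)\<^sup>2 + (n 1 \<bullet> P) * (n 3 \<bullet> P)"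
          "\<tau> 2 = \<tau> 3 \<Longrightarrow> s\<^sup>2 \<le> (n 2 \<bullet> P)\<^sup>2 + (n 3 \<bullet> P)\<^sup>2 + 1 * (n 2 \<bullet> P) * (n 3 \<bullet> P)" for P s C D G
    proof (intro exI[of _ "min (n 1 \<bullet> P) (min (n 2 \<bullet> P) (n 3 \<bullet> P))"] conjI)
      have tt: "\<tau> 1 = 1/2" "\<tau> 2 = 1/2" "\<tau> 3 = 1/2" using t by auto
      show "G (min (n 1 \<bullet> P) (min (n 2 \<bullet> P) (n 3 \<bullet> P)))" using G tt by (simp add: min_def)
      show "3 * D\<^sup>2 \<le> 1 \<or> 4 * (min (n 1 \<bullet> P) (min (n 2 \<bullet> P) (n 3 \<bullet> P)))\<^sup>2 \<le> s\<^sup>2 * (4 - 3 * D\<^sup>2)"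
        by (rule tetrahedral_rotations[OF C _ _ _ _ _ bessel_tetrahedral[OF norm P an]])
           (use D b s tt in auto)
    qed (use b in simp)
  qed (auto simp: an g nn inner_add_left simp del: One_nat_def)
qed

theorem density_octahedral:
  fixes n :: "nat \<Rightarrow> real^3"
  assumes norm: "norm (n 1) = 1" "norm (n 2) = 1" "norm (n 3) = 1"
    and ang: "n 1 \<bullet> n 2 = - cos (pi / 2)" "n 1 \<bullet> n 3 = - cos (pi / 3)" "n 2 \<bullet> n 3 = - cos (pi / 4)"
    and p: "p > 0" and \<tau>: "\<And>i. i \<in> {1..3} \<Longrightarrow> \<tau> i \<in> {0, 1/2}" and K: "K \<in> S2R"
  shows "packing_density (space_group 3 n \<tau> p) K \<le> optimal_density"
proof -
  define \<mu> where "\<mu> = sqrt 2"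
  have mu2: "\<mu>\<^sup>2 = 2" by (simp add: \<mu>_def)
  have mu: "141 / 100 \<le> \<mu>" "\<mu> \<le> 142 / 100" unfolding \<mu>_def
    by (rule real_le_rsqrt, simp add: power2_eq_square) (rule real_le_lsqrt, simp_all add: power2_eq_square)
  have an: "n 1 \<bullet> n 2 = 0" "n 1 \<bullet> n 3 = - (1 / 2)" "n 2 \<bullet> n 3 = - (\<mu> / 2)"
    using ang by (simp_all add: cos_60 cos_45 \<mu>_def)
  have g: "n 2 \<bullet> n 1 = 0" "n 3 \<bullet> n 1 = - (1 / 2)" "n 3 \<bullet> n 2 = - (\<mu> / 2)"
    using an by (simp_all add: inner_commute del: One_nat_def)
  have nn: "n 1 \<bullet> n 1 = 1" "n 2 \<bullet> n 2 = 1" "n 3 \<bullet> n 3 = 1" using norm by (auto simp: norm_eq_1)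
  have k: "2 \<le> (4::nat)" "n 2 \<bullet> n 3 = - cos (pi / real 4)" using ang(3) by simp_all
  obtain D where D: "finite D" "card D \<le> 2 * 4" "(\<lambda>P. P) \<in> D"
    "\<And>d. d \<in> D \<Longrightarrow> sphere_reflection (n 2) \<circ> d \<in> D" "\<And>d. d \<in> D \<Longrightarrow> sphere_reflection (n 3) \<circ> d \<in> D"
    using dihedral_closure[OF norm(2,3) k] by metis
  have c: "card D \<le> 8" using D(2) by simp
  obtain W where W: "finite W" "card W \<le> 48" "(\<lambda>P. P) \<in> W"
    "\<And>B. B \<in> W \<Longrightarrow> sphere_reflection (n 1) \<circ> B \<in> W"
    "\<And>B. B \<in> W \<Longrightarrow> sphere_reflection (n 2) \<circ> B \<in> W"
    "\<And>B. B \<in> W \<Longrightarrow> sphere_reflection (n 3) \<circ> B \<in> W"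
    using octahedral_order[OF norm an mu2 D(1) c D(3-5)] by metis
  show ?thesis
  proof (rule density_triangle_right_angle[OF norm an _ _ W _ _ _ p \<tau> K,
      where c="(4 + \<mu>) *\<^sub>R n 1 + (3 + 3 * \<mu>) *\<^sub>R n 2 + (6 + 2 * \<mu>) *\<^sub>R n 3"])
    show "real 48 * (1 - C) \<le> 2"
      if "norm P = 1" "0 \<le> s" "0 \<le> C" "s\<^sup>2 = 1 - C\<^sup>2" "s \<le> n 1 \<bullet> P" "s \<le> n 2 \<bullet> P" "s \<le> n 3 \<bullet> P" for P s C
      using octahedral_mirrors[OF that(3,4)] octahedral_form_ge[OF that(5-7,2) mu(1)] bessel_octahedral[OF norm that(1) an mu2] by simp
    show "\<exists>b\<ge>0. G b \<and> (3 * D\<^sup>2 \<le> 1 \<or> 4 * b\<^sup>2 \<le> s\<^sup>2 * (4 - 3 * D\<^sup>2))"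
      if P: "norm P = 1" and s0: "0 \<le> s" and C: "0 \<le> C" "C \<le> 1" "s\<^sup>2 = 1 - C\<^sup>2" and D: "D = real 48 * (1 - C) / 4"
        and b: "0 \<le> n 1 \<bullet> P" "0 \<le> n 2 \<bullet> P" "0 \<le> n 3 \<bullet> P"
        and t: "\<tau> 1 = 1/2 \<or> \<tau> 2 = 1/2" "\<tau> 1 = \<tau> 3"
        and m: "\<tau> 1 = 0 \<Longrightarrow> s \<le> n 1 \<bullet> P" "\<tau> 2 = 0 \<Longrightarrow> s \<le> n 2 \<bullet> P" "\<tau> 3 = 0 \<Longrightarrow> s \<le> n 3 \<bullet> P"
        and G: "\<tau> 1 = 1/2 \<Longrightarrow> G (n 1 \<bullet> P)" "\<tau> 2 = 1/2 \<Longrightarrow> G (n 2 \<bullet> P)" "\<tau> 3 = 1/2 \<Longrightarrow> G (n 3 \<bullet> P)"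
        and s: "\<tau> 1 = \<tau> 2 \<Longrightarrow> s\<^sup>2 \<le> (n 1 \<bullet> P)\<^sup>2 + (n 2 \<bullet> P)\<^sup>2"
          "s\<^sup>2 \<le> (n 1 \<bullet> P)\<^sup>2 + (n 3 \<bullet> P)\<^sup>2 + (n 1 \<bullet> P) * (n 3 \<bullet> P)"
          "\<tau> 2 = \<tau> 3 \<Longrightarrow> s\<^sup>2 \<le> (n 2 \<bullet> P)\<^sup>2 + (n 3 \<bullet> P)\<^sup>2 + \<mu> * (n 2 \<bullet> P) * (n 3 \<bullet> P)" for P s C D G
    proof -
      note Q = bessel_octahedral[OF norm P an mu2]
      have D': "D = 48 * (1 - C) / 4" using D by simp
      consider "\<tau> 1 = 0" "\<tau> 2 = 1/2" "\<tau> 3 = 0" | "\<tau> 1 = 1/2" "\<tau> 2 = 0" "\<tau> 3 = 1/2" | "\<tau> 1 = 1/2" "\<tau> 2 = 1/2" "\<tau> 3 = 1/2"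
        using t \<tau>[of 1] \<tau>[of 2] \<tau>[of 3] by auto
      then show ?thesis
      proof cases
        case 1
        from octahedral_0_half_0[OF C s0 D' mu(1) m(1)[OF 1(1)] b(2) m(3)[OF 1(3)] Q] show ?thesis
          using G(2)[OF 1(2)] b(2) by blast
      next
        case 2
        let ?c = "min (n 1 \<bullet> P) (n 3 \<bullet> P)"
        have c: "?c \<le> n 1 \<bullet> P" "?c \<le> n 3 \<bullet> P" "0 \<le> ?c" using b by auto
        have "3 * D\<^sup>2 \<le> 1 \<or> 4 * ?c\<^sup>2 \<le> s\<^sup>2 * (4 - 3 * D\<^sup>2)"
          by (rule octahedral_half_0_half[OF C s0 D' mu(1) c(1) m(2)[OF 2(2)] c(2,3) Q s(2)])
        moreover have "G ?c" using G(1)[OF 2(1)] G(3)[OF 2(3)] by (simp add: min_def)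
        ultimately show ?thesis using c(3) by blast
      next
        case 3
        let ?c = "min (n 1 \<bullet> P) (min (n 2 \<bullet> P) (n 3 \<bullet> P))"
        have c: "?c \<le> n 1 \<bullet> P" "?c \<le> n 2 \<bullet> P" "?c \<le> n 3 \<bullet> P" "0 \<le> ?c" using b by auto
        have "3 * D\<^sup>2 \<le> 1 \<or> 4 * ?c\<^sup>2 \<le> s\<^sup>2 * (4 - 3 * D\<^sup>2)"
          by (rule octahedral_rotations[OF C D' mu c Q _ s(2)]) (use s 3 in auto)
        moreover have "G ?c" using G(1)[OF 3(1)] G(2)[OF 3(2)] G(3)[OF 3(3)] by (simp add: min_def)
        ultimately show ?thesis using c(4) by blast
      qed
    qed
    have "((4 + \<mu>) *\<^sub>R n 1 + (3 + 3 * \<mu>) *\<^sub>R n 2 + (6 + 2 * \<mu>) *\<^sub>R n 3) \<bullet> n 1 = 1"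
      "((4 + \<mu>) *\<^sub>R n 1 + (3 + 3 * \<mu>) *\<^sub>R n 2 + (6 + 2 * \<mu>) *\<^sub>R n 3) \<bullet> n 2 = 1 + (2 - \<mu>\<^sup>2)"
      "((4 + \<mu>) *\<^sub>R n 1 + (3 + 3 * \<mu>) *\<^sub>R n 2 + (6 + 2 * \<mu>) *\<^sub>R n 3) \<bullet> n 3 = 1 + 3 / 2 * (2 - \<mu>\<^sup>2)"
      unfolding inner_add_left inner_scaleR_left an g nn by algebra+
    then show "0 < ((4 + \<mu>) *\<^sub>R n 1 + (3 + 3 * \<mu>) *\<^sub>R n 2 + (6 + 2 * \<mu>) *\<^sub>R n 3) \<bullet> n 1"
      "0 < ((4 + \<mu>) *\<^sub>R n 1 + (3 + 3 * \<mu>) *\<^sub>R n 2 + (6 + 2 * \<mu>) *\<^sub>R n 3) \<bullet> n 2"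
      "0 < ((4 + \<mu>) *\<^sub>R n 1 + (3 + 3 * \<mu>) *\<^sub>R n 2 + (6 + 2 * \<mu>) *\<^sub>R n 3) \<bullet> n 3"
      by (simp_all only: mu2) simp_all
  qed (use mu in auto)
qed

text \<open>At \<open>x = pi / 5\<close> the angles \<open>2 * x\<close> and \<open>3 * x\<close> have equal sines.\<close>

lemma golden_ratio_cos:
  defines "\<mu> \<equiv> 2 * cos (pi / 5)"
  shows "\<mu>\<^sup>2 = \<mu> + 1" "16 / 10 \<le> \<mu>" "\<mu> \<le> 165 / 100"
proof -
  define s where "s = sin (pi / 5)"
  define c where "c = cos (pi / 5)"
  have s: "0 < s" unfolding s_def by (rule sin_gt_zero) simp_all
  have c: "0 < c" unfolding c_def by (rule cos_gt_zero) simp_all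
  have sc: "s\<^sup>2 + c\<^sup>2 = 1" by (simp add: s_def c_def)
  have s2: "sin (2 * (pi / 5)) = 2 * s * c" unfolding s_def c_def by (rule sin_double)
  have "sin (2 * (pi / 5) + pi / 5) = s * (4 * c\<^sup>2 - 1)"
    unfolding sin_add s2 cos_double s_def[symmetric] c_def[symmetric] using sc by algebra
  moreover have "2 * (pi / 5) + pi / 5 = pi - 2 * (pi / 5)" by simp
  ultimately have "2 * s * c = s * (4 * c\<^sup>2 - 1)" using s2 by (metis sin_pi_minus)
  then have "s * (4 * c\<^sup>2 - 1 - 2 * c) = 0" by algebra
  then have "4 * c\<^sup>2 - 1 - 2 * c = 0" using s by simp
  then show m: "\<mu>\<^sup>2 = \<mu> + 1" unfolding \<mu>_def c_def[symmetric] by algebra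
  have m0: "0 < \<mu>" using c by (simp add: \<mu>_def c_def)
  show "16 / 10 \<le> \<mu>"
  proof (rule ccontr)
    assume h: "\<not> ?thesis"
    then have "\<mu> * \<mu> \<le> 16 / 10 * \<mu>" using m0 by (intro mult_right_mono) auto
    then show False using m h unfolding power2_eq_square by linarith
  qed
  show "\<mu> \<le> 165 / 100"
  proof (rule ccontr)
    assume h: "\<not> ?thesis"
    then have "165 / 100 * \<mu> \<le> \<mu> * \<mu>" using m0 by (intro mult_right_mono) auto
    then show False using m h unfolding power2_eq_square by linarith
  qed
qed

theorem density_icosahedral:
  fixes n :: "nat \<Rightarrow> real^3"
  assumes norm: "norm (n 1) = 1" "norm (n 2) = 1" "norm (n 3) = 1"
    and ang: "n 1 \<bullet> n 2 = - cos (pi / 2)" "n 1 \<bullet> n 3 = - cos (pi / 3)" "n 2 \<bullet> n 3 = - cos (pi / 5)"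
    and p: "p > 0" and \<tau>: "\<And>i. i \<in> {1..3} \<Longrightarrow> \<tau> i \<in> {0, 1/2}" and K: "K \<in> S2R"
  shows "packing_density (space_group 3 n \<tau> p) K \<le> optimal_density"
proof -
  define \<mu> where "\<mu> = 2 * cos (pi / 5)"
  have mu2: "\<mu>\<^sup>2 = \<mu> + 1" and mu: "16 / 10 \<le> \<mu>" "\<mu> \<le> 165 / 100"
    unfolding \<mu>_def by (rule golden_ratio_cos)+
  have an: "n 1 \<bullet> n 2 = 0" "n 1 \<bullet> n 3 = - (1 / 2)" "n 2 \<bullet> n 3 = - (\<mu> / 2)"
    using ang by (simp_all add: cos_60 \<mu>_def)
  have g: "n 2 \<bullet> n 1 = 0" "n 3 \<bullet> n 1 = - (1 / 2)" "n 3 \<bullet> n 2 = - (\<mu> / 2)"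
    using an by (simp_all add: inner_commute del: One_nat_def)
  have nn: "n 1 \<bullet> n 1 = 1" "n 2 \<bullet> n 2 = 1" "n 3 \<bullet> n 3 = 1" using norm by (auto simp: norm_eq_1)
  have k: "2 \<le> (5::nat)" "n 2 \<bullet> n 3 = - cos (pi / real 5)" using ang(3) by simp_all
  obtain D where D: "finite D" "card D \<le> 2 * 5" "(\<lambda>P. P) \<in> D"
    "\<And>d. d \<in> D \<Longrightarrow> sphere_reflection (n 2) \<circ> d \<in> D" "\<And>d. d \<in> D \<Longrightarrow> sphere_reflection (n 3) \<circ> d \<in> D"
    using dihedral_closure[OF norm(2,3) k] by metis
  have c: "card D \<le> 10" using D(2) by simp
  obtain W where W: "finite W" "card W \<le> 120" "(\<lambda>P. P) \<in> W"
    "\<And>B. B \<in> W \<Longrightarrow> sphere_reflection (n 1) \<circ> B \<in> W"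
    "\<And>B. B \<in> W \<Longrightarrow> sphere_reflection (n 2) \<circ> B \<in> W"
    "\<And>B. B \<in> W \<Longrightarrow> sphere_reflection (n 3) \<circ> B \<in> W"
    using icosahedral_order[OF norm an mu2 D(1) c D(3-5)] by metis
  show ?thesis
  proof (rule density_triangle_right_angle[OF norm an _ _ W _ _ _ p \<tau> K,
      where c="(5 * \<mu> + 5) *\<^sub>R n 1 + (9 * \<mu> + 6) *\<^sub>R n 2 + (10 * \<mu> + 8) *\<^sub>R n 3"])
    show "real 120 * (1 - C) \<le> 2"
      if "norm P = 1" "0 \<le> s" "0 \<le> C" "s\<^sup>2 = 1 - C\<^sup>2" "s \<le> n 1 \<bullet> P" "s \<le> n 2 \<bullet> P" "s \<le> n 3 \<bullet> P" for P s C
      using icosahedral_mirrors[OF that(3,4)] icosahedral_form_ge[OF that(5-7,2) mu(1)] bessel_icosahedral[OF norm that(1) an mu2] by simp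
    show "\<exists>b\<ge>0. G b \<and> (3 * D\<^sup>2 \<le> 1 \<or> 4 * b\<^sup>2 \<le> s\<^sup>2 * (4 - 3 * D\<^sup>2))"
      if P: "norm P = 1" and C: "0 \<le> C" "C \<le> 1" "s\<^sup>2 = 1 - C\<^sup>2" and D: "D = real 120 * (1 - C) / 4"
        and b: "0 \<le> n 1 \<bullet> P" "0 \<le> n 2 \<bullet> P" "0 \<le> n 3 \<bullet> P"
        and t: "\<tau> 1 = 1/2 \<or> \<tau> 2 = 1/2" "\<tau> 1 = \<tau> 3" "\<mu> = 1 \<or> \<mu>\<^sup>2 = \<mu> + 1 \<Longrightarrow> \<tau> 2 = \<tau> 3"
        and G: "\<tau> 1 = 1/2 \<Longrightarrow> G (n 1 \<bullet> P)" "\<tau> 2 = 1/2 \<Longrightarrow> G (n 2 \<bullet> P)" "\<tau> 3 = 1/2 \<Longrightarrow> G (n 3 \<bullet> P)"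
        and s: "\<tau> 1 = \<tau> 2 \<Longrightarrow> s\<^sup>2 \<le> (n 1 \<bullet> P)\<^sup>2 + (n 2 \<bullet> P)\<^sup>2"
          "s\<^sup>2 \<le> (n 1 \<bullet> P)\<^sup>2 + (n 3 \<bullet> P)\<^sup>2 + (n 1 \<bullet> P) * (n 3 \<bullet> P)"
          "\<tau> 2 = \<tau> 3 \<Longrightarrow> s\<^sup>2 \<le> (n 2 \<bullet> P)\<^sup>2 + (n 3 \<bullet> P)\<^sup>2 + \<mu> * (n 2 \<bullet> P) * (n 3 \<bullet> P)" for P s C D G
    proof (intro exI[of _ "min (n 1 \<bullet> P) (min (n 2 \<bullet> P) (n 3 \<bullet> P))"] conjI)
      have tt: "\<tau> 1 = 1/2" "\<tau> 2 = 1/2" "\<tau> 3 = 1/2" using t mu2 by auto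
      show "G (min (n 1 \<bullet> P) (min (n 2 \<bullet> P) (n 3 \<bullet> P)))" using G tt by (simp add: min_def)
      show "3 * D\<^sup>2 \<le> 1 \<or> 4 * (min (n 1 \<bullet> P) (min (n 2 \<bullet> P) (n 3 \<bullet> P)))\<^sup>2 \<le> s\<^sup>2 * (4 - 3 * D\<^sup>2)"
        by (rule icosahedral_rotations[OF C _ mu _ _ _ _ bessel_icosahedral[OF norm P an mu2] mu2 _ s(2)])
           (use D b s tt in auto)
    qed (use b in simp)
    have "((5 * \<mu> + 5) *\<^sub>R n 1 + (9 * \<mu> + 6) *\<^sub>R n 2 + (10 * \<mu> + 8) *\<^sub>R n 3) \<bullet> n 1 = 1"
      "((5 * \<mu> + 5) *\<^sub>R n 1 + (9 * \<mu> + 6) *\<^sub>R n 2 + (10 * \<mu> + 8) *\<^sub>R n 3) \<bullet> n 2 = 1 + 5 * (\<mu> + 1 - \<mu>\<^sup>2)"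
      "((5 * \<mu> + 5) *\<^sub>R n 1 + (9 * \<mu> + 6) *\<^sub>R n 2 + (10 * \<mu> + 8) *\<^sub>R n 3) \<bullet> n 3 = 1 + 9 / 2 * (\<mu> + 1 - \<mu>\<^sup>2)"
      unfolding inner_add_left inner_scaleR_left an g nn by algebra+
    then show "0 < ((5 * \<mu> + 5) *\<^sub>R n 1 + (9 * \<mu> + 6) *\<^sub>R n 2 + (10 * \<mu> + 8) *\<^sub>R n 3) \<bullet> n 1"
      "0 < ((5 * \<mu> + 5) *\<^sub>R n 1 + (9 * \<mu> + 6) *\<^sub>R n 2 + (10 * \<mu> + 8) *\<^sub>R n 3) \<bullet> n 2"
      "0 < ((5 * \<mu> + 5) *\<^sub>R n 1 + (9 * \<mu> + 6) *\<^sub>R n 2 + (10 * \<mu> + 8) *\<^sub>R n 3) \<bullet> n 3"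
      by (simp_all only: mu2) simp_all
  qed (use mu in auto)
qed

lemma interior_angle_inner:
  assumes "norm n = 1" "norm n' = 1" "interior_angle n n' = a"
  shows "n \<bullet> n' = - cos a"
proof -
  have "arccos (n \<bullet> n') = pi - a" using assms(3) by (simp add: interior_angle_def)
  moreover have "cos (arccos (n \<bullet> n')) = n \<bullet> n'" using inner_unit_bounds[OF assms(1,2)] by simp
  ultimately show ?thesis by simp
qed

theorem mirror_system_density_le:
  assumes ms: "mirror_system m n" and p: "p > 0" and \<tau>: "\<And>i. i \<in> {1..m} \<Longrightarrow> \<tau> i \<in> {0, 1/2}" and K: "K \<in> S2R"
  shows "packing_density (space_group m n \<tau> p) K \<le> optimal_density"
proof -
  have norm: "norm (n i) = 1" if "i \<in> {1..m}" for i using ms that by (auto simp: mirror_system_def)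
  have meet: "n i \<bullet> n j = - cos (pi / real k)"
    if "interior_angle (n i) (n j) = pi / real k" "i \<in> {1..m}" "j \<in> {1..m}" for i j k
    by (rule interior_angle_inner[OF norm[OF that(2)] norm[OF that(3)] that(1)])
  let ?a = "\<lambda>i j (k::nat). interior_angle (n i) (n j) = pi / real k"
  consider q where "m = 2" "q \<ge> 2" "?a 1 2 q" | q where "m = 3" "q \<ge> 2" "?a 1 3 2" "?a 2 3 2" "?a 1 2 q"
    | "m = 3" "?a 1 2 2" "?a 1 3 3" "?a 2 3 3" | "m = 3" "?a 1 2 2" "?a 1 3 3" "?a 2 3 4"
    | "m = 3" "?a 1 2 2" "?a 1 3 3" "?a 2 3 5"
    using ms unfolding mirror_system_def Let_def by blast
  then show ?thesis
  proof cases
    case 1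
    have "packing_density (space_group 2 n \<tau> p) K \<le> optimal_density"
      by (rule density_digon[OF _ _ 1(2) meet[OF 1(3)] p _ K]) (use 1 norm \<tau> in auto)
    then show ?thesis using 1 by simp
  next
    case 2
    have "n 1 \<bullet> n 3 = 0" "n 2 \<bullet> n 3 = 0" using meet[OF 2(3)] meet[OF 2(4)] 2(1) by simp_all
    note density_digon_equator[OF _ _ _ 2(2) meet[OF 2(5)] this p _ K]
    then have "packing_density (space_group 3 n \<tau> p) K \<le> optimal_density" using 2(1) norm \<tau> by auto
    then show ?thesis using 2 by simp
  next
    case 3
    have "packing_density (space_group 3 n \<tau> p) K \<le> optimal_density"
      by (rule density_tetrahedral[OF _ _ _ _ _ _ p _ K]) (use 3 norm \<tau> meet[OF 3(2)] meet[OF 3(3)] meet[OF 3(4)] in auto)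
    then show ?thesis using 3 by simp
  next
    case 4
    have "packing_density (space_group 3 n \<tau> p) K \<le> optimal_density"
      by (rule density_octahedral[OF _ _ _ _ _ _ p _ K]) (use 4 norm \<tau> meet[OF 4(2)] meet[OF 4(3)] meet[OF 4(4)] in auto)
    then show ?thesis using 4 by simp
  next
    case 5
    have "packing_density (space_group 3 n \<tau> p) K \<le> optimal_density"
      by (rule density_icosahedral[OF _ _ _ _ _ _ p _ K]) (use 5 norm \<tau> meet[OF 5(2)] meet[OF 5(3)] meet[OF 5(4)] in auto)
    then show ?thesis using 5 by simp
  qed
qed

section \<open>The optimal packing\<close>

text \<open>The linear parts of the optimal group are the sign changes of the first two coordinates.\<close>

definition axis_signs :: "real \<Rightarrow> real \<Rightarrow> real^3 \<Rightarrow> real^3" where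
  "axis_signs x y P = vector [x * P $ 1, y * P $ 2, P $ 3]"

lemma axis_signs_nth [simp]:
  "axis_signs x y P $ 1 = x * P $ 1" "axis_signs x y P $ 2 = y * P $ 2" "axis_signs x y P $ 3 = P $ 3"
  by (simp_all add: axis_signs_def)

lemma axis_signs_comp: "axis_signs x y \<circ> axis_signs x' y' = axis_signs (x * x') (y * y')"
  by (simp add: fun_eq_iff vec_eq_iff forall_3)

lemma axis_signs_ident: "axis_signs 1 1 = (\<lambda>P. P)"
  by (simp add: fun_eq_iff vec_eq_iff forall_3)

lemma axis_signs_orthogonal:
  assumes "x\<^sup>2 = 1" "y\<^sup>2 = 1"
  shows "orthogonal_transformation (axis_signs x y)"
  unfolding orthogonal_transformation_def
proof (intro conjI allI)
  show "linear (axis_signs x y)"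
    by (rule linearI) (simp_all add: vec_eq_iff forall_3 algebra_simps)
  show "axis_signs x y P \<bullet> axis_signs x y Q = P \<bullet> Q" for P Q
  proof -
    have "axis_signs x y P \<bullet> axis_signs x y Q = x\<^sup>2 * (P $ 1 * Q $ 1) + y\<^sup>2 * (P $ 2 * Q $ 2) + P $ 3 * Q $ 3"
      by (simp add: inner_3 power2_eq_square)
    then show ?thesis using assms by (simp add: inner_3)
  qed
qed

lemma sphere_reflection_axes:
  "sphere_reflection (vector [0, 1, 0]) = axis_signs 1 (-1)"
  "sphere_reflection (vector [1, 0, 0]) = axis_signs (-1) 1"
  by (simp_all add: fun_eq_iff vec_eq_iff forall_3 sphere_reflection_def inner_3)

definition optimal_group :: "real \<Rightarrow> (point \<Rightarrow> point) set" where
  "optimal_group \<tau> = generate (BijGroup S2R)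
     {glide_reflection (vector [0, 1, 0]) \<tau>, glide_reflection (vector [1, 0, 0]) \<tau>, fibre_translation (2 * \<tau>)}"

lemma optimal_group_generators:
  "{glide_reflection (vector [0, 1, 0]) \<tau>, glide_reflection (vector [1, 0, 0]) \<tau>, fibre_translation (2 * \<tau>)}
   = {isometry_of (axis_signs 1 (-1)) \<tau>, isometry_of (axis_signs (-1) 1) \<tau>, isometry_of (axis_signs 1 1) (2 * \<tau>)}"
  by (simp add: glide_reflection_eq fibre_translation_eq sphere_reflection_axes axis_signs_ident)

text \<open>In the optimal group every glide reflection changes one sign and moves by \<open>\<tau>\<close> along the fibre, so the number
of sign changes has the parity of the height \<open>k\<close> in units of \<open>\<tau>\<close>.\<close>

definition sign_parity :: "real \<Rightarrow> real \<Rightarrow> int \<Rightarrow> bool" where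
  "sign_parity x y k \<longleftrightarrow> x \<in> {1, -1} \<and> y \<in> {1, -1} \<and> x * y = (if even k then 1 else -1)"

lemma optimal_group_form:
  assumes "g \<in> optimal_group \<tau>"
  shows "\<exists>x y k. sign_parity x y k \<and> g = isometry_of (axis_signs x y) (of_int k * \<tau>)"
  using assms unfolding optimal_group_def optimal_group_generators
proof (induction rule: generate.induct)
  case one
  show ?case by (rule exI[of _ 1], rule exI[of _ 1], rule exI[of _ 0])
    (simp add: sign_parity_def one_BijGroup_S2R axis_signs_ident)
next
  case (incl h)
  then consider "h = isometry_of (axis_signs 1 (-1)) \<tau>" | "h = isometry_of (axis_signs (-1) 1) \<tau>"
    | "h = isometry_of (axis_signs 1 1) (2 * \<tau>)" by auto
  then show ?case
  proof cases
    case 1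
    show ?thesis by (rule exI[of _ 1], rule exI[of _ "-1"], rule exI[of _ 1]) (use 1 in \<open>simp add: sign_parity_def\<close>)
  next
    case 2
    show ?thesis by (rule exI[of _ "-1"], rule exI[of _ 1], rule exI[of _ 1]) (use 2 in \<open>simp add: sign_parity_def\<close>)
  next
    case 3
    show ?thesis by (rule exI[of _ 1], rule exI[of _ 1], rule exI[of _ 2]) (use 3 in \<open>simp add: sign_parity_def\<close>)
  qed
next
  case (inv h)
  have i: "inv\<^bsub>BijGroup S2R\<^esub> (isometry_of (axis_signs x y) s) = isometry_of (axis_signs x y) (- s)"
    if "x\<^sup>2 = 1" "y\<^sup>2 = 1" for x y s
  proof -
    have "inv_into UNIV (axis_signs x y) = axis_signs x y"
      by (rule inv_equality) (use that in \<open>simp_all add: vec_eq_iff forall_3 power2_eq_square flip: mult.assoc\<close>)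
    then show ?thesis using inv_isometry_of[OF axis_signs_orthogonal[OF that]] by simp
  qed
  consider "h = isometry_of (axis_signs 1 (-1)) \<tau>" | "h = isometry_of (axis_signs (-1) 1) \<tau>"
    | "h = isometry_of (axis_signs 1 1) (2 * \<tau>)" using inv by auto
  then show ?case
  proof cases
    case 1
    show ?thesis by (rule exI[of _ 1], rule exI[of _ "-1"], rule exI[of _ "-1"]) (use 1 in \<open>simp add: sign_parity_def i\<close>)
  next
    case 2
    show ?thesis by (rule exI[of _ "-1"], rule exI[of _ 1], rule exI[of _ "-1"]) (use 2 in \<open>simp add: sign_parity_def i\<close>)
  next
    case 3
    show ?thesis by (rule exI[of _ 1], rule exI[of _ 1], rule exI[of _ "-2"]) (use 3 in \<open>simp add: sign_parity_def i\<close>)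
  qed
next
  case (eng h1 h2)
  obtain x y k where 1: "sign_parity x y k" "h1 = isometry_of (axis_signs x y) (of_int k * \<tau>)" using eng.IH(1) by blast
  obtain x' y' k' where 2: "sign_parity x' y' k'" "h2 = isometry_of (axis_signs x' y') (of_int k' * \<tau>)" using eng.IH(2) by blast
  have o: "orthogonal_transformation (axis_signs x y)" "orthogonal_transformation (axis_signs x' y')"
    using 1(1) 2(1) by (auto intro!: axis_signs_orthogonal simp: sign_parity_def)
  have "(x * x') * (y * y') = (x * y) * (x' * y')" by (simp add: ac_simps)
  then have "sign_parity (x * x') (y * y') (k + k')" using 1(1) 2(1) by (auto simp: sign_parity_def)
  moreover have "h1 \<otimes>\<^bsub>BijGroup S2R\<^esub> h2 = isometry_of (axis_signs (x * x') (y * y')) (of_int (k + k') * \<tau>)"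
    unfolding 1(2) 2(2) isometry_of_mult[OF o] axis_signs_comp by (simp add: algebra_simps)
  ultimately show ?case by blast
qed

lemma sign_parity_orthogonal: "sign_parity x y k \<Longrightarrow> orthogonal_transformation (axis_signs x y)"
  by (auto intro!: axis_signs_orthogonal simp: sign_parity_def)

lemma optimal_group_motion_group:
  assumes "\<tau> > 0"
  shows "motion_group (optimal_group \<tau>) ((\<lambda>(x, y). axis_signs x y) ` ({1, -1} \<times> {1, -1})) \<tau>"
proof (rule motion_group.intro)
  show "subgroup (optimal_group \<tau>) (BijGroup S2R)"
    unfolding optimal_group_def optimal_group_generators
    by (rule group.generate_is_subgroup[OF group_BijGroup])
       (auto intro!: isometry_of_in_carrier axis_signs_orthogonal)
  show "\<exists>A\<in>(\<lambda>(x, y). axis_signs x y) ` ({1, -1} \<times> {1, -1}). \<exists>k::int. orthogonal_transformation A \<and> g = isometry_of A (k * \<tau>)"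
    if g: "g \<in> optimal_group \<tau>" for g
  proof -
    obtain x y k where h: "sign_parity x y k" "g = isometry_of (axis_signs x y) (of_int k * \<tau>)"
      using optimal_group_form[OF g] by blast
    have "axis_signs x y \<in> (\<lambda>(x, y). axis_signs x y) ` ({1, -1} \<times> {1, -1})"
      using h(1) by (intro image_eqI[of _ _ "(x, y)"]) (auto simp: sign_parity_def)
    then show ?thesis using sign_parity_orthogonal[OF h(1)] h(2) by blast
  qed
qed (use assms in auto)

lemma optimal_group_members:
  assumes "\<tau> > 0"
  shows "isometry_of (axis_signs 1 (-1)) \<tau> \<in> optimal_group \<tau>" "isometry_of (axis_signs (-1) 1) \<tau> \<in> optimal_group \<tau>"
    "isometry_of (axis_signs 1 (-1)) (- \<tau>) \<in> optimal_group \<tau>" "isometry_of (axis_signs (-1) 1) (- \<tau>) \<in> optimal_group \<tau>"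
    "isometry_of (axis_signs (-1) (-1)) 0 \<in> optimal_group \<tau>"
proof -
  interpret motion_group "optimal_group \<tau>" "(\<lambda>(x, y). axis_signs x y) ` ({1, -1} \<times> {1, -1})" \<tau>
    by (rule optimal_group_motion_group[OF assms])
  have o: "orthogonal_transformation (axis_signs 1 (-1))" "orthogonal_transformation (axis_signs (-1) 1)"
    "orthogonal_transformation (\<lambda>P::real^3. P)"
    by (auto intro!: axis_signs_orthogonal)
  show g: "isometry_of (axis_signs 1 (-1)) \<tau> \<in> optimal_group \<tau>" "isometry_of (axis_signs (-1) 1) \<tau> \<in> optimal_group \<tau>"
    unfolding optimal_group_def optimal_group_generators by (auto intro: generate.incl)
  have "isometry_of (\<lambda>P. P) (2 * \<tau>) \<in> optimal_group \<tau>"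
    unfolding optimal_group_def optimal_group_generators axis_signs_ident by (auto intro: generate.incl)
  then have t: "isometry_of (\<lambda>P. P) (- (2 * \<tau>)) \<in> optimal_group \<tau>" by (rule translation_minus)
  show g': "isometry_of (axis_signs 1 (-1)) (- \<tau>) \<in> optimal_group \<tau>" "isometry_of (axis_signs (-1) 1) (- \<tau>) \<in> optimal_group \<tau>"
    using translate_closed[OF g(1) o(1) t] translate_closed[OF g(2) o(2) t] by simp_all
  show "isometry_of (axis_signs (-1) (-1)) 0 \<in> optimal_group \<tau>"
    using mult_closed[OF g(1) g'(2) o(1,2)] by (simp add: axis_signs_comp)
qed

abbreviation (input) K_opt :: point where "K_opt \<equiv> geo_point (pi / 4) 0 0"

lemma K_opt_eq: "fst K_opt = vector [sqrt 2 / 2, sqrt 2 / 2, 0]" "snd K_opt = 0"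
  by (simp_all add: geo_point_def cos_45 sin_45)

lemma K_opt_S2R: "K_opt \<in> S2R"
  by (rule geo_point_S2R)

lemma K_opt_image:
  "isometry_of (axis_signs x y) s K_opt = (axis_signs x y (fst K_opt), s)"
  by (simp add: isometry_of_apply[OF K_opt_S2R] K_opt_eq)

lemma K_opt_inner:
  "fst K_opt \<bullet> axis_signs x y (fst K_opt) = (x + y) / 2"
  by (simp add: inner_3 K_opt_eq algebra_simps)

lemma K_opt_dist:
  assumes "x\<^sup>2 = 1" "y\<^sup>2 = 1"
  shows "geodesic_dist K_opt (isometry_of (axis_signs x y) s K_opt) = sqrt ((arccos ((x + y) / 2))\<^sup>2 + s\<^sup>2)"
  using geodesic_dist_eq[OF K_opt_S2R isometry_of_in_S2R[OF axis_signs_orthogonal[OF assms] K_opt_S2R]]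
  by (simp add: K_opt_image sphere_angle_def K_opt_inner K_opt_eq(2))

lemma optimal_fibre_translation:
  assumes "\<tau> > 0"
  shows "geodesic_dist K_opt (glide_reflection (vector [0, 1, 0]) \<tau> K_opt) = pi \<longleftrightarrow> \<tau> = sqrt 3 * pi / 2"
    and "geodesic_dist K_opt (glide_reflection (vector [1, 0, 0]) \<tau> K_opt) = pi \<longleftrightarrow> \<tau> = sqrt 3 * pi / 2"
    and "geodesic_dist (glide_reflection (vector [0, 1, 0]) \<tau> K_opt) (glide_reflection (vector [1, 0, 0]) \<tau> K_opt) = pi"
proof -
  have e: "sqrt ((pi / 2)\<^sup>2 + \<tau>\<^sup>2) = pi \<longleftrightarrow> \<tau> = sqrt 3 * pi / 2"
  proof
    assume "sqrt ((pi / 2)\<^sup>2 + \<tau>\<^sup>2) = pi"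
    then have "(pi / 2)\<^sup>2 + \<tau>\<^sup>2 = pi\<^sup>2" by (metis real_sqrt_eq_iff real_sqrt_abs abs_of_pos pi_gt_zero)
    then have "\<tau>\<^sup>2 = (sqrt 3 * pi / 2)\<^sup>2" by (simp add: power_mult_distrib power_divide)
    then show "\<tau> = sqrt 3 * pi / 2" by (rule power2_eq_imp_eq) (use assms in auto)
  next
    assume h: "\<tau> = sqrt 3 * pi / 2"
    have "(pi / 2)\<^sup>2 + \<tau>\<^sup>2 = pi\<^sup>2" unfolding h by (simp add: power_mult_distrib power_divide)
    then show "sqrt ((pi / 2)\<^sup>2 + \<tau>\<^sup>2) = pi" by simp
  qed
  show "geodesic_dist K_opt (glide_reflection (vector [0, 1, 0]) \<tau> K_opt) = pi \<longleftrightarrow> \<tau> = sqrt 3 * pi / 2"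
    "geodesic_dist K_opt (glide_reflection (vector [1, 0, 0]) \<tau> K_opt) = pi \<longleftrightarrow> \<tau> = sqrt 3 * pi / 2"
    using e by (simp_all add: glide_reflection_eq sphere_reflection_axes K_opt_dist)
  have o: "orthogonal_transformation (axis_signs 1 (-1))" "orthogonal_transformation (axis_signs (-1) 1)"
    by (auto intro!: axis_signs_orthogonal)
  have "axis_signs 1 (-1) (fst K_opt) \<bullet> axis_signs (-1) 1 (fst K_opt) = -1"
    by (simp add: inner_3 K_opt_eq)
  then show "geodesic_dist (glide_reflection (vector [0, 1, 0]) \<tau> K_opt) (glide_reflection (vector [1, 0, 0]) \<tau> K_opt) = pi"
    using geodesic_dist_eq[OF isometry_of_in_S2R[OF o(1) K_opt_S2R] isometry_of_in_S2R[OF o(2) K_opt_S2R]]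
    by (simp add: glide_reflection_eq sphere_reflection_axes K_opt_image sphere_angle_def)
qed

text \<open>Two different orbit points at the same height are antipodal.  If their heights differ by an odd multiple of
\<open>\<tau>\<close>, their spherical parts are at right angles and \<open>(pi / 2)\<^sup>2 + \<tau>\<^sup>2 = pi\<^sup>2\<close>.  In the remaining case
the heights differ by at least \<open>2 * \<tau>\<close>, which exceeds \<open>pi\<close>.\<close>

lemma optimal_dist_ge:
  assumes g: "g \<in> optimal_group (sqrt 3 * pi / 2)" "g \<noteq> \<one>\<^bsub>BijGroup S2R\<^esub>"
  shows "pi \<le> geodesic_dist K_opt (g K_opt)"
proof -
  obtain x y k where h: "sign_parity x y k" "g = isometry_of (axis_signs x y) (of_int k * (sqrt 3 * pi / 2))"
    using optimal_group_form[OF g(1)] by blast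
  have xy: "x\<^sup>2 = 1" "y\<^sup>2 = 1" using h(1) by (auto simp: sign_parity_def)
  have d: "geodesic_dist K_opt (g K_opt) = sqrt ((arccos ((x + y) / 2))\<^sup>2 + 3 / 4 * (of_int k)\<^sup>2 * pi\<^sup>2)"
    unfolding h(2) K_opt_dist[OF xy] by (simp add: power_mult_distrib power_divide)
  consider "x = 1" "y = 1" "even k" | "x = -1" "y = -1" | "x + y = 0" "odd k"
    using h(1) by (auto simp: sign_parity_def split: if_splits)
  then have "pi\<^sup>2 \<le> (arccos ((x + y) / 2))\<^sup>2 + 3 / 4 * (of_int k)\<^sup>2 * pi\<^sup>2"
  proof cases
    case 1
    have "k \<noteq> 0" using g(2) h(2) 1 by (auto simp: axis_signs_ident one_BijGroup_S2R)
    then have "2 \<le> \<bar>k\<bar>" using 1(3) by presburger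
    then have "2\<^sup>2 \<le> \<bar>real_of_int k\<bar>\<^sup>2" by (intro power_mono) linarith+
    then have "4 \<le> (real_of_int k)\<^sup>2" by simp
    then have "1 * pi\<^sup>2 \<le> 3 / 4 * (real_of_int k)\<^sup>2 * pi\<^sup>2" by (intro mult_right_mono) auto
    then show ?thesis by (simp add: zero_le_power2 add_increasing)
  next
    case 2
    then show ?thesis by simp
  next
    case 3
    have "1 \<le> \<bar>k\<bar>" using 3(2) by presburger
    then have "1\<^sup>2 \<le> \<bar>real_of_int k\<bar>\<^sup>2" by (intro power_mono) linarith+
    then have "3 / 4 * 1 * pi\<^sup>2 \<le> 3 / 4 * (real_of_int k)\<^sup>2 * pi\<^sup>2" by (intro mult_right_mono mult_left_mono) auto
    moreover have "(arccos ((x + y) / 2))\<^sup>2 = pi\<^sup>2 / 4" using 3(1) by (simp add: power_divide)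
    ultimately show ?thesis by linarith
  qed
  then have "sqrt (pi\<^sup>2) \<le> geodesic_dist K_opt (g K_opt)" unfolding d by (rule real_sqrt_le_mono)
  then show ?thesis by simp
qed

lemma optimal_trivial_stabilizer: "trivial_stabilizer (optimal_group (sqrt 3 * pi / 2)) K_opt"
proof -
  interpret motion_group "optimal_group (sqrt 3 * pi / 2)" "(\<lambda>(x, y). axis_signs x y) ` ({1, -1} \<times> {1, -1})" "sqrt 3 * pi / 2"
    by (rule optimal_group_motion_group) simp
  have one: "\<one>\<^bsub>BijGroup S2R\<^esub> \<in> optimal_group (sqrt 3 * pi / 2)" using subgroup by (rule subgroup.one_closed)
  have d0: "geodesic_dist K_opt K_opt = 0"
    using K_opt_dist[of 1 1 0] by (simp add: axis_signs_ident isometry_of_def K_opt_S2R)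
  have u: "\<one>\<^bsub>BijGroup S2R\<^esub> K_opt = K_opt" by (simp add: one_BijGroup_S2R isometry_of_def K_opt_S2R)
  have v: "g = \<one>\<^bsub>BijGroup S2R\<^esub>" if "g \<in> optimal_group (sqrt 3 * pi / 2)" "g K_opt = K_opt" for g
    using optimal_dist_ge[OF that(1)] that(2) d0 pi_gt_zero by (metis not_le)
  show ?thesis unfolding trivial_stabilizer_def
  proof (intro equalityI subsetI)
    fix g assume "g \<in> {g \<in> optimal_group (sqrt 3 * pi / 2). g K_opt = K_opt}"
    then have "g = \<one>\<^bsub>BijGroup S2R\<^esub>" by (intro v) blast+
    then show "g \<in> {\<one>\<^bsub>BijGroup S2R\<^esub>}" unfolding singleton_iff .
  next
    fix g assume "g \<in> {\<one>\<^bsub>BijGroup S2R\<^esub>}"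
    then have g: "g = \<one>\<^bsub>BijGroup S2R\<^esub>" by (rule singletonD)
    show "g \<in> {g \<in> optimal_group (sqrt 3 * pi / 2). g K_opt = K_opt}" unfolding g mem_Collect_eq using one u by (rule conjI)
  qed
qed

lemma optimal_packing_radius: "packing_radius (optimal_group (sqrt 3 * pi / 2)) K_opt = pi / 2"
  unfolding packing_radius_def
proof (rule cInf_eq_minimum)
  let ?g = "isometry_of (axis_signs 1 (-1)) (sqrt 3 * pi / 2)"
  have d: "geodesic_dist K_opt (?g K_opt) = pi"
    using optimal_fibre_translation(1)[of "sqrt 3 * pi / 2"] by (simp add: glide_reflection_eq sphere_reflection_axes)
  have "?g \<noteq> \<one>\<^bsub>BijGroup S2R\<^esub>"
  proof
    assume "?g = \<one>\<^bsub>BijGroup S2R\<^esub>"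
    then have "?g K_opt = K_opt" by (simp add: one_BijGroup_S2R isometry_of_def K_opt_S2R)
    then show False by (simp add: K_opt_image prod_eq_iff K_opt_eq)
  qed
  then show "pi / 2 \<in> (\<lambda>g. geodesic_dist K_opt (g K_opt) / 2) ` (optimal_group (sqrt 3 * pi / 2) - {\<one>\<^bsub>BijGroup S2R\<^esub>})"
    using optimal_group_members(1)[of "sqrt 3 * pi / 2"] d by (intro image_eqI[of _ _ ?g]) auto
  show "pi / 2 \<le> r" if r: "r \<in> (\<lambda>g. geodesic_dist K_opt (g K_opt) / 2) ` (optimal_group (sqrt 3 * pi / 2) - {\<one>\<^bsub>BijGroup S2R\<^esub>})" for r
  proof -
    obtain g where "g \<in> optimal_group (sqrt 3 * pi / 2)" "g \<noteq> \<one>\<^bsub>BijGroup S2R\<^esub>" "r = geodesic_dist K_opt (g K_opt) / 2"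
      using r by blast
    then show ?thesis using optimal_dist_ge[of g] by simp
  qed
qed

text \<open>The squared angle between a point and the nearer end of an axis, as a function of the inner product \<open>c\<close>.
The minimum makes it continuous on all reals.\<close>

definition squared_axis_angle :: "real \<Rightarrow> real" where
  "squared_axis_angle c = (arccos (min 1 \<bar>c\<bar>))\<^sup>2"

lemma squared_axis_angle_le: "squared_axis_angle c \<le> (pi / 2)\<^sup>2"
  unfolding squared_axis_angle_def by (intro power_mono arccos_le_pi2 arccos_lbound) auto

lemma squared_axis_angle_nonneg: "0 \<le> squared_axis_angle c"
  by (simp add: squared_axis_angle_def)

lemma squared_axis_angle_minus: "squared_axis_angle (- c) = squared_axis_angle c"
  by (simp add: squared_axis_angle_def)

lemma squared_axis_angle_continuous: "continuous_on UNIV squared_axis_angle"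
  unfolding squared_axis_angle_def[abs_def]
  by (intro continuous_on_power continuous_on_compose2[OF continuous_on_arccos'] continuous_intros) auto

lemma squared_axis_angle_eq:
  assumes "norm P = 1" "norm Q = 1" "0 \<le> P \<bullet> Q"
  shows "squared_axis_angle (P \<bullet> Q) = (sphere_angle P Q)\<^sup>2"
  using inner_unit_bounds[OF assms(1,2)] assms(3) by (simp add: squared_axis_angle_def sphere_angle_def)

text \<open>A point is compared with the four orbit points at the heights \<open>\<tau>\<close> and \<open>- \<tau>\<close>, which are the ends of the
second axis.  The terms \<open>t\<^sup>2\<close> cancel, so on a fibre the points closer to \<open>K_opt\<close> form an interval of this
length.\<close>

definition optimal_fibre_length :: "real \<Rightarrow> real^3 \<Rightarrow> real" where
  "optimal_fibre_length \<tau> Q =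
     (squared_axis_angle (axis_signs 1 (-1) (fst K_opt) \<bullet> Q) - squared_axis_angle (fst K_opt \<bullet> Q) + \<tau>\<^sup>2) / \<tau>"

text \<open>The antipodal orbit point at height 0 confines the cell to a hemisphere.\<close>

lemma optimal_cell_subset:
  assumes \<tau>: "\<tau> > 0" and X: "(Q, t) \<in> dv_cell (optimal_group \<tau>) K_opt"
  shows "0 \<le> fst K_opt \<bullet> Q" "\<bar>t\<bar> \<le> optimal_fibre_length \<tau> Q / 2"
proof -
  define P0 where "P0 = fst K_opt"
  have P0: "norm P0 = 1" using K_opt_S2R by (simp add: P0_def S2R_iff)
  have Q: "norm Q = 1" "(Q, t) \<in> S2R" using X by (auto simp: dv_cell_def S2R_iff)
  have img: "norm (axis_signs x y P0) = 1" if "x\<^sup>2 = 1" "y\<^sup>2 = 1" for x y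
    using orthogonal_transformation_norm[OF axis_signs_orthogonal[OF that], of P0] P0 by simp
  have d: "(sphere_angle P0 Q)\<^sup>2 + t\<^sup>2 \<le> (sphere_angle (axis_signs x y P0) Q)\<^sup>2 + (s - t)\<^sup>2"
    if g: "isometry_of (axis_signs x y) s \<in> optimal_group \<tau>" and xy: "x\<^sup>2 = 1" "y\<^sup>2 = 1" for x y s
  proof -
    have "geodesic_dist K_opt (Q, t) \<le> geodesic_dist (isometry_of (axis_signs x y) s K_opt) (Q, t)"
      using X g by (simp add: dv_cell_def)
    moreover have "geodesic_dist K_opt (Q, t) = sqrt ((sphere_angle P0 Q)\<^sup>2 + t\<^sup>2)"
      using geodesic_dist_eq[OF K_opt_S2R Q(2)] by (simp add: P0_def K_opt_eq(2))
    moreover have "geodesic_dist (isometry_of (axis_signs x y) s K_opt) (Q, t)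
      = sqrt ((sphere_angle (axis_signs x y P0) Q)\<^sup>2 + (s - t)\<^sup>2)"
      using geodesic_dist_eq[OF isometry_of_in_S2R[OF axis_signs_orthogonal[OF xy] K_opt_S2R] Q(2), of s]
      by (simp add: P0_def K_opt_image)
    ultimately show ?thesis by simp
  qed
  note mem = optimal_group_members[OF \<tau>]
  have neg: "axis_signs (-1) (-1) P0 = - P0" "axis_signs (-1) 1 P0 = - axis_signs 1 (-1) P0"
    by (simp_all add: vec_eq_iff forall_3 P0_def K_opt_eq)
  have "(sphere_angle P0 Q)\<^sup>2 \<le> (sphere_angle (- P0) Q)\<^sup>2" using d[OF mem(5)] by (simp add: neg)
  then have "sphere_angle P0 Q \<le> sphere_angle (- P0) Q"
    by (rule power2_le_imp_le) (use sphere_angle_bounds(1)[of "- P0" Q] P0 Q in simp)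
  then have "cos (sphere_angle (- P0) Q) \<le> cos (sphere_angle P0 Q)"
    by (intro cos_monotone_0_pi_le) (use sphere_angle_bounds[of "- P0" Q] sphere_angle_bounds[of P0 Q] P0 Q in auto)
  then have p0: "0 \<le> P0 \<bullet> Q" using cos_sphere_angle[of "- P0" Q] cos_sphere_angle[of P0 Q] P0 Q by simp
  then show "0 \<le> fst K_opt \<bullet> Q" by (simp add: P0_def)
  define P1 where "P1 = axis_signs 1 (-1) P0"
  have n1: "norm P1 = 1" unfolding P1_def by (rule img) auto
  have "(sphere_angle P0 Q)\<^sup>2 + t\<^sup>2 \<le> squared_axis_angle (P1 \<bullet> Q) + (s - t)\<^sup>2" if "s = \<tau> \<or> s = - \<tau>" for s
  proof (cases "0 \<le> P1 \<bullet> Q")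
    case True
    have "isometry_of (axis_signs 1 (-1)) s \<in> optimal_group \<tau>" using that mem(1,3) by auto
    from d[OF this] show ?thesis using squared_axis_angle_eq[OF n1 Q(1) True] by (simp add: P1_def)
  next
    case False
    then have "squared_axis_angle (- P1 \<bullet> Q) = (sphere_angle (- P1) Q)\<^sup>2"
      using n1 Q by (intro squared_axis_angle_eq) auto
    then have e: "squared_axis_angle (P1 \<bullet> Q) = (sphere_angle (- P1) Q)\<^sup>2" by (simp add: squared_axis_angle_minus)
    have "isometry_of (axis_signs (-1) 1) s \<in> optimal_group \<tau>" using that mem(2,4) by auto
    from d[OF this] show ?thesis using e by (simp add: P1_def neg)
  qed
  from this[of \<tau>] this[of "- \<tau>"]
  have "2 * \<tau> * \<bar>t\<bar> \<le> squared_axis_angle (P1 \<bullet> Q) - (sphere_angle P0 Q)\<^sup>2 + \<tau>\<^sup>2"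
    by (cases "0 \<le> t") (simp_all add: power2_diff power2_sum algebra_simps)
  then have "2 * \<tau> * \<bar>t\<bar> \<le> squared_axis_angle (P1 \<bullet> Q) - squared_axis_angle (P0 \<bullet> Q) + \<tau>\<^sup>2"
    using squared_axis_angle_eq[OF P0 Q(1) p0] by simp
  then show "\<bar>t\<bar> \<le> optimal_fibre_length \<tau> Q / 2"
    using \<tau> by (simp add: optimal_fibre_length_def P0_def P1_def field_simps)
qed

lemma optimal_fibre_length_measurable: "optimal_fibre_length \<tau> \<in> borel_measurable borel"
  unfolding optimal_fibre_length_def[abs_def] divide_inverse
  by (intro borel_measurable_continuous_onI continuous_intros continuous_on_compose2[OF squared_axis_angle_continuous]) auto

lemma nn_integral_orthogonal:
  assumes "orthogonal_transformation A" "f \<in> borel_measurable borel"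
  shows "(\<integral>\<^sup>+P. f (A P) \<partial>sphere_area) = (\<integral>\<^sup>+P. f P \<partial>sphere_area)"
proof -
  have "A \<in> borel_measurable borel"
    using orthogonal_transformation_continuous[OF assms(1)] by (intro borel_measurable_continuous_onI)
  then have "A \<in> measurable sphere_area borel" by (simp add: measurable_def)
  from nn_integral_distr[OF this, of f] assms(2)
  show ?thesis using distr_sphere_area_orthogonal[OF assms(1)] by simp
qed

text \<open>The two closed hemispheres together have no more area than the sphere.\<close>

lemma great_circle_null:
  assumes N: "norm (N::real^3) = 1"
  shows "AE P in sphere_area. N \<bullet> P \<noteq> 0"
proof (rule AE_I)
  let ?A = "{P. 0 \<le> N \<bullet> P}" and ?B = "{P. 0 \<le> (- N) \<bullet> P}"
  have s: "?A \<in> sets sphere_area" "?B \<in> sets sphere_area"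
    by (simp_all only: sets_sphere_area) (intro borel_closed closed_Collect_le continuous_intros)+
  have "emeasure sphere_area ?A = ennreal (2 * pi)" "emeasure sphere_area ?B = ennreal (2 * pi)"
    using emeasure_cap[OF N, of "pi / 2"] emeasure_cap[of "- N" "pi / 2"] N by simp_all
  moreover have "?A \<union> ?B = UNIV" by auto
  ultimately have "ennreal (2 * pi) + ennreal (2 * pi) = ennreal (4 * pi) + emeasure sphere_area (?A \<inter> ?B)"
    using emeasure_Un_Int[OF s] emeasure_sphere_area_UNIV by simp
  then have "ennreal (4 * pi) + 0 = ennreal (4 * pi) + emeasure sphere_area (?A \<inter> ?B)"
    by (simp flip: ennreal_plus)
  then show "emeasure sphere_area (?A \<inter> ?B) = 0"
    unfolding ennreal_add_left_cancel by auto
  show "{P \<in> space sphere_area. \<not> N \<bullet> P \<noteq> 0} \<subseteq> ?A \<inter> ?B" by auto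
  show "?A \<inter> ?B \<in> sets sphere_area" using s by (rule sets.Int)
qed

lemma optimal_fibre_length_nonneg:
  assumes "pi / 2 \<le> \<tau>"
  shows "0 \<le> optimal_fibre_length \<tau> Q"
proof -
  have t: "0 < \<tau>" using assms pi_gt_zero by linarith
  have "(pi / 2)\<^sup>2 \<le> \<tau>\<^sup>2" using assms by (intro power_mono) auto
  then show ?thesis unfolding optimal_fibre_length_def
    using squared_axis_angle_le squared_axis_angle_nonneg t by (intro divide_nonneg_pos) (smt (verit))
qed

text \<open>The reflection that exchanges the two axes replaces the length \<open>f\<close> by \<open>2 * \<tau> - f\<close>, so the mean of \<open>f\<close>
over the sphere is \<open>\<tau>\<close>.  The antipodal map preserves \<open>f\<close> and exchanges the hemispheres, so the mean over
the hemisphere is \<open>\<tau>\<close> as well.\<close>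

lemma integral_optimal_fibre_length:
  assumes "pi / 2 \<le> \<tau>"
  shows "(\<integral>\<^sup>+Q. ennreal (optimal_fibre_length \<tau> Q) * indicator {Q. 0 \<le> fst K_opt \<bullet> Q} Q \<partial>sphere_area) = ennreal (2 * pi * \<tau>)"
proof -
  let ?f = "optimal_fibre_length \<tau>" and ?P = "fst K_opt"
  let ?h = "\<lambda>Q. ennreal (?f Q) * indicator {Q. 0 \<le> ?P \<bullet> Q} Q"
  let ?r = "axis_signs 1 (-1)"
  have t: "0 < \<tau>" using assms pi_gt_zero by linarith
  have f0: "0 \<le> ?f Q" for Q by (rule optimal_fibre_length_nonneg[OF assms])
  have P: "norm ?P = 1" using K_opt_S2R by (simp add: S2R_iff)
  have fm[measurable]: "?f \<in> borel_measurable borel" by (rule optimal_fibre_length_measurable)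
  have S[measurable]: "{Q. 0 \<le> ?P \<bullet> Q} \<in> sets borel" by (intro borel_closed closed_Collect_le continuous_intros)
  have hm[measurable]: "?h \<in> borel_measurable borel" by measurable
  have r: "orthogonal_transformation ?r" by (rule axis_signs_orthogonal) auto
  have m: "orthogonal_transformation (\<lambda>P::real^3. - P)"
    by (simp add: orthogonal_transformation_neg)
  define I where "I = (\<integral>\<^sup>+Q. ?h Q \<partial>sphere_area)"
  define T where "T = (\<integral>\<^sup>+Q. ennreal (?f Q) \<partial>sphere_area)"
  have "?f Q + ?f (?r Q) = 2 * \<tau>" for Q
  proof -
    have "?r ?P \<bullet> ?r Q = ?P \<bullet> Q" "?P \<bullet> ?r Q = ?r ?P \<bullet> Q" by (simp_all add: inner_3)
    then show ?thesis using t by (simp add: optimal_fibre_length_def field_simps power2_eq_square)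
  qed
  then have "ennreal (?f Q) + ennreal (?f (?r Q)) = ennreal (2 * \<tau>)" for Q
    using f0 by (simp flip: ennreal_plus)
  then have "(\<integral>\<^sup>+Q. ennreal (?f Q) + ennreal (?f (?r Q)) \<partial>sphere_area) = ennreal (2 * \<tau>) * ennreal (4 * pi)"
    by (simp add: emeasure_sphere_area_UNIV)
  moreover have "(\<integral>\<^sup>+Q. ennreal (?f Q) + ennreal (?f (?r Q)) \<partial>sphere_area) = T + T"
  proof -
    have rm: "?r \<in> borel_measurable borel"
      using orthogonal_transformation_continuous[OF r] by (intro borel_measurable_continuous_onI)
    have fm': "(\<lambda>Q. ennreal (?f Q)) \<in> borel_measurable borel" by measurable
    have "(\<lambda>Q. ennreal (?f (?r Q))) \<in> borel_measurable borel"
      using measurable_compose[OF rm fm] by simp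
    then have "(\<integral>\<^sup>+Q. ennreal (?f Q) + ennreal (?f (?r Q)) \<partial>sphere_area)
      = T + (\<integral>\<^sup>+Q. ennreal (?f (?r Q)) \<partial>sphere_area)"
      unfolding T_def using fm' by (intro nn_integral_add) (simp_all add: measurable_def)
    also have "(\<integral>\<^sup>+Q. ennreal (?f (?r Q)) \<partial>sphere_area) = T"
      unfolding T_def using fm by (intro nn_integral_orthogonal[OF r, of "\<lambda>Q. ennreal (?f Q)"]) simp
    finally show ?thesis .
  qed
  ultimately have TT: "T + T = ennreal (8 * pi * \<tau>)" using t by (simp flip: ennreal_mult)
  have "I + I = (\<integral>\<^sup>+Q. ?h Q + ?h (- Q) \<partial>sphere_area)"
  proof -
    have mm: "(\<lambda>Q. ?h (- Q)) \<in> borel_measurable borel"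
      using measurable_compose[OF borel_measurable_uminus[OF measurable_ident] hm] by simp
    have "(\<integral>\<^sup>+Q. ?h (- Q) \<partial>sphere_area) = I"
      unfolding I_def by (rule nn_integral_orthogonal[OF m hm])
    moreover have "(\<integral>\<^sup>+Q. ?h Q + ?h (- Q) \<partial>sphere_area) = I + (\<integral>\<^sup>+Q. ?h (- Q) \<partial>sphere_area)"
      unfolding I_def using hm mm by (intro nn_integral_add) (simp_all add: measurable_def)
    ultimately show ?thesis by simp
  qed
  also have "\<dots> = T"
    unfolding T_def
  proof (rule nn_integral_cong_AE)
    have "?f (- Q) = ?f Q" for Q by (simp add: optimal_fibre_length_def squared_axis_angle_minus)
    then show "AE Q in sphere_area. ?h Q + ?h (- Q) = ennreal (?f Q)"
      using great_circle_null[OF P] by (auto simp: indicator_def elim!: eventually_mono)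
  qed
  finally have II: "I + I = T" .
  have "I \<noteq> \<infinity>" using TT II by (auto simp: infinity_ennreal_def)
  then obtain i where i: "0 \<le> i" "I = ennreal i" by (cases I) (auto simp: infinity_ennreal_def)
  have "ennreal (4 * i) = ennreal (8 * pi * \<tau>)" using TT[folded II] i by (simp flip: ennreal_plus)
  then have "i = 2 * pi * \<tau>" using i t by simp
  then show ?thesis using i(2) by (simp add: I_def)
qed

theorem optimal_cell_volume:
  assumes \<tau>: "pi / 2 \<le> \<tau>"
  shows "0 < Vol (dv_cell (optimal_group \<tau>) K_opt)" "Vol (dv_cell (optimal_group \<tau>) K_opt) \<le> 2 * pi * \<tau>"
proof -
  have t: "0 < \<tau>" using assms pi_gt_zero by linarith
  interpret motion_group "optimal_group \<tau>" "(\<lambda>(x, y). axis_signs x y) ` ({1, -1} \<times> {1, -1})" \<tau>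
    by (rule optimal_group_motion_group[OF t])
  let ?D = "dv_cell (optimal_group \<tau>) K_opt"
  let ?f = "optimal_fibre_length \<tau>"
  have f0: "0 \<le> ?f Q" for Q by (rule optimal_fibre_length_nonneg[OF assms])
  have D: "?D \<in> sets borel" by (rule dv_cell_borel[OF K_opt_S2R])
  have "emeasure riemannian_volume ?D = (\<integral>\<^sup>+Q. emeasure lborel (Pair Q -` ?D) \<partial>sphere_area)"
    by (rule emeasure_riemannian_volume_fibres[OF D])
  also have "\<dots> \<le> (\<integral>\<^sup>+Q. ennreal (?f Q) * indicator {Q. 0 \<le> fst K_opt \<bullet> Q} Q \<partial>sphere_area)"
  proof (rule nn_integral_mono)
    fix Q
    show "emeasure lborel (Pair Q -` ?D) \<le> ennreal (?f Q) * indicator {Q. 0 \<le> fst K_opt \<bullet> Q} Q"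
    proof (cases "0 \<le> fst K_opt \<bullet> Q")
      case True
      have "Pair Q -` ?D \<subseteq> {- (?f Q / 2)..?f Q / 2}"
      proof
        fix b assume "b \<in> Pair Q -` ?D"
        then have "\<bar>b\<bar> \<le> ?f Q / 2" by (intro optimal_cell_subset(2)[OF t]) simp
        then show "b \<in> {- (?f Q / 2)..?f Q / 2}" unfolding atLeastAtMost_iff by linarith
      qed
      then have "emeasure lborel (Pair Q -` ?D) \<le> emeasure lborel {- (?f Q / 2)..?f Q / 2}"
        by (intro emeasure_mono) auto
      then show ?thesis using True f0[of Q] by simp
    next
      case False
      then have "Pair Q -` ?D = {}" using optimal_cell_subset(1)[OF t] by auto
      then show ?thesis by simp
    qed
  qed
  also have "\<dots> = ennreal (2 * pi * \<tau>)" by (rule integral_optimal_fibre_length[OF assms])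
  finally have le: "emeasure riemannian_volume ?D \<le> ennreal (2 * pi * \<tau>)" .
  then show "Vol ?D \<le> 2 * pi * \<tau>"
    unfolding Vol_def measure_def using t by (intro enn2real_leI) auto
  have "ennreal (4 * pi * \<tau>) \<le> of_nat (card ((\<lambda>(x, y). axis_signs x y) ` ({1, -1} \<times> {1, -1}))) * emeasure riemannian_volume ?D"
  proof (rule dv_cell_volume_ge[OF K_opt_S2R t])
    fix A s s'
    assume A: "isometry_of A s \<in> optimal_group \<tau>" "isometry_of A s' \<in> optimal_group \<tau>" "orthogonal_transformation A"
    have e: "\<exists>k::int. u = k * \<tau>" if u: "isometry_of A u \<in> optimal_group \<tau>" for u
    proof -
      obtain B and k :: int where "orthogonal_transformation B" "isometry_of A u = isometry_of B (k * \<tau>)"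
        using form[OF u] by blast
      then show ?thesis using isometry_of_inject(2)[OF A(3)] by blast
    qed
    obtain k k' :: int where "s = k * \<tau>" "s' = k' * \<tau>" using e[OF A(1)] e[OF A(2)] by blast
    then show "\<exists>k::int. s' - s = k * \<tau>" by (intro exI[of _ "k' - k"]) (simp add: algebra_simps)
  qed
  moreover have "0 < ennreal (4 * pi * \<tau>)" using t by simp
  ultimately have "emeasure riemannian_volume ?D \<noteq> 0" by (metis mult_zero_right not_le)
  moreover have "emeasure riemannian_volume ?D \<noteq> \<infinity>" using le by (auto simp: top_unique infinity_ennreal_def)
  ultimately show "0 < Vol ?D"
    unfolding Vol_def measure_def by (simp add: enn2real_positive_iff infinity_ennreal_def less_top zero_less_iff_neq_zero)
qed

lemma optimal_density_attained:
  "optimal_density \<le> Vol (geodesic_ball K_opt (pi / 2)) / Vol (dv_cell (optimal_group (sqrt 3 * pi / 2)) K_opt)"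
proof -
  have "1 * pi \<le> sqrt 3 * pi" by (intro mult_right_mono) auto
  then have "pi / 2 \<le> sqrt 3 * pi / 2" by simp
  note v = optimal_cell_volume[OF this]
  have "2 * pi * (sqrt 3 * pi / 2) = sqrt 3 * pi\<^sup>2" by (simp add: power2_eq_square)
  then have "Vol (dv_cell (optimal_group (sqrt 3 * pi / 2)) K_opt) \<le> sqrt 3 * pi\<^sup>2" using v(2) by (simp only:)
  moreover have "0 \<le> Vol (geodesic_ball K_opt (pi / 2))" by (simp add: Vol_def)
  moreover have "0 < sqrt 3 * pi\<^sup>2 * Vol (dv_cell (optimal_group (sqrt 3 * pi / 2)) K_opt)"
    by (rule mult_pos_pos[OF _ v(1)]) simp
  ultimately show ?thesis unfolding optimal_density_def by (rule divide_left_mono)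
qed

text \<open>This is the group 2q.I.2 with \<open>q = 2\<close> and lattice parameter \<open>2 * \<tau>\<close>.\<close>

lemma optimal_group_glide_reflection_space_group:
  assumes "\<tau> > 0"
  shows "glide_reflection_space_group (optimal_group \<tau>)"
proof -
  define n :: "nat \<Rightarrow> real^3" where "n = (\<lambda>i. if i = 1 then vector [0, 1, 0] else vector [1, 0, 0])"
  have n: "norm (n i) = 1" for i by (simp add: n_def norm_eq_1 inner_3)
  have "interior_angle (n 1) (n 2) = pi / real 2" by (simp add: n_def interior_angle_def inner_3)
  then have "mirror_system 2 n" using n unfolding mirror_system_def Let_def by (intro conjI disjI1) auto
  moreover have "optimal_group \<tau> = space_group 2 n (\<lambda>_. 1 / 2) (2 * \<tau>)"
  proof -
    have "{1..2} = {1, 2::nat}" by auto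
    then have "(\<lambda>i. glide_reflection (n i) (1 / 2 * (2 * \<tau>))) ` {1..2} \<union> {fibre_translation (2 * \<tau>)}
      = {glide_reflection (vector [0, 1, 0]) \<tau>, glide_reflection (vector [1, 0, 0]) \<tau>, fibre_translation (2 * \<tau>)}"
      by (simp add: n_def insert_commute)
    then show ?thesis unfolding space_group_def optimal_group_def by (simp only:)
  qed
  ultimately show ?thesis unfolding glide_reflection_space_group_def using assms
    by (intro exI[of _ "2::nat"] exI[of _ n] exI[of _ "\<lambda>_. 1 / 2"] exI[of _ "2 * \<tau>"]) auto
qed

lemma space_group_packing_density_le:
  assumes "generalized_Coxeter_space_group \<Gamma> \<or> glide_reflection_space_group \<Gamma>" "K \<in> S2R"
  shows "packing_density \<Gamma> K \<le> optimal_density"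
proof -
  consider m n p where "mirror_system m n" "p > 0" "\<Gamma> = space_group m n (\<lambda>_. 0) p"
    | m n \<tau> p where "mirror_system m n" "p > 0" "\<forall>i\<in>{1..m}. \<tau> i \<in> {0, 1 / 2}" "\<Gamma> = space_group m n \<tau> p"
    using assms(1) unfolding generalized_Coxeter_space_group_def glide_reflection_space_group_def by metis
  then show ?thesis
  proof cases
    case 1
    show ?thesis unfolding 1(3) by (rule mirror_system_density_le[OF 1(1,2) _ assms(2)]) simp
  next
    case 2
    show ?thesis unfolding 2(4) by (rule mirror_system_density_le[OF 2(1,2) bspec[OF 2(3)] assms(2)])
  qed
qed

theorem theorem3p8:
  fixes K :: point and R :: real
    and G1 G2 :: "real \<Rightarrow> point \<Rightarrow> point"
    and determined :: "real \<Rightarrow> bool"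
    and \<Gamma>_opt :: "real \<Rightarrow> (point \<Rightarrow> point) set"
  assumes "K = geo_point (pi / 4) 0 0" and "R = pi / 2"
    and "\<And>\<tau>. G1 \<tau> = glide_reflection (vector [0, 1, 0]) \<tau>"
    and "\<And>\<tau>. G2 \<tau> = glide_reflection (vector [1, 0, 0]) \<tau>"
    and "\<And>\<tau>. determined \<tau> \<longleftrightarrow> \<tau> > 0 \<and>
           geodesic_dist K (G1 \<tau> K) = 2 * R \<and> geodesic_dist K (G2 \<tau> K) = 2 * R \<and>
           geodesic_dist (G1 \<tau> K) (G2 \<tau> K) = 2 * R"
    and "\<And>\<tau>. \<Gamma>_opt \<tau> = generate (BijGroup S2R) {G1 \<tau>, G2 \<tau>, fibre_translation (2 * \<tau>)}"
  shows "(\<exists>!\<tau>. determined \<tau>) \<and>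
    (\<forall>\<tau>. determined \<tau> \<longrightarrow>
       glide_reflection_space_group (\<Gamma>_opt \<tau>) \<and>
       trivial_stabilizer (\<Gamma>_opt \<tau>) K \<and>
       packing_radius (\<Gamma>_opt \<tau>) K = R \<and>
       (\<forall>\<Gamma> K'. (generalized_Coxeter_space_group \<Gamma> \<or> glide_reflection_space_group \<Gamma>) \<and>
          K' \<in> S2R \<and> trivial_stabilizer \<Gamma> K' \<longrightarrow>
          packing_density \<Gamma> K' \<le> Vol (geodesic_ball K R) / Vol (dv_cell (\<Gamma>_opt \<tau>) K)))"
proof -
  have d: "determined \<tau> \<longleftrightarrow> \<tau> = sqrt 3 * pi / 2" for \<tau>
  proof -
    have "sqrt 3 * pi / 2 > 0" by simp
    then show ?thesis using optimal_fibre_translation[of \<tau>] unfolding assms by fastforce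
  qed
  have G: "\<Gamma>_opt \<tau> = optimal_group \<tau>" for \<tau> unfolding assms(3,4,6) optimal_group_def ..
  have "sqrt 3 * pi / 2 > 0" by simp
  note gr = optimal_group_glide_reflection_space_group[OF this]
  show ?thesis
  proof (intro conjI allI impI)
    show "\<exists>!\<tau>. determined \<tau>" by (rule ex1I[of _ "sqrt 3 * pi / 2"]) (simp_all only: d)
    fix \<tau> assume "determined \<tau>"
    then have t: "\<tau> = sqrt 3 * pi / 2" using d by blast
    show "glide_reflection_space_group (\<Gamma>_opt \<tau>)" unfolding G t by (rule gr)
    show "trivial_stabilizer (\<Gamma>_opt \<tau>) K" unfolding G t assms(1) by (rule optimal_trivial_stabilizer)
    show "packing_radius (\<Gamma>_opt \<tau>) K = R" unfolding G t assms(1,2) by (rule optimal_packing_radius)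
    fix \<Gamma> K'
    assume "(generalized_Coxeter_space_group \<Gamma> \<or> glide_reflection_space_group \<Gamma>) \<and> K' \<in> S2R \<and> trivial_stabilizer \<Gamma> K'"
    then have "packing_density \<Gamma> K' \<le> optimal_density" using space_group_packing_density_le by blast
    also note optimal_density_attained
    finally show "packing_density \<Gamma> K' \<le> Vol (geodesic_ball K R) / Vol (dv_cell (\<Gamma>_opt \<tau>) K)"
      unfolding G t assms(1,2) .
  qed
qed


end
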